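(* Let $\Bbbk$ be a commutative ring, $q\in\Bbbk^\times$ and $n\in\mathbb N$. For a partition $\lambda=(\lambda_1\ge\dots\ge\lambda_r)$ of $n$ put $$f_\lambda:=[\lambda_1-\lambda_2]!\,[\lambda_2-\lambda_3]!\dotsm[\lambda_{r-1}-\lambda_r]!\,[\lambda_r]!\in\Bbbk .$$ Then there is a one-to-one correspondence $$\operatorname{Irr}(H_n)\;\longleftrightarrow\;\bigsqcup_{\lambda\text{ partition of }n}\operatorname{Irr}^{\Bbbk f_\lambda}(\Bbbk)$$ induced by the Morita context functors: to a partition $\lambda$ and $V\in\operatorname{Irr}^{\Bbbk f_\lambda}(\Bbbk)$ corresponds the simple $H_n$-module $$\operatorname{Image}\bigl(S_\lambda\otimes_\Bbbk V\to\operatorname{Hom}_\Bbbk(S^*_\lambda,V)\bigr).$$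
   Context: $[k]=1+q+\dots+q^{k-1}$ and $[k]!=[1][2]\dotsm[k]$. $\operatorname{Irr}(R)$ is the set of isomorphism classes of simple left $R$-modules and, for a 2-sided ideal $I\subset R$, $\operatorname{Irr}^I(R)=\{V\in\operatorname{Irr}(R): IV=V\}$. The Iwahori–Hecke algebra $H_n=H_n(q)$ is the $\Bbbk$-algebra generated by $T_1,\dots,T_{n-1}$ with $T_iT_j=T_jT_i$ for $|i-j|\ge2$, $T_iT_{i+1}T_i=T_{i+1}T_iT_{i+1}$, $(T_i-q)(T_i+1)=0$ (so $H_0=H_1=\Bbbk$). For $w\in\mathfrak S_n$ with reduced expression $s_{i_1}\dotsm s_{i_r}$ put $T_w=T_{i_1}\dotsm T_{i_r}$. A composition $\lambda$ of $n$ is a sequence $(\lambda_1,\lambda_2,\dots)$ of non-negative integers with sum $n$; $\mathfrak S_\lambda\subset\mathfrak S_n$ is the Young subgroup and $m_\lambda=\sum_{w\in\mathfrak S_\lambda}T_w$. Dominance order: $\lambda\le\mu$ iff $\lambda_1+\dots+\lambda_k\le\mu_1+\dots+\mu_k$ for all $k$. For compositions $\lambda,\mu$ of $n$ put $M_{\lambda;\mu}:=H_nm_\lambda\cap m_\mu H_n$. For compositions $\lambda,\mu,\nu$ there is a well-defined product $\circ_\mu\colon M_{\mu;\nu}\otimes M_{\lambda;\mu}\to M_{\lambda;\nu}$, $xm_\mu\otimes m_\mu y\mapsto xm_\mu y$. Put $M^\nu_{\lambda;\mu}:=M_{\nu;\mu}\circ_\nu M_{\lambda;\nu}\subset M_{\lambda;\mu}$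 and $M^{(\nu)}_{\lambda;\mu}:=M_{\lambda;\mu}/\sum_{\pi>\nu}M^\pi_{\lambda;\mu}$. With $(1^n)=(1,\dots,1)$, so that $M_{(1^n);(1^n)}=H_n$, the Specht module is the left $H_n$-module $S_\lambda:=M^{(\lambda)}_{\lambda;(1^n)}$, and $S^*_\lambda:=M^{(\lambda)}_{(1^n);\lambda}$ is a right $H_n$-module. For a partition $\lambda$ (with $q$ invertible), $M^{(\lambda)}_{\lambda;\lambda}$ is free of rank one over $\Bbbk$ on $m_\lambda$, and multiplication in $H_n$ induces a bilinear map $\rho\colon S^*_\lambda\otimes_{H_n}S_\lambda\to M^{(\lambda)}_{\lambda;\lambda}\simeq\Bbbk$. The map in the claim is $x\otimes v\mapsto(y\mapsto\rho(y\otimes x)v)$. *)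

theory Defs
  imports "HOL-Combinatorics.Permutations" "HOL-Algebra.Module" "HOL-Algebra.QuotRing" "HOL-Algebra.Free_Abelian_Groups"
begin

section \<open>Left modules over a ring, simple modules\<close>

text \<open>
  Modules are given by the record type \<^type>\<open>module\<close> of HOL-Algebra; the fields
  \<open>mult\<close> and \<open>one\<close> of that record play no role for modules.  The locale
  \<^locale>\<open>module\<close> is restricted to commutative scalars, so left modules over an arbitrary
  ring are introduced here; for a commutative ring both notions agree.
\<close>

locale left_module = R?: ring R + M?: abelian_group M
  for R :: "('r, 'x) ring_scheme" (structure) and M :: "('r, 'm, 'y) module_scheme" (structure) +
  assumes smult_closed:
      "\<lbrakk>a \<in> carrier R; x \<in> carrier M\<rbrakk> \<Longrightarrow> a \<odot>\<^bsub>M\<^esub> x \<in> carrier M"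
    and smult_l_distr:
      "\<lbrakk>a \<in> carrier R; b \<in> carrier R; x \<in> carrier M\<rbrakk>
        \<Longrightarrow> (a \<oplus> b) \<odot>\<^bsub>M\<^esub> x = a \<odot>\<^bsub>M\<^esub> x \<oplus>\<^bsub>M\<^esub> b \<odot>\<^bsub>M\<^esub> x"
    and smult_r_distr:
      "\<lbrakk>a \<in> carrier R; x \<in> carrier M; y \<in> carrier M\<rbrakk>
        \<Longrightarrow> a \<odot>\<^bsub>M\<^esub> (x \<oplus>\<^bsub>M\<^esub> y) = a \<odot>\<^bsub>M\<^esub> x \<oplus>\<^bsub>M\<^esub> a \<odot>\<^bsub>M\<^esub> y"
    and smult_assoc:
      "\<lbrakk>a \<in> carrier R; b \<in> carrier R; x \<in> carrier M\<rbrakk>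
        \<Longrightarrow> (a \<otimes> b) \<odot>\<^bsub>M\<^esub> x = a \<odot>\<^bsub>M\<^esub> (b \<odot>\<^bsub>M\<^esub> x)"
    and smult_one: "x \<in> carrier M \<Longrightarrow> \<one> \<odot>\<^bsub>M\<^esub> x = x"

definition simple_module :: "('r, 'x) ring_scheme \<Rightarrow> ('r, 'm) module \<Rightarrow> bool" where
  "simple_module R M \<longleftrightarrow>
     left_module R M \<and> carrier M \<noteq> {\<zero>\<^bsub>M\<^esub>} \<and>
     (\<forall>N. submodule N R M \<longrightarrow> N = {\<zero>\<^bsub>M\<^esub>} \<or> N = carrier M)"

definition module_iso ::
    "('r, 'x) ring_scheme \<Rightarrow> ('r, 'm) module \<Rightarrow> ('r, 'n) module \<Rightarrow> bool" where
  "module_iso R M N \<longleftrightarrow>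
     (\<exists>f. bij_betw f (carrier M) (carrier N) \<and>
          (\<forall>x\<in>carrier M. \<forall>y\<in>carrier M. f (x \<oplus>\<^bsub>M\<^esub> y) = f x \<oplus>\<^bsub>N\<^esub> f y) \<and>
          (\<forall>a\<in>carrier R. \<forall>x\<in>carrier M. f (a \<odot>\<^bsub>M\<^esub> x) = a \<odot>\<^bsub>N\<^esub> f x))"

text \<open>
  Every simple left \<open>R\<close>-module is isomorphic to \<open>R/L\<close> for a maximal left ideal \<open>L\<close>, and the
  elements of \<open>R/L\<close> are subsets of \<open>R\<close>.  Hence all isomorphism classes are represented by
  modules whose elements have type \<open>'r set\<close>, and \<open>Irr R\<close> is the set of isomorphism classes of
  simple modules of this kind.  \<open>simple_class R M\<close> is the class in \<open>Irr R\<close> of a simple module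
  \<open>M\<close> whose elements may have any type.
\<close>

definition Irr :: "('r, 'x) ring_scheme \<Rightarrow> ('r, 'r set) module set set" where
  "Irr R = {M. simple_module R M} //
             {(M, N). simple_module R M \<and> simple_module R N \<and> module_iso R M N}"

definition simple_class ::
    "('r, 'x) ring_scheme \<Rightarrow> ('r, 'm) module \<Rightarrow> ('r, 'r set) module set" where
  "simple_class R M = {N. simple_module R N \<and> module_iso R M N}"

definition ideal_smult :: "'r set \<Rightarrow> ('r, 'm) module \<Rightarrow> 'm set" where
  "ideal_smult I M = generate (add_monoid M) {a \<odot>\<^bsub>M\<^esub> x | a x. a \<in> I \<and> x \<in> carrier M}"

definition Irr_ideal ::
    "('r, 'x) ring_scheme \<Rightarrow> 'r set \<Rightarrow> ('r, 'r set) module set set" where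
  "Irr_ideal R I = {c \<in> Irr R. \<forall>V\<in>c. ideal_smult I V = carrier V}"


section \<open>Tensor products over a commutative ring\<close>

definition tensor_relations ::
    "('a, 'k) ring_scheme \<Rightarrow> ('a, 's) module \<Rightarrow> ('a, 'v) module \<Rightarrow> ('s \<times> 'v \<Rightarrow>\<^sub>0 int) set" where
  "tensor_relations K A B =
     {frag_of (x \<oplus>\<^bsub>A\<^esub> y, v) - frag_of (x, v) - frag_of (y, v) | x y v.
        x \<in> carrier A \<and> y \<in> carrier A \<and> v \<in> carrier B} \<union>
     {frag_of (x, v \<oplus>\<^bsub>B\<^esub> w) - frag_of (x, v) - frag_of (x, w) | x v w.
        x \<in> carrier A \<and> v \<in> carrier B \<and> w \<in> carrier B} \<union>
     {frag_of (c \<odot>\<^bsub>A\<^esub> x, v) - frag_of (x, c \<odot>\<^bsub>B\<^esub> v) | c x v.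
        c \<in> carrier K \<and> x \<in> carrier A \<and> v \<in> carrier B}"

definition tensor_kernel ::
    "('a, 'k) ring_scheme \<Rightarrow> ('a, 's) module \<Rightarrow> ('a, 'v) module \<Rightarrow> ('s \<times> 'v \<Rightarrow>\<^sub>0 int) set" where
  "tensor_kernel K A B =
     generate (free_Abelian_group (carrier A \<times> carrier B)) (tensor_relations K A B)"

text \<open>The underlying abelian group of the tensor product, written multiplicatively.\<close>

definition tensor ::
    "('a, 'k) ring_scheme \<Rightarrow> ('a, 's) module \<Rightarrow> ('a, 'v) module
      \<Rightarrow> ('s \<times> 'v \<Rightarrow>\<^sub>0 int) set monoid" where
  "tensor K A B = free_Abelian_group (carrier A \<times> carrier B) Mod tensor_kernel K A B"

definition pure_tensor ::
    "('a, 'k) ring_scheme \<Rightarrow> ('a, 's) module \<Rightarrow> ('a, 'v) module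
      \<Rightarrow> 's \<Rightarrow> 'v \<Rightarrow> ('s \<times> 'v \<Rightarrow>\<^sub>0 int) set" where
  "pure_tensor K A B x v =
     tensor_kernel K A B #>\<^bsub>free_Abelian_group (carrier A \<times> carrier B)\<^esub> frag_of (x, v)"

text \<open>The homomorphism on the tensor product determined by its values on pure tensors.\<close>

definition tensor_lift ::
    "('a, 'k) ring_scheme \<Rightarrow> ('a, 's) module \<Rightarrow> ('a, 'v) module \<Rightarrow> ('r, 'c) module
      \<Rightarrow> ('s \<Rightarrow> 'v \<Rightarrow> 'c) \<Rightarrow> ('s \<times> 'v \<Rightarrow>\<^sub>0 int) set \<Rightarrow> 'c" where
  "tensor_lift K A B C \<beta> =
     (THE g. g \<in> hom (tensor K A B) (add_monoid C) \<and> g \<in> extensional (carrier (tensor K A B)) \<and>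
             (\<forall>x\<in>carrier A. \<forall>v\<in>carrier B. g (pure_tensor K A B x v) = \<beta> x v))"


section \<open>Linear maps out of a right module\<close>

definition linear_maps ::
    "('a, 'k) ring_scheme \<Rightarrow> ('a, 's) module \<Rightarrow> ('a, 'v) module \<Rightarrow> ('s \<Rightarrow> 'v) set" where
  "linear_maps K A B =
     {\<phi> \<in> carrier A \<rightarrow>\<^sub>E carrier B.
        (\<forall>x\<in>carrier A. \<forall>y\<in>carrier A. \<phi> (x \<oplus>\<^bsub>A\<^esub> y) = \<phi> x \<oplus>\<^bsub>B\<^esub> \<phi> y) \<and>
        (\<forall>c\<in>carrier K. \<forall>x\<in>carrier A. \<phi> (c \<odot>\<^bsub>A\<^esub> x) = c \<odot>\<^bsub>B\<^esub> \<phi> x)}"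

text \<open>
  If a ring acts on \<open>A\<close> from the right by \<open>act\<close>, then it acts on the \<open>K\<close>-linear maps
  \<open>A \<rightarrow> B\<close> from the left by \<open>(h\<phi>)(y) = \<phi>(yh)\<close>.
\<close>

definition hom_module ::
    "('a, 'k) ring_scheme \<Rightarrow> ('a, 's) module \<Rightarrow> ('s \<Rightarrow> 'h \<Rightarrow> 's) \<Rightarrow> ('a, 'v) module
      \<Rightarrow> ('h, 's \<Rightarrow> 'v) module" where
  "hom_module K A act B =
     \<lparr>carrier = linear_maps K A B, mult = undefined, one = undefined,
      ring.zero = (\<lambda>y\<in>carrier A. \<zero>\<^bsub>B\<^esub>),
      add = (\<lambda>\<phi> \<psi>. \<lambda>y\<in>carrier A. \<phi> y \<oplus>\<^bsub>B\<^esub> \<psi> y),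
      smult = (\<lambda>h \<phi>. \<lambda>y\<in>carrier A. \<phi> (act y h))\<rparr>"


section \<open>Compositions, partitions and Young subgroups\<close>

text \<open>The entry with index \<open>i\<close> of a composition \<open>l\<close> is the part \<open>\<lambda>\<^sub>i\<^sub>+\<^sub>1\<close>.\<close>

definition composition :: "nat \<Rightarrow> (nat \<Rightarrow> nat) \<Rightarrow> bool" where
  "composition n l \<longleftrightarrow> finite {i. l i \<noteq> 0} \<and> (\<Sum>i | l i \<noteq> 0. l i) = n"

definition is_partition :: "nat \<Rightarrow> (nat \<Rightarrow> nat) \<Rightarrow> bool" where
  "is_partition n l \<longleftrightarrow> composition n l \<and> antimono l"

definition dominated :: "(nat \<Rightarrow> nat) \<Rightarrow> (nat \<Rightarrow> nat) \<Rightarrow> bool" where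
  "dominated l m \<longleftrightarrow> (\<forall>k. (\<Sum>i<k. l i) \<le> (\<Sum>i<k. m i))"

definition ones :: "nat \<Rightarrow> nat \<Rightarrow> nat" where
  "ones n i = (if i < n then 1 else 0)"

definition block :: "(nat \<Rightarrow> nat) \<Rightarrow> nat \<Rightarrow> nat set" where
  "block l i = {(\<Sum>j<i. l j) <.. (\<Sum>j<Suc i. l j)}"

definition young_subgroup :: "nat \<Rightarrow> (nat \<Rightarrow> nat) \<Rightarrow> (nat \<Rightarrow> nat) set" where
  "young_subgroup n l = {w. w permutes {1..n} \<and> (\<forall>i. w ` block l i = block l i)}"

text \<open>The word \<open>[i\<^sub>1,\<dots>,i\<^sub>r]\<close> stands for the product of the simple transpositions \<open>s\<^sub>i = (i, i+1)\<close>.\<close>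

definition word_perm :: "nat list \<Rightarrow> nat \<Rightarrow> nat" where
  "word_perm is = foldr (\<lambda>i w. transpose i (Suc i) \<circ> w) is id"

definition reduced_word :: "nat \<Rightarrow> (nat \<Rightarrow> nat) \<Rightarrow> nat list \<Rightarrow> bool" where
  "reduced_word n w is \<longleftrightarrow>
     set is \<subseteq> {1..<n} \<and> word_perm is = w \<and>
     (\<forall>js. set js \<subseteq> {1..<n} \<and> word_perm js = w \<longrightarrow> length is \<le> length js)"


section \<open>Free algebras and quotient algebras\<close>

text \<open>
  The free associative \<open>K\<close>-algebra on \<open>X\<close>: finitely supported functions from words over \<open>X\<close>
  to \<open>K\<close>, with the convolution product.  The record type \<^type>\<open>module\<close> carries both the
  ring structure and the scalar multiplication by \<open>K\<close>.
\<close>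

definition free_alg :: "('a, 'k) ring_scheme \<Rightarrow> 'x set \<Rightarrow> ('a, 'x list \<Rightarrow> 'a) module" where
  "free_alg K X =
     \<lparr>carrier = {f. (\<forall>w. f w \<in> carrier K) \<and> finite {w. f w \<noteq> \<zero>\<^bsub>K\<^esub>} \<and>
                    (\<forall>w. f w \<noteq> \<zero>\<^bsub>K\<^esub> \<longrightarrow> set w \<subseteq> X)},
      mult = (\<lambda>f g w. \<Oplus>\<^bsub>K\<^esub>i\<in>{..length w}. f (take i w) \<otimes>\<^bsub>K\<^esub> g (drop i w)),
      one = (\<lambda>w. if w = [] then \<one>\<^bsub>K\<^esub> else \<zero>\<^bsub>K\<^esub>),
      ring.zero = (\<lambda>w. \<zero>\<^bsub>K\<^esub>),
      add = (\<lambda>f g w. f w \<oplus>\<^bsub>K\<^esub> g w),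
      smult = (\<lambda>c f w. c \<otimes>\<^bsub>K\<^esub> f w)\<rparr>"

definition free_gen :: "('a, 'k) ring_scheme \<Rightarrow> 'x \<Rightarrow> 'x list \<Rightarrow> 'a" where
  "free_gen K x = (\<lambda>w. if w = [x] then \<one>\<^bsub>K\<^esub> else \<zero>\<^bsub>K\<^esub>)"

definition quot_alg :: "('a, 'f) module \<Rightarrow> 'f set \<Rightarrow> ('a, 'f set) module" where
  "quot_alg F I =
     ring.extend (F Quot I) (module.fields (\<lambda>c C. \<Union>x\<in>C. I +>\<^bsub>F\<^esub> (c \<odot>\<^bsub>F\<^esub> x)))"


section \<open>The Iwahori--Hecke algebra and its Specht modules\<close>

locale hecke_setup =
  fixes K :: "('a, 'k) ring_scheme" (structure) and q :: 'a and n :: nat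
begin

definition qint :: "nat \<Rightarrow> 'a" where
  "qint k = (\<Oplus>i\<in>{..<k}. q [^] i)"

definition qfact :: "nat \<Rightarrow> 'a" where
  "qfact k = (\<Otimes>i\<in>{1..k}. qint i)"

text \<open>For a partition the support \<open>{i. l i \<noteq> 0}\<close> is an initial segment of the natural numbers,
  and the last factor is \<open>[\<lambda>\<^sub>r - 0]!\<close>.\<close>

definition f_prod :: "(nat \<Rightarrow> nat) \<Rightarrow> 'a" where
  "f_prod l = (\<Otimes>i\<in>{i. l i \<noteq> 0}. qfact (l i - l (Suc i)))"

abbreviation Free :: "('a, nat list \<Rightarrow> 'a) module" where
  "Free \<equiv> free_alg K {1..<n}"

abbreviation X :: "nat \<Rightarrow> nat list \<Rightarrow> 'a" where
  "X \<equiv> free_gen K"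

definition hecke_relations :: "(nat list \<Rightarrow> 'a) set" where
  "hecke_relations =
     {X i \<otimes>\<^bsub>Free\<^esub> X j \<ominus>\<^bsub>Free\<^esub> X j \<otimes>\<^bsub>Free\<^esub> X i | i j.
        i \<in> {1..<n} \<and> j \<in> {1..<n} \<and> (i + 2 \<le> j \<or> j + 2 \<le> i)} \<union>
     {X i \<otimes>\<^bsub>Free\<^esub> X (Suc i) \<otimes>\<^bsub>Free\<^esub> X i
        \<ominus>\<^bsub>Free\<^esub> X (Suc i) \<otimes>\<^bsub>Free\<^esub> X i \<otimes>\<^bsub>Free\<^esub> X (Suc i) | i.
        i \<in> {1..<n} \<and> Suc i \<in> {1..<n}} \<union>
     {(X i \<ominus>\<^bsub>Free\<^esub> q \<odot>\<^bsub>Free\<^esub> \<one>\<^bsub>Free\<^esub>) \<otimes>\<^bsub>Free\<^esub> (X i \<oplus>\<^bsub>Free\<^esub> \<one>\<^bsub>Free\<^esub>) | i.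
        i \<in> {1..<n}}"

definition H :: "('a, (nat list \<Rightarrow> 'a) set) module" where
  "H = quot_alg Free (Idl\<^bsub>Free\<^esub> hecke_relations)"

definition T :: "nat \<Rightarrow> (nat list \<Rightarrow> 'a) set" where
  "T i = (Idl\<^bsub>Free\<^esub> hecke_relations) +>\<^bsub>Free\<^esub> X i"

definition T_perm :: "(nat \<Rightarrow> nat) \<Rightarrow> (nat list \<Rightarrow> 'a) set" where
  "T_perm w = foldr (\<lambda>i h. T i \<otimes>\<^bsub>H\<^esub> h) (SOME is. reduced_word n w is) \<one>\<^bsub>H\<^esub>"

definition m :: "(nat \<Rightarrow> nat) \<Rightarrow> (nat list \<Rightarrow> 'a) set" where
  "m l = (\<Oplus>\<^bsub>H\<^esub>w\<in>young_subgroup n l. T_perm w)"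

text \<open>\<open>M l k\<close> is \<open>M\<^bsub>\<lambda>;\<mu>\<^esub>\<close> for \<open>l = \<lambda>\<close> and \<open>k = \<mu>\<close>.\<close>

definition M :: "(nat \<Rightarrow> nat) \<Rightarrow> (nat \<Rightarrow> nat) \<Rightarrow> (nat list \<Rightarrow> 'a) set set" where
  "M l k = {x \<otimes>\<^bsub>H\<^esub> m l | x. x \<in> carrier H} \<inter> {m k \<otimes>\<^bsub>H\<^esub> y | y. y \<in> carrier H}"

definition circ ::
    "(nat \<Rightarrow> nat) \<Rightarrow> (nat list \<Rightarrow> 'a) set \<Rightarrow> (nat list \<Rightarrow> 'a) set \<Rightarrow> (nat list \<Rightarrow> 'a) set" where
  "circ k a b =
     (THE c. \<exists>x\<in>carrier H. \<exists>y\<in>carrier H.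
        a = x \<otimes>\<^bsub>H\<^esub> m k \<and> b = m k \<otimes>\<^bsub>H\<^esub> y \<and> c = x \<otimes>\<^bsub>H\<^esub> m k \<otimes>\<^bsub>H\<^esub> y)"

text \<open>\<open>M_through p l k\<close> is \<open>M\<^sup>\<pi>\<^bsub>\<lambda>;\<mu>\<^esub>\<close>, and \<open>M_above p l k\<close> is the sum of the
  \<open>M\<^sup>\<pi>'\<^bsub>\<lambda>;\<mu>\<^esub>\<close> over all compositions \<open>\<pi>' > \<pi>\<close>.\<close>

definition M_through ::
    "(nat \<Rightarrow> nat) \<Rightarrow> (nat \<Rightarrow> nat) \<Rightarrow> (nat \<Rightarrow> nat) \<Rightarrow> (nat list \<Rightarrow> 'a) set set" where
  "M_through p l k =
     generate (add_monoid H) {circ p a b | a b. a \<in> M p k \<and> b \<in> M l p}"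

definition M_above ::
    "(nat \<Rightarrow> nat) \<Rightarrow> (nat \<Rightarrow> nat) \<Rightarrow> (nat \<Rightarrow> nat) \<Rightarrow> (nat list \<Rightarrow> 'a) set set" where
  "M_above p l k =
     generate (add_monoid H)
       (\<Union>p'\<in>{p'. composition n p' \<and> dominated p p' \<and> p' \<noteq> p}. M_through p' l k)"

text \<open>\<open>M_quot p l k\<close> is the \<open>K\<close>-module \<open>M\<^sup>(\<^sup>\<pi>\<^sup>)\<^bsub>\<lambda>;\<mu>\<^esub>\<close>; its elements are additive cosets.\<close>

definition M_quot ::
    "(nat \<Rightarrow> nat) \<Rightarrow> (nat \<Rightarrow> nat) \<Rightarrow> (nat \<Rightarrow> nat) \<Rightarrow> ('a, (nat list \<Rightarrow> 'a) set set) module" where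
  "M_quot p l k =
     \<lparr>carrier = (\<lambda>x. M_above p l k +>\<^bsub>H\<^esub> x) ` M l k, mult = undefined, one = undefined,
      ring.zero = M_above p l k, add = set_add H,
      smult = (\<lambda>c C. \<Union>x\<in>C. M_above p l k +>\<^bsub>H\<^esub> (c \<odot>\<^bsub>H\<^esub> x))\<rparr>"

text \<open>
  The Specht module \<open>S\<^sub>\<lambda>\<close> and its companion \<open>S\<^sup>*\<^sub>\<lambda>\<close>, as \<open>K\<close>-modules.  The right action of \<open>H\<close> on
  \<open>S\<^sup>*\<^sub>\<lambda>\<close> gives the left \<open>H\<close>-module structure on the linear maps \<open>S\<^sup>*\<^sub>\<lambda> \<rightarrow> V\<close>, and thereby the one on
  the image of \<open>S\<^sub>\<lambda> \<otimes> V\<close>, for which the left action of \<open>H\<close> on \<open>S\<^sub>\<lambda>\<close> is not needed.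
\<close>

definition specht :: "(nat \<Rightarrow> nat) \<Rightarrow> ('a, (nat list \<Rightarrow> 'a) set set) module" where
  "specht l = M_quot l l (ones n)"

definition dual_specht :: "(nat \<Rightarrow> nat) \<Rightarrow> ('a, (nat list \<Rightarrow> 'a) set set) module" where
  "dual_specht l = M_quot l (ones n) l"

definition dual_specht_act ::
    "(nat \<Rightarrow> nat) \<Rightarrow> (nat list \<Rightarrow> 'a) set set \<Rightarrow> (nat list \<Rightarrow> 'a) set
      \<Rightarrow> (nat list \<Rightarrow> 'a) set set" where
  "dual_specht_act l C h = (\<Union>y\<in>C. M_above l (ones n) l +>\<^bsub>H\<^esub> (y \<otimes>\<^bsub>H\<^esub> h))"

text \<open>
  \<open>rho l D C\<close> is the scalar \<open>\<rho>(D \<otimes> C)\<close>: the product of \<open>D \<in> S\<^sup>*\<^sub>\<lambda>\<close> and \<open>C \<in> S\<^sub>\<lambda>\<close> in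
  \<open>M\<^sup>(\<^sup>\<lambda>\<^sup>)\<^bsub>\<lambda>;\<lambda>\<^esub>\<close> is expressed in the basis given by the class of \<open>m\<^sub>\<lambda>\<close>.
\<close>

definition rho ::
    "(nat \<Rightarrow> nat) \<Rightarrow> (nat list \<Rightarrow> 'a) set set \<Rightarrow> (nat list \<Rightarrow> 'a) set set \<Rightarrow> 'a" where
  "rho l D C =
     (THE c. c \<in> carrier K \<and>
        (\<Union>y\<in>D. \<Union>x\<in>C. M_above l l l +>\<^bsub>H\<^esub> (y \<otimes>\<^bsub>H\<^esub> x)) =
        c \<odot>\<^bsub>M_quot l l l\<^esub> (M_above l l l +>\<^bsub>H\<^esub> m l))"

definition specht_hom ::
    "(nat \<Rightarrow> nat) \<Rightarrow> ('a, 'v) module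
      \<Rightarrow> ((nat list \<Rightarrow> 'a) set, (nat list \<Rightarrow> 'a) set set \<Rightarrow> 'v) module" where
  "specht_hom l V = hom_module K (dual_specht l) (dual_specht_act l) V"

definition specht_map ::
    "(nat \<Rightarrow> nat) \<Rightarrow> ('a, 'v) module
      \<Rightarrow> ((nat list \<Rightarrow> 'a) set set \<times> 'v \<Rightarrow>\<^sub>0 int) set \<Rightarrow> (nat list \<Rightarrow> 'a) set set \<Rightarrow> 'v" where
  "specht_map l V =
     tensor_lift K (specht l) V (specht_hom l V)
       (\<lambda>x v. \<lambda>y\<in>carrier (dual_specht l). rho l y x \<odot>\<^bsub>V\<^esub> v)"

definition specht_image ::
    "(nat \<Rightarrow> nat) \<Rightarrow> ('a, 'v) module
      \<Rightarrow> ((nat list \<Rightarrow> 'a) set, (nat list \<Rightarrow> 'a) set set \<Rightarrow> 'v) module" where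
  "specht_image l V =
     (specht_hom l V)\<lparr>carrier := specht_map l V ` carrier (tensor K (specht l) V)\<rparr>"

end

end

theory Submission
  imports Defs
begin

text \<open>
  A simple module \<open>L\<close> has a highest weight: a partition \<open>\<lambda>\<close> with \<open>m\<^sub>\<lambda>L \<noteq> 0\<close> and \<open>m\<^sub>\<pi>L = 0\<close> for all
  compositions \<open>\<pi> > \<lambda>\<close>.  As \<open>m\<^sub>\<lambda>hm\<^sub>\<lambda> \<equiv> B(h)m\<^sub>\<lambda>\<close> modulo terms through higher weights, \<open>m\<^sub>\<lambda>L\<close> is a simple module over the
  ground ring, and \<open>L\<close> is recovered from it as the image in the theorem.  Conversely that image is simple for a given
  \<open>V\<close> if and only if some \<open>B(h)\<close> does not annihilate \<open>V\<close>, so the point is to compare the ideal generated by all \<open>B(h)\<close>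
  with \<open>f\<^sub>\<lambda>\<close>.

  On one side, \<open>B\<close> takes on \<open>T\<^sub>w\<close>, where \<open>w\<close> reverses the columns of the row reading tableau, a value that is a unit
  times a product of quantum integers \<open>[k]\<close> with \<open>k \<le> \<lambda>\<^sub>i - \<lambda>\<^sub>i\<^sub>+\<^sub>1\<close>; it is computed in the representation of the algebra
  on functions on words.  On the other side, splitting and merging rows gives operators \<open>E\<^sub>i\<close>, \<open>F\<^sub>i\<close> with
  \<open>[E\<^sub>i, F\<^sub>i] = [\<mu>\<^sub>i] - [\<mu>\<^sub>i\<^sub>+\<^sub>1]\<close>, and every \<open>B(h)\<close> is a combination of coefficients that arise from moving words in the
  \<open>E\<^sub>i\<close> past words in the \<open>F\<^sub>i\<close>.  Modulo \<open>[e]\<close> these coefficients do not change if \<open>e\<close> columns of length \<open>i\<close> are removed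
  from \<open>\<lambda>\<close>; for \<open>e \<ge> 2\<close> the resulting weight of single boxes has a negative entry, so all \<open>B(h)\<close> are divisible by \<open>[e]\<close>
  in the sense of ideals.
\<close>

section \<open>The free algebra and the Hecke algebra\<close>

text \<open>Over an arbitrary ring it has to be certified that a multiple of \<open>m l\<close> is
  not absorbed by terms through higher weights. The certificate is an evaluation in one
  representation, and this dictates its sign: as adjacent equal letters are negated, a row
  symmetrizer annihilates every word with a repeated letter inside a row, and a word whose content
  is given by the columns of \<lambda> has such a repetition for every shape above \<lambda>.

  Divisibility by [e] is a congruence modulo an ideal because nothing may be cancelled. The ideal is
  finally the annihilator of a simple module over the ground ring, which is prime, so products of
  quantum integers can be treated factor by factor.

  The coefficients depend on weights through quantum integers of the entries, extended to negative
  arguments by means of the inverse of q. Once columns are removed they are coefficients of a Hecke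
  algebra of smaller rank, and the freeness of its symmetrizer modulo higher weights makes them
  vanish.\<close>

lemma (in abelian_group) eq_of_minus_zero:
  assumes "a \<ominus> b = \<zero>" "a \<in> carrier G" "b \<in> carrier G"
  shows "a = b"
  using assms by (metis a_minus_def add.inv_equality minus_minus add.inv_closed)

section \<open>Convolution of functions on words over a commutative ring\<close>

context cring begin

definition conv :: "('x list \<Rightarrow> 'a) \<Rightarrow> ('x list \<Rightarrow> 'a) \<Rightarrow> 'x list \<Rightarrow> 'a" where
  "conv f g w = (\<Oplus>i\<in>{..length w}. f (take i w) \<otimes> g (drop i w))"

text \<open>Convolution at a word is a finite sum for arbitrary functions, so its identities are
  proved on \<open>valued\<close> and finite support is imposed afterwards. The argument type is
  left open because the same set serves below as the space of coefficient functions on words of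
  positions.\<close>

definition valued :: "('x \<Rightarrow> 'a) set" where
  "valued = {f. \<forall>w. f w \<in> carrier R}"

lemma valuedD [simp]: "f \<in> valued \<Longrightarrow> f w \<in> carrier R"
  by (simp add: valued_def)

lemma valuedI [intro]: "(\<And>w. f w \<in> carrier R) \<Longrightarrow> f \<in> valued"
  unfolding valued_def by blast

lemma conv_Nil: "f \<in> valued \<Longrightarrow> g \<in> valued \<Longrightarrow> conv f g [] = f [] \<otimes> g []"
  by (simp add: conv_def)

lemma conv_Cons:
  assumes "f \<in> valued" "g \<in> valued"
  shows "conv f g (x # w) = f [] \<otimes> g (x # w) \<oplus> conv (\<lambda>u. f (x # u)) g w"
proof -
  have "conv f g (x # w) = (\<Oplus>i\<in>{..length w}. f (take (Suc i) (x # w)) \<otimes> g (drop (Suc i) (x # w)))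
      \<oplus> f (take 0 (x # w)) \<otimes> g (drop 0 (x # w))"
    using assms finsum_Suc2 [of "\<lambda>i. f (take i (x # w)) \<otimes> g (drop i (x # w))" "length w"]
    by (simp add: conv_def Pi_def)
  then show ?thesis
    using assms by (simp add: conv_def a_comm finsum_closed)
qed

lemma conv_closed [simp]: "f \<in> valued \<Longrightarrow> g \<in> valued \<Longrightarrow> conv f g \<in> valued"
  by (rule valuedI) (simp add: conv_def finsum_closed)

lemma conv_closed' [simp]: "f \<in> valued \<Longrightarrow> g \<in> valued \<Longrightarrow> conv f g w \<in> carrier R"
  by simp

lemma valued_Cons [simp]: "f \<in> valued \<Longrightarrow> (\<lambda>u. f (x # u)) \<in> valued"
  by auto

lemma conv_add_left:
  assumes "f \<in> valued" "g \<in> valued" "h \<in> valued"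
  shows "conv (\<lambda>w. f w \<oplus> g w) h w = conv f h w \<oplus> conv g h w"
  unfolding conv_def using assms by (simp add: l_distr finsum_addf)

lemma conv_add_right:
  assumes "f \<in> valued" "g \<in> valued" "h \<in> valued"
  shows "conv h (\<lambda>w. f w \<oplus> g w) w = conv h f w \<oplus> conv h g w"
  unfolding conv_def using assms by (simp add: r_distr finsum_addf)

lemma conv_smult_left:
  assumes "f \<in> valued" "h \<in> valued" "c \<in> carrier R"
  shows "conv (\<lambda>w. c \<otimes> f w) h w = c \<otimes> conv f h w"
  unfolding conv_def using assms by (simp add: m_assoc finsum_rdistr)

lemma conv_smult_right:
  assumes "f \<in> valued" "h \<in> valued" "c \<in> carrier R"
  shows "conv f (\<lambda>w. c \<otimes> h w) w = c \<otimes> conv f h w"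
  unfolding conv_def using assms by (simp add: m_lcomm finsum_rdistr)

text \<open>Splitting off the first letter with \<open>conv_Cons\<close> leads to the same claim for
  the translated function \<open>\<lambda>u. f (x # u)\<close>; generalizing over \<open>f\<close>
  lets this induction take the place of an interchange of double sums.\<close>

lemma conv_assoc:
  assumes "f \<in> valued" "g \<in> valued" "h \<in> valued"
  shows "conv (conv f g) h w = conv f (conv g h) w"
  using assms
proof (induction w arbitrary: f g)
  case Nil
  then show ?case by (simp add: conv_Nil m_assoc)
next
  case (Cons x w)
  have "conv (\<lambda>u. conv f g (x # u)) h w
      = conv (\<lambda>u. f [] \<otimes> g (x # u) \<oplus> conv (\<lambda>u. f (x # u)) g u) h w"
    using Cons.prems by (simp add: conv_Cons)
  also have "\<dots> = conv (\<lambda>u. f [] \<otimes> g (x # u)) h w \<oplus> conv (conv (\<lambda>u. f (x # u)) g) h w"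
    using Cons.prems by (subst conv_add_left) auto
  also have "\<dots> = f [] \<otimes> conv (\<lambda>u. g (x # u)) h w \<oplus> conv (\<lambda>u. f (x # u)) (conv g h) w"
    using Cons by (simp add: conv_smult_left)
  finally show ?case
    using Cons.prems by (simp add: conv_Cons conv_Nil r_distr m_assoc a_assoc)
qed

definition delta :: "'x \<Rightarrow> 'x \<Rightarrow> 'a" where
  "delta w u = (if u = w then \<one> else \<zero>)"

lemma delta_valued [simp]: "delta w \<in> valued" by (auto simp: delta_def)

lemma conv_zero_left: "h \<in> valued \<Longrightarrow> conv (\<lambda>w. \<zero>) h w = \<zero>"
  using conv_smult_left [of "\<lambda>w. \<zero>" h \<zero> w] by (simp add: valuedI)

lemma conv_delta_Nil_left: "h \<in> valued \<Longrightarrow> conv (delta []) h w = h w"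
proof (cases w)
  case (Cons x u)
  assume "h \<in> valued"
  moreover have "(\<lambda>u. delta [] (x # u)) = (\<lambda>_. \<zero>)" by (simp add: delta_def)
  ultimately show ?thesis
    using Cons by (simp add: conv_Cons conv_zero_left) (simp add: delta_def)
qed (simp add: conv_Nil, simp add: delta_def)

lemma conv_delta_Nil_right: "h \<in> valued \<Longrightarrow> conv h (delta []) w = h w"
proof (induction w arbitrary: h)
  case Nil
  then show ?case by (simp add: conv_Nil, simp add: delta_def)
next
  case (Cons x u)
  then show ?case by (simp add: conv_Cons, simp add: delta_def)
qed

lemma conv_delta_Cons: "conv (delta [x]) (delta w) = delta (x # w)"
proof
  fix u
  have eq: "(\<lambda>u. delta [x] (y # u)) = (if y = x then delta [] else (\<lambda>_. \<zero>))" for y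
    by (auto simp: delta_def)
  show "conv (delta [x]) (delta w) u = delta (x # w) u"
  proof (cases u)
    case Nil
    then show ?thesis by (simp add: conv_Nil, simp add: delta_def)
  next
    case (Cons y v)
    have "conv (delta [x]) (delta w) u = conv (\<lambda>u. delta [x] (y # u)) (delta w) v"
      unfolding Cons by (subst conv_Cons; simp) (simp add: delta_def)
    also have "\<dots> = (if y = x then delta w v else \<zero>)"
      unfolding eq by (auto simp: conv_delta_Nil_left conv_zero_left)
    finally show ?thesis by (auto simp: Cons delta_def)
  qed
qed

lemma free_alg_simps [simp]:
  "monoid.mult (free_alg R X) = conv" "one (free_alg R X) = delta []"
  "ring.zero (free_alg R X) = (\<lambda>w. \<zero>)" "ring.add (free_alg R X) = (\<lambda>f g w. f w \<oplus> g w)"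
  "smult (free_alg R X) = (\<lambda>c f w. c \<otimes> f w)"
  by (simp_all add: free_alg_def conv_def [abs_def] delta_def [abs_def])

lemma free_alg_carrier:
  "f \<in> carrier (free_alg R X) \<longleftrightarrow>
     f \<in> valued \<and> finite {w. f w \<noteq> \<zero>} \<and> (\<forall>w. f w \<noteq> \<zero> \<longrightarrow> set w \<subseteq> X)"
  unfolding free_alg_def valued_def by simp

lemma conv_support:
  assumes "f \<in> valued" "g \<in> valued"
  shows "{w. conv f g w \<noteq> \<zero>} \<subseteq> (\<lambda>(u, v). u @ v) ` ({w. f w \<noteq> \<zero>} \<times> {w. g w \<noteq> \<zero>})"
proof
  fix w assume w: "w \<in> {w. conv f g w \<noteq> \<zero>}"
  have "\<exists>i. f (take i w) \<otimes> g (drop i w) \<noteq> \<zero>"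
  proof (rule ccontr)
    assume "\<not> ?thesis"
    then have "conv f g w = \<zero>" by (simp add: conv_def)
    then show False using w by simp
  qed
  then obtain i where "f (take i w) \<noteq> \<zero>" "g (drop i w) \<noteq> \<zero>"
    using assms by (metis r_null l_null valuedD)
  then show "w \<in> (\<lambda>(u, v). u @ v) ` ({w. f w \<noteq> \<zero>} \<times> {w. g w \<noteq> \<zero>})"
    by (intro image_eqI [of _ _ "(take i w, drop i w)"]) auto
qed

lemma free_alg_conv_closed:
  assumes "f \<in> carrier (free_alg R X)" "g \<in> carrier (free_alg R X)"
  shows "conv f g \<in> carrier (free_alg R X)"
proof -
  have f: "f \<in> valued" "finite {w. f w \<noteq> \<zero>}" "\<And>w. f w \<noteq> \<zero> \<Longrightarrow> set w \<subseteq> X"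
    and g: "g \<in> valued" "finite {w. g w \<noteq> \<zero>}" "\<And>w. g w \<noteq> \<zero> \<Longrightarrow> set w \<subseteq> X"
    using assms by (simp_all add: free_alg_carrier)
  note supp = conv_support [OF f(1) g(1)]
  have "finite {w. conv f g w \<noteq> \<zero>}"
    using f g by (intro finite_subset [OF supp] finite_imageI finite_SigmaI)
  moreover have "set w \<subseteq> X" if w: "conv f g w \<noteq> \<zero>" for w
  proof -
    obtain u v where "w = u @ v" "f u \<noteq> \<zero>" "g v \<noteq> \<zero>"
      using subsetD [OF supp, of w] w by auto
    then show ?thesis using f(3) [of u] g(3) [of v] unfolding \<open>w = u @ v\<close> set_append by blast
  qed
  ultimately show ?thesis using f(1) g(1) by (simp add: free_alg_carrier)
qed

lemma free_alg_add_closed: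
  assumes "f \<in> carrier (free_alg R X)" "g \<in> carrier (free_alg R X)"
  shows "(\<lambda>w. f w \<oplus> g w) \<in> carrier (free_alg R X)"
proof -
  have supp: "{w. f w \<oplus> g w \<noteq> \<zero>} \<subseteq> {w. f w \<noteq> \<zero>} \<union> {w. g w \<noteq> \<zero>}" by auto
  have "finite {w. f w \<oplus> g w \<noteq> \<zero>}"
    using assms by (intro finite_subset [OF supp]) (simp add: free_alg_carrier)
  then show ?thesis
    using assms supp by (auto simp: free_alg_carrier)
qed

lemma free_alg_smult_closed:
  assumes "f \<in> carrier (free_alg R X)" "c \<in> carrier R"
  shows "(\<lambda>w. c \<otimes> f w) \<in> carrier (free_alg R X)"
proof -
  have supp: "{w. c \<otimes> f w \<noteq> \<zero>} \<subseteq> {w. f w \<noteq> \<zero>}" using assms by auto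
  have "finite {w. c \<otimes> f w \<noteq> \<zero>}"
    using assms by (intro finite_subset [OF supp]) (simp add: free_alg_carrier)
  then show ?thesis
    using assms supp by (auto simp: free_alg_carrier)
qed

lemma delta_in_free_alg: "set w \<subseteq> X \<Longrightarrow> delta w \<in> carrier (free_alg R X)"
  by (auto simp: free_alg_carrier delta_def)

lemma zero_in_free_alg: "(\<lambda>w. \<zero>) \<in> carrier (free_alg R X)"
  by (auto simp: free_alg_carrier)

lemma valuedI_carrier: "f \<in> carrier (free_alg R X) \<Longrightarrow> f \<in> valued"
  by (simp add: free_alg_carrier)

lemma free_alg_ring: "ring (free_alg R X)"
proof (rule ringI)
  show "abelian_group (free_alg R X)"
  proof (rule abelian_groupI; simp add: free_alg_add_closed zero_in_free_alg)
    show "\<exists>g\<in>carrier (free_alg R X). (\<lambda>w. g w \<oplus> f w) = (\<lambda>w. \<zero>)"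
      if "f \<in> carrier (free_alg R X)" for f
      using that free_alg_smult_closed [of f X "\<ominus> \<one>"]
      by (intro bexI [of _ "\<lambda>w. \<ominus> \<one> \<otimes> f w"]) (auto simp: free_alg_carrier l_minus l_neg)
  qed (auto simp: free_alg_carrier a_ac)
  show "monoid (free_alg R X)"
  proof (rule monoidI, unfold free_alg_simps)
    fix f g h
    assume "f \<in> carrier (free_alg R X)" "g \<in> carrier (free_alg R X)" "h \<in> carrier (free_alg R X)"
    then show "conv (conv f g) h = conv f (conv g h)"
      by (simp add: conv_assoc fun_eq_iff valuedI_carrier)
  qed (auto simp: free_alg_conv_closed delta_in_free_alg conv_delta_Nil_left conv_delta_Nil_right valuedI_carrier)
qed (auto simp: conv_add_left conv_add_right fun_eq_iff valuedI_carrier)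

text \<open>Reduces claims that are linear in an element to monomials; one word is removed from the
  support at a time.\<close>

lemma free_alg_induct [consumes 1, case_names zero add]:
  assumes f: "f \<in> carrier (free_alg R X)"
    and zero: "P (\<lambda>w. \<zero>)"
    and add: "\<And>c w g. c \<in> carrier R \<Longrightarrow> set w \<subseteq> X \<Longrightarrow> g \<in> carrier (free_alg R X) \<Longrightarrow> P g
        \<Longrightarrow> P (\<lambda>u. c \<otimes> delta w u \<oplus> g u)"
  shows "P f"
  using f
proof (induction "card {w. f w \<noteq> \<zero>}" arbitrary: f)
  case 0
  then have "f = (\<lambda>w. \<zero>)" by (auto simp: free_alg_carrier)
  then show ?case using zero by simp
next
  case (Suc k)
  then obtain w where w: "f w \<noteq> \<zero>"
    by (cases "{w. f w \<noteq> \<zero>} = {}") auto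
  define g where "g u = (if u = w then \<zero> else f u)" for u
  have supp: "{u. g u \<noteq> \<zero>} = {u. f u \<noteq> \<zero>} - {w}" by (auto simp: g_def)
  have g: "g \<in> carrier (free_alg R X)"
    using Suc.prems unfolding free_alg_carrier supp by (auto simp: g_def)
  have "card {u. g u \<noteq> \<zero>} = k"
    unfolding supp using Suc.prems Suc.hyps(2) w by (simp add: free_alg_carrier)
  then have "P g" using Suc.hyps(1) g by blast
  moreover have "f = (\<lambda>u. f w \<otimes> delta w u \<oplus> g u)"
    using Suc.prems by (auto simp: g_def delta_def free_alg_carrier)
  moreover have "f w \<in> carrier R" "set w \<subseteq> X"
    using Suc.prems w by (auto simp: free_alg_carrier)
  ultimately show ?case
    using add [of "f w" w g] g by simp
qed

declare free_alg_simps [simp del]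

end

declare One_nat_def [simp del]

locale hecke = hecke_setup K q n + cring K
  for K :: "('a, 'k) ring_scheme" (structure) and q :: 'a and n :: nat +
  assumes q_unit: "q \<in> Units K"
begin

lemma q_closed [simp]: "q \<in> carrier K" using q_unit by blast

sublocale Free: ring Free by (rule free_alg_ring)

abbreviation Irel where "Irel \<equiv> Idl\<^bsub>Free\<^esub> hecke_relations"

lemma X_delta: "X i = delta [i]"
  by (auto simp: free_gen_def delta_def)

lemma X_closed [simp]: "i \<in> {1..<n} \<Longrightarrow> X i \<in> carrier Free"
  by (simp add: X_delta delta_in_free_alg)

lemma smult_one_closed [simp]: "c \<in> carrier K \<Longrightarrow> c \<odot>\<^bsub>Free\<^esub> \<one>\<^bsub>Free\<^esub> \<in> carrier Free"
  by (simp add: free_alg_simps free_alg_smult_closed delta_in_free_alg)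

lemma relations_closed: "hecke_relations \<subseteq> carrier Free"
proof -
  have "q \<odot>\<^bsub>Free\<^esub> \<one>\<^bsub>Free\<^esub> \<in> carrier Free" by simp
  then show ?thesis
    unfolding hecke_relations_def
    by (auto intro!: Free.minus_closed Free.m_closed Free.add.m_closed)
qed

lemma I_ideal: "ideal Irel Free"
  by (rule Free.genideal_ideal [OF relations_closed])

sublocale I: ideal Irel Free by (rule I_ideal)

sublocale FQ: ring "Free Quot Irel" by (rule I.quotient_is_ring)

lemma H_simps:
  "carrier H = carrier (Free Quot Irel)" "monoid.mult H = monoid.mult (Free Quot Irel)" "one H = one (Free Quot Irel)"
  "ring.zero H = ring.zero (Free Quot Irel)" "ring.add H = ring.add (Free Quot Irel)"
  by (simp_all add: H_def quot_alg_def ring.extend_def module.fields_def)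

lemma H_ring: "ring H"
proof (rule ringI)
  show "abelian_group H"
    unfolding abelian_group_def abelian_group_axioms_def abelian_monoid_def H_simps
    using FQ.add.comm_group_axioms FQ.add.comm_monoid_axioms
    by (simp add: comm_group_def comm_monoid_def comm_monoid_axioms_def group_def group_axioms_def monoid_def Units_def)
  show "monoid H"
    using FQ.monoid_axioms unfolding Group.monoid_def H_simps .
qed (unfold H_simps, (rule FQ.l_distr FQ.r_distr; assumption)+)

sublocale H: ring H by (rule H_ring)

section \<open>The quotient map and the central scalars\<close>

definition proj :: "(nat list \<Rightarrow> 'a) \<Rightarrow> (nat list \<Rightarrow> 'a) set" where
  "proj f = Irel +>\<^bsub>Free\<^esub> f"

lemma proj_hom: "proj \<in> ring_hom Free H"
  using I.rcos_ring_hom unfolding ring_hom_def proj_def H_simps .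

sublocale proj: ring_hom_ring Free H proj
  by (rule ring_hom_ringI2) (auto simp: Free.ring_axioms H.ring_axioms proj_hom)

lemma proj_surj: "h \<in> carrier H \<Longrightarrow> \<exists>f\<in>carrier Free. h = proj f"
  unfolding H_simps FactRing_def A_RCOSETS_def' proj_def by auto

lemma proj_zero_iff: "f \<in> carrier Free \<Longrightarrow> proj f = \<zero>\<^bsub>H\<^esub> \<longleftrightarrow> f \<in> Irel"
  unfolding proj_def H_simps FactRing_def
  using I.a_rcos_const I.a_rcos_self by auto

text \<open>Scalars become central elements, so that scalar multiplication turns into ring
  multiplication (\<open>H_smult\<close>) and module identities can be settled by ring
  simplification.\<close>

definition \<iota> :: "'a \<Rightarrow> (nat list \<Rightarrow> 'a) set" where
  "\<iota> c = proj (c \<odot>\<^bsub>Free\<^esub> \<one>\<^bsub>Free\<^esub>)"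

lemma \<iota>_closed [simp]: "c \<in> carrier K \<Longrightarrow> \<iota> c \<in> carrier H"
  by (simp add: \<iota>_def proj.hom_closed del: free_alg_simps)

lemma smult_conv:
  assumes "f \<in> carrier Free" "c \<in> carrier K"
  shows "(\<lambda>w. c \<otimes> f w) = (c \<odot>\<^bsub>Free\<^esub> \<one>\<^bsub>Free\<^esub>) \<otimes>\<^bsub>Free\<^esub> f"
    and "(\<lambda>w. c \<otimes> f w) = f \<otimes>\<^bsub>Free\<^esub> (c \<odot>\<^bsub>Free\<^esub> \<one>\<^bsub>Free\<^esub>)"
  using assms(2) valuedI_carrier [OF assms(1)]
  by (auto simp: free_alg_simps conv_smult_left conv_smult_right conv_delta_Nil_left conv_delta_Nil_right)

lemma \<iota>_proj:
  assumes "f \<in> carrier Free" "c \<in> carrier K"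
  shows "proj (\<lambda>w. c \<otimes> f w) = \<iota> c \<otimes>\<^bsub>H\<^esub> proj f"
    and "proj (\<lambda>w. c \<otimes> f w) = proj f \<otimes>\<^bsub>H\<^esub> \<iota> c"
  unfolding \<iota>_def smult_conv(1) [OF assms] 
   apply (simp add: assms)
  unfolding smult_conv(1) [OF assms, symmetric] smult_conv(2) [OF assms]
  by (simp add: assms)

lemma \<iota>_central: "c \<in> carrier K \<Longrightarrow> h \<in> carrier H \<Longrightarrow> h \<otimes>\<^bsub>H\<^esub> \<iota> c = \<iota> c \<otimes>\<^bsub>H\<^esub> h"
  using proj_surj [of h] \<iota>_proj by metis

lemma \<iota>_add: "c \<in> carrier K \<Longrightarrow> d \<in> carrier K \<Longrightarrow> \<iota> (c \<oplus> d) = \<iota> c \<oplus>\<^bsub>H\<^esub> \<iota> d"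
  unfolding \<iota>_def by (subst proj.hom_add [symmetric]) (auto simp: free_alg_simps l_distr delta_in_free_alg free_alg_smult_closed)

lemma \<iota>_mult: "c \<in> carrier K \<Longrightarrow> d \<in> carrier K \<Longrightarrow> \<iota> (c \<otimes> d) = \<iota> c \<otimes>\<^bsub>H\<^esub> \<iota> d"
  using \<iota>_proj(1) [of "\<lambda>w. d \<otimes> delta [] w" c] free_alg_smult_closed [of "delta []" "{1..<n}" d]
  by (simp add: \<iota>_def free_alg_simps delta_in_free_alg m_assoc)

lemma \<iota>_one [simp]: "\<iota> \<one> = \<one>\<^bsub>H\<^esub>"
proof -
  have "(\<lambda>w. \<one> \<otimes> delta [] w) = delta []" by auto
  then show ?thesis using proj.hom_one by (simp add: \<iota>_def free_alg_simps)
qed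

lemma \<iota>_zero [simp]: "\<iota> \<zero> = \<zero>\<^bsub>H\<^esub>"
  using proj.hom_zero by (simp add: \<iota>_def free_alg_simps)

lemma \<iota>_uminus: "c \<in> carrier K \<Longrightarrow> \<iota> (\<ominus> c) = \<ominus>\<^bsub>H\<^esub> \<iota> c"
  by (metis H.minus_equality \<iota>_add \<iota>_closed \<iota>_zero a_inv_closed l_neg)

lemma \<iota>_minus: "c \<in> carrier K \<Longrightarrow> d \<in> carrier K \<Longrightarrow> \<iota> (c \<ominus> d) = \<iota> c \<ominus>\<^bsub>H\<^esub> \<iota> d"
  by (simp add: a_minus_def \<iota>_add \<iota>_uminus H.minus_eq)

text \<open>The scalar multiple of a coset is a union over its representatives; each representative
  contributes the same coset, because scaling it is multiplication by \<open>\<iota> c\<close> after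
  projection.\<close>

lemma H_smult:
  assumes "c \<in> carrier K" "h \<in> carrier H"
  shows "c \<odot>\<^bsub>H\<^esub> h = \<iota> c \<otimes>\<^bsub>H\<^esub> h"
proof -
  obtain f where f: "f \<in> carrier Free" "h = proj f" using proj_surj assms by blast
  have eq: "Irel +>\<^bsub>Free\<^esub> (c \<odot>\<^bsub>Free\<^esub> x) = \<iota> c \<otimes>\<^bsub>H\<^esub> h" if "x \<in> h" for x
  proof -
    have "x \<in> Irel +>\<^bsub>Free\<^esub> f" using that f by (simp add: proj_def)
    then have x: "x \<in> carrier Free" "proj x = h"
      using f I.a_repr_independence' [of x f] I.a_rcosets_carrier
      by (auto simp: proj_def a_r_coset_def' dest: I.a_Hcarr)
    then show ?thesis using \<iota>_proj(1) [of x c] assms by (simp add: proj_def free_alg_simps)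
  qed
  have "f \<in> h" using f by (simp add: proj_def I.a_rcos_self)
  moreover have "c \<odot>\<^bsub>H\<^esub> h = (\<Union>x\<in>h. Irel +>\<^bsub>Free\<^esub> (c \<odot>\<^bsub>Free\<^esub> x))"
    by (simp add: H_def quot_alg_def ring.extend_def module.fields_def)
  ultimately show ?thesis using eq by auto
qed

end

abbreviation s :: "nat \<Rightarrow> nat \<Rightarrow> nat" where "s i \<equiv> transpose i (Suc i)"

context hecke begin

abbreviation hmult (infixl "\<cdot>" 70) where "x \<cdot> y \<equiv> x \<otimes>\<^bsub>H\<^esub> y"
abbreviation hadd (infixl "\<^bold>+" 65) where "x \<^bold>+ y \<equiv> x \<oplus>\<^bsub>H\<^esub> y"
abbreviation hone ("\<^bold>1") where "\<^bold>1 \<equiv> \<one>\<^bsub>H\<^esub>"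
abbreviation hzero ("\<^bold>0") where "\<^bold>0 \<equiv> \<zero>\<^bsub>H\<^esub>"

section \<open>The generators and their relations in the quotient\<close>

lemma T_proj: "T i = proj (X i)"
  by (simp add: T_def proj_def)

lemma T_closed: "i \<in> {1..<n} \<Longrightarrow> T i \<in> carrier H"
  by (simp add: T_proj)

lemma proj_relation: "r \<in> hecke_relations \<Longrightarrow> proj r = \<^bold>0"
  using proj_zero_iff [of r] Free.genideal_self [OF relations_closed] relations_closed by blast

lemma proj_minus: "f \<in> carrier Free \<Longrightarrow> g \<in> carrier Free \<Longrightarrow> proj (f \<ominus>\<^bsub>Free\<^esub> g) = proj f \<ominus>\<^bsub>H\<^esub> proj g"
  by (simp add: a_minus_def)

lemma proj_minus_relation:
  assumes "f \<ominus>\<^bsub>Free\<^esub> g \<in> hecke_relations" "f \<in> carrier Free" "g \<in> carrier Free"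
  shows "proj f = proj g"
  using proj_relation [OF assms(1)] assms(2,3) by - (rule H.eq_of_minus_zero, simp_all add: proj_minus)

text \<open>Setting \<open>t i = 1\<close> outside the range of generators makes every expression in the
  generators an element of the algebra; the relations hold for indices in range only.\<close>

definition t :: "nat \<Rightarrow> (nat list \<Rightarrow> 'a) set" where
  "t i = (if i \<in> {1..<n} then T i else \<^bold>1)"

lemma t_closed [simp]: "t i \<in> carrier H"
  by (simp add: t_def T_closed)

lemma t_far: "i + 2 \<le> j \<or> j + 2 \<le> i \<Longrightarrow> t i \<cdot> t j = t j \<cdot> t i"
proof (cases "i \<in> {1..<n} \<and> j \<in> {1..<n}")
  case True
  assume "i + 2 \<le> j \<or> j + 2 \<le> i"
  then have "X i \<otimes>\<^bsub>Free\<^esub> X j \<ominus>\<^bsub>Free\<^esub> X j \<otimes>\<^bsub>Free\<^esub> X i \<in> hecke_relations"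
    unfolding hecke_relations_def using True by blast
  from proj_minus_relation [OF this] show ?thesis
    using True by (simp add: t_def T_proj)
qed (auto simp: t_def T_closed)

lemma t_braid:
  assumes "1 \<le> i" "Suc i < n"
  shows "t i \<cdot> t (Suc i) \<cdot> t i = t (Suc i) \<cdot> t i \<cdot> t (Suc i)"
proof -
  have i: "i \<in> {1..<n}" "Suc i \<in> {1..<n}" using assms by auto
  then have "X i \<otimes>\<^bsub>Free\<^esub> X (Suc i) \<otimes>\<^bsub>Free\<^esub> X i
      \<ominus>\<^bsub>Free\<^esub> X (Suc i) \<otimes>\<^bsub>Free\<^esub> X i \<otimes>\<^bsub>Free\<^esub> X (Suc i) \<in> hecke_relations"
    unfolding hecke_relations_def by blast
  from proj_minus_relation [OF this] show ?thesis
    using i by (simp add: t_def T_proj)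
qed

text \<open>In this form the quadratic relation says directly that every element of the right ideal
  generated by 1 + \<open>t i\<close> is an eigenvector of \<open>t i\<close> with eigenvalue q; row
  symmetrizers are of this kind (\<open>t_eigen\<close>).\<close>

lemma t_quad:
  assumes "1 \<le> i" "i < n"
  shows "t i \<cdot> (\<^bold>1 \<^bold>+ t i) = \<iota> q \<cdot> (\<^bold>1 \<^bold>+ t i)"
proof -
  have i: "i \<in> {1..<n}" using assms by auto
  then have rel: "(X i \<ominus>\<^bsub>Free\<^esub> q \<odot>\<^bsub>Free\<^esub> \<one>\<^bsub>Free\<^esub>) \<otimes>\<^bsub>Free\<^esub> (X i \<oplus>\<^bsub>Free\<^esub> \<one>\<^bsub>Free\<^esub>) \<in> hecke_relations"
    unfolding hecke_relations_def by blast
  have "(T i \<ominus>\<^bsub>H\<^esub> \<iota> q) \<cdot> (T i \<^bold>+ \<^bold>1) = \<^bold>0"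
    using proj_relation [OF rel] i by (simp add: T_proj proj_minus \<iota>_def)
  then have "T i \<cdot> (T i \<^bold>+ \<^bold>1) \<ominus>\<^bsub>H\<^esub> \<iota> q \<cdot> (T i \<^bold>+ \<^bold>1) = \<^bold>0"
    using T_closed [OF i] by (simp only: a_minus_def H.l_distr H.l_minus H.a_closed H.one_closed \<iota>_closed q_closed H.a_inv_closed)
  then have "T i \<cdot> (T i \<^bold>+ \<^bold>1) = \<iota> q \<cdot> (T i \<^bold>+ \<^bold>1)"
    using T_closed [OF i] by - (rule H.eq_of_minus_zero, simp_all)
  then show ?thesis using i T_closed [OF i] by (simp add: t_def H.a_comm)
qed

definition Tw :: "nat list \<Rightarrow> (nat list \<Rightarrow> 'a) set" where
  "Tw w = foldr (\<lambda>i h. t i \<cdot> h) w \<^bold>1"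

lemma Tw_simps [simp]: "Tw [] = \<^bold>1" "Tw (i # w) = t i \<cdot> Tw w"
  by (simp_all add: Tw_def)

lemma Tw_closed [simp]: "Tw w \<in> carrier H"
  by (induction w) auto

lemma Tw_append [simp]: "Tw (v @ w) = Tw v \<cdot> Tw w"
  by (induction v) (auto simp: H.m_assoc)

lemma proj_delta: "set w \<subseteq> {1..<n} \<Longrightarrow> proj (delta w) = Tw w"
proof (induction w)
  case Nil
  then show ?case using proj.hom_one by (simp add: free_alg_simps)
next
  case (Cons i w)
  have "delta (i # w) = X i \<otimes>\<^bsub>Free\<^esub> delta w"
    by (simp add: free_alg_simps X_delta conv_delta_Cons)
  then have "proj (delta (i # w)) = proj (X i) \<cdot> proj (delta w)"
    using Cons.prems by (simp add: delta_in_free_alg)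
  then show ?case using Cons by (simp add: t_def T_proj)
qed

lemma H_induct [consumes 1, case_names zero add]:
  assumes h: "h \<in> carrier H" and zero: "P \<^bold>0"
    and add: "\<And>c w g. c \<in> carrier K \<Longrightarrow> set w \<subseteq> {1..<n} \<Longrightarrow> g \<in> carrier H \<Longrightarrow> P g
      \<Longrightarrow> P (\<iota> c \<cdot> Tw w \<^bold>+ g)"
  shows "P h"
proof -
  obtain f where f: "f \<in> carrier Free" "h = proj f" using proj_surj h by blast
  have "P (proj f)"
    using f(1)
  proof (induction rule: free_alg_induct)
    case zero
    then show ?case using assms(2) proj.hom_zero by (simp add: free_alg_simps)
  next
    case (add c w g)
    have d: "(\<lambda>u. c \<otimes> delta w u) \<in> carrier Free"
      using add by (simp add: free_alg_smult_closed delta_in_free_alg)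
    have "proj (\<lambda>u. c \<otimes> delta w u \<oplus> g u) = proj ((\<lambda>u. c \<otimes> delta w u) \<oplus>\<^bsub>Free\<^esub> g)"
      by (simp add: free_alg_simps)
    also have "\<dots> = \<iota> c \<cdot> Tw w \<^bold>+ proj g"
      using add d by (simp add: \<iota>_proj(1) delta_in_free_alg proj_delta)
    finally show ?case using add assms(3) by simp
  qed
  then show ?thesis using f by simp
qed

section \<open>The signed permutation modules on words\<close>

text \<open>Words are functions from positions to letters.  \<open>opN i\<close> is the action of the generator
  with index \<open>i\<close> on coefficient functions of formal combinations of words: adjacent equal letters
  are negated.\<close>

definition opN :: "nat \<Rightarrow> ((nat \<Rightarrow> nat) \<Rightarrow> 'a) \<Rightarrow> (nat \<Rightarrow> nat) \<Rightarrow> 'a" where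
  "opN i \<nu> x = (if x (Suc i) < x i then q \<otimes> \<nu> (x \<circ> s i)
     else if x i < x (Suc i) then \<nu> (x \<circ> s i) \<oplus> (q \<ominus> \<one>) \<otimes> \<nu> x else \<ominus> \<nu> x)"

definition opw :: "nat list \<Rightarrow> ((nat \<Rightarrow> nat) \<Rightarrow> 'a) \<Rightarrow> (nat \<Rightarrow> nat) \<Rightarrow> 'a" where
  "opw w = foldr opN w"

lemma opw_simps [simp]: "opw [] \<nu> = \<nu>" "opw (i # w) \<nu> = opN i (opw w \<nu>)"
  by (simp_all add: opw_def)

lemma opN_valued [simp]: "\<nu> \<in> valued \<Longrightarrow> opN i \<nu> \<in> valued"
  by (rule valuedI) (simp add: opN_def)

lemma opw_valued [simp]: "\<nu> \<in> valued \<Longrightarrow> opw w \<nu> \<in> valued"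
  by (induction w) auto

lemma opN_gt: "x (Suc i) < x i \<Longrightarrow> opN i \<nu> x = q \<otimes> \<nu> (x \<circ> s i)"
  and opN_lt: "x i < x (Suc i) \<Longrightarrow> opN i \<nu> x = \<nu> (x \<circ> s i) \<oplus> (q \<ominus> \<one>) \<otimes> \<nu> x"
  and opN_eq: "x i = x (Suc i) \<Longrightarrow> opN i \<nu> x = \<ominus> \<nu> x"
  by (simp_all add: opN_def)

lemma opN_linear:
  assumes "\<nu> \<in> valued" "\<mu> \<in> valued" "c \<in> carrier K"
  shows "opN i (\<lambda>x. c \<otimes> \<nu> x \<oplus> \<mu> x) = (\<lambda>x. c \<otimes> opN i \<nu> x \<oplus> opN i \<mu> x)"
proof
  fix x
  define a b a' b' where ab: "a = \<nu> x" "b = \<mu> x" "a' = \<nu> (x \<circ> s i)" "b' = \<mu> (x \<circ> s i)"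
  have "a \<in> carrier K" "b \<in> carrier K" "a' \<in> carrier K" "b' \<in> carrier K"
    using assms by (simp_all add: ab)
  with assms(3) q_closed show "opN i (\<lambda>x. c \<otimes> \<nu> x \<oplus> \<mu> x) x = c \<otimes> opN i \<nu> x \<oplus> opN i \<mu> x"
    by - (cases "x i" "x (Suc i)" rule: linorder_cases; simp only: opN_gt opN_lt opN_eq ab [symmetric]; algebra)
qed

lemma opN_zero: "opN i (\<lambda>x. \<zero>) = (\<lambda>x. \<zero>)"
  by (auto simp: opN_def fun_eq_iff)

lemma s_s [simp]: "x \<circ> s i \<circ> s i = x"
  by (simp add: o_assoc [symmetric])

lemma s_i: "(x \<circ> s i) i = x (Suc i)" and s_Suc: "(x \<circ> s i) (Suc i) = x i"
  by simp_all

lemma opN_quad: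
  assumes "\<nu> \<in> valued"
  shows "opN i (opN i \<nu>) x = q \<otimes> \<nu> x \<oplus> (q \<ominus> \<one>) \<otimes> opN i \<nu> x"
proof -
  define a a' where ab: "a = \<nu> x" "a' = \<nu> (x \<circ> s i)"
  have "a \<in> carrier K" "a' \<in> carrier K" using assms by (simp_all add: ab)
  with q_closed show ?thesis
    by - (cases "x i" "x (Suc i)" rule: linorder_cases; simp only: opN_gt opN_lt opN_eq s_s s_i s_Suc ab [symmetric]; algebra)
qed

lemma opN_far:
  assumes "\<nu> \<in> valued" and ij: "i + 2 \<le> j \<or> j + 2 \<le> i"
  shows "opN i (opN j \<nu>) x = opN j (opN i \<nu>) x"
proof -
  have x: "(x \<circ> s i) j = x j" "(x \<circ> s i) (Suc j) = x (Suc j)" "(x \<circ> s j) i = x i" "(x \<circ> s j) (Suc i) = x (Suc i)"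
    using ij by (auto simp: transpose_def)
  have c: "x \<circ> s j \<circ> s i = x \<circ> s i \<circ> s j"
    using ij by (auto simp: fun_eq_iff transpose_def)
  define a b d e where ab: "a = \<nu> x" "b = \<nu> (x \<circ> s i)" "d = \<nu> (x \<circ> s j)" "e = \<nu> (x \<circ> s i \<circ> s j)"
  have "a \<in> carrier K" "b \<in> carrier K" "d \<in> carrier K" "e \<in> carrier K" using assms by (simp_all add: ab)
  with q_closed show ?thesis
    by - (cases "x i" "x (Suc i)" rule: linorder_cases; cases "x j" "x (Suc j)" rule: linorder_cases;
        simp only: opN_gt opN_lt opN_eq x c ab [symmetric]; algebra)
qed

text \<open>Every relative order of the three letters, ties included, is checked; each case is an
  identity between the values of \<nu> on the rearrangements of three positions.\<close>

lemma opN_braid: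
  assumes "\<nu> \<in> valued"
  shows "opN i (opN (Suc i) (opN i \<nu>)) x = opN (Suc i) (opN i (opN (Suc i) \<nu>)) x"
proof -
  let ?j = "Suc i"
  have c: "x \<circ> s ?j \<circ> s i \<circ> s ?j = x \<circ> s i \<circ> s ?j \<circ> s i"
    by (auto simp: fun_eq_iff transpose_def)
  have x: "(x \<circ> s i) i = x ?j" "(x \<circ> s i) ?j = x i" "(x \<circ> s i) (Suc ?j) = x (Suc ?j)"
    "(x \<circ> s ?j) i = x i" "(x \<circ> s ?j) ?j = x (Suc ?j)" "(x \<circ> s ?j) (Suc ?j) = x ?j" for x :: "nat \<Rightarrow> nat"
    by (auto simp: transpose_def)
  define a b d e f g where ab: "a = \<nu> x" "b = \<nu> (x \<circ> s i)" "d = \<nu> (x \<circ> s ?j)"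
    "e = \<nu> (x \<circ> s i \<circ> s ?j)" "f = \<nu> (x \<circ> s ?j \<circ> s i)" "g = \<nu> (x \<circ> s i \<circ> s ?j \<circ> s i)"
  \<comment> \<open>Normalization is first carried out with \<open>r\<close> as an independent
    letter; cases that depend on its relation to \<open>q\<close> are finished by substituting r + 1
    for \<open>q\<close>.\<close>
  define r where "r = q \<ominus> \<one>"
  have qr: "q = r \<oplus> \<one>" unfolding r_def using q_closed by algebra
  have "a \<in> carrier K" "b \<in> carrier K" "d \<in> carrier K" "e \<in> carrier K" "f \<in> carrier K" "g \<in> carrier K" "r \<in> carrier K"
    using assms by (simp_all add: ab r_def)
  with q_closed show ?thesis
    by - (cases "x i" "x ?j" rule: linorder_cases; cases "x i" "x (Suc ?j)" rule: linorder_cases;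
        cases "x ?j" "x (Suc ?j)" rule: linorder_cases;
        (linarith | (simp only: opN_gt opN_lt opN_eq x c s_s ab [symmetric] r_def [symmetric];
          algebra; simp only: qr; algebra)))
qed


section \<open>From operators on words to a representation of the Hecke algebra\<close>

definition actF :: "(nat list \<Rightarrow> 'a) \<Rightarrow> ((nat \<Rightarrow> nat) \<Rightarrow> 'a) \<Rightarrow> (nat \<Rightarrow> nat) \<Rightarrow> 'a" where
  "actF f \<nu> x = (\<Oplus>w\<in>{w. f w \<noteq> \<zero>}. f w \<otimes> opw w \<nu> x)"

lemma actF_eq:
  assumes "f \<in> valued" "\<nu> \<in> valued" "finite A" "{w. f w \<noteq> \<zero>} \<subseteq> A"
  shows "actF f \<nu> x = (\<Oplus>w\<in>A. f w \<otimes> opw w \<nu> x)"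
  unfolding actF_def using assms
  by (intro add.finprod_mono_neutral_cong_left) auto

lemma actF_valued [simp]: "f \<in> valued \<Longrightarrow> \<nu> \<in> valued \<Longrightarrow> actF f \<nu> \<in> valued"
  by (rule valuedI) (simp add: actF_def finsum_closed Pi_def)

lemma actF_zero: "actF (\<lambda>w. \<zero>) \<nu> = (\<lambda>x. \<zero>)"
  by (simp add: actF_def fun_eq_iff)

lemma actF_add:
  assumes "f \<in> carrier Free" "g \<in> carrier Free" "\<nu> \<in> valued"
  shows "actF (\<lambda>w. f w \<oplus> g w) \<nu> = (\<lambda>x. actF f \<nu> x \<oplus> actF g \<nu> x)"
proof
  fix x
  let ?A = "{w. f w \<noteq> \<zero>} \<union> {w. g w \<noteq> \<zero>}"
  have v: "f \<in> valued" "g \<in> valued" "finite ?A" "(\<lambda>w. f w \<oplus> g w) \<in> valued"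
    using assms by (auto simp: free_alg_carrier)
  have "actF (\<lambda>w. f w \<oplus> g w) \<nu> x = (\<Oplus>w\<in>?A. (f w \<oplus> g w) \<otimes> opw w \<nu> x)"
    using v assms by (intro actF_eq) auto
  also have "\<dots> = (\<Oplus>w\<in>?A. f w \<otimes> opw w \<nu> x \<oplus> g w \<otimes> opw w \<nu> x)"
    using v assms by (intro finsum_cong') (auto simp: l_distr)
  also have "\<dots> = (\<Oplus>w\<in>?A. f w \<otimes> opw w \<nu> x) \<oplus> (\<Oplus>w\<in>?A. g w \<otimes> opw w \<nu> x)"
    using v assms by (intro finsum_addf) auto
  also have "\<dots> = actF f \<nu> x \<oplus> actF g \<nu> x"
    using v assms by (simp add: actF_eq [of f \<nu> ?A] actF_eq [of g \<nu> ?A])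
  finally show "actF (\<lambda>w. f w \<oplus> g w) \<nu> x = actF f \<nu> x \<oplus> actF g \<nu> x" .
qed

lemma actF_delta:
  assumes "c \<in> carrier K" "\<nu> \<in> valued"
  shows "actF (\<lambda>u. c \<otimes> delta w u) \<nu> = (\<lambda>x. c \<otimes> opw w \<nu> x)"
proof
  fix x
  have "actF (\<lambda>u. c \<otimes> delta w u) \<nu> x = (\<Oplus>u\<in>{w}. c \<otimes> delta w u \<otimes> opw u \<nu> x)"
    using assms by (intro actF_eq valuedI) (auto simp: delta_def)
  then show "actF (\<lambda>u. c \<otimes> delta w u) \<nu> x = c \<otimes> opw w \<nu> x"
    using assms by (simp add: delta_def)
qed

lemma smult_delta_closed: "c \<in> carrier K \<Longrightarrow> set w \<subseteq> {1..<n} \<Longrightarrow> (\<lambda>u. c \<otimes> delta w u) \<in> carrier Free"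
  by (simp add: free_alg_smult_closed delta_in_free_alg)

lemma actF_step:
  assumes "c \<in> carrier K" "set w \<subseteq> {1..<n}" "g \<in> carrier Free" "\<nu> \<in> valued"
  shows "actF (\<lambda>u. c \<otimes> delta w u \<oplus> g u) \<nu> = (\<lambda>x. c \<otimes> opw w \<nu> x \<oplus> actF g \<nu> x)"
  using assms by (simp add: actF_add smult_delta_closed actF_delta)

lemma conv_smult_delta:
  assumes "c \<in> carrier K" "set w \<subseteq> {1..<n}" "g \<in> carrier Free" "h \<in> carrier Free"
  shows "conv h (\<lambda>u. c \<otimes> delta w u \<oplus> g u) = (\<lambda>u. c \<otimes> conv h (delta w) u \<oplus> conv h g u)"
    and "conv (\<lambda>u. c \<otimes> delta w u \<oplus> g u) h = (\<lambda>u. c \<otimes> conv (delta w) h u \<oplus> conv g h u)"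
  using assms valuedI_carrier [OF smult_delta_closed [OF assms(1,2)]]
  by (simp_all add: fun_eq_iff conv_add_right conv_add_left conv_smult_right conv_smult_left valuedI_carrier)

lemma actF_gen:
  assumes "i \<in> {1..<n}" "g \<in> carrier Free" "\<nu> \<in> valued"
  shows "actF (conv (delta [i]) g) \<nu> = opN i (actF g \<nu>)"
  using assms(2)
proof (induction rule: free_alg_induct)
  case zero
  have "conv (delta [i]) (\<lambda>w. \<zero>) = (\<lambda>w. \<zero>)"
    using conv_smult_right [of "delta [i]" "\<lambda>w. \<zero>" \<zero>] by (auto simp: valuedI)
  then show ?case by (simp add: actF_zero opN_zero)
next
  case (add c w g)
  have d: "delta [i] \<in> carrier Free" using assms by (simp add: delta_in_free_alg)
  have w: "set (i # w) \<subseteq> {1..<n}" using assms add by auto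
  show ?case
    unfolding conv_smult_delta(1) [OF add(1,2,3) d] conv_delta_Cons
    using add w assms d
    by (simp add: actF_step free_alg_conv_closed opN_linear valuedI_carrier)
qed

lemma actF_word:
  assumes "g \<in> carrier Free" "\<nu> \<in> valued" "set w \<subseteq> {1..<n}"
  shows "actF (conv (delta w) g) \<nu> = opw w (actF g \<nu>)"
  using assms(3)
proof (induction w)
  case Nil
  have "conv (delta []) g = g" using assms by (auto simp: conv_delta_Nil_left valuedI_carrier)
  then show ?case by simp
next
  case (Cons i w)
  have "conv (delta (i # w)) g = conv (delta [i]) (conv (delta w) g)"
    using assms conv_assoc [of "delta [i]" "delta w" g] by (auto simp: conv_delta_Cons valuedI_carrier)
  then show ?case
    using Cons assms by (simp add: actF_gen free_alg_conv_closed delta_in_free_alg)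
qed

lemma actF_smult:
  assumes "g \<in> carrier Free" "\<nu> \<in> valued" "c \<in> carrier K"
  shows "actF (\<lambda>w. c \<otimes> g w) \<nu> = (\<lambda>x. c \<otimes> actF g \<nu> x)"
  using assms(1)
proof (induction rule: free_alg_induct)
  case zero
  then show ?case using assms by (simp add: actF_zero)
next
  case (add d w g)
  have eq: "(\<lambda>u. c \<otimes> (d \<otimes> delta w u \<oplus> g u)) = (\<lambda>u. (c \<otimes> d) \<otimes> delta w u \<oplus> c \<otimes> g u)"
    using add assms by (auto simp: r_distr m_assoc fun_eq_iff valuedI_carrier)
  then show ?case
    using add assms actF_step [of "c \<otimes> d" w "\<lambda>u. c \<otimes> g u" \<nu>]
    by (simp add: eq actF_step free_alg_smult_closed r_distr m_assoc valuedI_carrier)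
qed

lemma actF_conv:
  assumes "f \<in> carrier Free" "g \<in> carrier Free" "\<nu> \<in> valued"
  shows "actF (conv f g) \<nu> = actF f (actF g \<nu>)"
  using assms(1)
proof (induction rule: free_alg_induct)
  case zero
  have "conv (\<lambda>w. \<zero>) g = (\<lambda>w. \<zero>)"
    using assms by (auto simp: conv_zero_left valuedI_carrier)
  then show ?case by (simp add: actF_zero)
next
  case (add c w f)
  have cl: "conv (delta w) g \<in> carrier Free"
    using add assms by (simp add: free_alg_conv_closed delta_in_free_alg)
  show ?case
    unfolding conv_smult_delta(2) [OF add(1,2,3) assms(2)]
    using add assms cl
    by (simp add: actF_add actF_smult free_alg_smult_closed free_alg_conv_closed actF_word actF_step valuedI_carrier)
qed

text \<open>The kernel of the representation of the free algebra. It is a two-sided ideal containing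
  the relations, hence contains the ideal that they generate, and the action descends to
  \<open>H\<close>.\<close>

definition Ann :: "(nat list \<Rightarrow> 'a) set" where
  "Ann = {f \<in> carrier Free. \<forall>\<nu>\<in>valued. actF f \<nu> = (\<lambda>x. \<zero>)}"

lemma actF_on_zero: "f \<in> carrier Free \<Longrightarrow> actF f (\<lambda>x. \<zero>) = (\<lambda>x. \<zero>)"
proof -
  have "opw w (\<lambda>x. \<zero>) = (\<lambda>x. \<zero>)" for w by (induction w) (auto simp: opN_zero)
  then show "f \<in> carrier Free \<Longrightarrow> actF f (\<lambda>x. \<zero>) = (\<lambda>x. \<zero>)"
    by (auto simp: actF_def fun_eq_iff valuedI_carrier intro!: add.finprod_one_eqI)
qed

lemma Ann_ideal: "ideal Ann Free"
proof (rule idealI)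
  show "ring Free" by (rule Free.ring_axioms)
  show "subgroup Ann (add_monoid Free)"
  proof (rule Free.add.subgroupI)
    show "Ann \<subseteq> carrier Free" by (auto simp: Ann_def)
    have "(\<lambda>w. \<zero>) \<in> Ann"
      using zero_in_free_alg by (simp add: Ann_def actF_zero)
    then show "Ann \<noteq> {}" by blast
    fix f assume f: "f \<in> Ann"
    have "\<ominus>\<^bsub>Free\<^esub> f = (\<lambda>w. \<ominus> \<one> \<otimes> f w)"
      using f free_alg_smult_closed [of f "{1..<n}" "\<ominus> \<one>"]
      by (intro Free.minus_equality) (auto simp: free_alg_simps Ann_def valuedI_carrier l_minus l_neg fun_eq_iff)
    then show "\<ominus>\<^bsub>Free\<^esub> f \<in> Ann"
      using f free_alg_smult_closed [of f "{1..<n}" "\<ominus> \<one>"]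
      by (auto simp: Ann_def actF_smult)
    fix g assume g: "g \<in> Ann"
    show "f \<oplus>\<^bsub>Free\<^esub> g \<in> Ann"
      using f g by (auto simp: free_alg_simps Ann_def actF_add free_alg_add_closed)
  qed
  fix f g assume f: "f \<in> Ann" and g: "g \<in> carrier Free"
  show "f \<otimes>\<^bsub>Free\<^esub> g \<in> Ann" "g \<otimes>\<^bsub>Free\<^esub> f \<in> Ann"
    using f g by (auto simp: free_alg_simps Ann_def free_alg_conv_closed actF_conv valuedI_carrier actF_on_zero)
qed

lemma actF_minus_Ann:
  assumes "f \<in> carrier Free" "g \<in> carrier Free" "\<And>\<nu> x. \<nu> \<in> valued \<Longrightarrow> actF f \<nu> x = actF g \<nu> x"
  shows "f \<ominus>\<^bsub>Free\<^esub> g \<in> Ann"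
proof -
  have h: "f \<ominus>\<^bsub>Free\<^esub> g \<in> carrier Free" using assms by simp
  have "actF (f \<ominus>\<^bsub>Free\<^esub> g) \<nu> x = \<zero>" if \<nu>: "\<nu> \<in> valued" for \<nu> x
  proof -
    have "(f \<ominus>\<^bsub>Free\<^esub> g) \<oplus>\<^bsub>Free\<^esub> g = f"
      using assms by (simp add: a_minus_def Free.a_assoc Free.l_neg)
    then have "actF f \<nu> x = actF (f \<ominus>\<^bsub>Free\<^esub> g) \<nu> x \<oplus> actF g \<nu> x"
      using actF_add [OF h assms(2) \<nu>] by (simp add: free_alg_simps)
    then show ?thesis
      using assms h \<nu> by (simp add: valuedI_carrier)
  qed
  then show ?thesis using h by (auto simp: Ann_def)
qed

lemma actF_X: "i \<in> {1..<n} \<Longrightarrow> \<nu> \<in> valued \<Longrightarrow> actF (X i) \<nu> = opN i \<nu>"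
  using actF_delta [of \<one> \<nu> "[i]"] valuedI_carrier [OF X_closed, of i] by (simp add: X_delta)

lemma relations_Ann: "hecke_relations \<subseteq> Ann"
proof -
  note act = actF_conv actF_X valuedI_carrier X_closed free_alg_conv_closed
  have "X i \<otimes>\<^bsub>Free\<^esub> X j \<ominus>\<^bsub>Free\<^esub> X j \<otimes>\<^bsub>Free\<^esub> X i \<in> Ann"
    if "i \<in> {1..<n} \<and> j \<in> {1..<n} \<and> (i + 2 \<le> j \<or> j + 2 \<le> i)" for i j
    using that by (intro actF_minus_Ann) (auto simp: free_alg_simps act opN_far)
  moreover have "X i \<otimes>\<^bsub>Free\<^esub> X (Suc i) \<otimes>\<^bsub>Free\<^esub> X i
        \<ominus>\<^bsub>Free\<^esub> X (Suc i) \<otimes>\<^bsub>Free\<^esub> X i \<otimes>\<^bsub>Free\<^esub> X (Suc i) \<in> Ann"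
    if "i \<in> {1..<n} \<and> Suc i \<in> {1..<n}" for i
    using that by (intro actF_minus_Ann) (auto simp: free_alg_simps act opN_braid)
  moreover have "(X i \<ominus>\<^bsub>Free\<^esub> q \<odot>\<^bsub>Free\<^esub> \<one>\<^bsub>Free\<^esub>) \<otimes>\<^bsub>Free\<^esub> (X i \<oplus>\<^bsub>Free\<^esub> \<one>\<^bsub>Free\<^esub>) \<in> Ann"
    if i: "i \<in> {1..<n}" for i
  proof -
    let ?Q = "q \<odot>\<^bsub>Free\<^esub> \<one>\<^bsub>Free\<^esub>"
    have cl: "?Q \<in> carrier Free" "X i \<in> carrier Free" using i by auto
    have one: "\<And>\<nu>. \<nu> \<in> valued \<Longrightarrow> actF \<one>\<^bsub>Free\<^esub> \<nu> = \<nu>"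
      using actF_delta [of \<one> _ "[]"] by (auto simp: free_alg_simps)
    have "actF (X i \<otimes>\<^bsub>Free\<^esub> (X i \<oplus>\<^bsub>Free\<^esub> \<one>\<^bsub>Free\<^esub>)) \<nu> x = actF (?Q \<otimes>\<^bsub>Free\<^esub> (X i \<oplus>\<^bsub>Free\<^esub> \<one>\<^bsub>Free\<^esub>)) \<nu> x"
      if \<nu>: "\<nu> \<in> valued" for \<nu> x
    proof -
      have sum: "actF (X i \<oplus>\<^bsub>Free\<^esub> \<one>\<^bsub>Free\<^esub>) \<nu> = (\<lambda>x. opN i \<nu> x \<oplus> \<nu> x)"
        using actF_add [OF cl(2) Free.one_closed \<nu>] i \<nu> by (simp add: free_alg_simps actF_X one [unfolded free_alg_simps])
      have v: "(\<lambda>x. opN i \<nu> x \<oplus> \<nu> x) \<in> valued" "opN i \<nu> \<in> valued" using \<nu> by (auto intro!: valuedI)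
      have eq: "(\<lambda>x. opN i \<nu> x \<oplus> \<nu> x) = (\<lambda>x. \<one> \<otimes> opN i \<nu> x \<oplus> \<nu> x)"
        using \<nu> by simp
      have cl2: "(X i \<oplus>\<^bsub>Free\<^esub> \<one>\<^bsub>Free\<^esub>) \<in> carrier Free" using cl by simp
      have "actF (X i \<otimes>\<^bsub>Free\<^esub> (X i \<oplus>\<^bsub>Free\<^esub> \<one>\<^bsub>Free\<^esub>)) \<nu> = actF (X i) (actF (X i \<oplus>\<^bsub>Free\<^esub> \<one>\<^bsub>Free\<^esub>) \<nu>)"
        using actF_conv [OF cl(2) cl2 \<nu>] by (simp add: free_alg_simps)
      then have "actF (X i \<otimes>\<^bsub>Free\<^esub> (X i \<oplus>\<^bsub>Free\<^esub> \<one>\<^bsub>Free\<^esub>)) \<nu> x = opN i (\<lambda>x. \<one> \<otimes> opN i \<nu> x \<oplus> \<nu> x) x"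
        unfolding sum using v i by (simp add: actF_X eq [symmetric])
      also have "\<dots> = q \<otimes> \<nu> x \<oplus> (q \<ominus> \<one>) \<otimes> opN i \<nu> x \<oplus> opN i \<nu> x"
        using v \<nu> by (subst opN_linear) (auto simp: opN_quad)
      also have "\<dots> = q \<otimes> (opN i \<nu> x \<oplus> \<nu> x)"
      proof -
        define a b where ab: "a = opN i \<nu> x" "b = \<nu> x"
        have "a \<in> carrier K" "b \<in> carrier K" using v \<nu> by (auto simp: ab)
        then show ?thesis
          using q_closed unfolding ab [symmetric] by algebra
      qed
      also have "\<dots> = actF (?Q \<otimes>\<^bsub>Free\<^esub> (X i \<oplus>\<^bsub>Free\<^esub> \<one>\<^bsub>Free\<^esub>)) \<nu> x"
        using actF_smult [OF cl2 \<nu> q_closed] sum smult_conv(1) [OF cl2 q_closed] by simp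
      finally show ?thesis .
    qed
    then have "X i \<otimes>\<^bsub>Free\<^esub> (X i \<oplus>\<^bsub>Free\<^esub> \<one>\<^bsub>Free\<^esub>) \<ominus>\<^bsub>Free\<^esub> ?Q \<otimes>\<^bsub>Free\<^esub> (X i \<oplus>\<^bsub>Free\<^esub> \<one>\<^bsub>Free\<^esub>) \<in> Ann"
      using cl by (intro actF_minus_Ann) auto
    then show ?thesis
      using cl by (simp add: a_minus_def Free.l_distr Free.l_minus)
  qed
  ultimately show ?thesis unfolding hecke_relations_def by blast
qed

lemma I_Ann: "Irel \<subseteq> Ann"
  by (rule Free.genideal_minimal [OF Ann_ideal relations_Ann])

definition act :: "(nat list \<Rightarrow> 'a) set \<Rightarrow> ((nat \<Rightarrow> nat) \<Rightarrow> 'a) \<Rightarrow> (nat \<Rightarrow> nat) \<Rightarrow> 'a" where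
  "act h = actF (SOME f. f \<in> carrier Free \<and> h = proj f)"

text \<open>Two representatives differ by an element of \<open>Irel\<close>, which acts as zero by
  \<open>I_Ann\<close>; so the choice made in \<open>act\<close> is immaterial.\<close>

lemma act_proj:
  assumes "f \<in> carrier Free" "\<nu> \<in> valued"
  shows "act (proj f) \<nu> = actF f \<nu>"
proof -
  define g where "g = (SOME g. g \<in> carrier Free \<and> proj f = proj g)"
  have g: "g \<in> carrier Free" "proj f = proj g"
    using someI [of "\<lambda>g. g \<in> carrier Free \<and> proj f = proj g" f] assms by (auto simp: g_def)
  have "proj (g \<ominus>\<^bsub>Free\<^esub> f) = \<^bold>0"
    using g assms by (simp add: proj_minus a_minus_def H.r_neg)
  then have d: "g \<ominus>\<^bsub>Free\<^esub> f \<in> Ann"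
    using g assms I_Ann by (simp add: proj_zero_iff subset_iff)
  have "(g \<ominus>\<^bsub>Free\<^esub> f) \<oplus>\<^bsub>Free\<^esub> f = g"
    using g assms by (simp add: a_minus_def Free.a_assoc Free.l_neg)
  then have "actF g \<nu> = (\<lambda>x. actF (g \<ominus>\<^bsub>Free\<^esub> f) \<nu> x \<oplus> actF f \<nu> x)"
    using actF_add [of "g \<ominus>\<^bsub>Free\<^esub> f" f \<nu>] g assms by (simp add: free_alg_simps)
  also have "\<dots> = actF f \<nu>" using d assms by (simp add: Ann_def valuedI_carrier)
  finally show ?thesis by (simp add: act_def g_def)
qed

lemma act_valued [simp]: "h \<in> carrier H \<Longrightarrow> \<nu> \<in> valued \<Longrightarrow> act h \<nu> \<in> valued"
  using proj_surj [of h] by (auto simp: act_proj valuedI_carrier)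

lemma act_mult: "a \<in> carrier H \<Longrightarrow> b \<in> carrier H \<Longrightarrow> \<nu> \<in> valued \<Longrightarrow> act (a \<cdot> b) \<nu> = act a (act b \<nu>)"
proof -
  assume "a \<in> carrier H" "b \<in> carrier H" and \<nu>: "\<nu> \<in> valued"
  then obtain f g where fg: "f \<in> carrier Free" "a = proj f" "g \<in> carrier Free" "b = proj g"
    using proj_surj by meson
  have "a \<cdot> b = proj (conv f g)" using fg proj.hom_mult by (simp add: free_alg_simps)
  then show ?thesis using fg \<nu> by (simp add: act_proj actF_conv free_alg_conv_closed valuedI_carrier)
qed

lemma act_add: "a \<in> carrier H \<Longrightarrow> b \<in> carrier H \<Longrightarrow> \<nu> \<in> valued \<Longrightarrow> act (a \<^bold>+ b) \<nu> = (\<lambda>x. act a \<nu> x \<oplus> act b \<nu> x)"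
proof -
  assume "a \<in> carrier H" "b \<in> carrier H" and \<nu>: "\<nu> \<in> valued"
  then obtain f g where fg: "f \<in> carrier Free" "a = proj f" "g \<in> carrier Free" "b = proj g"
    using proj_surj by meson
  have "a \<^bold>+ b = proj (\<lambda>w. f w \<oplus> g w)" using fg proj.hom_add by (simp add: free_alg_simps)
  then show ?thesis using fg \<nu> by (simp add: act_proj actF_add free_alg_add_closed)
qed

lemma act_iota: "c \<in> carrier K \<Longrightarrow> \<nu> \<in> valued \<Longrightarrow> act (\<iota> c) \<nu> = (\<lambda>x. c \<otimes> \<nu> x)"
  using actF_delta [of c \<nu> "[]"] act_proj [of "\<lambda>u. c \<otimes> delta [] u" \<nu>] smult_delta_closed [of c "[]"]
  by (simp add: \<iota>_def free_alg_simps)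

lemma act_zero: "\<nu> \<in> valued \<Longrightarrow> act \<^bold>0 \<nu> = (\<lambda>x. \<zero>)"
  using act_iota [of \<zero> \<nu>] by simp

lemma act_one: "\<nu> \<in> valued \<Longrightarrow> act \<^bold>1 \<nu> = \<nu>"
  using act_iota [of \<one> \<nu>] by simp

lemma act_t: "1 \<le> i \<Longrightarrow> i < n \<Longrightarrow> \<nu> \<in> valued \<Longrightarrow> act (t i) \<nu> = opN i \<nu>"
  by (simp add: t_def T_proj act_proj actF_X)

lemma act_Tw: "set w \<subseteq> {1..<n} \<Longrightarrow> \<nu> \<in> valued \<Longrightarrow> act (Tw w) \<nu> = opw w \<nu>"
  by (induction w) (auto simp: act_one act_mult act_t)

end

section \<open>Normal forms of permutations\<close>

lemma word_perm_simps [simp]: "word_perm [] = id" "word_perm (i # w) = s i \<circ> word_perm w"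
  by (simp_all add: word_perm_def)

lemma word_perm_append: "word_perm (v @ w) = word_perm v \<circ> word_perm w"
  by (induction v) (auto simp: o_assoc)

lemma word_perm_snoc [simp]: "word_perm (w @ [i]) = word_perm w \<circ> s i"
  by (auto simp: word_perm_append)

lemma s_permutes: "1 \<le> i \<Longrightarrow> i < k \<Longrightarrow> s i permutes {1..k}"
  by (rule permutes_swap_id) auto

lemma word_perm_permutes: "set w \<subseteq> {1..<k} \<Longrightarrow> word_perm w permutes {1..k}"
  by (induction w) (auto simp: permutes_id intro: permutes_compose s_permutes)

text \<open>\<open>del p k w\<close> deletes the entry in position \<open>p\<close> of the one-line notation of a permutation of
  \<open>1, \<dots>, k + 1\<close>.  For \<open>w p = k + 1\<close> the remainder permutes \<open>1, \<dots>, k\<close>.\<close>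

definition del :: "nat \<Rightarrow> nat \<Rightarrow> (nat \<Rightarrow> nat) \<Rightarrow> nat \<Rightarrow> nat" where
  "del p k w x = (if x < p then w x else if x \<le> k then w (Suc x) else x)"

definition chain :: "nat \<Rightarrow> nat \<Rightarrow> nat list" where
  "chain p k = rev [p..<Suc k]"

definition cyc :: "nat \<Rightarrow> nat \<Rightarrow> nat \<Rightarrow> nat" where
  "cyc p k x = (if x < p then x else if x = p then Suc k else if x \<le> Suc k then x - 1 else x)"

text \<open>The word follows the factorization of a permutation of 1, ..., k + 1 into a permutation
  of 1, ..., k and the cycle that carries the position \<open>p\<close> of the largest entry to the
  end. The word of that cycle is \<open>chain p k\<close>, which is empty for p = k + 1.\<close>

primrec nf :: "nat \<Rightarrow> (nat \<Rightarrow> nat) \<Rightarrow> nat list" where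
  "nf 0 w = []"
| "nf (Suc k) w = nf k (del (Hilbert_Choice.inv w (Suc k)) k w) @ chain (Hilbert_Choice.inv w (Suc k)) k"

lemma chain_empty [simp]: "chain (Suc k) k = []" by (simp add: chain_def)

lemma chain_Cons: "p \<le> Suc k \<Longrightarrow> chain p (Suc k) = Suc k # chain p k"
  by (simp add: chain_def)

lemma chain_snoc: "p \<le> k \<Longrightarrow> chain p k = chain (Suc p) k @ [p]"
  by (simp add: chain_def upt_conv_Cons)

lemma set_chain: "set (chain p k) = {p..k}" by (auto simp: chain_def)

lemma word_perm_chain: "p \<le> Suc k \<Longrightarrow> word_perm (chain p k) = cyc p k"
proof (induction k)
  case 0
  then have "p = 0 \<or> p = 1" by auto
  then show ?case
    by (auto simp: chain_def cyc_def fun_eq_iff transpose_def)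
next
  case (Suc k)
  show ?case
  proof (cases "p = Suc (Suc k)")
    case True
    then show ?thesis by (auto simp: cyc_def fun_eq_iff)
  next
    case False
    then have "p \<le> Suc k" using Suc.prems by simp
    then show ?thesis using Suc.IH
      by (auto simp: chain_Cons cyc_def fun_eq_iff transpose_def)
  qed
qed

lemma cyc_permutes: "1 \<le> p \<Longrightarrow> p \<le> Suc k \<Longrightarrow> cyc p k permutes {1..Suc k}"
  using word_perm_permutes [of "chain p k" "Suc k"] word_perm_chain [of p k] by (simp add: set_chain subset_iff)

context
  fixes k p and w :: "nat \<Rightarrow> nat"
  assumes w: "w permutes {1..Suc k}" and p: "w p = Suc k"
begin

lemma max_position: "1 \<le> p" "p \<le> Suc k" "Hilbert_Choice.inv w (Suc k) = p"
  using w p permutes_in_image [OF w, of p] permutes_inv_eq [OF w] by auto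

lemma del_cyc: "del p k w \<circ> cyc p k = w"
proof
  fix x
  show "(del p k w \<circ> cyc p k) x = w x"
    using max_position p permutes_not_in [OF w, of x] by (auto simp: del_def cyc_def)
qed

lemma del_permutes: "del p k w permutes {1..k}"
proof -
  have c: "cyc p k permutes {1..Suc k}" using cyc_permutes max_position by blast
  have "del p k w = w \<circ> Hilbert_Choice.inv (cyc p k)"
    using del_cyc permutes_inv_o(1) [OF c] by (metis comp_assoc comp_id)
  then have "del p k w permutes {1..Suc k}"
    using permutes_compose [OF permutes_inv [OF c] w] by simp
  then show ?thesis
    by (rule permutes_superset) (use max_position p in \<open>auto simp: del_def\<close>)
qed

lemma nf_Suc: "nf (Suc k) w = nf k (del p k w) @ chain p k"
  using max_position by simp

end

lemma del_comp_cyc: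
  assumes "v permutes {1..k}" "1 \<le> p" "p \<le> Suc k"
  shows "del p k (v \<circ> cyc p k) = v" and "(v \<circ> cyc p k) p = Suc k"
    and "v \<circ> cyc p k permutes {1..Suc k}"
proof -
  show "del p k (v \<circ> cyc p k) = v"
    using assms permutes_not_in [OF assms(1)] by (auto simp: del_def cyc_def fun_eq_iff)
  show "(v \<circ> cyc p k) p = Suc k"
    using assms permutes_not_in [OF assms(1), of "Suc k"] by (simp add: cyc_def)
  have "v permutes {1..Suc k}" by (rule permutes_subset [OF assms(1)]) auto
  then show "v \<circ> cyc p k permutes {1..Suc k}"
    using permutes_compose [OF cyc_permutes [OF assms(2,3)]] by simp
qed

lemma max_position_ex:
  assumes "w permutes {1..Suc k}" obtains p where "w p = Suc k" "1 \<le> p" "p \<le> Suc k"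
  using permutes_inverses(1) [OF assms, of "Suc k"] max_position [OF assms] by metis

lemma nf_word:
  assumes "w permutes {1..k}"
  shows "word_perm (nf k w) = w \<and> set (nf k w) \<subseteq> {1..<k}"
  using assms
proof (induction k arbitrary: w)
  case 0
  then show ?case by simp
next
  case (Suc k)
  obtain p where p: "w p = Suc k" "1 \<le> p" "p \<le> Suc k" using max_position_ex [OF Suc.prems] .
  have IH: "word_perm (nf k (del p k w)) = del p k w" "set (nf k (del p k w)) \<subseteq> {1..<k}"
    using Suc.IH [OF del_permutes [OF Suc.prems p(1)]] by auto
  have "word_perm (nf (Suc k) w) = w"
    unfolding nf_Suc [OF Suc.prems p(1)] word_perm_append IH word_perm_chain [OF p(3)]
    by (rule del_cyc [OF Suc.prems p(1)])
  moreover have "set (nf (Suc k) w) \<subseteq> {1..<Suc k}"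
    unfolding nf_Suc [OF Suc.prems p(1)] using IH(2) p by (auto simp: set_chain)
  ultimately show ?case by blast
qed

text \<open>The Young subgroup of a labelling of the positions; it is well behaved if the positions with
  a given label form an interval.\<close>

definition stab :: "nat \<Rightarrow> (nat \<Rightarrow> 'b) \<Rightarrow> (nat \<Rightarrow> nat) set" where
  "stab k st = {w. w permutes {1..k} \<and> (\<forall>x\<in>{1..k}. st (w x) = st x)}"

definition convex :: "nat \<Rightarrow> (nat \<Rightarrow> 'b) \<Rightarrow> bool" where
  "convex k st \<longleftrightarrow> (\<forall>i j l. 1 \<le> i \<longrightarrow> i \<le> j \<longrightarrow> j \<le> l \<longrightarrow> l \<le> k \<longrightarrow> st i = st l \<longrightarrow> st j = st i)"

lemma convexD: "convex k st \<Longrightarrow> 1 \<le> i \<Longrightarrow> i \<le> j \<Longrightarrow> j \<le> l \<Longrightarrow> l \<le> k \<Longrightarrow> st i = st l \<Longrightarrow> st j = st i"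
  unfolding convex_def by blast

lemma convex_mono: "convex k st \<Longrightarrow> j \<le> k \<Longrightarrow> convex j st"
  unfolding convex_def by (meson order_trans)

definition off :: "(nat \<Rightarrow> 'b) \<Rightarrow> nat \<Rightarrow> nat" where
  "off st p = card {j \<in> {1..<p}. st j = st p}"

text \<open>The positions from which the largest entry can come form a final segment; therefore the
  sum of the corresponding cycles has the Horner form \<open>Dn\<close>.\<close>

lemma convex_class:
  assumes "convex (Suc k) st"
  shows "{p \<in> {1..Suc k}. st p = st (Suc k)} = {Suc k - off st (Suc k)..Suc k}" and "off st (Suc k) \<le> k"
proof -
  let ?A = "{p \<in> {1..Suc k}. st p = st (Suc k)}"
  define a where "a = Min ?A"
  have fin: "finite ?A" and ne: "?A \<noteq> {}" by auto
  have a: "a \<in> ?A" unfolding a_def using Min_in [OF fin ne] .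
  have A: "?A = {a..Suc k}"
  proof
    show "?A \<subseteq> {a..Suc k}"
    proof
      fix j assume "j \<in> ?A"
      then show "j \<in> {a..Suc k}" using Min_le [OF fin] by (auto simp: a_def)
    qed
    show "{a..Suc k} \<subseteq> ?A"
    proof
      fix j assume "j \<in> {a..Suc k}"
      then show "j \<in> ?A" using a convexD [OF assms, of a j "Suc k"] by simp
    qed
  qed
  have a_le: "a \<le> Suc k" "1 \<le> a" using a by simp_all
  have "{j \<in> {1..<Suc k}. st j = st (Suc k)} = ?A \<inter> {..<Suc k}" by force
  also have "\<dots> = {a..<Suc k}" unfolding A using a_le by force
  finally have off: "off st (Suc k) = Suc k - a" by (simp add: off_def)
  show "?A = {Suc k - off st (Suc k)..Suc k}" using A off a_le by simp
  show "off st (Suc k) \<le> k" using off a_le by simp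
qed

text \<open>Deleting the largest entry shifts the positions to the right of \<open>p\<close>. By
  convexity they all carry the label of the last position, so the labelling does not notice the
  shift.\<close>

lemma stab_del:
  assumes w: "w \<in> stab (Suc k) st" and p: "w p = Suc k" and st: "convex (Suc k) st"
  shows "del p k w \<in> stab k st" "p \<in> {1..Suc k}" "st p = st (Suc k)"
proof -
  have wp: "w permutes {1..Suc k}" and ws: "\<And>x. x \<in> {1..Suc k} \<Longrightarrow> st (w x) = st x"
    using w by (auto simp: stab_def)
  show pp: "p \<in> {1..Suc k}" "st p = st (Suc k)"
    using max_position [OF wp p] ws [of p] p by auto
  have "st (del p k w x) = st x" if x: "x \<in> {1..k}" for x
  proof (cases "x < p")
    case False
    then have "st x = st p" "st (Suc x) = st p"
      using convexD [OF st, of p x "Suc k"] convexD [OF st, of p "Suc x" "Suc k"] pp x by auto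
    then show ?thesis using False x ws [of "Suc x"] by (auto simp: del_def)
  qed (use x ws in \<open>auto simp: del_def\<close>)
  then show "del p k w \<in> stab k st"
    using del_permutes [OF wp p] by (auto simp: stab_def)
qed

lemma stab_cyc:
  assumes v: "v \<in> stab k st" and p: "p \<in> {1..Suc k}" "st p = st (Suc k)" and st: "convex (Suc k) st"
  shows "v \<circ> cyc p k \<in> stab (Suc k) st"
proof -
  have vp: "v permutes {1..k}" and vs: "\<And>x. x \<in> {1..k} \<Longrightarrow> st (v x) = st x"
    using v by (auto simp: stab_def)
  have "st ((v \<circ> cyc p k) x) = st x" if x: "x \<in> {1..Suc k}" for x
  proof -
    consider "x < p" | "x = p" | "p < x" by linarith
    then show ?thesis
    proof cases
      case 1
      then show ?thesis using p x vs by (auto simp: cyc_def)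
    next
      case 2
      then show ?thesis using p permutes_not_in [OF vp, of "Suc k"] by (simp add: cyc_def)
    next
      case 3
      then have "st (x - 1) = st p" "st x = st p"
        using convexD [OF st, of p "x - 1" "Suc k"] convexD [OF st, of p x "Suc k"] p x by auto
      then show ?thesis using 3 x vs [of "x - 1"] p by (cases x) (auto simp: cyc_def)
    qed
  qed
  then show ?thesis
    using del_comp_cyc(3) [OF vp] p by (auto simp: stab_def)
qed

text \<open>Each chain runs through the positions of a single label class, so the normal form of an
  element of the Young subgroup is a word in the generators of that subgroup.\<close>

lemma stab_nf_set:
  assumes "w \<in> stab k st" "convex k st"
  shows "set (nf k w) \<subseteq> {i. st i = st (Suc i)}"
  using assms
proof (induction k arbitrary: w)
  case (Suc k)
  then have wp: "w permutes {1..Suc k}" by (simp add: stab_def)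
  obtain p where p: "w p = Suc k" using max_position_ex [OF wp] .
  note d = stab_del [OF Suc.prems(1) p Suc.prems(2)]
  have "set (nf k (del p k w)) \<subseteq> {i. st i = st (Suc i)}"
    using Suc.IH [OF d(1)] convex_mono [OF Suc.prems(2), of k] by simp
  moreover have "st i = st (Suc i)" if "i \<in> {p..k}" for i
    using that d convexD [OF Suc.prems(2), of p i "Suc k"] convexD [OF Suc.prems(2), of p "Suc i" "Suc k"] by auto
  ultimately show ?case
    unfolding nf_Suc [OF wp p] by (auto simp: set_chain)
qed (simp_all add: stab_def)

context hecke begin

section \<open>Braid relations along normal forms\<close>

lemma Tw_commute:
  assumes "\<forall>i\<in>set w. i + 2 \<le> j \<or> j + 2 \<le> i"
  shows "Tw w \<cdot> t j = t j \<cdot> Tw w"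
  using assms
proof (induction w)
  case (Cons i w)
  have "t i \<cdot> Tw w \<cdot> t j = t i \<cdot> t j \<cdot> Tw w" using Cons by (simp add: H.m_assoc)
  also have "t i \<cdot> t j = t j \<cdot> t i" using Cons.prems by (intro t_far) auto
  finally show ?case by (simp add: H.m_assoc)
qed simp

text \<open>The letters of the chain other than \<open>Suc j\<close> and \<open>j\<close> commute
  with the letter that has to pass them, and one braid relation in the middle lowers the index by
  one.\<close>

lemma Tw_chain_shift:
  assumes "1 \<le> p" "p \<le> j" "j < k" "k < n"
  shows "Tw (chain p k) \<cdot> t (Suc j) = t j \<cdot> Tw (chain p k)"
proof -
  have "chain p k = rev [Suc (Suc j)..<Suc k] @ [Suc j, j] @ rev [p..<j]"
  proof -
    have "[p..<Suc k] = [p..<j] @ [j] @ [Suc j] @ [Suc (Suc j)..<Suc k]"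
      using assms by (metis append.assoc append_Cons append_Nil le_eq_less_or_eq less_SucI not_less_eq upt_conv_Cons upt_add_eq_append le_add_diff_inverse)
    then show ?thesis by (simp add: chain_def)
  qed
  then have eq: "Tw (chain p k) = Tw (rev [Suc (Suc j)..<Suc k]) \<cdot> (t (Suc j) \<cdot> t j) \<cdot> Tw (rev [p..<j])"
    by (simp add: H.m_assoc)
  let ?A = "Tw (rev [Suc (Suc j)..<Suc k])" and ?B = "Tw (rev [p..<j])"
  have "Tw (chain p k) \<cdot> t (Suc j) = ?A \<cdot> (t (Suc j) \<cdot> t j) \<cdot> (?B \<cdot> t (Suc j))"
    unfolding eq by (simp add: H.m_assoc)
  also have "?B \<cdot> t (Suc j) = t (Suc j) \<cdot> ?B" by (rule Tw_commute) auto
  also have "?A \<cdot> (t (Suc j) \<cdot> t j) \<cdot> (t (Suc j) \<cdot> ?B) = ?A \<cdot> (t (Suc j) \<cdot> t j \<cdot> t (Suc j)) \<cdot> ?B"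
    by (simp add: H.m_assoc)
  also have "t (Suc j) \<cdot> t j \<cdot> t (Suc j) = t j \<cdot> t (Suc j) \<cdot> t j"
    using assms by (intro t_braid [symmetric]) auto
  also have "?A \<cdot> (t j \<cdot> t (Suc j) \<cdot> t j) \<cdot> ?B = (?A \<cdot> t j) \<cdot> (t (Suc j) \<cdot> t j) \<cdot> ?B"
    by (simp add: H.m_assoc)
  also have "?A \<cdot> t j = t j \<cdot> ?A" by (rule Tw_commute) auto
  finally show ?thesis unfolding eq by (simp add: H.m_assoc)
qed

text \<open>The effect of an ascent on the normal form is controlled by the position
  \<open>p\<close> of the largest entry. From this, the product along a reduced word turns out to
  depend on the permutation alone, as in Matsumoto's theorem.\<close>

lemma nf_step:
  assumes "w permutes {1..k}" "k \<le> n" "1 \<le> i" "i < k" "w i < w (Suc i)"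
  shows "Tw (nf k (w \<circ> s i)) = Tw (nf k w) \<cdot> t i \<and> length (nf k (w \<circ> s i)) = Suc (length (nf k w))"
  using assms
proof (induction k arbitrary: w i)
  case (Suc k)
  note wp = Suc.prems(1)
  obtain p where p: "w p = Suc k" "1 \<le> p" "p \<le> Suc k" using max_position_ex [OF wp] .
  have wsp: "w \<circ> s i permutes {1..Suc k}"
    using permutes_compose [OF s_permutes wp] Suc.prems by simp
  note dp = del_permutes [OF wp p(1)]
  have "p \<noteq> i"
  proof
    assume "p = i"
    then have "Suc k < w (Suc i)" using Suc.prems p by simp
    moreover have "w (Suc i) \<in> {1..Suc k}"
      using permutes_in_image [OF wp, of "Suc i"] Suc.prems by auto
    ultimately show False by simp
  qed
  then consider "Suc i < p" | "p = Suc i" | "p < i" by linarith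
  \<comment> \<open>If the largest entry stands to the right of both positions, \<open>t i\<close>
    commutes with the chain. If it stands in the right one of them, it moves one place and the chain
    grows by the letter \<open>i\<close>. If it stands to the left, deletion lowers the position of
    the ascent by one, and so does passing the chain for the generator.\<close>
  then show ?case
  proof cases
    case 1
    then have p': "(w \<circ> s i) p = Suc k" using p by (simp add: transpose_def)
    have d: "del p k (w \<circ> s i) = del p k w \<circ> s i"
      using 1 p Suc.prems(4) unfolding fun_eq_iff del_def transpose_def comp_apply by auto
    have IH: "Tw (nf k (del p k w \<circ> s i)) = Tw (nf k (del p k w)) \<cdot> t i"
      "length (nf k (del p k w \<circ> s i)) = Suc (length (nf k (del p k w)))"
      using Suc.IH [OF dp, of i] 1 Suc.prems p by (simp_all add: comp_def del_def [of p k w i] del_def [of p k w "Suc i"])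
    have "Tw (chain p k) \<cdot> t i = t i \<cdot> Tw (chain p k)"
      using 1 by (intro Tw_commute) (auto simp: set_chain)
    then show ?thesis
      unfolding nf_Suc [OF wp p(1)] nf_Suc [OF wsp p'] d using IH by (simp add: H.m_assoc)
  next
    case 2
    then have p': "(w \<circ> s i) i = Suc k" using p by simp
    have d: "del i k (w \<circ> s i) = del p k w"
      using 2 p Suc.prems(4) unfolding fun_eq_iff del_def transpose_def comp_apply
      by (auto simp: less_Suc_eq)
    show ?thesis
      unfolding nf_Suc [OF wp p(1)] nf_Suc [OF wsp p'] d using 2 Suc.prems
      by (simp add: chain_snoc [of i k] H.m_assoc)
  next
    case 3
    then have p': "(w \<circ> s i) p = Suc k" using p by (simp add: transpose_def)
    obtain j where j: "i = Suc j" using 3 by (cases i) auto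
    have d: "del p k (w \<circ> s i) = del p k w \<circ> s j"
      using 3 p Suc.prems(4) unfolding fun_eq_iff del_def transpose_def comp_apply j by auto
    have IH: "Tw (nf k (del p k w \<circ> s j)) = Tw (nf k (del p k w)) \<cdot> t j"
      "length (nf k (del p k w \<circ> s j)) = Suc (length (nf k (del p k w)))"
      using Suc.IH [OF dp, of j] 3 Suc.prems p
      by (simp_all add: comp_def del_def [of p k w j] del_def [of p k w "Suc j"] j)
    have "Tw (chain p k) \<cdot> t i = t j \<cdot> Tw (chain p k)"
      unfolding j using 3 Suc.prems p by (intro Tw_chain_shift) (auto simp: j)
    then show ?thesis
      unfolding nf_Suc [OF wp p(1)] nf_Suc [OF wsp p'] d using IH by (simp add: H.m_assoc)
  qed
qed simp

section \<open>Length and the standard elements of the algebra\<close>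

definition ln :: "(nat \<Rightarrow> nat) \<Rightarrow> nat" where "ln w = length (nf n w)"

definition N :: "(nat \<Rightarrow> nat) \<Rightarrow> (nat list \<Rightarrow> 'a) set" where "N w = Tw (nf n w)"

lemma N_closed [simp]: "N w \<in> carrier H" by (simp add: N_def)

lemma step_up:
  assumes "w permutes {1..n}" "1 \<le> i" "i < n" "w i < w (Suc i)"
  shows "N (w \<circ> s i) = N w \<cdot> t i" "ln (w \<circ> s i) = Suc (ln w)"
  using nf_step [OF assms(1) order.refl assms(2-4)] by (auto simp: N_def ln_def)

lemma step_down:
  assumes "w permutes {1..n}" "1 \<le> i" "i < n" "w (Suc i) < w i"
  shows "ln w = Suc (ln (w \<circ> s i))"
  using step_up(2) [of "w \<circ> s i" i] permutes_compose [OF s_permutes [OF assms(2,3)] assms(1)] assms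
  by simp

lemma permutes_neq: "w permutes A \<Longrightarrow> w (i::nat) \<noteq> w (Suc i)"
  using permutes_inj [of w A] by (metis inj_eq n_not_Suc_n)

text \<open>A letter changes \<open>ln\<close> by exactly one, upwards at an ascent and downwards at
  a descent; hence no word can be shorter than the normal form.\<close>

lemma ln_le:
  assumes "set w \<subseteq> {1..<n}"
  shows "ln (word_perm w) \<le> length w"
  using assms
proof (induction w rule: rev_induct)
  case Nil
  have "ln id = 0"
  proof -
    have "nf k id = []" for k
    proof (induction k)
      case (Suc k)
      have "del (Suc k) k id = id" by (auto simp: del_def fun_eq_iff)
      then show ?case unfolding nf.simps using Suc by (simp add: id_def)
    qed simp
    then show ?thesis by (simp only: ln_def list.size)
  qed
  then show ?case by (simp only: word_perm_simps)
next
  case (snoc i w)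
  have wp: "word_perm w permutes {1..n}" using snoc.prems by (intro word_perm_permutes) auto
  have i: "1 \<le> i" "i < n" using snoc.prems by auto
  consider "word_perm w i < word_perm w (Suc i)" | "word_perm w (Suc i) < word_perm w i"
    using permutes_neq [OF wp, of i] by linarith
  then show ?case
    using snoc step_up(2) [OF wp i] step_down [OF wp i] by cases (auto simp: comp_def)
qed

lemma nf_reduced: "w permutes {1..n} \<Longrightarrow> word_perm (nf n w) = w \<and> set (nf n w) \<subseteq> {1..<n}"
  by (rule nf_word)

lemma reduced_snoc:
  assumes "set (w @ [i]) \<subseteq> {1..<n}" "ln (word_perm (w @ [i])) = length (w @ [i])"
  shows "ln (word_perm w) = length w" "word_perm w i < word_perm w (Suc i)"
proof -
  have wp: "word_perm w permutes {1..n}" using assms by (intro word_perm_permutes) auto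
  have i: "1 \<le> i" "i < n" using assms by auto
  have le: "ln (word_perm w) \<le> length w" using assms by (intro ln_le) auto
  show lt: "word_perm w i < word_perm w (Suc i)"
  proof (rule ccontr)
    assume "\<not> ?thesis"
    then have "word_perm w (Suc i) < word_perm w i" using permutes_neq [OF wp, of i] by linarith
    from step_down [OF wp i this] show False using assms(2) le unfolding word_perm_snoc by simp
  qed
  show "ln (word_perm w) = length w"
    using step_up(2) [OF wp i lt] assms(2) unfolding word_perm_snoc by simp
qed

lemma N_id: "N id = \<^bold>1"
  using ln_le [of "[]"] by (simp add: ln_def N_def)

text \<open>Prefixes of a reduced word are reduced, and each letter is an ascent of the prefix
  before it (\<open>reduced_snoc\<close>), so \<open>step_up\<close> applies letter by
  letter.\<close>

lemma Tw_reduced: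
  assumes "set w \<subseteq> {1..<n}" "ln (word_perm w) = length w"
  shows "Tw w = N (word_perm w)"
  using assms
proof (induction w rule: rev_induct)
  case Nil
  then show ?case by (simp only: N_id word_perm_simps Tw_simps)
next
  case (snoc i w)
  have wp: "word_perm w permutes {1..n}" using snoc.prems by (intro word_perm_permutes) auto
  have i: "1 \<le> i" "i < n" using snoc.prems by auto
  note r = reduced_snoc [OF snoc.prems]
  have "set w \<subseteq> {1..<n}" using snoc.prems by simp
  then have "Tw (w @ [i]) = N (word_perm w) \<cdot> t i" using snoc.IH r(1) by simp
  also have "\<dots> = N (word_perm w \<circ> s i)" using step_up(1) [OF wp i r(2)] by simp
  finally show ?case unfolding word_perm_snoc .
qed

text \<open>Exchanges the arbitrary reduced word chosen in \<open>T_perm\<close> for the normal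
  form, on which all further computations rest.\<close>

lemma T_perm_N:
  assumes w: "w permutes {1..n}"
  shows "T_perm w = N w"
proof -
  have ex: "reduced_word n w (nf n w)"
    using nf_reduced [OF w] ln_le by (force simp: reduced_word_def ln_def)
  define u where "u = (SOME is. reduced_word n w is)"
  have "reduced_word n w u" unfolding u_def using ex by (rule someI)
  then have u: "set u \<subseteq> {1..<n}" "word_perm u = w" "length u \<le> ln w"
    using nf_reduced [OF w] by (auto simp: reduced_word_def ln_def)
  have "foldr (\<lambda>i h. T i \<cdot> h) v \<^bold>1 = Tw v" if "set v \<subseteq> {1..<n}" for v
    using that by (induction v) (auto simp: t_def)
  then have "T_perm w = Tw u" using u by (simp add: T_perm_def u_def [symmetric])
  also have "\<dots> = N w" using Tw_reduced [OF u(1)] ln_le [OF u(1)] u by simp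
  finally show ?thesis .
qed

text \<open>If w takes j, j + 1 to neighbours, left multiplication by the image transposition and
  right multiplication by the original one give the same permutation, and in both products the
  lengths add up.\<close>

lemma transport:
  assumes w: "w permutes {1..n}" and j: "1 \<le> j" "j < n" "w (Suc j) = Suc (w j)"
  shows "t (w j) \<cdot> N w = N w \<cdot> t j"
proof -
  have wj: "w j \<in> {1..<n}"
    using permutes_in_image [OF w, of j] permutes_in_image [OF w, of "Suc j"] j by auto
  have eq: "s (w j) \<circ> w = w \<circ> s j"
    using inj_eq [OF permutes_inj [OF w]] j(3) unfolding fun_eq_iff transpose_def comp_apply by metis
  have red: "ln (word_perm (w j # nf n w)) = length (w j # nf n w)"
    using nf_reduced [OF w] step_up(2) [OF w j(1,2)] j(3) eq by (simp add: ln_def)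
  have "t (w j) \<cdot> N w = Tw (w j # nf n w)" by (simp add: N_def)
  also have "\<dots> = N (w \<circ> s j)"
    using Tw_reduced [OF _ red] nf_reduced [OF w] wj eq by auto
  finally show ?thesis using step_up(1) [OF w j(1,2)] j(3) by simp
qed

subsection \<open>Symmetrizers\<close>

text \<open>\<open>Dn b k\<close> is the sum of the \<open>t b \<cdot> t (b - 1) \<cdot> \<dots> \<cdot> t (b - l + 1)\<close> for \<open>l = 0, \<dots>, k\<close>,
  in Horner form.\<close>

primrec Dn :: "nat \<Rightarrow> nat \<Rightarrow> (nat list \<Rightarrow> 'a) set" where
  "Dn b 0 = \<^bold>1"
| "Dn b (Suc k) = \<^bold>1 \<^bold>+ t b \<cdot> Dn (b - 1) k"

lemma Dn_closed [simp]: "Dn b k \<in> carrier H"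
  by (induction k arbitrary: b) auto

text \<open>The sum over a Young subgroup, built up position by position: each factor sums the
  cycles that insert the new position among the earlier ones with the same label.\<close>

primrec symm :: "(nat \<Rightarrow> 'b) \<Rightarrow> nat \<Rightarrow> (nat list \<Rightarrow> 'a) set" where
  "symm st 0 = \<^bold>1"
| "symm st (Suc k) = symm st k \<cdot> Dn k (off st (Suc k))"

lemma symm_closed [simp]: "symm st k \<in> carrier H"
  by (induction k) auto

lemma sum_chain:
  fixes m k :: nat
  shows "m \<le> k \<Longrightarrow> (\<Oplus>\<^bsub>H\<^esub>p\<in>{Suc k - m..Suc k}. Tw (chain p k)) = Dn k m"
proof (induction m arbitrary: k)
  case (Suc m)
  then obtain k' where k: "k = Suc k'" by (cases k) auto
  have "{Suc k - Suc m..Suc k} = insert (Suc k) {Suc k' - m..Suc k'}" using Suc k by auto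
  then have "(\<Oplus>\<^bsub>H\<^esub>p\<in>{Suc k - Suc m..Suc k}. Tw (chain p k))
      = \<^bold>1 \<^bold>+ (\<Oplus>\<^bsub>H\<^esub>p\<in>{Suc k' - m..Suc k'}. Tw (chain p k))"
    by (simp add: k)
  also have "(\<Oplus>\<^bsub>H\<^esub>p\<in>{Suc k' - m..Suc k'}. Tw (chain p k))
      = (\<Oplus>\<^bsub>H\<^esub>p\<in>{Suc k' - m..Suc k'}. t k \<cdot> Tw (chain p k'))"
    by (intro H.finsum_cong') (auto simp: k chain_Cons)
  also have "\<dots> = t k \<cdot> Dn k' m"
    using Suc k by (simp add: H.finsum_rdistr [symmetric])
  finally show ?case by (simp add: k)
qed simp

lemma finite_stab: "finite (stab k st)"
  by (rule finite_subset [OF _ finite_permutations [of "{1..k}"]]) (auto simp: stab_def)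

text \<open>The Young subgroup on k + 1 positions is the disjoint union of the cosets of the one on
  k positions by the cycles \<open>cyc p k\<close>, and normal forms are concatenated along this
  decomposition.\<close>

lemma sum_stab:
  assumes "convex k st"
  shows "(\<Oplus>\<^bsub>H\<^esub>w\<in>stab k st. Tw (nf k w)) = symm st k"
  using assms
proof (induction k)
  case 0
  have "stab 0 st = {id}" by (auto simp: stab_def permutes_id)
  then show ?case by simp
next
  case (Suc k)
  let ?P = "{p \<in> {1..Suc k}. st p = st (Suc k)}"
  let ?A = "\<lambda>p. (\<lambda>v. v \<circ> cyc p k) ` stab k st"
  have conv: "convex k st" using Suc.prems convex_mono by fastforce
  have eq: "stab (Suc k) st = (\<Union>p\<in>?P. ?A p)"
  proof
    show "(\<Union>p\<in>?P. ?A p) \<subseteq> stab (Suc k) st" using stab_cyc [OF _ _ _ Suc.prems] by auto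
    show "stab (Suc k) st \<subseteq> (\<Union>p\<in>?P. ?A p)"
    proof
      fix w assume w: "w \<in> stab (Suc k) st"
      then have wp: "w permutes {1..Suc k}" by (simp add: stab_def)
      obtain p where p: "w p = Suc k" using max_position_ex [OF wp] .
      have "w = del p k w \<circ> cyc p k" using del_cyc [OF wp p] by simp
      then show "w \<in> (\<Union>p\<in>?P. ?A p)" using stab_del [OF w p Suc.prems] by blast
    qed
  qed
  have stabp: "v permutes {1..k}" if "v \<in> stab k st" for v using that by (simp add: stab_def)
  have inj: "inj_on (\<lambda>v. v \<circ> cyc p k) (stab k st)" if "p \<in> ?P" for p
    by (rule inj_onI) (metis (no_types, lifting) del_comp_cyc(1) stabp that mem_Collect_eq atLeastAtMost_iff)
  have disj: "?A p \<inter> ?A p' = {}" if "p \<in> ?P" "p' \<in> ?P" "p \<noteq> p'" for p p'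
  proof (rule ccontr)
    assume "?A p \<inter> ?A p' \<noteq> {}"
    then obtain v v' where v: "v \<in> stab k st" "v' \<in> stab k st" "v \<circ> cyc p k = v' \<circ> cyc p' k" by auto
    have "Hilbert_Choice.inv (v \<circ> cyc p k) (Suc k) = p"
      using max_position(3) [OF del_comp_cyc(3,2)] stabp [OF v(1)] that(1)
      by (metis (no_types, lifting) atLeastAtMost_iff mem_Collect_eq)
    moreover have "Hilbert_Choice.inv (v' \<circ> cyc p' k) (Suc k) = p'"
      using max_position(3) [OF del_comp_cyc(3,2)] stabp [OF v(2)] that(2)
      by (metis (no_types, lifting) atLeastAtMost_iff mem_Collect_eq)
    ultimately show False using v(3) that(3) by simp
  qed
  have "(\<Oplus>\<^bsub>H\<^esub>w\<in>stab (Suc k) st. Tw (nf (Suc k) w))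
      = (\<Oplus>\<^bsub>H\<^esub>p\<in>?P. \<Oplus>\<^bsub>H\<^esub>w\<in>?A p. Tw (nf (Suc k) w))"
    unfolding eq using disj
    by (intro H.add.finprod_UN_disjoint) (auto simp: finite_stab pairwise_def disjnt_def simp del: nf.simps)
  also have "\<dots> = (\<Oplus>\<^bsub>H\<^esub>p\<in>?P. symm st k \<cdot> Tw (chain p k))"
  proof (rule H.finsum_cong')
    fix p assume p: "p \<in> ?P"
    have "(\<Oplus>\<^bsub>H\<^esub>w\<in>?A p. Tw (nf (Suc k) w)) = (\<Oplus>\<^bsub>H\<^esub>v\<in>stab k st. Tw (nf (Suc k) (v \<circ> cyc p k)))"
      using inj [OF p] by (intro H.finsum_reindex) auto
    also have "\<dots> = (\<Oplus>\<^bsub>H\<^esub>v\<in>stab k st. Tw (nf k v) \<cdot> Tw (chain p k))"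
    proof (rule H.finsum_cong')
      fix v assume "v \<in> stab k st"
      then have v: "v permutes {1..k}" by (rule stabp)
      have pp: "1 \<le> p" "p \<le> Suc k" using p by auto
      show "Tw (nf (Suc k) (v \<circ> cyc p k)) = Tw (nf k v) \<cdot> Tw (chain p k)"
        unfolding nf_Suc [OF del_comp_cyc(3,2) [OF v pp]] del_comp_cyc(1) [OF v pp] by simp
    qed auto
    also have "\<dots> = symm st k \<cdot> Tw (chain p k)"
      using Suc.IH [OF conv] by (simp add: H.finsum_ldistr [symmetric] finite_stab)
    finally show "(\<Oplus>\<^bsub>H\<^esub>w\<in>?A p. Tw (nf (Suc k) w)) = symm st k \<cdot> Tw (chain p k)" .
  qed auto
  also have "\<dots> = symm st k \<cdot> (\<Oplus>\<^bsub>H\<^esub>p\<in>?P. Tw (chain p k))"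
    by (simp add: H.finsum_rdistr)
  also have "(\<Oplus>\<^bsub>H\<^esub>p\<in>?P. Tw (chain p k)) = Dn k (off st (Suc k))"
    unfolding convex_class(1) [OF Suc.prems] by (rule sum_chain [OF convex_class(2) [OF Suc.prems]])
  finally show ?case by simp
qed

end

section \<open>Row symmetrizers\<close>

context hecke begin

text \<open>Together with \<open>Dn\<close> these are the four sums of coset representatives for
  taking one box out of a row. \<open>Up\<close> and \<open>Dn\<close> belong to the last box and
  stand to the left and to the right of the smaller symmetrizer; \<open>Dw\<close> and
  \<open>Uw\<close> do the same for the first box. Compare \<open>sy_Up\<close>,
  \<open>sy_Dw\<close> and \<open>sy_Uw\<close>.\<close>

primrec Up :: "nat \<Rightarrow> nat \<Rightarrow> (nat list \<Rightarrow> 'a) set" where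
  "Up b 0 = \<^bold>1"
| "Up b (Suc k) = \<^bold>1 \<^bold>+ Up (b - 1) k \<cdot> t b"

primrec Dw :: "nat \<Rightarrow> nat \<Rightarrow> (nat list \<Rightarrow> 'a) set" where
  "Dw c 0 = \<^bold>1"
| "Dw c (Suc k) = \<^bold>1 \<^bold>+ Dw (Suc c) k \<cdot> t c"

primrec Uw :: "nat \<Rightarrow> nat \<Rightarrow> (nat list \<Rightarrow> 'a) set" where
  "Uw c 0 = \<^bold>1"
| "Uw c (Suc k) = \<^bold>1 \<^bold>+ t c \<cdot> Uw (Suc c) k"

text \<open>The symmetrizer of a row occupying the positions \<open>c + 1, \<dots>, c + k\<close>.\<close>

primrec sy :: "nat \<Rightarrow> nat \<Rightarrow> (nat list \<Rightarrow> 'a) set" where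
  "sy c 0 = \<^bold>1"
| "sy c (Suc k) = sy c k \<cdot> Dn (c + k) k"

lemma Up_closed [simp]: "Up b k \<in> carrier H" by (induction k arbitrary: b) auto
lemma Dw_closed [simp]: "Dw b k \<in> carrier H" by (induction k arbitrary: b) auto
lemma Uw_closed [simp]: "Uw b k \<in> carrier H" by (induction k arbitrary: b) auto
lemma sy_closed [simp]: "sy b k \<in> carrier H" by (induction k arbitrary: b) auto

text \<open>Keeps track of the generators that occur in an element: elements whose index sets are at
  distance at least two commute (\<open>gen_commute\<close>).\<close>

inductive_set gen :: "nat set \<Rightarrow> (nat list \<Rightarrow> 'a) set set" for A where
  gen_one: "\<^bold>1 \<in> gen A"
| gen_t: "i \<in> A \<Longrightarrow> t i \<in> gen A"
| gen_add: "x \<in> gen A \<Longrightarrow> y \<in> gen A \<Longrightarrow> x \<^bold>+ y \<in> gen A"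
| gen_mult: "x \<in> gen A \<Longrightarrow> y \<in> gen A \<Longrightarrow> x \<cdot> y \<in> gen A"

lemma gen_closed: "x \<in> gen A \<Longrightarrow> x \<in> carrier H"
  by (induction rule: gen.induct) auto

lemma gen_mono: "x \<in> gen A \<Longrightarrow> A \<subseteq> B \<Longrightarrow> x \<in> gen B"
  by (induction rule: gen.induct) (auto intro: gen.intros)

lemma gen_commute_t:
  assumes "x \<in> gen A" "\<And>i. i \<in> A \<Longrightarrow> i + 2 \<le> j \<or> j + 2 \<le> i"
  shows "x \<cdot> t j = t j \<cdot> x"
  using assms(1)
proof (induction rule: gen.induct)
  case (gen_mult x y)
  then have xy: "x \<in> carrier H" "y \<in> carrier H" by (auto dest: gen_closed)
  then show ?case using gen_mult.IH by (metis H.m_assoc t_closed)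
next
  case (gen_t i)
  then show ?case using assms(2) t_far by blast
next
  case (gen_add x y)
  then have "x \<in> carrier H" "y \<in> carrier H" by (blast dest: gen_closed)+
  then show ?case using gen_add by (simp add: H.l_distr H.r_distr)
qed simp

lemma gen_commute:
  assumes "x \<in> gen A" "y \<in> gen B" "\<And>i j. i \<in> A \<Longrightarrow> j \<in> B \<Longrightarrow> i + 2 \<le> j \<or> j + 2 \<le> i"
  shows "x \<cdot> y = y \<cdot> x"
  using assms(2)
proof (induction rule: gen.induct)
  case (gen_t j)
  then show ?case using gen_commute_t [OF assms(1)] assms(3) by blast
next
  case (gen_mult y z)
  have x: "x \<in> carrier H" using gen_closed assms(1) by blast
  have yz: "y \<in> carrier H" "z \<in> carrier H" using gen_mult by (auto dest: gen_closed)
  then show ?case using gen_mult.IH x by (metis H.m_assoc)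
next
  case (gen_add y z)
  then have "y \<in> carrier H" "z \<in> carrier H" by (blast dest: gen_closed)+
  then show ?case using gen_add gen_closed [OF assms(1)] by (simp add: H.l_distr H.r_distr)
qed (use gen_closed [OF assms(1)] in simp)

lemma Dn_gen: "Dn b k \<in> gen {j. b < j + k \<and> j \<le> b}"
proof (induction k arbitrary: b)
  case (Suc k)
  have "Dn (b - 1) k \<in> gen {j. b < j + Suc k \<and> j \<le> b}" by (rule gen_mono [OF Suc]) auto
  then show ?case by (auto intro!: gen.intros)
qed (simp add: gen.intros)

lemma Up_gen: "Up b k \<in> gen {j. b < j + k \<and> j \<le> b}"
proof (induction k arbitrary: b)
  case (Suc k)
  have "Up (b - 1) k \<in> gen {j. b < j + Suc k \<and> j \<le> b}" by (rule gen_mono [OF Suc]) auto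
  then show ?case by (auto intro!: gen.intros)
qed (simp add: gen.intros)

lemma Dw_gen: "Dw c k \<in> gen {c..<c + k}"
proof (induction k arbitrary: c)
  case (Suc k)
  have "Dw (Suc c) k \<in> gen {c..<c + Suc k}" by (rule gen_mono [OF Suc]) auto
  then show ?case by (auto intro!: gen.intros)
qed (simp add: gen.intros)

lemma Uw_gen: "Uw c k \<in> gen {c..<c + k}"
proof (induction k arbitrary: c)
  case (Suc k)
  have "Uw (Suc c) k \<in> gen {c..<c + Suc k}" by (rule gen_mono [OF Suc]) auto
  then show ?case by (auto intro!: gen.intros)
qed (simp add: gen.intros)

lemma sy_gen: "sy c k \<in> gen {c<..<c + k}"
proof (induction k)
  case (Suc k)
  have "sy c k \<in> gen {c<..<c + Suc k}" by (rule gen_mono [OF Suc]) auto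
  moreover have "Dn (c + k) k \<in> gen {c<..<c + Suc k}" by (rule gen_mono [OF Dn_gen]) auto
  ultimately show ?case by (auto intro!: gen.intros)
qed (simp add: gen.intros)

text \<open>The recursion for \<open>sy\<close> puts the coset sum on the right. The new generator
  commutes with the symmetrizer that is two boxes shorter, and moving it across brings the coset sum
  to the left.\<close>

lemma sy_Up: "sy c (Suc k) = Up (c + k) k \<cdot> sy c k"
proof (induction k)
  case (Suc k)
  let ?S = "sy c (Suc k)" and ?t = "t (c + Suc k)" and ?U = "Up (c + k) k" and ?D = "Dn (c + k) k"
  have comm: "sy c k \<cdot> ?t = ?t \<cdot> sy c k"
    by (rule gen_commute_t [OF sy_gen]) auto
  have "sy c (Suc (Suc k)) = ?S \<cdot> (\<^bold>1 \<^bold>+ ?t \<cdot> ?D)" by simp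
  also have "\<dots> = ?S \<^bold>+ ?S \<cdot> ?t \<cdot> ?D" by (simp add: H.r_distr H.m_assoc)
  also have "?S \<cdot> ?t \<cdot> ?D = ?U \<cdot> (sy c k \<cdot> ?t) \<cdot> ?D" unfolding Suc by (simp add: H.m_assoc)
  also have "\<dots> = ?U \<cdot> ?t \<cdot> ?S" unfolding comm by (simp add: H.m_assoc)
  also have "?S \<^bold>+ ?U \<cdot> ?t \<cdot> ?S = (\<^bold>1 \<^bold>+ ?U \<cdot> ?t) \<cdot> ?S" by (simp add: H.l_distr)
  finally show ?case by simp
qed simp

text \<open>The Horner form opens the sum at its shortest term. Here the longest one is split off,
  because a full chain can be moved across a symmetrizer by \<open>sy_shift\<close>.\<close>

lemma Dn_snoc: "Dn (b + k) (Suc k) = Dn (b + k) k \<^bold>+ Tw (chain b (b + k))"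
proof (induction k)
  case 0
  then show ?case by (simp add: chain_def)
next
  case (Suc k)
  have "chain b (b + Suc k) = (b + Suc k) # chain b (b + k)" by (simp add: chain_def)
  then have "Dn (b + Suc k) (Suc (Suc k)) = \<^bold>1 \<^bold>+ t (b + Suc k) \<cdot> Dn (b + k) (Suc k)"
    and c: "Tw (chain b (b + Suc k)) = t (b + Suc k) \<cdot> Tw (chain b (b + k))"
    by simp_all
  then show ?case unfolding Suc c by (simp add: H.r_distr H.a_assoc)
qed

lemma Dw_snoc: "Dw c (Suc k) = Dw c k \<^bold>+ Tw (chain c (c + k))"
proof (induction k arbitrary: c)
  case 0
  then show ?case by (simp add: chain_def)
next
  case (Suc k)
  have "chain c (c + Suc k) = chain (Suc c) (Suc c + k) @ [c]"
    by (simp add: chain_snoc)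
  then have c: "Tw (chain c (c + Suc k)) = Tw (chain (Suc c) (Suc c + k)) \<cdot> t c" by simp
  have "Dw c (Suc (Suc k)) = \<^bold>1 \<^bold>+ Dw (Suc c) (Suc k) \<cdot> t c" by simp
  also have "Dw (Suc c) (Suc k) = Dw (Suc c) k \<^bold>+ Tw (chain (Suc c) (Suc c + k))" by (rule Suc)
  finally show ?case unfolding c by (simp add: H.l_distr H.a_assoc)
qed

lemma Up_snoc: "Up (b + k) (Suc k) = Up (b + k) k \<^bold>+ Tw (rev (chain b (b + k)))"
proof (induction k)
  case 0
  then show ?case by (simp add: chain_def)
next
  case (Suc k)
  have "rev (chain b (b + Suc k)) = rev (chain b (b + k)) @ [b + Suc k]" by (simp add: chain_def)
  then have c: "Tw (rev (chain b (b + Suc k))) = Tw (rev (chain b (b + k))) \<cdot> t (b + Suc k)" by simp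
  have "Up (b + Suc k) (Suc (Suc k)) = \<^bold>1 \<^bold>+ Up (b + k) (Suc k) \<cdot> t (b + Suc k)" by simp
  then show ?case unfolding Suc c by (simp add: H.l_distr H.a_assoc)
qed

lemma Uw_snoc: "Uw c (Suc k) = Uw c k \<^bold>+ Tw (rev (chain c (c + k)))"
proof (induction k arbitrary: c)
  case 0
  then show ?case by (simp add: chain_def)
next
  case (Suc k)
  have "rev (chain c (c + Suc k)) = c # rev (chain (Suc c) (Suc c + k))"
    by (simp add: chain_snoc)
  then have c: "Tw (rev (chain c (c + Suc k))) = t c \<cdot> Tw (rev (chain (Suc c) (Suc c + k)))" by simp
  have "Uw c (Suc (Suc k)) = \<^bold>1 \<^bold>+ t c \<cdot> Uw (Suc c) (Suc k)" by simp
  also have "Uw (Suc c) (Suc k) = Uw (Suc c) k \<^bold>+ Tw (rev (chain (Suc c) (Suc c + k)))" by (rule Suc)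
  finally show ?case unfolding c by (simp add: H.r_distr H.a_assoc)
qed

lemma Tw_rev_chain_shift:
  assumes "1 \<le> p" "p \<le> j" "j < k" "k < n"
  shows "t (Suc j) \<cdot> Tw (rev (chain p k)) = Tw (rev (chain p k)) \<cdot> t j"
proof -
  have "rev (chain p k) = [p..<j] @ [j, Suc j] @ [Suc (Suc j)..<Suc k]"
  proof -
    have "[p..<Suc k] = [p..<j] @ [j] @ [Suc j] @ [Suc (Suc j)..<Suc k]"
      using assms by (metis append.assoc append_Cons append_Nil le_eq_less_or_eq less_SucI not_less_eq upt_conv_Cons upt_add_eq_append le_add_diff_inverse)
    then show ?thesis by (simp add: chain_def)
  qed
  then have eq: "Tw (rev (chain p k)) = Tw [p..<j] \<cdot> (t j \<cdot> t (Suc j)) \<cdot> Tw [Suc (Suc j)..<Suc k]"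
    by (simp add: H.m_assoc)
  let ?B = "Tw [Suc (Suc j)..<Suc k]" and ?A = "Tw [p..<j]"
  have "t (Suc j) \<cdot> Tw (rev (chain p k)) = (t (Suc j) \<cdot> ?A) \<cdot> (t j \<cdot> t (Suc j)) \<cdot> ?B"
    unfolding eq by (simp add: H.m_assoc)
  also have "t (Suc j) \<cdot> ?A = ?A \<cdot> t (Suc j)" by (rule Tw_commute [symmetric]) auto
  also have "?A \<cdot> t (Suc j) \<cdot> (t j \<cdot> t (Suc j)) \<cdot> ?B = ?A \<cdot> (t (Suc j) \<cdot> t j \<cdot> t (Suc j)) \<cdot> ?B"
    by (simp add: H.m_assoc)
  also have "t (Suc j) \<cdot> t j \<cdot> t (Suc j) = t j \<cdot> t (Suc j) \<cdot> t j"
    using assms by (intro t_braid [symmetric]) auto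
  also have "?A \<cdot> (t j \<cdot> t (Suc j) \<cdot> t j) \<cdot> ?B = ?A \<cdot> (t j \<cdot> t (Suc j)) \<cdot> (t j \<cdot> ?B)"
    by (simp add: H.m_assoc)
  also have "t j \<cdot> ?B = ?B \<cdot> t j" by (rule Tw_commute [symmetric]) auto
  finally show ?thesis unfolding eq by (simp add: H.m_assoc)
qed

lemma Dn_shift:
  assumes x: "x \<in> carrier H" and sh: "\<And>i. 1 \<le> i \<Longrightarrow> i < k \<Longrightarrow> x \<cdot> t (c + i) = t (c' + i) \<cdot> x"
    and "l \<le> r" "r < k"
  shows "x \<cdot> Dn (c + r) l = Dn (c' + r) l \<cdot> x"
  using assms(3,4)
proof (induction l arbitrary: r)
  case (Suc l)
  then obtain r' where r: "r = Suc r'" by (cases r) auto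
  have IH: "x \<cdot> Dn (c + r') l = Dn (c' + r') l \<cdot> x" using Suc r by simp
  have "x \<cdot> Dn (c + r) (Suc l) = x \<^bold>+ (x \<cdot> t (c + r)) \<cdot> Dn (c + r') l"
    using x by (simp add: r H.r_distr H.m_assoc)
  also have "x \<cdot> t (c + r) = t (c' + r) \<cdot> x" using sh [of r] Suc.prems by (simp add: r)
  also have "t (c' + r) \<cdot> x \<cdot> Dn (c + r') l = t (c' + r) \<cdot> Dn (c' + r') l \<cdot> x"
    using x IH by (simp add: H.m_assoc)
  finally show ?case using x by (simp add: r H.l_distr)
qed (use x in simp)

text \<open>Used for long chains, which move a row by one position, and for the block permutation
  that exchanges two rows.\<close>

lemma sy_shift:
  assumes x: "x \<in> carrier H" and sh: "\<And>i. 1 \<le> i \<Longrightarrow> i < k \<Longrightarrow> x \<cdot> t (c + i) = t (c' + i) \<cdot> x"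
  shows "x \<cdot> sy c k = sy c' k \<cdot> x"
  using sh
proof (induction k)
  case (Suc k)
  have IH: "x \<cdot> sy c k = sy c' k \<cdot> x" using Suc by simp
  have D: "x \<cdot> Dn (c + k) k = Dn (c' + k) k \<cdot> x" using Dn_shift [OF x Suc.prems] by simp
  have "x \<cdot> sy c (Suc k) = x \<cdot> sy c k \<cdot> Dn (c + k) k" using x by (simp add: H.m_assoc)
  also have "\<dots> = sy c' k \<cdot> (x \<cdot> Dn (c + k) k)" unfolding IH using x by (simp add: H.m_assoc)
  finally show ?case unfolding D using x by (simp add: H.m_assoc)
qed (use x in simp)

text \<open>The longest coset representative of the last box is split off on the right and
  transported to the left by the chain shift; there it is the longest representative for the first
  box.\<close>

lemma sy_Dw:
  assumes "c + Suc b \<le> n"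
  shows "sy c (Suc b) = Dw (Suc c) b \<cdot> sy (Suc c) b"
  using assms
proof (induction b)
  case (Suc b)
  let ?C = "Tw (chain (Suc c) (Suc c + b))"
  have shift: "?C \<cdot> sy (Suc c) (Suc b) = sy c (Suc b) \<cdot> ?C"
    using Tw_chain_shift [of "Suc c" _ "Suc c + b"] Suc.prems by (intro sy_shift) simp_all
  have "sy c (Suc (Suc b)) = sy c (Suc b) \<cdot> Dn (Suc c + b) (Suc b)" by simp
  also have "\<dots> = sy c (Suc b) \<cdot> Dn (Suc c + b) b \<^bold>+ sy c (Suc b) \<cdot> ?C"
    unfolding Dn_snoc by (simp add: H.r_distr del: sy.simps)
  also have "sy c (Suc b) \<cdot> Dn (Suc c + b) b = Dw (Suc c) b \<cdot> sy (Suc c) (Suc b)"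
    using Suc by (simp add: H.m_assoc)
  also have "sy c (Suc b) \<cdot> ?C = ?C \<cdot> sy (Suc c) (Suc b)" using shift by simp
  also have "Dw (Suc c) b \<cdot> sy (Suc c) (Suc b) \<^bold>+ ?C \<cdot> sy (Suc c) (Suc b) = Dw (Suc c) (Suc b) \<cdot> sy (Suc c) (Suc b)"
    unfolding Dw_snoc by (simp add: H.l_distr del: sy.simps)
  finally show ?case .
qed simp

lemma sy_Uw:
  assumes "c + Suc b \<le> n"
  shows "sy c (Suc b) = sy (Suc c) b \<cdot> Uw (Suc c) b"
  using assms
proof (induction b)
  case (Suc b)
  let ?C = "Tw (rev (chain (Suc c) (Suc c + b)))"
  have shift: "?C \<cdot> sy c (Suc b) = sy (Suc c) (Suc b) \<cdot> ?C"
    using Tw_rev_chain_shift [of "Suc c" _ "Suc c + b"] Suc.prems by (intro sy_shift) simp_all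
  have "sy c (Suc (Suc b)) = Up (Suc c + b) (Suc b) \<cdot> sy c (Suc b)" by (simp add: sy_Up del: sy.simps Up.simps)
  also have "\<dots> = Up (Suc c + b) b \<cdot> sy c (Suc b) \<^bold>+ ?C \<cdot> sy c (Suc b)"
    unfolding Up_snoc by (simp add: H.l_distr del: sy.simps)
  also have "Up (Suc c + b) b \<cdot> sy c (Suc b) = Up (Suc c + b) b \<cdot> sy (Suc c) b \<cdot> Uw (Suc c) b"
    using Suc by (simp add: H.m_assoc del: sy.simps)
  also have "Up (Suc c + b) b \<cdot> sy (Suc c) b = sy (Suc c) (Suc b)" by (simp add: sy_Up del: sy.simps Up.simps)
  also have "?C \<cdot> sy c (Suc b) = sy (Suc c) (Suc b) \<cdot> ?C" using shift by simp
  also have "sy (Suc c) (Suc b) \<cdot> Uw (Suc c) b \<^bold>+ sy (Suc c) (Suc b) \<cdot> ?C = sy (Suc c) (Suc b) \<cdot> Uw (Suc c) (Suc b)"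
    unfolding Uw_snoc by (simp add: H.r_distr del: sy.simps)
  finally show ?case .
qed simp

lemma sy_left_factor:
  assumes "c + k \<le> n" "c < j" "j < c + k"
  shows "\<exists>x\<in>carrier H. sy c k = (\<^bold>1 \<^bold>+ t j) \<cdot> x"
  using assms
proof (induction k arbitrary: c)
  case (Suc k)
  show ?case
  proof (cases "j < c + k")
    case True
    then obtain x where x: "x \<in> carrier H" "sy c k = (\<^bold>1 \<^bold>+ t j) \<cdot> x" using Suc.IH [of c] Suc.prems by auto
    have "sy c (Suc k) = (\<^bold>1 \<^bold>+ t j) \<cdot> x \<cdot> Dn (c + k) k" by (simp only: sy.simps x(2))
    also have "\<dots> = (\<^bold>1 \<^bold>+ t j) \<cdot> (x \<cdot> Dn (c + k) k)" using x(1) by (intro H.m_assoc) auto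
    finally have "sy c (Suc k) = (\<^bold>1 \<^bold>+ t j) \<cdot> (x \<cdot> Dn (c + k) k)" .
    moreover have "x \<cdot> Dn (c + k) k \<in> carrier H" using x(1) by simp
    ultimately show ?thesis using x by blast
  next
    case False
    then have j: "j = c + k" using Suc.prems by simp
    show ?thesis
    proof (cases "k = 1")
      case True
      then have "sy c (Suc k) = (\<^bold>1 \<^bold>+ t j) \<cdot> \<^bold>1" by (simp add: j One_nat_def)
      then show ?thesis by blast
    next
      \<comment> \<open>For the last generator the first box is split off instead of the last one,
        so that the generator lies inside the shorter row.\<close>
      case False
      then obtain x where x: "x \<in> carrier H" "sy (Suc c) k = (\<^bold>1 \<^bold>+ t j) \<cdot> x"
        using Suc.IH [of "Suc c"] Suc.prems j by auto
      have "sy c (Suc k) = (\<^bold>1 \<^bold>+ t j) \<cdot> x \<cdot> Uw (Suc c) k" by (simp only: sy_Uw [OF Suc.prems(1)] x(2))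
      also have "\<dots> = (\<^bold>1 \<^bold>+ t j) \<cdot> (x \<cdot> Uw (Suc c) k)" using x(1) by (intro H.m_assoc) auto
      finally have "sy c (Suc k) = (\<^bold>1 \<^bold>+ t j) \<cdot> (x \<cdot> Uw (Suc c) k)" .
      moreover have "x \<cdot> Uw (Suc c) k \<in> carrier H" using x(1) by simp
      ultimately show ?thesis using x by blast
    qed
  qed
qed simp

lemma t_eigen:
  assumes "1 \<le> j" "j < n" "x \<in> carrier H" "u = (\<^bold>1 \<^bold>+ t j) \<cdot> x"
  shows "t j \<cdot> u = \<iota> q \<cdot> u"
  using t_quad [OF assms(1,2)] assms(3,4) by (simp add: H.m_assoc [symmetric])

subsection \<open>The elements \<open>m\<close> as products over the rows\<close>

abbreviation psum :: "(nat \<Rightarrow> nat) \<Rightarrow> nat \<Rightarrow> nat" where "psum l k \<equiv> (\<Sum>i<k. l i)"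

end

section \<open>Compositions, partial sums and the row of a position\<close>

lemma composition_psum:
  assumes "composition n l" shows "\<exists>r0. \<forall>r\<ge>r0. (\<Sum>i<r. l i) = n"
proof -
  have fin: "finite {i. l i \<noteq> 0}" and sum: "(\<Sum>i | l i \<noteq> 0. l i) = n"
    using assms by (auto simp: composition_def)
  obtain r0 where r0: "{i. l i \<noteq> 0} \<subseteq> {..<r0}" using finite_nat_bounded [OF fin] by blast
  have "(\<Sum>i<r. l i) = n" if "r \<ge> r0" for r
    unfolding sum [symmetric] using r0 that by (intro sum.mono_neutral_right) auto
  then show ?thesis by blast
qed

lemma psum_mono: "(i::nat) \<le> j \<Longrightarrow> (\<Sum>k<i. l k) \<le> (\<Sum>k<j. l k :: nat)"
  by (intro sum_mono2) auto

lemma composition_psum_le: "composition n l \<Longrightarrow> (\<Sum>i<r. l i) \<le> n"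
  using composition_psum [of n l] psum_mono [of r _ l] by (metis le_cases order_trans)

lemma compositionI:
  fixes r :: nat
  assumes "(\<Sum>i<r. l i) = n" "\<And>i. i \<ge> r \<Longrightarrow> l i = 0"
  shows "composition n l"
proof -
  have sub: "{i. l i \<noteq> 0} \<subseteq> {..<r}" using assms(2) linorder_not_less by blast
  have "(\<Sum>i | l i \<noteq> 0. l i) = (\<Sum>i<r. l i)" using sub by (intro sum.mono_neutral_left) auto
  then show ?thesis using assms sub finite_subset [OF sub] by (simp add: composition_def)
qed

lemma composition_zero:
  assumes "composition n l" "(\<Sum>i<r. l i) = n" "i \<ge> r" shows "l i = 0"
proof -
  have "(\<Sum>k<r. l k) \<le> (\<Sum>k<i. l k)" by (rule psum_mono [OF assms(3)])
  then show ?thesis using composition_psum_le [OF assms(1), of "Suc i"] assms(2) by simp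
qed

text \<open>Positions count from 1 and rows from 0. Taking the least index skips empty rows.\<close>

definition row :: "(nat \<Rightarrow> nat) \<Rightarrow> nat \<Rightarrow> nat" where
  "row l p = (LEAST i. p \<le> (\<Sum>k<Suc i. l k))"

lemma row_eq:
  assumes "(\<Sum>k<i. l k) < p" "p \<le> (\<Sum>k<Suc i. l k)" shows "row l p = i"
  unfolding row_def
proof (rule Least_equality)
  show "p \<le> (\<Sum>k<Suc i. l k)" by fact
  fix j assume j: "p \<le> (\<Sum>k<Suc j. l k)"
  show "i \<le> j"
  proof (rule ccontr)
    assume "\<not> i \<le> j"
    then have "(\<Sum>k<Suc j. l k) \<le> (\<Sum>k<i. l k)" by (intro psum_mono) simp
    then show False using j assms by simp
  qed
qed

lemma row_bounds:
  assumes "composition n l" "1 \<le> p" "p \<le> n"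
  shows "(\<Sum>k<row l p. l k) < p" "p \<le> (\<Sum>k<Suc (row l p). l k)"
proof -
  obtain r0 where "\<forall>r\<ge>r0. (\<Sum>i<r. l i) = n" using composition_psum [OF assms(1)] by blast
  then have ex: "p \<le> (\<Sum>k<Suc r0. l k)" using assms by (metis le_SucI order.refl)
  show ub: "p \<le> (\<Sum>k<Suc (row l p). l k)" using LeastI [of "\<lambda>i. p \<le> (\<Sum>k<Suc i. l k)" r0] ex by (simp add: row_def)
  show "(\<Sum>k<row l p. l k) < p"
  proof (cases "row l p")
    case 0
    then show ?thesis using assms by simp
  next
    case (Suc j)
    then have "\<not> p \<le> (\<Sum>k<Suc j. l k)" using not_less_Least [of j "\<lambda>i. p \<le> (\<Sum>k<Suc i. l k)"] by (simp add: row_def)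
    then show ?thesis using Suc by simp
  qed
qed

lemma row_mono:
  assumes "composition n l" "1 \<le> p" "p \<le> p'" "p' \<le> n" shows "row l p \<le> row l p'"
proof (rule ccontr)
  assume "\<not> row l p \<le> row l p'"
  then have "(\<Sum>k<Suc (row l p'). l k) \<le> (\<Sum>k<row l p. l k)" by (intro psum_mono) simp
  then show False using row_bounds [OF assms(1), of p] row_bounds [OF assms(1), of p'] assms by simp
qed

lemma convex_row: "composition n l \<Longrightarrow> convex n (row l)"
  unfolding convex_def
proof (intro allI impI)
  fix i j k assume *: "composition n l" "1 \<le> i" "i \<le> j" "j \<le> k" "k \<le> n" "row l i = row l k"
  then show "row l j = row l i" using row_mono [of n l i j] row_mono [of n l j k] by linarith
qed

lemma young_subgroup_stab:
  assumes l: "composition n l" shows "young_subgroup n l = stab n (row l)"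
proof -
  have block: "p \<in> block l i \<longleftrightarrow> 1 \<le> p \<and> p \<le> n \<and> row l p = i" for p i
  proof
    assume "p \<in> block l i"
    then have p: "(\<Sum>k<i. l k) < p" "p \<le> (\<Sum>k<Suc i. l k)" by (simp_all add: block_def)
    then show "1 \<le> p \<and> p \<le> n \<and> row l p = i"
      using row_eq [OF p] composition_psum_le [OF l, of "Suc i"] by linarith
  qed (use row_bounds [OF l, of p] in \<open>auto simp: block_def\<close>)
  show ?thesis
  proof (rule equalityI; rule subsetI)
    fix w assume w: "w \<in> young_subgroup n l"
    then have wp: "w permutes {1..n}" and wb: "\<And>i. w ` block l i = block l i" by (simp_all add: young_subgroup_def)
    have "row l (w x) = row l x" if "x \<in> {1..n}" for x
    proof -
      have "x \<in> block l (row l x)" using block that by simp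
      then have "w x \<in> block l (row l x)" using wb by blast
      then show ?thesis using block by simp
    qed
    then show "w \<in> stab n (row l)" using wp by (simp add: stab_def)
  next
    fix w assume w: "w \<in> stab n (row l)"
    then have wp: "w permutes {1..n}" and wr: "\<And>x. x \<in> {1..n} \<Longrightarrow> row l (w x) = row l x" by (simp_all add: stab_def)
    have "w ` block l i = block l i" for i
    \<comment> \<open>Preservation of the labels gives an inclusion; finiteness of the block and
      injectivity turn it into an equality.\<close>
    proof (rule endo_inj_surj)
      show "finite (block l i)" by (simp add: block_def)
      show "inj_on w (block l i)" using permutes_inj [OF wp] by (rule inj_on_subset) simp
      show "w ` block l i \<subseteq> block l i"
      proof
        fix y assume "y \<in> w ` block l i"
        then obtain x where x: "y = w x" "x \<in> {1..n}" "row l x = i" using block by auto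
        then have "y \<in> {1..n}" using permutes_in_image [OF wp, of x] by simp
        then show "y \<in> block l i" unfolding block using x wr [OF x(2)] by simp
      qed
    qed
    then show "w \<in> young_subgroup n l" using wp by (simp add: young_subgroup_def)
  qed
qed

context hecke begin

primrec mm :: "(nat \<Rightarrow> nat) \<Rightarrow> nat \<Rightarrow> (nat list \<Rightarrow> 'a) set" where
  "mm l 0 = \<^bold>1"
| "mm l (Suc i) = mm l i \<cdot> sy (psum l i) (l i)"

lemma mm_closed [simp]: "mm l i \<in> carrier H" by (induction i) auto

lemma off_row:
  assumes "composition n l" "k < l i"
  shows "off (row l) (psum l i + Suc k) = k"
proof -
  have le: "psum l i + l i \<le> n" using composition_psum_le [OF assms(1), of "Suc i"] by simp
  have r: "row l (psum l i + Suc k) = i" using assms by (intro row_eq) auto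
  have "{j \<in> {1..<psum l i + Suc k}. row l j = i} = {psum l i<..<psum l i + Suc k}"
  proof (rule equalityI; rule subsetI)
    fix j assume j: "j \<in> {psum l i<..<psum l i + Suc k}"
    then have "row l j = i" using assms(2) by (intro row_eq) auto
    then show "j \<in> {j \<in> {1..<psum l i + Suc k}. row l j = i}" using j by simp
  next
    fix j assume j: "j \<in> {j \<in> {1..<psum l i + Suc k}. row l j = i}"
    then have "1 \<le> j" "j \<le> n" "row l j = i" using le assms(2) by simp_all
    then have "psum l i < j" using row_bounds(1) [OF assms(1), of j] by simp
    then show "j \<in> {psum l i<..<psum l i + Suc k}" using j by simp
  qed
  then show ?thesis unfolding off_def r by simp
qed

text \<open>Inside a row \<open>off\<close> counts the boxes already present, so the positionwise
  factors of \<open>symm\<close> group into row symmetrizers.\<close>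

lemma symm_row:
  assumes "composition n l"
  shows "k \<le> l i \<Longrightarrow> symm (row l) (psum l i + k) = mm l i \<cdot> sy (psum l i) k"
proof (induction i arbitrary: k)
  case 0
  then show ?case
  proof (induction k)
    case (Suc k)
    then show ?case using off_row [OF assms, of k 0] by (simp add: H.m_assoc)
  qed simp
next
  case (Suc i)
  show ?case
    using Suc.prems
  proof (induction k)
    case 0
    then show ?case using Suc.IH [of "l i"] by simp
  next
    case (Suc k)
    then show ?case using off_row [OF assms, of k "Suc i"] by (simp add: H.m_assoc)
  qed
qed

lemma m_symm:
  assumes "composition n l"
  shows "m l = symm (row l) n"
proof -
  have "m l = (\<Oplus>\<^bsub>H\<^esub>w\<in>stab n (row l). T_perm w)"
    unfolding m_def young_subgroup_stab [OF assms] by (rule refl)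
  also have "\<dots> = (\<Oplus>\<^bsub>H\<^esub>w\<in>stab n (row l). Tw (nf n w))"
    by (rule H.finsum_cong') (auto simp: T_perm_N N_def stab_def)
  finally show ?thesis using sum_stab [OF convex_row [OF assms]] by simp
qed

lemma m_mm:
  assumes "composition n l" "psum l r = n"
  shows "m l = mm l r"
  using symm_row [OF assms(1), of 0 r] m_symm [OF assms(1)] assms(2) by simp

lemma m_closed [simp]: "composition n l \<Longrightarrow> m l \<in> carrier H"
  by (simp add: m_symm)

lemma m_mm_ex: "composition n l \<Longrightarrow> \<exists>r0. \<forall>r\<ge>r0. m l = mm l r \<and> psum l r = n"
  using composition_psum [of n l] m_mm by blast

lemma mm_gen: "mm l i \<in> gen {..<psum l i}"
proof (induction i)
  case (Suc i)
  have "mm l i \<in> gen {..<psum l (Suc i)}" by (rule gen_mono [OF Suc]) auto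
  moreover have "sy (psum l i) (l i) \<in> gen {..<psum l (Suc i)}" by (rule gen_mono [OF sy_gen]) auto
  ultimately show ?case by (simp add: gen_mult del: sum.lessThan_Suc)
qed (simp add: gen.intros)

text \<open>With \<open>mm_cong\<close> for the rows before, this isolates the two rows between
  which a box is moved: the factor coming from all later rows is literally the same on both
  sides.\<close>

lemma mm_split:
  assumes "\<And>k. j \<le> k \<Longrightarrow> l k = l' k" "psum l j = psum l' j"
  shows "\<exists>z\<in>gen {psum l j<..}. mm l (j + r) = mm l j \<cdot> z \<and> mm l' (j + r) = mm l' j \<cdot> z"
proof (induction r)
  case 0
  show ?case by (intro bexI [of _ "\<^bold>1"]) (simp_all add: gen_one)
next
  case (Suc r)
  then obtain z where z: "z \<in> gen {psum l j<..}" "mm l (j + r) = mm l j \<cdot> z" "mm l' (j + r) = mm l' j \<cdot> z" by blast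
  have eq: "psum l (j + r) = psum l' (j + r)"
    using assms by (induction r) auto
  have ge: "psum l j \<le> psum l (j + r)" by (rule psum_mono) simp
  have s: "sy (psum l (j + r)) (l (j + r)) \<in> gen {psum l j<..}"
    by (rule gen_mono [OF sy_gen]) (use ge in auto)
  show ?case
    using z s gen_closed [OF z(1)] assms(1) [of "j + r"] eq
    by (intro bexI [of _ "z \<cdot> sy (psum l (j + r)) (l (j + r))"]) (auto simp: H.m_assoc intro: gen_mult)
qed

text \<open>The factors of different rows involve generators at distance at least two, so any row
  factor can be brought to the front.\<close>

lemma row_left:
  assumes l: "composition n l"
  shows "\<exists>x\<in>carrier H. m l = sy (psum l i) (l i) \<cdot> x"
proof -
  obtain r0 where r0: "\<forall>r\<ge>r0. m l = mm l r \<and> psum l r = n" using m_mm_ex [OF l] by blast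
  have comm: "mm l i \<cdot> sy (psum l i) (l i) = sy (psum l i) (l i) \<cdot> mm l i"
    by (rule gen_commute [OF mm_gen sy_gen]) auto
  obtain z where z: "z \<in> gen {psum l (Suc i)<..}" "mm l (Suc i + r0) = mm l (Suc i) \<cdot> z"
    using mm_split [of "Suc i" l l r0] by auto
  have "m l = mm l (Suc i + r0)" using r0 by (metis le_add2)
  then have "m l = mm l i \<cdot> sy (psum l i) (l i) \<cdot> z" unfolding z(2) by simp
  then show ?thesis
    unfolding comm using gen_closed [OF z(1)] by (intro bexI [of _ "mm l i \<cdot> z"]) (simp_all add: H.m_assoc)
qed

lemma m_eigen:
  assumes l: "composition n l" and j: "psum l i < j" "j < psum l (Suc i)"
  shows "t j \<cdot> m l = \<iota> q \<cdot> m l" and "\<exists>x\<in>carrier H. m l = (\<^bold>1 \<^bold>+ t j) \<cdot> x"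
proof -
  obtain x where x: "x \<in> carrier H" "m l = sy (psum l i) (l i) \<cdot> x" using row_left [OF l] by blast
  have le: "psum l i + l i \<le> n" using composition_psum_le [OF l, of "Suc i"] by simp
  then obtain y where y: "y \<in> carrier H" "sy (psum l i) (l i) = (\<^bold>1 \<^bold>+ t j) \<cdot> y"
    using sy_left_factor [OF le, of j] j by auto
  have eq: "m l = (\<^bold>1 \<^bold>+ t j) \<cdot> (y \<cdot> x)" using x y by (simp add: H.m_assoc)
  then show "\<exists>x\<in>carrier H. m l = (\<^bold>1 \<^bold>+ t j) \<cdot> x" using x y by blast
  show "t j \<cdot> m l = \<iota> q \<cdot> m l"
    by (rule t_eigen [of j "y \<cdot> x"]) (use eq x y j le in auto)
qed

end

section \<open>Moving one box between adjacent rows\<close>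

text \<open>Polymorphic because it is applied both to compositions and to integer weights; in the
  latter an entry may become negative.\<close>

definition wF :: "(nat \<Rightarrow> 'b::{plus,minus,one}) \<Rightarrow> nat \<Rightarrow> nat \<Rightarrow> 'b" where
  "wF l i = l(i := l i - 1, Suc i := l (Suc i) + 1)"

definition wE :: "(nat \<Rightarrow> 'b::{plus,minus,one}) \<Rightarrow> nat \<Rightarrow> nat \<Rightarrow> 'b" where
  "wE l i = l(i := l i + 1, Suc i := l (Suc i) - 1)"

lemma wF_simps [simp]: "wF l i i = l i - 1" "wF l i (Suc i) = l (Suc i) + 1"
  and wF_other: "k \<noteq> i \<Longrightarrow> k \<noteq> Suc i \<Longrightarrow> wF l i k = l k"
  by (simp_all add: wF_def)

lemma wE_simps [simp]: "wE l i i = l i + 1" "wE l i (Suc i) = l (Suc i) - 1"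
  and wE_other: "k \<noteq> i \<Longrightarrow> k \<noteq> Suc i \<Longrightarrow> wE l i k = l k"
  by (simp_all add: wE_def)

text \<open>Exactly one partial sum changes, which is how dominance is controlled later. The
  correction stands on the lowered side to avoid a truncated subtraction.\<close>

lemma psum_wF: "1 \<le> l i \<Longrightarrow> (\<Sum>j<k. wF l i j) + (if k = Suc i then 1 else 0) = (\<Sum>j<k. l j :: nat)"
  by (induction k) (auto simp: wF_def)

lemma psum_wE: "1 \<le> l (Suc i) \<Longrightarrow> (\<Sum>j<k. wE l i j) = (\<Sum>j<k. l j :: nat) + (if k = Suc i then 1 else 0)"
  by (induction k) (auto simp: wE_def)

lemma composition_wF:
  assumes "composition n l" "1 \<le> l i" shows "composition n (wF l i)"
proof -
  obtain r0 where r0: "\<forall>r\<ge>r0. (\<Sum>j<r. l j) = n" using composition_psum [OF assms(1)] by blast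
  define r where "r = r0 + i + 2"
  have r: "(\<Sum>j<r. l j) = n" using r0 unfolding r_def by (metis le_add1 add.assoc)
  have z: "l j = 0" if "j \<ge> r" for j using composition_zero [OF assms(1) r that] .
  show ?thesis
  proof (rule compositionI [of _ r])
    show "(\<Sum>j<r. wF l i j) = n" using psum_wF [of l i r, OF assms(2)] r unfolding r_def by simp
    show "wF l i j = 0" if "j \<ge> r" for j
      using z [OF that] that by (simp add: wF_other r_def)
  qed
qed

lemma composition_wE:
  assumes "composition n l" "1 \<le> l (Suc i)" shows "composition n (wE l i)"
proof -
  obtain r0 where r0: "\<forall>r\<ge>r0. (\<Sum>j<r. l j) = n" using composition_psum [OF assms(1)] by blast
  define r where "r = r0 + i + 2"
  have r: "(\<Sum>j<r. l j) = n" using r0 unfolding r_def by (metis le_add1 add.assoc)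
  have z: "l j = 0" if "j \<ge> r" for j using composition_zero [OF assms(1) r that] .
  show ?thesis
  proof (rule compositionI [of _ r])
    show "(\<Sum>j<r. wE l i j) = n" using psum_wE [of l i r, OF assms(2)] r unfolding r_def by simp
    show "wE l i j = 0" if "j \<ge> r" for j
      using z [OF that] that by (simp add: wE_other r_def)
  qed
qed

context hecke begin

lemma gen_commute_elem:
  assumes x: "x \<in> carrier H" "\<And>j. j \<in> A \<Longrightarrow> x \<cdot> t j = t j \<cdot> x" and y: "y \<in> gen A"
  shows "x \<cdot> y = y \<cdot> x"
  using y
proof (induction rule: gen.induct)
  case (gen_add y z)
  then have "y \<in> carrier H" "z \<in> carrier H" by (blast dest: gen_closed)+
  then show ?case using gen_add x by (simp add: H.l_distr H.r_distr)
next
  case (gen_mult y z)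
  then have "y \<in> carrier H" "z \<in> carrier H" by (blast dest: gen_closed)+
  then show ?case using gen_mult.IH x by (metis H.m_assoc)
qed (use x in auto)

lemma mm_cong: "(\<And>k. k < i \<Longrightarrow> l k = l' k) \<Longrightarrow> mm l i = mm l' i"
proof (induction i)
  case (Suc i)
  have "psum l i = psum l' i" using Suc.prems by (intro sum.cong) auto
  then show ?case using Suc by simp
qed simp

definition two_rows :: "(nat \<Rightarrow> nat) \<Rightarrow> nat \<Rightarrow> (nat list \<Rightarrow> 'a) set" where
  "two_rows l i = sy (psum l i) (l i) \<cdot> sy (psum l (Suc i)) (l (Suc i))"

lemma two_rows_closed [simp]: "two_rows l i \<in> carrier H" by (simp add: two_rows_def)

text \<open>The rows before the two commute with \<open>x\<close> and the rows after them with
  \<open>y\<close>, so an identity for two adjacent rows extends to the whole symmetrizer.\<close>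

lemma two_rows_intertwine:
  assumes l: "composition n l" "composition n l'"
    and agree: "\<And>k. k \<noteq> i \<Longrightarrow> k \<noteq> Suc i \<Longrightarrow> l k = l' k" "psum l (Suc (Suc i)) = psum l' (Suc (Suc i))"
    and x: "x \<in> carrier H" "\<And>j. j < psum l i \<Longrightarrow> x \<cdot> t j = t j \<cdot> x"
    and y: "y \<in> carrier H" "\<And>j. j > psum l (Suc (Suc i)) \<Longrightarrow> y \<cdot> t j = t j \<cdot> y"
    and rel: "x \<cdot> two_rows l i = two_rows l' i \<cdot> y"
  shows "x \<cdot> m l = m l' \<cdot> y"
proof -
  let ?j = "Suc (Suc i)"
  obtain r1 where r1: "\<forall>r\<ge>r1. m l = mm l r \<and> psum l r = n" using m_mm_ex [OF l(1)] by blast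
  obtain r2 where r2: "\<forall>r\<ge>r2. m l' = mm l' r \<and> psum l' r = n" using m_mm_ex [OF l(2)] by blast
  obtain z where z: "z \<in> gen {psum l ?j<..}" "mm l (?j + (r1 + r2)) = mm l ?j \<cdot> z" "mm l' (?j + (r1 + r2)) = mm l' ?j \<cdot> z"
    using mm_split [of ?j l l' "r1 + r2"] agree by auto
  have zc: "z \<in> carrier H" using z(1) gen_closed by blast
  have mi: "mm l' i = mm l i" using agree by (intro mm_cong) auto
  have "m l = mm l (?j + (r1 + r2))" using r1 by (metis le_add1 le_add2 add.assoc order_trans)
  then have ml: "m l = mm l i \<cdot> two_rows l i \<cdot> z" unfolding z(2) by (simp add: two_rows_def H.m_assoc)
  have "m l' = mm l' (?j + (r1 + r2))" using r2 by (metis le_add2 add.assoc)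
  then have ml': "m l' = mm l i \<cdot> two_rows l' i \<cdot> z" unfolding z(3) mi [symmetric] by (simp add: two_rows_def H.m_assoc)
  have xm: "x \<cdot> mm l i = mm l i \<cdot> x" by (rule gen_commute_elem [OF x(1) _ mm_gen]) (use x(2) in simp)
  have yz: "y \<cdot> z = z \<cdot> y" by (rule gen_commute_elem [OF y(1) _ z(1)]) (use y(2) in simp)
  have "x \<cdot> m l = (x \<cdot> mm l i) \<cdot> two_rows l i \<cdot> z" unfolding ml using x zc by (simp add: H.m_assoc)
  also have "\<dots> = mm l i \<cdot> (x \<cdot> two_rows l i) \<cdot> z" unfolding xm using x zc by (simp add: H.m_assoc)
  also have "\<dots> = mm l i \<cdot> two_rows l' i \<cdot> (y \<cdot> z)" unfolding rel using y zc by (simp add: H.m_assoc)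
  also have "\<dots> = m l' \<cdot> y" unfolding yz ml' using y zc by (simp add: H.m_assoc)
  finally show ?thesis .
qed

text \<open>The box that moves is the one at the boundary of the two rows: its position stays and
  the boundary shifts. \<open>Fop\<close> sums the coset representatives that insert it into the
  lower row, \<open>Eop\<close> those that insert it into the upper one.\<close>

definition Fop :: "(nat \<Rightarrow> nat) \<Rightarrow> nat \<Rightarrow> (nat list \<Rightarrow> 'a) set" where
  "Fop l i = Dw (psum l (Suc i)) (l (Suc i))"

definition Eop :: "(nat \<Rightarrow> nat) \<Rightarrow> nat \<Rightarrow> (nat list \<Rightarrow> 'a) set" where
  "Eop l i = Up (psum l (Suc i)) (l i)"

lemma Fop_closed [simp]: "Fop l i \<in> carrier H" by (simp add: Fop_def)
lemma Eop_closed [simp]: "Eop l i \<in> carrier H" by (simp add: Eop_def)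

lemma Fop_gen: "Fop l i \<in> gen {psum l (Suc i)..<psum l (Suc (Suc i))}"
  using Dw_gen [of "psum l (Suc i)" "l (Suc i)"] by (simp add: Fop_def)

lemma Eop_gen: "Eop l i \<in> gen {psum l i<..psum l (Suc i)}"
  unfolding Eop_def by (rule gen_mono [OF Up_gen]) auto

text \<open>The last box of row i is split off by \<open>Dn\<close> on the right and absorbed into
  the next row by \<open>Dw\<close> on the left; each of the two sums commutes with the symmetrizer
  of the other row.\<close>

lemma Fop_m:
  assumes l: "composition n l" and pos: "1 \<le> l i"
  shows "\<exists>y\<in>carrier H. Fop l i \<cdot> m l = m (wF l i) \<cdot> y"
proof -
  obtain a where a: "l i = Suc a" using pos by (cases "l i") auto
  define e where "e = psum l i + a"
  define b where "b = l (Suc i)"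
  have le: "e + Suc b \<le> n" using composition_psum_le [OF l, of "Suc (Suc i)"] by (simp add: e_def b_def a)
  have ps: "psum (wF l i) i = psum l i" "psum (wF l i) (Suc i) = e" "psum l (Suc i) = Suc e"
    using psum_wF [of l i i, OF pos] psum_wF [of l i "Suc i", OF pos] a unfolding e_def by (simp_all add: wF_def)
  have w: "wF l i i = a" "wF l i (Suc i) = Suc b" by (simp_all add: a b_def)
  have F: "Fop l i = Dw (Suc e) b" unfolding Fop_def ps(3) b_def ..
  have "Dw (Suc e) b \<cdot> sy (psum l i) a = sy (psum l i) a \<cdot> Dw (Suc e) b"
    by (rule gen_commute [OF Dw_gen sy_gen]) (auto simp: e_def)
  moreover have "Dn e a \<cdot> sy (Suc e) b = sy (Suc e) b \<cdot> Dn e a"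
    by (rule gen_commute [OF Dn_gen sy_gen]) auto
  ultimately have "Dw (Suc e) b \<cdot> (sy (psum l i) a \<cdot> Dn e a \<cdot> sy (Suc e) b)
      = sy (psum l i) a \<cdot> (Dw (Suc e) b \<cdot> sy (Suc e) b) \<cdot> Dn e a"
    by (metis H.m_assoc Dw_closed sy_closed Dn_closed H.m_closed)
  also have "Dw (Suc e) b \<cdot> sy (Suc e) b = sy e (Suc b)" using sy_Dw [OF le] by simp
  finally have eq: "Dw (Suc e) b \<cdot> (sy (psum l i) a \<cdot> Dn e a \<cdot> sy (Suc e) b) = sy (psum l i) a \<cdot> sy e (Suc b) \<cdot> Dn e a" .
  have "sy (psum l i) (Suc a) = sy (psum l i) a \<cdot> Dn e a" by (simp add: e_def)
  then have "two_rows l i = sy (psum l i) a \<cdot> Dn e a \<cdot> sy (Suc e) b"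
    unfolding two_rows_def ps(3) a b_def by simp
  moreover have "two_rows (wF l i) i = sy (psum l i) a \<cdot> sy e (Suc b)"
    unfolding two_rows_def ps(1,2) w ..
  ultimately have rel: "Fop l i \<cdot> two_rows l i = two_rows (wF l i) i \<cdot> Dn e a"
    using eq unfolding F by simp
  have far1: "Fop l i \<cdot> t j = t j \<cdot> Fop l i" if "j < psum l i" for j
    by (rule gen_commute_t [OF Fop_gen]) (use that pos in \<open>auto simp: a\<close>)
  have far2: "Dn e a \<cdot> t j = t j \<cdot> Dn e a" if "j > psum l (Suc (Suc i))" for j
    by (rule gen_commute_t [OF Dn_gen]) (use that in \<open>auto simp: e_def a\<close>)
  have "Fop l i \<cdot> m l = m (wF l i) \<cdot> Dn e a"
  proof (rule two_rows_intertwine [OF l composition_wF [OF l pos]])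
    show "l k = wF l i k" if "k \<noteq> i" "k \<noteq> Suc i" for k using that by (simp add: wF_other)
    show "psum l (Suc (Suc i)) = psum (wF l i) (Suc (Suc i))"
      using psum_wF [of l i "Suc (Suc i)"] pos by (simp del: sum.lessThan_Suc)
  qed (fact far1 far2 rel Fop_closed Dn_closed)+
  then show ?thesis by (rule bexI) (rule Dn_closed)
qed

lemma Eop_m:
  assumes l: "composition n l" and pos: "1 \<le> l (Suc i)"
  shows "\<exists>y\<in>carrier H. Eop l i \<cdot> m l = m (wE l i) \<cdot> y"
proof -
  obtain b where b: "l (Suc i) = Suc b" using pos by (cases "l (Suc i)") auto
  define e where "e = psum l (Suc i)"
  define a where "a = l i"
  have le: "e + Suc b \<le> n" using composition_psum_le [OF l, of "Suc (Suc i)"] by (simp add: e_def b)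
  have e: "e = psum l i + a" by (simp add: e_def a_def)
  have ps: "psum (wE l i) i = psum l i" "psum (wE l i) (Suc i) = Suc e"
    using psum_wE [of l i i] psum_wE [of l i "Suc i"] pos by (simp_all add: e_def)
  have w: "wE l i i = Suc a" "wE l i (Suc i) = b" by (simp_all add: b a_def)
  have "Up e a \<cdot> (sy (psum l i) a \<cdot> sy e (Suc b)) = (Up e a \<cdot> sy (psum l i) a) \<cdot> (sy (Suc e) b \<cdot> Uw (Suc e) b)"
    unfolding sy_Uw [OF le] by (simp add: H.m_assoc)
  also have "Up e a \<cdot> sy (psum l i) a = sy (psum l i) (Suc a)" unfolding e sy_Up ..
  finally have rel: "Eop l i \<cdot> two_rows l i = two_rows (wE l i) i \<cdot> Uw (Suc e) b"
    unfolding Eop_def two_rows_def ps w b a_def [symmetric] e_def [symmetric] by (simp only: H.m_assoc sy_closed Uw_closed)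
  have far1: "Eop l i \<cdot> t j = t j \<cdot> Eop l i" if "j < psum l i" for j
    by (rule gen_commute_t [OF Eop_gen]) (use that in auto)
  have far2: "Uw (Suc e) b \<cdot> t j = t j \<cdot> Uw (Suc e) b" if "j > psum l (Suc (Suc i))" for j
    by (rule gen_commute_t [OF Uw_gen]) (use that in \<open>auto simp: e_def b\<close>)
  have "Eop l i \<cdot> m l = m (wE l i) \<cdot> Uw (Suc e) b"
  proof (rule two_rows_intertwine [OF l composition_wE [OF l pos]])
    show "l k = wE l i k" if "k \<noteq> i" "k \<noteq> Suc i" for k using that by (simp add: wE_other)
    show "psum l (Suc (Suc i)) = psum (wE l i) (Suc (Suc i))"
      using psum_wE [of l i "Suc (Suc i)"] pos by (simp del: sum.lessThan_Suc)
  qed (fact far1 far2 rel Eop_closed Uw_closed)+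
  then show ?thesis by (rule bexI) (rule Uw_closed)
qed

section \<open>Quantum integers, integer weights and the operators on vectors of given
  weight\<close>

lemma qint_closed [simp]: "qint k \<in> carrier K"
  by (simp add: qint_def finsum_closed Pi_def)

lemma qint_0 [simp]: "qint 0 = \<zero>" by (simp add: qint_def)

lemma qint_Suc: "qint (Suc k) = \<one> \<oplus> q \<otimes> qint k"
proof -
  have "qint (Suc k) = (\<Oplus>i\<in>{..k}. q [^] i)" by (simp add: qint_def lessThan_Suc_atMost)
  also have "\<dots> = \<one> \<oplus> (\<Oplus>i\<in>{..<k}. q [^] Suc i)"
  proof (cases k)
    case (Suc k')
    then show ?thesis
      using finsum_Suc2 [of "\<lambda>i. q [^] i" k'] by (simp add: lessThan_Suc_atMost a_comm Pi_def finsum_closed del: nat_pow_Suc)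
  qed simp
  also have "(\<Oplus>i\<in>{..<k}. q [^] Suc i) = q \<otimes> qint k"
    by (simp add: qint_def finsum_rdistr Pi_def m_comm)
  finally show ?thesis .
qed

text \<open>The terms of \<open>Up b k\<close> have lengths 0, ..., k and act on an eigenvector by
  1, q, ..., q^k.\<close>

lemma Up_eigen:
  assumes "u \<in> carrier H" "\<And>j. b < j + k \<Longrightarrow> j \<le> b \<Longrightarrow> t j \<cdot> u = \<iota> q \<cdot> u"
  shows "Up b k \<cdot> u = \<iota> (qint (Suc k)) \<cdot> u"
  using assms(2)
proof (induction k arbitrary: b)
  case 0
  then show ?case using assms(1) by (simp add: qint_Suc)
next
  case (Suc k)
  have "Up b (Suc k) \<cdot> u = u \<^bold>+ Up (b - 1) k \<cdot> (t b \<cdot> u)" using assms(1) by (simp add: H.l_distr H.m_assoc)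
  also have "t b \<cdot> u = \<iota> q \<cdot> u" using Suc.prems by simp
  also have "Up (b - 1) k \<cdot> (\<iota> q \<cdot> u) = \<iota> q \<cdot> (Up (b - 1) k \<cdot> u)"
    using assms(1) \<iota>_central [OF q_closed, of "Up (b - 1) k"] by (simp add: H.m_assoc [symmetric])
  also have "Up (b - 1) k \<cdot> u = \<iota> (qint (Suc k)) \<cdot> u" using Suc.prems by (intro Suc.IH) auto
  finally show ?case
    using assms(1) by (simp add: qint_Suc [of "Suc k"] \<iota>_add \<iota>_mult H.l_distr H.m_assoc)
qed

lemma Dw_eigen:
  assumes "u \<in> carrier H" "\<And>j. c \<le> j \<Longrightarrow> j < c + k \<Longrightarrow> t j \<cdot> u = \<iota> q \<cdot> u"
  shows "Dw c k \<cdot> u = \<iota> (qint (Suc k)) \<cdot> u"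
  using assms(2)
proof (induction k arbitrary: c)
  case 0
  then show ?case using assms(1) by (simp add: qint_Suc)
next
  case (Suc k)
  have "Dw c (Suc k) \<cdot> u = u \<^bold>+ Dw (Suc c) k \<cdot> (t c \<cdot> u)" using assms(1) by (simp add: H.l_distr H.m_assoc)
  also have "t c \<cdot> u = \<iota> q \<cdot> u" using Suc.prems by simp
  also have "Dw (Suc c) k \<cdot> (\<iota> q \<cdot> u) = \<iota> q \<cdot> (Dw (Suc c) k \<cdot> u)"
    using assms(1) \<iota>_central [OF q_closed, of "Dw (Suc c) k"] by (simp add: H.m_assoc [symmetric])
  also have "Dw (Suc c) k \<cdot> u = \<iota> (qint (Suc k)) \<cdot> u" using Suc.prems by (intro Suc.IH) auto
  finally show ?case
    using assms(1) by (simp add: qint_Suc [of "Suc k"] \<iota>_add \<iota>_mult H.l_distr H.m_assoc)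
qed

text \<open>Quantum integers for negative arguments, continuing the recursion \<open>[k + 1] = 1 + q [k]\<close>.\<close>

primrec qneg :: "nat \<Rightarrow> 'a" where
  "qneg 0 = \<zero>"
| "qneg (Suc k) = inv q \<otimes> (qneg k \<ominus> \<one>)"

definition qi :: "int \<Rightarrow> 'a" where
  "qi z = (if 0 \<le> z then qint (nat z) else qneg (nat (- z)))"

lemma qinv_closed [simp]: "inv q \<in> carrier K" using q_unit by simp

lemma qneg_closed [simp]: "qneg k \<in> carrier K" by (induction k) auto

lemma qi_closed [simp]: "qi z \<in> carrier K" by (simp add: qi_def)

lemma qi_of_nat: "0 \<le> z \<Longrightarrow> qi z = qint (nat z)" by (simp add: qi_def)

lemma qi_Suc: "qi (z + 1) = \<one> \<oplus> q \<otimes> qi z"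
proof (cases "0 \<le> z")
  case True
  then have "nat (z + 1) = Suc (nat z)" by simp
  then show ?thesis using True by (simp add: qi_def qint_Suc)
next
  case False
  then obtain k where k: "nat (- z) = Suc k" by (cases "nat (- z)") auto
  have inv: "q \<otimes> inv q = \<one>" using q_unit by (simp add: Units_r_inv)
  have "q \<otimes> qi z = (q \<otimes> inv q) \<otimes> (qneg k \<ominus> \<one>)"
    using False k by (simp add: qi_def m_assoc)
  then have "\<one> \<oplus> q \<otimes> qi z = \<one> \<oplus> (qneg k \<ominus> \<one>)" unfolding inv by simp
  also have "\<dots> = qneg k" using a_lcomm [of \<one> "qneg k" "\<ominus> \<one>"] by (simp add: a_minus_def r_neg)
  finally have rec: "\<one> \<oplus> q \<otimes> qi z = qneg k" .
  show ?thesis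
  proof (cases "z = - 1")
    case True
    then have "k = 0" using k by simp
    then have "qi (z + 1) = qneg k" using True by (simp add: qi_def)
    then show ?thesis using rec by simp
  next
    case False
    then have "\<not> 0 \<le> z + 1" "nat (- (z + 1)) = k" using k \<open>\<not> 0 \<le> z\<close> by auto
    then have "qi (z + 1) = qneg k" by (simp add: qi_def)
    then show ?thesis using rec by simp
  qed
qed

text \<open>Weights are integer valued; a vector of invalid weight is zero, and a vector of valid weight
  \<open>\<mu>\<close> lies in the right ideal generated by the row symmetrizer of \<open>\<mu>\<close>.\<close>

definition valid :: "(nat \<Rightarrow> int) \<Rightarrow> bool" where
  "valid \<mu> \<longleftrightarrow> (\<forall>i. 0 \<le> \<mu> i) \<and> composition n (nat \<circ> \<mu>)"

definition good :: "(nat \<Rightarrow> int) \<Rightarrow> (nat list \<Rightarrow> 'a) set \<Rightarrow> bool" where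
  "good \<mu> u \<longleftrightarrow> u \<in> carrier H \<and> (u = \<^bold>0 \<or> valid \<mu> \<and> (\<exists>y\<in>carrier H. u = m (nat \<circ> \<mu>) \<cdot> y))"

definition opF :: "(nat \<Rightarrow> int) \<Rightarrow> nat \<Rightarrow> (nat list \<Rightarrow> 'a) set \<Rightarrow> (nat list \<Rightarrow> 'a) set" where
  "opF \<mu> i u = (if 1 \<le> \<mu> i then Fop (nat \<circ> \<mu>) i \<cdot> u else \<^bold>0)"

definition opE :: "(nat \<Rightarrow> int) \<Rightarrow> nat \<Rightarrow> (nat list \<Rightarrow> 'a) set \<Rightarrow> (nat list \<Rightarrow> 'a) set" where
  "opE \<mu> i u = (if 1 \<le> \<mu> (Suc i) then Eop (nat \<circ> \<mu>) i \<cdot> u else \<^bold>0)"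

lemma good_closed: "good \<mu> u \<Longrightarrow> u \<in> carrier H" by (simp add: good_def)

lemma good_zero [simp]: "good \<mu> \<^bold>0" by (simp add: good_def)

lemma nat_wF: "\<forall>j. 0 \<le> \<mu> j \<Longrightarrow> 1 \<le> \<mu> i \<Longrightarrow> nat \<circ> wF \<mu> i = wF (nat \<circ> \<mu>) i"
  by (auto simp: wF_def fun_eq_iff nat_diff_distrib' nat_add_distrib)

lemma nat_wE: "\<forall>j. 0 \<le> \<mu> j \<Longrightarrow> 1 \<le> \<mu> (Suc i) \<Longrightarrow> nat \<circ> wE \<mu> i = wE (nat \<circ> \<mu>) i"
  by (auto simp: wE_def fun_eq_iff nat_diff_distrib' nat_add_distrib)

lemma valid_wF: "valid \<mu> \<Longrightarrow> 1 \<le> \<mu> i \<Longrightarrow> valid (wF \<mu> i)"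
  using composition_wF [of n "nat \<circ> \<mu>" i] nat_wF [of \<mu> i] by (auto simp: valid_def) (auto simp: wF_def)

lemma valid_wE: "valid \<mu> \<Longrightarrow> 1 \<le> \<mu> (Suc i) \<Longrightarrow> valid (wE \<mu> i)"
  using composition_wE [of n "nat \<circ> \<mu>" i] nat_wE [of \<mu> i] by (auto simp: valid_def) (auto simp: wE_def)

lemma good_opF: assumes "good \<mu> u" shows "good (wF \<mu> i) (opF \<mu> i u)"
proof (cases "u = \<^bold>0 \<or> \<not> 1 \<le> \<mu> i")
  case True
  then show ?thesis by (auto simp: opF_def)
next
  case False
  then obtain y where v: "valid \<mu>" "1 \<le> \<mu> i" and y: "y \<in> carrier H" "u = m (nat \<circ> \<mu>) \<cdot> y"
    using assms by (auto simp: good_def)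
  have c: "composition n (nat \<circ> \<mu>)" using v by (simp add: valid_def)
  have p: "1 \<le> (nat \<circ> \<mu>) i" unfolding comp_apply using v(2) by linarith
  obtain z where z: "z \<in> carrier H" "Fop (nat \<circ> \<mu>) i \<cdot> m (nat \<circ> \<mu>) = m (wF (nat \<circ> \<mu>) i) \<cdot> z"
    using Fop_m [OF c p] by blast
  have c': "composition n (wF (nat \<circ> \<mu>) i)" using composition_wF [OF c p] .
  have "opF \<mu> i u = m (wF (nat \<circ> \<mu>) i) \<cdot> (z \<cdot> y)"
    using v y z c c' by (simp add: opF_def H.m_assoc [symmetric])
  then show ?thesis
    using valid_wF [OF v] nat_wF [of \<mu> i] v y z c' unfolding good_def valid_def by auto
qed

lemma good_opE: assumes "good \<mu> u" shows "good (wE \<mu> i) (opE \<mu> i u)"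
proof (cases "u = \<^bold>0 \<or> \<not> 1 \<le> \<mu> (Suc i)")
  case True
  then show ?thesis by (auto simp: opE_def)
next
  case False
  then obtain y where v: "valid \<mu>" "1 \<le> \<mu> (Suc i)" and y: "y \<in> carrier H" "u = m (nat \<circ> \<mu>) \<cdot> y"
    using assms by (auto simp: good_def)
  have c: "composition n (nat \<circ> \<mu>)" using v by (simp add: valid_def)
  have p: "1 \<le> (nat \<circ> \<mu>) (Suc i)" unfolding comp_apply using v(2) by linarith
  obtain z where z: "z \<in> carrier H" "Eop (nat \<circ> \<mu>) i \<cdot> m (nat \<circ> \<mu>) = m (wE (nat \<circ> \<mu>) i) \<cdot> z"
    using Eop_m [OF c p] by blast
  have c': "composition n (wE (nat \<circ> \<mu>) i)" using composition_wE [OF c p] .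
  have "opE \<mu> i u = m (wE (nat \<circ> \<mu>) i) \<cdot> (z \<cdot> y)"
    using v y z c c' by (simp add: opE_def H.m_assoc [symmetric])
  then show ?thesis
    using valid_wE [OF v] nat_wE [of \<mu> i] v y z c' unfolding good_def valid_def by auto
qed

lemma eigen_row:
  assumes c: "composition n l" and y: "y \<in> carrier H" and j: "psum l i < j" "j < psum l (Suc i)"
  shows "t j \<cdot> (m l \<cdot> y) = \<iota> q \<cdot> (m l \<cdot> y)"
  using m_eigen(1) [OF c j] c y by (simp add: H.m_assoc [symmetric])

text \<open>Let e be the boundary between the rows. The operators at the given weight are 1 + D t_e
  and 1 + U t_e, where D and U are the operators at the changed weights. As U and D commute, the
  terms with t_e agree on both sides, and what remains is U u and D u, which are quantum integers
  times \<open>u\<close> because \<open>u\<close> is an eigenvector. With an empty row one of the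
  two products is impossible, hence the separate cases.\<close>

lemma EF_same:
  assumes c: "composition n l" and y: "y \<in> carrier H" and u: "u = m l \<cdot> y"
  shows "1 \<le> l i \<Longrightarrow> 1 \<le> l (Suc i) \<Longrightarrow>
      Eop (wF l i) i \<cdot> (Fop l i \<cdot> u) \<^bold>+ \<iota> (qint (l (Suc i))) \<cdot> u = Fop (wE l i) i \<cdot> (Eop l i \<cdot> u) \<^bold>+ \<iota> (qint (l i)) \<cdot> u"
    and "1 \<le> l i \<Longrightarrow> l (Suc i) = 0 \<Longrightarrow> Eop (wF l i) i \<cdot> (Fop l i \<cdot> u) = \<iota> (qint (l i)) \<cdot> u"
    and "l i = 0 \<Longrightarrow> 1 \<le> l (Suc i) \<Longrightarrow> Fop (wE l i) i \<cdot> (Eop l i \<cdot> u) = \<iota> (qint (l (Suc i))) \<cdot> u"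
proof -
  have uc: "u \<in> carrier H" using c y u by simp
  have E: "Eop (wF l i) i = Up (psum l i + a) a" "Up (psum l i + a) a \<cdot> u = \<iota> (qint (l i)) \<cdot> u" if a: "l i = Suc a" for a
  proof -
    show "Eop (wF l i) i = Up (psum l i + a) a"
      using psum_wF [of l i "Suc i"] a by (simp add: Eop_def del: sum.lessThan_Suc) simp
    show "Up (psum l i + a) a \<cdot> u = \<iota> (qint (l i)) \<cdot> u"
      unfolding a u using c y a by (intro Up_eigen eigen_row) auto
  qed
  have F: "Fop (wE l i) i = Dw (Suc (psum l (Suc i))) b" "Dw (Suc (psum l (Suc i))) b \<cdot> u = \<iota> (qint (l (Suc i))) \<cdot> u"
    if b: "l (Suc i) = Suc b" for b
  proof -
    show "Fop (wE l i) i = Dw (Suc (psum l (Suc i))) b"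
      using psum_wE [of l i "Suc i"] b by (simp add: Fop_def Suc_eq_plus1 [symmetric] del: sum.lessThan_Suc)
    show "Dw (Suc (psum l (Suc i))) b \<cdot> u = \<iota> (qint (l (Suc i))) \<cdot> u"
      unfolding b u using c y b by (intro Dw_eigen eigen_row [of l y "Suc i"]) auto
  qed
  show "Eop (wF l i) i \<cdot> (Fop l i \<cdot> u) = \<iota> (qint (l i)) \<cdot> u" if "1 \<le> l i" "l (Suc i) = 0"
  proof -
    obtain a where "l i = Suc a" using \<open>1 \<le> l i\<close> by (cases "l i") auto
    then show ?thesis using E that uc by (simp add: Fop_def)
  qed
  show "Fop (wE l i) i \<cdot> (Eop l i \<cdot> u) = \<iota> (qint (l (Suc i))) \<cdot> u" if "l i = 0" "1 \<le> l (Suc i)"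
  proof -
    obtain b where "l (Suc i) = Suc b" using \<open>1 \<le> l (Suc i)\<close> by (cases "l (Suc i)") auto
    then show ?thesis using F that uc by (simp add: Eop_def)
  qed
  show "Eop (wF l i) i \<cdot> (Fop l i \<cdot> u) \<^bold>+ \<iota> (qint (l (Suc i))) \<cdot> u = Fop (wE l i) i \<cdot> (Eop l i \<cdot> u) \<^bold>+ \<iota> (qint (l i)) \<cdot> u"
    if pos: "1 \<le> l i" "1 \<le> l (Suc i)"
  proof -
    obtain a where a: "l i = Suc a" using pos by (cases "l i") auto
    obtain b where b: "l (Suc i) = Suc b" using pos by (cases "l (Suc i)") auto
    define e where "e = psum l (Suc i)"
    have e: "e = Suc (psum l i + a)" by (simp add: e_def a)
    let ?U = "Up (psum l i + a) a" and ?D = "Dw (Suc e) b"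
    have Fl: "Fop l i = \<^bold>1 \<^bold>+ ?D \<cdot> t e" by (simp add: Fop_def b e_def [symmetric] del: sum.lessThan_Suc)
    have El: "Eop l i = \<^bold>1 \<^bold>+ ?U \<cdot> t e" by (simp add: Eop_def a e_def [symmetric] del: sum.lessThan_Suc) (simp add: e)
    have UD: "?U \<cdot> ?D = ?D \<cdot> ?U" by (rule gen_commute [OF Up_gen Dw_gen]) (auto simp: e)
    have U: "?U \<cdot> u = \<iota> (qint (l i)) \<cdot> u" and D: "?D \<cdot> u = \<iota> (qint (l (Suc i))) \<cdot> u"
      using E(2) [OF a] F(2) [OF b] by (simp_all add: e_def)
    define x where "x = ?U \<cdot> (?D \<cdot> (t e \<cdot> u))"
    have x': "x = ?D \<cdot> (?U \<cdot> (t e \<cdot> u))" and xc: "x \<in> carrier H"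
      unfolding x_def using UD uc by (simp_all add: H.m_assoc [symmetric])
    have "Eop (wF l i) i \<cdot> (Fop l i \<cdot> u) = \<iota> (qint (l i)) \<cdot> u \<^bold>+ x"
      unfolding E(1) [OF a] Fl x_def using uc U by (simp add: H.l_distr H.r_distr H.m_assoc)
    moreover have "Fop (wE l i) i \<cdot> (Eop l i \<cdot> u) = \<iota> (qint (l (Suc i))) \<cdot> u \<^bold>+ x"
      unfolding F(1) [OF b] El x' e_def [symmetric] using uc D by (simp add: H.l_distr H.r_distr H.m_assoc)
    ultimately show ?thesis using xc uc by (simp add: H.a_ac)
  qed
qed

text \<open>The row in the middle receives a box in front from the row above and one at its end from
  the row below. In either order the result contains the symmetrizer of the row enlarged on both
  sides, so there is no commutator.\<close>

lemma EF_next: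
  assumes c: "composition n l" and y: "y \<in> carrier H" and u: "u = m l \<cdot> y"
    and pos: "1 \<le> l i" "1 \<le> l (Suc (Suc i))"
  shows "Eop (wF l i) (Suc i) \<cdot> (Fop l i \<cdot> u) = Fop (wE l (Suc i)) i \<cdot> (Eop l (Suc i) \<cdot> u)"
proof -
  obtain e where e: "psum l (Suc i) = Suc e" using pos(1) by (cases "psum l (Suc i)") auto
  define b where "b = l (Suc i)"
  have d: "psum l (Suc (Suc i)) = Suc e + b" using e by (simp add: b_def)
  have le: "Suc e + b + 1 \<le> n" using composition_psum_le [OF c, of "Suc (Suc (Suc i))"] d pos(2) by simp
  obtain x where x: "x \<in> carrier H" "m l = sy (Suc e) b \<cdot> x" using row_left [OF c, of "Suc i"] e by (auto simp: b_def)
  have ops: "Eop (wF l i) (Suc i) = Up (Suc e + b) (Suc b)" "Fop l i = Dw (Suc e) b"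
    "Fop (wE l (Suc i)) i = Dw (Suc e) (Suc b)" "Eop l (Suc i) = Up (Suc e + b) b"
    using psum_wF [of l i "Suc (Suc i)", OF pos(1)] psum_wE [of l "Suc i" "Suc i", OF pos(2)] e d
    unfolding Eop_def Fop_def by (simp_all add: b_def wE_other Suc_eq_plus1 [symmetric] del: sum.lessThan_Suc Up.simps Dw.simps)
  have "Up (Suc e + b) (Suc b) \<cdot> (Dw (Suc e) b \<cdot> sy (Suc e) b) = sy e (Suc (Suc b))"
    using sy_Dw [of e b] le sy_Up [of e "Suc b"] by (simp del: sy.simps Up.simps)
  moreover have "Dw (Suc e) (Suc b) \<cdot> (Up (Suc e + b) b \<cdot> sy (Suc e) b) = sy e (Suc (Suc b))"
    using sy_Dw [of e "Suc b"] le sy_Up [of "Suc e" b] by (simp del: sy.simps Up.simps Dw.simps)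
  ultimately have eq: "Up (Suc e + b) (Suc b) \<cdot> (Dw (Suc e) b \<cdot> sy (Suc e) b) =
      Dw (Suc e) (Suc b) \<cdot> (Up (Suc e + b) b \<cdot> sy (Suc e) b)" by simp
  have sh: "A \<cdot> (B \<cdot> u) = A \<cdot> (B \<cdot> sy (Suc e) b) \<cdot> (x \<cdot> y)" if "A \<in> carrier H" "B \<in> carrier H" for A B
    unfolding u x using that x y by (simp add: H.m_assoc)
  show ?thesis unfolding ops using sh eq by (simp del: Up.simps Dw.simps)
qed

text \<open>For i = j + 1 the two ranges of generators are separated by row i, and two boxes in that
  row are just enough for them to commute. With a single box both \<open>opE\<close> after
  \<open>opF\<close> and \<open>opF\<close> after \<open>opE\<close> are zero.\<close>

lemma EF_far:
  assumes u: "u \<in> carrier H" and ij: "i \<noteq> j" "j \<noteq> Suc i"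
    and pos: "1 \<le> l i" "1 \<le> l (Suc j)" "i = Suc j \<Longrightarrow> 2 \<le> l i"
  shows "Eop (wF l i) j \<cdot> (Fop l i \<cdot> u) = Fop (wE l j) i \<cdot> (Eop l j \<cdot> u)"
proof -
  have ops: "Eop (wF l i) j = Eop l j" "Fop (wE l j) i = Fop l i"
    using psum_wF [of l i "Suc j", OF pos(1)] psum_wE [of l j "Suc i", OF pos(2)] ij
    unfolding Eop_def Fop_def by (auto simp: wF_other wE_other simp del: sum.lessThan_Suc)
  have "Eop l j \<cdot> Fop l i = Fop l i \<cdot> Eop l j"
  proof (rule gen_commute [OF Eop_gen Fop_gen])
    fix a b assume ab: "a \<in> {psum l j<..psum l (Suc j)}" "b \<in> {psum l (Suc i)..<psum l (Suc (Suc i))}"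
    consider "Suc (Suc i) \<le> j" | "i = Suc j" | "Suc (Suc j) \<le> i" using ij by linarith
    then show "a + 2 \<le> b \<or> b + 2 \<le> a"
    proof cases
      case 1
      then show ?thesis using ab psum_mono [of "Suc (Suc i)" j l] by auto
    next
      case 2
      then show ?thesis using ab pos by auto
    next
      case 3
      have "psum l (Suc (Suc j)) \<le> psum l i" using 3 by (rule psum_mono)
      then show ?thesis using ab pos by auto
    qed
  qed
  then show ?thesis unfolding ops using u by (simp add: H.m_assoc [symmetric])
qed

lemma EF:
  assumes g: "good \<mu> u"
  shows "opE (wF \<mu> i) j (opF \<mu> i u) = opF (wE \<mu> j) i (opE \<mu> j u) \<^bold>+
    (if i = j then \<iota> (qi (\<mu> i) \<ominus> qi (\<mu> (Suc i))) \<cdot> u else \<^bold>0)"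
proof (cases "u = \<^bold>0")
  case True
  then show ?thesis by (simp add: opE_def opF_def)
next
  case False
  define l where "l = nat \<circ> \<mu>"
  obtain y where v: "valid \<mu>" and y: "y \<in> carrier H" "u = m l \<cdot> y"
    using g False by (auto simp: good_def l_def)
  have nn: "\<forall>k. 0 \<le> \<mu> k" and c: "composition n l" using v by (auto simp: valid_def l_def)
  have uc: "u \<in> carrier H" using g good_closed by blast
  have li: "l k = nat (\<mu> k)" for k by (simp add: l_def)
  have nF: "nat \<circ> wF \<mu> k = wF l k" if "1 \<le> \<mu> k" for k using nat_wF [OF nn that] by (simp add: l_def)
  have nE: "nat \<circ> wE \<mu> k = wE l k" if "1 \<le> \<mu> (Suc k)" for k using nat_wE [OF nn that] by (simp add: l_def)
  have qil: "qi (\<mu> k) = qint (l k)" for k using nn by (simp add: qi_of_nat li)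
  show ?thesis
  proof (cases "i = j")
    case True
    have nni: "0 \<le> \<mu> i" "0 \<le> \<mu> (Suc i)" using nn by auto
    have LE: "opE (wF \<mu> i) i (opF \<mu> i u) = (if 1 \<le> \<mu> i then Eop (wF l i) i \<cdot> (Fop l i \<cdot> u) else \<^bold>0)"
      using nF [of i] nni by (auto simp: opE_def opF_def l_def)
    have RE: "opF (wE \<mu> i) i (opE \<mu> i u) = (if 1 \<le> \<mu> (Suc i) then Fop (wE l i) i \<cdot> (Eop l i \<cdot> u) else \<^bold>0)"
      using nE [of i] nni by (auto simp: opE_def opF_def l_def)
    note S = EF_same [OF c y(1) y(2), of i]
    have move: "X = Y \<^bold>+ \<iota> (A \<ominus> B) \<cdot> u" if "X \<^bold>+ \<iota> B \<cdot> u = Y \<^bold>+ \<iota> A \<cdot> u" "X \<in> carrier H" "Y \<in> carrier H" "A \<in> carrier K" "B \<in> carrier K" for X Y A B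
    proof -
      have "X = (X \<^bold>+ \<iota> B \<cdot> u) \<^bold>+ \<ominus>\<^bsub>H\<^esub> (\<iota> B \<cdot> u)"
        using that(2-) uc by (simp add: H.a_assoc H.r_neg)
      also have "\<dots> = Y \<^bold>+ (\<iota> A \<cdot> u \<^bold>+ \<ominus>\<^bsub>H\<^esub> (\<iota> B \<cdot> u))"
        unfolding that(1) using that(2-) uc by (simp add: H.a_assoc)
      also have "\<iota> A \<cdot> u \<^bold>+ \<ominus>\<^bsub>H\<^esub> (\<iota> B \<cdot> u) = \<iota> (A \<ominus> B) \<cdot> u"
        using that(2-) uc by (simp add: \<iota>_minus H.minus_eq H.l_distr H.l_minus)
      finally show ?thesis .
    qed
    consider "1 \<le> \<mu> i" "1 \<le> \<mu> (Suc i)" | "1 \<le> \<mu> i" "\<mu> (Suc i) = 0" | "\<mu> i = 0" "1 \<le> \<mu> (Suc i)" | "\<mu> i = 0" "\<mu> (Suc i) = 0"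
      using nni by linarith
    then have "opE (wF \<mu> i) i (opF \<mu> i u) \<^bold>+ \<iota> (qint (l (Suc i))) \<cdot> u = opF (wE \<mu> i) i (opE \<mu> i u) \<^bold>+ \<iota> (qint (l i)) \<cdot> u"
    proof cases
      case 1
      then show ?thesis unfolding LE RE using S(1) by (simp add: li)
    next
      case 2
      then show ?thesis unfolding LE RE using S(2) uc by (simp add: li)
    next
      case 3
      then show ?thesis unfolding LE RE using S(3) uc by (simp add: li)
    next
      case 4
      then show ?thesis unfolding LE RE using uc by (simp add: li)
    qed
    then have "opE (wF \<mu> i) i (opF \<mu> i u) = opF (wE \<mu> i) i (opE \<mu> i u) \<^bold>+ \<iota> (qint (l i) \<ominus> qint (l (Suc i))) \<cdot> u"
      by (rule move) (use uc in \<open>simp_all add: LE RE\<close>)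
    then show ?thesis using True by (simp add: qil)
  next
    case ij: False
    \<comment> \<open>Either both orders of moving the two boxes are possible or neither is; in the
      second case both sides vanish by the conventions of \<open>opE\<close> and
      \<open>opF\<close>.\<close>
    have w: "1 \<le> \<mu> i \<and> 1 \<le> wF \<mu> i (Suc j) \<longleftrightarrow> 1 \<le> \<mu> (Suc j) \<and> 1 \<le> wE \<mu> j i"
      using ij by (auto simp: wF_def wE_def)
    show ?thesis
    proof (cases "1 \<le> \<mu> i \<and> 1 \<le> wF \<mu> i (Suc j)")
      case True
      then have p: "1 \<le> \<mu> i" "1 \<le> wF \<mu> i (Suc j)" "1 \<le> \<mu> (Suc j)" "1 \<le> wE \<mu> j i" using w by auto
      have "Eop (wF l i) j \<cdot> (Fop l i \<cdot> u) = Fop (wE l j) i \<cdot> (Eop l j \<cdot> u)"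
      proof (cases "j = Suc i")
        case True
        then show ?thesis using EF_next [OF c y(1) y(2), of i] p by (simp add: li)
      next
        case False
        have "2 \<le> l i" if "i = Suc j" using p that by (simp add: wF_def li)
        then show ?thesis using EF_far [OF uc ij False, of l] p by (simp add: li)
      qed
      then show ?thesis using p ij nF [of i] nE [of j] uc by (simp add: opE_def opF_def l_def)
    next
      case False
      then have "\<not> (1 \<le> \<mu> (Suc j) \<and> 1 \<le> wE \<mu> j i)" using w by simp
      then show ?thesis using False ij by (auto simp: opE_def opF_def)
    qed
  qed
qed

end

section \<open>Normal ordering\<close>

text \<open>A lowering word is applied from its last letter to its first, a raising word from its
  first to its last. When raising follows lowering, the heads of the two lists therefore meet, which
  is the place where letters are commuted.\<close>

primrec wtF :: "(nat \<Rightarrow> int) \<Rightarrow> nat list \<Rightarrow> nat \<Rightarrow> int" where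
  "wtF \<mu> [] = \<mu>"
| "wtF \<mu> (i # I) = wF (wtF \<mu> I) i"

primrec wtE :: "(nat \<Rightarrow> int) \<Rightarrow> nat list \<Rightarrow> nat \<Rightarrow> int" where
  "wtE \<mu> [] = \<mu>"
| "wtE \<mu> (j # J) = wtE (wE \<mu> j) J"

lemma wE_wF: "wE (wF \<mu> i) j = wF (wE (\<mu> :: nat \<Rightarrow> int) j) i"
  by (auto simp: wE_def wF_def fun_eq_iff)

lemma wtF_wE: "wtF (wE \<mu> j) I = wE (wtF \<mu> I) j"
  by (induction I) (auto simp: wE_wF)

lemma wtE_snoc: "wtE \<mu> (J @ [j]) = wE (wtE \<mu> J) j"
  by (induction J arbitrary: \<mu>) auto

lemma wtF_snoc: "wtF \<mu> (I @ [i]) = wtF (wF \<mu> i) I"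
  by (induction I) auto

lemma isum_wF: "(\<Sum>j<k. wF \<mu> i j) = (\<Sum>j<k. \<mu> j :: int) - (if k = Suc i then 1 else 0)"
  by (induction k) (auto simp: wF_def)

lemma isum_wE: "(\<Sum>j<k. wE \<mu> i j) = (\<Sum>j<k. \<mu> j :: int) + (if k = Suc i then 1 else 0)"
  by (induction k) (auto simp: wE_def)

lemma isum_wtF: "(\<Sum>j<Suc k. wtF \<mu> I j) = (\<Sum>j<Suc k. \<mu> j) - int (count_list I k)"
  by (induction I) (auto simp: isum_wF simp del: sum.lessThan_Suc)

lemma isum_wtE: "(\<Sum>j<Suc k. wtE \<mu> J j) = (\<Sum>j<Suc k. \<mu> j) + int (count_list J k)"
  by (induction J arbitrary: \<mu>) (auto simp: isum_wE simp del: sum.lessThan_Suc)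

lemma wtF_same: "wtF \<mu> I = \<mu> \<Longrightarrow> I = []"
  using isum_wtF [of \<mu> I "hd I"] by (cases I) auto

text \<open>The change of weight effected by a word is independent of the starting weight; so taking
  columns away from the weights is compatible with words.\<close>

lemma wtF_add: "wtF (\<lambda>k. \<mu> k + \<delta> k) I = (\<lambda>k. wtF \<mu> I k + \<delta> k)"
  by (induction I) (auto simp: wF_def fun_eq_iff)

lemma wtE_add: "wtE (\<lambda>k. \<mu> k + \<delta> k) J = (\<lambda>k. wtE \<mu> J k + \<delta> k)"
proof (induction J arbitrary: \<mu>)
  case (Cons j J)
  have "wE (\<lambda>k. \<mu> k + \<delta> k) j = (\<lambda>k. wE \<mu> j k + \<delta> k)" by (auto simp: wE_def fun_eq_iff)
  then show ?case using Cons by simp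
qed simp

definition wt0 :: "(nat \<Rightarrow> nat) \<Rightarrow> nat \<Rightarrow> int" where "wt0 l k = int (l k)"

lemma nat_wt0 [simp]: "nat \<circ> wt0 l = l" by (simp add: fun_eq_iff wt0_def)

context hecke begin

primrec FV :: "(nat \<Rightarrow> int) \<Rightarrow> (nat list \<Rightarrow> 'a) set \<Rightarrow> nat list \<Rightarrow> (nat list \<Rightarrow> 'a) set" where
  "FV \<mu> u [] = u"
| "FV \<mu> u (i # I) = opF (wtF \<mu> I) i (FV \<mu> u I)"

primrec EV :: "(nat \<Rightarrow> int) \<Rightarrow> (nat list \<Rightarrow> 'a) set \<Rightarrow> nat list \<Rightarrow> (nat list \<Rightarrow> 'a) set" where
  "EV \<mu> u [] = u"
| "EV \<mu> u (j # J) = EV (wE \<mu> j) (opE \<mu> j u) J"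

lemma EV_snoc: "EV \<mu> u (J @ [j]) = opE (wtE \<mu> J) j (EV \<mu> u J)"
  by (induction J arbitrary: \<mu> u) auto

lemma FV_snoc: "FV \<mu> u (I @ [i]) = FV (wF \<mu> i) (opF \<mu> i u) I"
  by (induction I) (auto simp: wtF_snoc)

lemma good_FV: "good \<mu> u \<Longrightarrow> good (wtF \<mu> I) (FV \<mu> u I)"
  by (induction I) (auto intro: good_opF)

lemma good_EV: "good \<mu> u \<Longrightarrow> good (wtE \<mu> J) (EV \<mu> u J)"
  by (induction J arbitrary: \<mu> u) (auto intro: good_opE)

lemma opF_left: "\<exists>z\<in>carrier H. \<forall>u\<in>carrier H. opF \<mu> i u = z \<cdot> u"
  by (rule bexI [of _ "if 1 \<le> \<mu> i then Fop (nat \<circ> \<mu>) i else \<^bold>0"]) (simp_all add: opF_def)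

lemma opE_left: "\<exists>z\<in>carrier H. \<forall>u\<in>carrier H. opE \<mu> i u = z \<cdot> u"
  by (rule bexI [of _ "if 1 \<le> \<mu> (Suc i) then Eop (nat \<circ> \<mu>) i else \<^bold>0"]) (simp_all add: opE_def)

lemma FV_left: "\<exists>z\<in>carrier H. \<forall>u\<in>carrier H. FV \<mu> u I = z \<cdot> u"
proof (induction I)
  case Nil
  show ?case by (rule bexI [of _ "\<^bold>1"]) simp_all
next
  case (Cons i I)
  then obtain z where z: "z \<in> carrier H" "\<forall>u\<in>carrier H. FV \<mu> u I = z \<cdot> u" by blast
  obtain y where y: "y \<in> carrier H" "\<forall>u\<in>carrier H. opF (wtF \<mu> I) i u = y \<cdot> u" using opF_left by blast
  show ?case by (rule bexI [of _ "y \<cdot> z"]) (use y z in \<open>simp_all add: H.m_assoc\<close>)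
qed

lemma EV_left: "\<exists>z\<in>carrier H. \<forall>u\<in>carrier H. EV \<mu> u J = z \<cdot> u"
proof (induction J arbitrary: \<mu>)
  case Nil
  show ?case by (rule bexI [of _ "\<^bold>1"]) simp_all
next
  case (Cons j J)
  then obtain z where z: "z \<in> carrier H" "\<forall>u\<in>carrier H. EV (wE \<mu> j) u J = z \<cdot> u" by blast
  obtain y where y: "y \<in> carrier H" "\<forall>u\<in>carrier H. opE \<mu> j u = y \<cdot> u" using opE_left by blast
  show ?case by (rule bexI [of _ "z \<cdot> y"]) (use y z in \<open>simp_all add: H.m_assoc\<close>)
qed

text \<open>All operators at a fixed weight are left multiplications, from which additivity and
  compatibility with scalars and with right multiplication follow at once.\<close>

definition linop :: "((nat list \<Rightarrow> 'a) set \<Rightarrow> (nat list \<Rightarrow> 'a) set) \<Rightarrow> bool" where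
  "linop f \<longleftrightarrow> (\<exists>z\<in>carrier H. \<forall>u\<in>carrier H. f u = z \<cdot> u)"

lemma linopD:
  assumes "linop f"
  shows "u \<in> carrier H \<Longrightarrow> f u \<in> carrier H"
    and "u \<in> carrier H \<Longrightarrow> v \<in> carrier H \<Longrightarrow> f (u \<^bold>+ v) = f u \<^bold>+ f v"
    and "c \<in> carrier K \<Longrightarrow> u \<in> carrier H \<Longrightarrow> f (\<iota> c \<cdot> u) = \<iota> c \<cdot> f u"
    and "u \<in> carrier H \<Longrightarrow> v \<in> carrier H \<Longrightarrow> f (u \<cdot> v) = f u \<cdot> v"
    and "f \<^bold>0 = \<^bold>0"
proof -
  obtain z where z: "z \<in> carrier H" "\<And>u. u \<in> carrier H \<Longrightarrow> f u = z \<cdot> u" using assms by (auto simp: linop_def)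
  show "u \<in> carrier H \<Longrightarrow> f u \<in> carrier H" using z by simp
  show "u \<in> carrier H \<Longrightarrow> v \<in> carrier H \<Longrightarrow> f (u \<^bold>+ v) = f u \<^bold>+ f v" using z by (simp add: H.r_distr)
  show "c \<in> carrier K \<Longrightarrow> u \<in> carrier H \<Longrightarrow> f (\<iota> c \<cdot> u) = \<iota> c \<cdot> f u"
    using z \<iota>_central [of c z] by (simp add: H.m_assoc [symmetric])
  show "u \<in> carrier H \<Longrightarrow> v \<in> carrier H \<Longrightarrow> f (u \<cdot> v) = f u \<cdot> v" using z by (simp add: H.m_assoc)
  show "f \<^bold>0 = \<^bold>0" using z by simp
qed

lemmas linop_simps = linopD(1,2,3,5)

lemma linop_opF: "linop (opF \<mu> i)" using opF_left by (simp add: linop_def)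
lemma linop_opE: "linop (opE \<mu> i)" using opE_left by (simp add: linop_def)
lemma linop_FV: "linop (\<lambda>u. FV \<mu> u I)" using FV_left by (simp add: linop_def)
lemma linop_EV: "linop (\<lambda>u. EV \<mu> u J)" using EV_left by (simp add: linop_def)

text \<open>Formal linear combinations of words in the lowering operators are lists of pairs of a
  coefficient and a word.\<close>

definition lc :: "(nat \<Rightarrow> int) \<Rightarrow> (nat list \<Rightarrow> 'a) set \<Rightarrow> ('a \<times> nat list) list \<Rightarrow> (nat list \<Rightarrow> 'a) set" where
  "lc \<mu> u L = foldr (\<lambda>x acc. \<iota> (fst x) \<cdot> FV \<mu> u (snd x) \<^bold>+ acc) L \<^bold>0"

lemma lc_simps [simp]: "lc \<mu> u [] = \<^bold>0" "lc \<mu> u (x # L) = \<iota> (fst x) \<cdot> FV \<mu> u (snd x) \<^bold>+ lc \<mu> u L"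
  by (simp_all add: lc_def)

definition weighted :: "(nat \<Rightarrow> int) \<Rightarrow> (nat \<Rightarrow> int) \<Rightarrow> ('a \<times> nat list) list \<Rightarrow> bool" where
  "weighted \<mu> \<nu> L \<longleftrightarrow> (\<forall>x\<in>set L. fst x \<in> carrier K \<and> wtF \<mu> (snd x) = \<nu>)"

lemma weighted_simps [simp]: "weighted \<mu> \<nu> []"
  "weighted \<mu> \<nu> (x # L) \<longleftrightarrow> fst x \<in> carrier K \<and> wtF \<mu> (snd x) = \<nu> \<and> weighted \<mu> \<nu> L"
  "weighted \<mu> \<nu> (L @ L') \<longleftrightarrow> weighted \<mu> \<nu> L \<and> weighted \<mu> \<nu> L'"
  by (auto simp: weighted_def)

lemma FV_closed: "good \<mu> u \<Longrightarrow> FV \<mu> u I \<in> carrier H"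
  using good_FV good_closed by blast

lemma lc_closed: "good \<mu> u \<Longrightarrow> weighted \<mu> \<nu> L \<Longrightarrow> lc \<mu> u L \<in> carrier H"
  by (induction L) (auto simp: FV_closed)

lemma lc_append:
  "good \<mu> u \<Longrightarrow> weighted \<mu> \<nu> L \<Longrightarrow> weighted \<mu> \<nu> L' \<Longrightarrow> lc \<mu> u (L @ L') = lc \<mu> u L \<^bold>+ lc \<mu> u L'"
  by (induction L) (simp_all add: FV_closed lc_closed [where \<nu> = \<nu>] H.a_assoc)

definition prep :: "nat \<Rightarrow> ('a \<times> nat list) list \<Rightarrow> ('a \<times> nat list) list" where
  "prep i L = map (\<lambda>x. (fst x, i # snd x)) L"

lemma lc_prep: "good \<mu> u \<Longrightarrow> weighted \<mu> \<nu> L \<Longrightarrow> lc \<mu> u (prep i L) = opF \<nu> i (lc \<mu> u L) \<and> weighted \<mu> (wF \<nu> i) (prep i L)"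
  by (induction L) (simp_all add: prep_def linop_simps [OF linop_opF] FV_closed lc_closed [where \<nu> = \<nu>])

text \<open>\<open>cm \<mu> j I\<close> collects the terms that arise when the raising operator with index \<open>j\<close> is moved past
  the lowering word \<open>I\<close>.\<close>

primrec cm :: "(nat \<Rightarrow> int) \<Rightarrow> nat \<Rightarrow> nat list \<Rightarrow> ('a \<times> nat list) list" where
  "cm \<mu> j [] = []"
| "cm \<mu> j (i # I) = prep i (cm \<mu> j I) @
    (if i = j then [(qi (wtF \<mu> I i) \<ominus> qi (wtF \<mu> I (Suc i)), I)] else [])"

lemma wE_wF_same: "wE (wF \<mu> i) i = (\<mu> :: nat \<Rightarrow> int)"
  by (auto simp: wE_def wF_def)

lemma weighted_prep: "weighted \<mu> \<nu> L \<Longrightarrow> weighted \<mu> (wF \<nu> i) (prep i L)"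
  by (auto simp: weighted_def prep_def)

lemma weighted_cm: "weighted \<mu> (wE (wtF \<mu> I) j) (cm \<mu> j I)"
proof (induction I)
  case (Cons i I)
  have "wF (wE (wtF \<mu> I) i) i = wtF \<mu> I" by (auto simp: wE_def wF_def)
  then show ?case using weighted_prep [OF Cons, of i] by (auto simp: wE_wF)
qed simp

text \<open>\<open>EF\<close> is iterated along the lowering word: every letter equal to
  \<open>j\<close> contributes one term in which this letter is deleted, with the quantum integers
  of the weight reached at that moment as coefficient.\<close>

lemma commute:
  assumes g: "good \<mu> u"
  shows "opE (wtF \<mu> I) j (FV \<mu> u I) = FV (wE \<mu> j) (opE \<mu> j u) I \<^bold>+ lc \<mu> u (cm \<mu> j I)"
proof (induction I)
  case Nil
  then show ?case using good_closed [OF good_opE [OF g, of j]] by simp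
next
  case (Cons i I)
  let ?\<nu> = "wtF \<mu> I" and ?x = "FV \<mu> u I" and ?e = "FV (wE \<mu> j) (opE \<mu> j u) I"
  let ?c = "if i = j then \<iota> (qi (?\<nu> i) \<ominus> qi (?\<nu> (Suc i))) \<cdot> ?x else \<^bold>0"
  have gx: "good ?\<nu> ?x" by (rule good_FV [OF g])
  have ec: "?e \<in> carrier H" using FV_closed [OF good_opE [OF g]] .
  have lcc: "lc \<mu> u (cm \<mu> j I) \<in> carrier H" by (rule lc_closed [OF g weighted_cm])
  have xc: "?x \<in> carrier H" using gx good_closed by blast
  have pr: "lc \<mu> u (prep i (cm \<mu> j I)) = opF (wE ?\<nu> j) i (lc \<mu> u (cm \<mu> j I))"
    using lc_prep [OF g weighted_cm] by blast
  have prw: "weighted \<mu> (wE (wtF \<mu> (i # I)) j) (prep i (cm \<mu> j I))"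
    using weighted_prep [OF weighted_cm] by (simp add: wE_wF)
  have fin: "lc \<mu> u (cm \<mu> j (i # I)) = opF (wE ?\<nu> j) i (lc \<mu> u (cm \<mu> j I)) \<^bold>+ ?c"
    unfolding cm.simps using lc_append [OF g prw, of "if i = j then [(qi (?\<nu> i) \<ominus> qi (?\<nu> (Suc i)), I)] else []"] xc pr
    by (auto simp: wE_wF_same)
  have "opE (wtF \<mu> (i # I)) j (FV \<mu> u (i # I)) = opF (wE ?\<nu> j) i (opE ?\<nu> j ?x) \<^bold>+ ?c"
    using EF [OF gx] by simp
  also have "opE ?\<nu> j ?x = ?e \<^bold>+ lc \<mu> u (cm \<mu> j I)" by (rule Cons)
  also have "opF (wE ?\<nu> j) i (?e \<^bold>+ lc \<mu> u (cm \<mu> j I)) = opF (wE ?\<nu> j) i ?e \<^bold>+ opF (wE ?\<nu> j) i (lc \<mu> u (cm \<mu> j I))"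
    by (rule linopD(2) [OF linop_opF ec lcc])
  also have "opF (wE ?\<nu> j) i ?e = FV (wE \<mu> j) (opE \<mu> j u) (i # I)" by (simp add: wtF_wE)
  finally show ?case
    unfolding fin using FV_closed [OF good_opE [OF g], of j "i # I"] lcc xc linopD(1) [OF linop_opF lcc]
    by (simp add: H.a_assoc del: FV.simps)
qed

text \<open>\<open>WS True\<close> is the span of all words applied to \<open>m l\<close>, raising operators first; \<open>WS False\<close> is the
  span of the words with at least one raising operator.\<close>

inductive_set WS :: "bool \<Rightarrow> (nat \<Rightarrow> nat) \<Rightarrow> (nat \<Rightarrow> int) \<Rightarrow> (nat list \<Rightarrow> 'a) set set"
  for b :: bool and l :: "nat \<Rightarrow> nat" and \<mu> :: "nat \<Rightarrow> int" where
  WS_zero: "\<^bold>0 \<in> WS b l \<mu>"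
| WS_add: "x \<in> WS b l \<mu> \<Longrightarrow> y \<in> WS b l \<mu> \<Longrightarrow> x \<^bold>+ y \<in> WS b l \<mu>"
| WS_smult: "c \<in> carrier K \<Longrightarrow> x \<in> WS b l \<mu> \<Longrightarrow> \<iota> c \<cdot> x \<in> WS b l \<mu>"
| WS_gen: "b \<or> J \<noteq> [] \<Longrightarrow> wtF (wtE (wt0 l) J) I = \<mu>
    \<Longrightarrow> FV (wtE (wt0 l) J) (EV (wt0 l) (m l) J) I \<in> WS b l \<mu>"

lemma good_m: "composition n l \<Longrightarrow> good (wt0 l) (m l)"
  unfolding good_def valid_def by (simp add: wt0_def) (metis H.one_closed H.r_one m_closed)

lemma WS_closed: "x \<in> WS b l \<mu> \<Longrightarrow> composition n l \<Longrightarrow> x \<in> carrier H"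
  by (induction rule: WS.induct) (auto intro: FV_closed good_EV good_m)

lemma WS_opF: "x \<in> WS b l \<mu> \<Longrightarrow> composition n l \<Longrightarrow> opF \<mu> i x \<in> WS b l (wF \<mu> i)"
proof (induction rule: WS.induct)
  case (WS_gen J I)
  then show ?case using WS.WS_gen [of b J l "i # I" "wF \<mu> i"] by auto
qed (auto simp: linop_simps [OF linop_opF] WS_closed intro: WS.intros)

lemma WS_lc:
  assumes "weighted (wtE (wt0 l) J) \<mu> L" "b \<or> J \<noteq> []"
  shows "lc (wtE (wt0 l) J) (EV (wt0 l) (m l) J) L \<in> WS b l \<mu>"
  using assms(1) by (induction L) (auto intro!: WS.intros assms(2))

text \<open>Moving the new raising operator next to the raising word appends it there; the
  commutator terms merely shorten the lowering word and keep the raising word.\<close>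

lemma WS_opE: "x \<in> WS b l \<mu> \<Longrightarrow> composition n l \<Longrightarrow> opE \<mu> j x \<in> WS b l (wE \<mu> j)"
proof (induction rule: WS.induct)
  case (WS_gen J I)
  let ?\<nu> = "wtE (wt0 l) J" and ?u = "EV (wt0 l) (m l) J"
  have g: "good ?\<nu> ?u" using WS_gen good_EV good_m by blast
  have "FV (wtE (wt0 l) (J @ [j])) (EV (wt0 l) (m l) (J @ [j])) I \<in> WS b l (wE \<mu> j)"
    by (rule WS.WS_gen) (use WS_gen in \<open>auto simp: wtE_snoc wtF_wE\<close>)
  then have "FV (wE ?\<nu> j) (opE ?\<nu> j ?u) I \<in> WS b l (wE \<mu> j)"
    by (simp add: wtE_snoc EV_snoc)
  moreover have "lc ?\<nu> ?u (cm ?\<nu> j I) \<in> WS b l (wE \<mu> j)"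
    using WS_gen by (intro WS_lc) (auto intro: weighted_cm)
  ultimately have "opE (wtF ?\<nu> I) j (FV ?\<nu> ?u I) \<in> WS b l (wE \<mu> j)"
    unfolding commute [OF g] by (rule WS.WS_add)
  then show ?case using WS_gen by simp
qed (auto simp: linop_simps [OF linop_opE] WS_closed intro: WS.intros)

lemma WS_EV: "x \<in> WS b l \<mu> \<Longrightarrow> composition n l \<Longrightarrow> EV \<mu> x J \<in> WS b l (wtE \<mu> J)"
  by (induction J arbitrary: \<mu> x) (auto intro: WS_opE)

text \<open>The words without raising part are collected in an explicit list, since it is on such
  lists that the coefficients \<open>klc\<close> and \<open>pr\<close> are computed.\<close>

lemma WS_decomp:
  assumes "x \<in> WS True l \<mu>" "composition n l"
  shows "\<exists>a\<in>WS False l \<mu>. \<exists>L. weighted (wt0 l) \<mu> L \<and> x = a \<^bold>+ lc (wt0 l) (m l) L"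
  using assms
proof (induction rule: WS.induct)
  case WS_zero
  then show ?case by (intro bexI [of _ "\<^bold>0"] exI [of _ "[]"]) (auto intro: WS.WS_zero)
next
  case (WS_add x y)
  then obtain a L b L' where *: "a \<in> WS False l \<mu>" "weighted (wt0 l) \<mu> L" "x = a \<^bold>+ lc (wt0 l) (m l) L"
    "b \<in> WS False l \<mu>" "weighted (wt0 l) \<mu> L'" "y = b \<^bold>+ lc (wt0 l) (m l) L'" by blast
  note c = WS_closed [OF *(1) WS_add.prems] WS_closed [OF *(4) WS_add.prems]
    lc_closed [OF good_m [OF WS_add.prems] *(2)] lc_closed [OF good_m [OF WS_add.prems] *(5)]
  have "x \<^bold>+ y = (a \<^bold>+ b) \<^bold>+ lc (wt0 l) (m l) (L @ L')"
    unfolding * lc_append [OF good_m [OF WS_add.prems] *(2,5)] using c by (simp add: H.a_ac)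
  moreover have "a \<^bold>+ b \<in> WS False l \<mu>" using * by (auto intro: WS.WS_add)
  moreover have "weighted (wt0 l) \<mu> (L @ L')" using * by simp
  ultimately show ?case by blast
next
  case (WS_smult c x)
  then obtain a L where *: "a \<in> WS False l \<mu>" "weighted (wt0 l) \<mu> L" "x = a \<^bold>+ lc (wt0 l) (m l) L" by blast
  let ?L = "map (\<lambda>x. (c \<otimes> fst x, snd x)) L"
  have g: "good (wt0 l) (m l)" using WS_smult good_m by blast
  have "weighted (wt0 l) \<mu> ?L \<and> \<iota> c \<cdot> lc (wt0 l) (m l) L = lc (wt0 l) (m l) ?L"
    using *(2) by (induction L) (use WS_smult.hyps in \<open>simp_all add: H.r_distr lc_closed [OF g, of \<mu>] FV_closed [OF g] \<iota>_mult H.m_assoc\<close>)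
  moreover have "\<iota> c \<cdot> x = \<iota> c \<cdot> a \<^bold>+ \<iota> c \<cdot> lc (wt0 l) (m l) L"
    unfolding *(3) using WS_smult WS_closed [OF *(1)] lc_closed [OF g *(2)] by (simp add: H.r_distr)
  moreover have "\<iota> c \<cdot> a \<in> WS False l \<mu>" using WS_smult * by (auto intro: WS.WS_smult)
  ultimately show ?case by (intro bexI [of _ "\<iota> c \<cdot> a"] exI [of _ ?L]) simp_all
next
  case (WS_gen J I)
  show ?case
  proof (cases "J = []")
    case True
    have g: "good (wt0 l) (m l)" using WS_gen good_m by blast
    show ?thesis
      by (intro bexI [of _ "\<^bold>0"] exI [of _ "[(\<one>, I)]"])
        (use True WS_gen FV_closed [OF g, of I] in \<open>auto intro: WS.WS_zero\<close>)
  next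
    case False
    then have "FV (wtE (wt0 l) J) (EV (wt0 l) (m l) J) I \<in> WS False l \<mu>"
      using WS_gen by (intro WS.WS_gen) auto
    moreover from this have "FV (wtE (wt0 l) J) (EV (wt0 l) (m l) J) I \<in> carrier H"
      using WS_closed WS_gen by blast
    ultimately show ?thesis
      by (intro bexI [of _ "FV (wtE (wt0 l) J) (EV (wt0 l) (m l) J) I"] exI [of _ "[]"]) auto
  qed
qed

text \<open>\<open>pr \<mu> J I\<close> is the coefficient of the highest weight vector in the raising word \<open>J\<close> applied to the
  lowering word \<open>I\<close>.\<close>

definition klc :: "(nat list \<Rightarrow> 'a) \<Rightarrow> ('a \<times> nat list) list \<Rightarrow> 'a" where
  "klc f L = foldr (\<lambda>x acc. fst x \<otimes> f (snd x) \<oplus> acc) L \<zero>"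

lemma klc_simps [simp]: "klc f [] = \<zero>" "klc f (x # L) = fst x \<otimes> f (snd x) \<oplus> klc f L"
  by (simp_all add: klc_def)

primrec pr :: "(nat \<Rightarrow> int) \<Rightarrow> nat list \<Rightarrow> nat list \<Rightarrow> 'a" where
  "pr \<mu> [] = (\<lambda>I. if I = [] then \<one> else \<zero>)"
| "pr \<mu> (j # J) = (\<lambda>I. klc (pr \<mu> J) (cm \<mu> j I))"

lemma klc_closed: "(\<And>I. f I \<in> carrier K) \<Longrightarrow> weighted \<mu> \<nu> L \<Longrightarrow> klc f L \<in> carrier K"
  by (induction L) auto

lemma pr_closed [simp]: "pr \<mu> J I \<in> carrier K"
  by (induction J arbitrary: I) (auto intro: klc_closed weighted_cm)

lemma EV_lc:
  assumes l: "composition n l" and w: "weighted (wt0 l) \<nu> L"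
    and IH: "\<And>I. wtF (wt0 l) I = \<nu> \<Longrightarrow>
      \<exists>a\<in>WS False l (wt0 l). EV \<nu> (FV (wt0 l) (m l) I) J = a \<^bold>+ \<iota> (pr (wt0 l) J I) \<cdot> m l"
  shows "\<exists>a\<in>WS False l (wt0 l). EV \<nu> (lc (wt0 l) (m l) L) J = a \<^bold>+ \<iota> (klc (pr (wt0 l) J) L) \<cdot> m l"
  using w
proof (induction L)
  case Nil
  show ?case by (rule bexI [of _ "\<^bold>0"]) (use l linopD(5) [OF linop_EV] in \<open>auto intro: WS.WS_zero\<close>)
next
  case (Cons x L)
  have g: "good (wt0 l) (m l)" using l good_m by blast
  have x: "fst x \<in> carrier K" "wtF (wt0 l) (snd x) = \<nu>" and wL: "weighted (wt0 l) \<nu> L" using Cons.prems by auto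
  obtain a where a: "a \<in> WS False l (wt0 l)" "EV \<nu> (lc (wt0 l) (m l) L) J = a \<^bold>+ \<iota> (klc (pr (wt0 l) J) L) \<cdot> m l"
    using Cons.IH wL by blast
  obtain b where b: "b \<in> WS False l (wt0 l)" "EV \<nu> (FV (wt0 l) (m l) (snd x)) J = b \<^bold>+ \<iota> (pr (wt0 l) J (snd x)) \<cdot> m l"
    using IH [OF x(2)] by blast
  have c: "a \<in> carrier H" "b \<in> carrier H" "m l \<in> carrier H" "klc (pr (wt0 l) J) L \<in> carrier K"
    using a b l WS_closed klc_closed [OF pr_closed wL] by auto
  have "EV \<nu> (lc (wt0 l) (m l) (x # L)) J = \<iota> (fst x) \<cdot> EV \<nu> (FV (wt0 l) (m l) (snd x)) J \<^bold>+ EV \<nu> (lc (wt0 l) (m l) L) J"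
    using x FV_closed [OF g] lc_closed [OF g wL] by (simp add: linop_simps [OF linop_EV])
  also have "\<dots> = (\<iota> (fst x) \<cdot> b \<^bold>+ a) \<^bold>+ \<iota> (klc (pr (wt0 l) J) (x # L)) \<cdot> m l"
    unfolding a(2) b(2) using c x by (simp add: \<iota>_add \<iota>_mult H.l_distr H.r_distr H.m_assoc H.a_ac)
  finally show ?case using a(1) b(1) x by (auto intro: WS.intros)
qed

text \<open>Modulo words that raise first, a raising letter can only disappear in a commutator, and
  this is the recursion that defines \<open>pr\<close>. At the end the weight forces the remaining
  lowering word to be empty, because lowering strictly decreases a partial sum.\<close>

lemma EV_FV:
  assumes l: "composition n l"
  shows "wtE (wtF (wt0 l) I) J = wt0 l \<Longrightarrow>
    \<exists>a\<in>WS False l (wt0 l). EV (wtF (wt0 l) I) (FV (wt0 l) (m l) I) J = a \<^bold>+ \<iota> (pr (wt0 l) J I) \<cdot> m l"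
proof (induction J arbitrary: I)
  case Nil
  then have "I = []" using wtF_same by simp
  then show ?case using l by (intro bexI [of _ "\<^bold>0"]) (auto intro: WS.WS_zero)
next
  case (Cons j J)
  let ?L = "wt0 l" and ?\<nu> = "wtF (wt0 l) I"
  have g: "good ?L (m l)" using l good_m by blast
  have lcw: "weighted ?L (wE ?\<nu> j) (cm ?L j I)" by (rule weighted_cm)
  obtain a where a: "a \<in> WS False l ?L" "EV (wE ?\<nu> j) (lc ?L (m l) (cm ?L j I)) J = a \<^bold>+ \<iota> (pr ?L (j # J) I) \<cdot> m l"
  proof -
    have "\<exists>a\<in>WS False l ?L. EV (wE ?\<nu> j) (FV ?L (m l) I') J = a \<^bold>+ \<iota> (pr ?L J I') \<cdot> m l"
      if "wtF ?L I' = wE ?\<nu> j" for I'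
      using Cons.IH [of I'] Cons.prems that by simp
    from EV_lc [OF l lcw this] show ?thesis using that by (auto simp del: lc_simps)
  qed
  let ?e = "FV (wE ?L j) (opE ?L j (m l)) I"
  have "FV (wtE ?L [j]) (EV ?L (m l) [j]) I \<in> WS False l (wE ?\<nu> j)"
    by (rule WS.WS_gen) (auto simp: wtF_wE)
  then have e: "?e \<in> WS False l (wE ?\<nu> j)" by simp
  then have eE: "EV (wE ?\<nu> j) ?e J \<in> WS False l ?L" using WS_EV [OF e l, of J] Cons.prems by simp
  have "EV ?\<nu> (FV ?L (m l) I) (j # J) = EV (wE ?\<nu> j) ?e J \<^bold>+ EV (wE ?\<nu> j) (lc ?L (m l) (cm ?L j I)) J"
    using WS_closed [OF e l] lc_closed [OF g lcw] by (simp add: commute [OF g] linop_simps [OF linop_EV])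
  also have "\<dots> = (EV (wE ?\<nu> j) ?e J \<^bold>+ a) \<^bold>+ \<iota> (pr ?L (j # J) I) \<cdot> m l"
    unfolding a(2) using WS_closed [OF eE l] WS_closed [OF a(1) l] l
    by (intro H.a_assoc [symmetric]) (auto simp del: pr.simps)
  finally show ?case using WS.WS_add [OF eE a(1)] by blast
qed

subsection \<open>Splitting into single boxes\<close>

lemma psum_ones: "psum (ones n) k = min k n"
  by (induction k) (auto simp: ones_def)

lemma composition_ones: "composition n (ones n)"
  by (rule compositionI [of _ n]) (simp add: psum_ones, simp add: ones_def)

lemma m_ones [simp]: "m (ones n) = \<^bold>1"
proof -
  have "sy c 1 = \<^bold>1" for c by (simp add: One_nat_def)
  then have "mm (ones n) r = \<^bold>1" for r
    by (induction r) (auto simp: ones_def)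
  then show ?thesis using m_mm_ex [OF composition_ones] by force
qed

lemma merge_one:
  assumes l: "composition n l" and pos: "1 \<le> l i" "l (Suc i) = 0"
  shows "Eop (wF l i) i \<cdot> m (wF l i) = m l"
proof -
  let ?l = "wF l i"
  obtain a where a: "l i = Suc a" using pos by (cases "l i") auto
  have ps: "psum ?l i = psum l i" "psum ?l (Suc i) = psum l i + a"
    using psum_wF [of l i i] psum_wF [of l i "Suc i"] pos a by simp_all
  have "sy c 1 = \<^bold>1" for c by (simp add: One_nat_def)
  then have "two_rows ?l i = sy (psum l i) a"
    using pos a by (simp add: two_rows_def ps del: sum.lessThan_Suc)
  moreover have "two_rows l i = sy (psum l i) (Suc a)"
    using pos a by (simp add: two_rows_def del: sum.lessThan_Suc sy.simps(2))
  moreover have "Eop ?l i = Up (psum l i + a) a" unfolding Eop_def ps using a by simp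
  ultimately have rel: "Eop ?l i \<cdot> two_rows ?l i = two_rows l i \<cdot> \<^bold>1"
    by (simp add: sy_Up del: sy.simps)
  have "Eop ?l i \<cdot> m ?l = m l \<cdot> \<^bold>1"
  proof (rule two_rows_intertwine [OF composition_wF [OF l pos(1)] l])
    show "wF l i k = l k" if "k \<noteq> i" "k \<noteq> Suc i" for k using that by (simp add: wF_other)
    show "psum ?l (Suc (Suc i)) = psum l (Suc (Suc i))"
      using psum_wF [of l i "Suc (Suc i)"] pos by (simp del: sum.lessThan_Suc)
    show "Eop ?l i \<cdot> t j = t j \<cdot> Eop ?l i" if "j < psum ?l i" for j
      by (rule gen_commute_t [OF Eop_gen]) (use that in auto)
  qed (use rel in simp_all)
  then show ?thesis using l by simp
qed

text \<open>Take the largest k < n such that the first k rows hold more than k boxes. By maximality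
  row k is empty and exactly k + 1 boxes precede it; the last nonempty row before it can give up a
  box, and single boxes are still dominated afterwards.\<close>

lemma split_box:
  assumes l: "composition n l" and d: "dominated (ones n) l" and ne: "l \<noteq> ones n"
  shows "\<exists>i. 1 \<le> l i \<and> l (Suc i) = 0 \<and> Suc i < psum l (Suc i)"
proof -
  have dom: "min k n \<le> psum l k" for k using d by (simp add: dominated_def psum_ones)
  have le: "psum l k \<le> n" for k by (rule composition_psum_le [OF l])
  have "\<exists>k<n. k < psum l k"
  proof (rule ccontr)
    assume "\<not> ?thesis"
    then have "psum l k \<le> k" if "k < n" for k using that by (meson not_less)
    then have eq: "psum l k = min k n" for k using dom [of k] le [of k] by (cases "k < n") (force simp: min_def)+
    have "l k = ones n k" for k
    proof -
      have "psum l k + l k = min (Suc k) n" using eq [of "Suc k"] by simp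
      then show ?thesis using eq [of k] by (cases "k < n") (simp_all add: ones_def One_nat_def)
    qed
    then show False using ne by auto
  qed
  then have fin: "finite {k. k < n \<and> k < psum l k}" "{k. k < n \<and> k < psum l k} \<noteq> {}" by auto
  define k where "k = Max {k. k < n \<and> k < psum l k}"
  have k: "k < n" "k < psum l k" using Max_in [OF fin] by (auto simp: k_def)
  have "psum l (Suc k) \<le> Suc k"
  proof (cases "Suc k < n")
    case True
    have "\<not> Suc k < psum l (Suc k)"
    proof
      assume "Suc k < psum l (Suc k)"
      then have "Suc k \<le> k" using True Max_ge [OF fin(1), of "Suc k"] by (auto simp: k_def simp del: sum.lessThan_Suc)
      then show False by simp
    qed
    then show ?thesis by simp
  next
    case False
    then show ?thesis using le [of "Suc k"] k by linarith
  qed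
  then have lk: "l k = 0" "psum l k = Suc k" using k by auto
  have "\<exists>i<k. l i \<noteq> 0"
  proof (rule ccontr)
    assume "\<not> ?thesis"
    then have "psum l k = 0" by simp
    then show False using k by simp
  qed
  then have fin2: "finite {i. i < k \<and> l i \<noteq> 0}" "{i. i < k \<and> l i \<noteq> 0} \<noteq> {}" by auto
  define i where "i = Max {i. i < k \<and> l i \<noteq> 0}"
  have i: "i < k" "l i \<noteq> 0" using Max_in [OF fin2] by (auto simp: i_def)
  have z: "l j = 0" if "i < j" "j \<le> k" for j
  proof (rule ccontr)
    assume "l j \<noteq> 0"
    then have "j \<in> {i. i < k \<and> l i \<noteq> 0}" using that lk by (cases "j = k") auto
    then have "j \<le> i" unfolding i_def by (rule Max_ge [OF fin2(1)])
    then show False using that by simp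
  qed
  have "psum l (Suc i) = psum l k"
    using z i by (intro sum.mono_neutral_left) auto
  then show ?thesis using i lk z [of "Suc i"] by (intro exI [of _ i]) auto
qed

text \<open>Moving a box into an empty row is the operator 1, so \<open>m l\<close> is at the same
  time a vector of the weight of single boxes. The reverse path multiplies by the symmetrizer in
  steps (\<open>merge_one\<close>). Each split lowers the sum of the partial sums, on which the
  induction runs.\<close>

lemma split_merge:
  assumes "composition n l" "dominated (ones n) l"
  shows "\<exists>I J. wtF (wt0 l) I = wt0 (ones n) \<and> (\<forall>u\<in>carrier H. FV (wt0 l) u I = u) \<and>
    wtE (wt0 (ones n)) J = wt0 l \<and> (\<forall>x\<in>carrier H. EV (wt0 (ones n)) x J = m l \<cdot> x)"
  using assms
proof (induction "\<Sum>k<Suc n. psum l k" arbitrary: l rule: less_induct)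
  case less
  show ?case
  proof (cases "l = ones n")
    case True
    then show ?thesis by (intro exI [of _ "[]"]) auto
  next
    case False
    obtain i where i: "1 \<le> l i" "l (Suc i) = 0" "Suc i < psum l (Suc i)"
      using split_box [OF less.prems False] by blast
    let ?l = "wF l i"
    have ps: "psum ?l k + (if k = Suc i then 1 else 0) = psum l k" for k using psum_wF [of l i k] i by simp
    have l': "composition n ?l" using composition_wF less.prems i by blast
    have "min k n \<le> psum ?l k" for k
    proof (cases "k = Suc i")
      case True
      then show ?thesis using i ps [of k] by (simp del: sum.lessThan_Suc)
    next
      case False
      then show ?thesis using ps [of k] less.prems(2) by (simp add: dominated_def psum_ones)
    qed
    then have d': "dominated (ones n) ?l" by (simp add: dominated_def psum_ones)
    have "Suc i < n" using i(3) composition_psum_le [OF less.prems(1), of "Suc i"] by linarith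
    have "psum ?l k \<le> psum l k" for k using ps [of k] by linarith
    moreover have "psum ?l (Suc i) < psum l (Suc i)" using ps [of "Suc i"] by (simp del: sum.lessThan_Suc)
    ultimately have "(\<Sum>k<Suc n. psum ?l k) < (\<Sum>k<Suc n. psum l k)"
      using \<open>Suc i < n\<close> by (intro sum_strict_mono_ex1) (auto simp del: sum.lessThan_Suc intro!: bexI [of _ "Suc i"])
    from less.hyps [OF this l' d'] obtain I J where IJ: "wtF (wt0 ?l) I = wt0 (ones n)"
      "\<forall>u\<in>carrier H. FV (wt0 ?l) u I = u" "wtE (wt0 (ones n)) J = wt0 ?l"
      "\<forall>x\<in>carrier H. EV (wt0 (ones n)) x J = m ?l \<cdot> x" by blast
    have wF: "wF (wt0 l) i = wt0 ?l" using i by (auto simp: wF_def wt0_def fun_eq_iff of_nat_diff)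
    have wE: "wE (wt0 ?l) i = wt0 l" using wE_wF_same [of "wt0 l" i] wF by simp
    have opF: "opF (wt0 l) i u = u" if "u \<in> carrier H" for u
      using i that by (simp add: opF_def Fop_def wt0_def)
    have opE: "opE (wt0 ?l) i (m ?l \<cdot> x) = m l \<cdot> x" if "x \<in> carrier H" for x
      using merge_one [OF less.prems(1) i(1,2)] that l'
      by (simp add: opE_def wt0_def H.m_assoc [symmetric])
    show ?thesis
    proof (intro exI conjI)
      show "wtF (wt0 l) (I @ [i]) = wt0 (ones n)" by (simp add: wtF_snoc wF IJ)
      show "\<forall>u\<in>carrier H. FV (wt0 l) u (I @ [i]) = u" using IJ opF by (simp add: FV_snoc wF)
      show "wtE (wt0 (ones n)) (J @ [i]) = wt0 l" by (simp add: wtE_snoc IJ wE)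
      show "\<forall>x\<in>carrier H. EV (wt0 (ones n)) x (J @ [i]) = m l \<cdot> x" using IJ opE by (simp add: EV_snoc)
    qed
  qed
qed

text \<open>At the weight of single boxes the generators of the algebra are themselves expressed by
  the operators; hence spans of operator words are left ideals there, which gives
  \<open>all_words\<close>.\<close>

lemma EF_ones:
  assumes "u \<in> carrier H" "Suc i < n"
  shows "opE (wF (wt0 (ones n)) i) i (opF (wt0 (ones n)) i u) = (\<^bold>1 \<^bold>+ t (Suc i)) \<cdot> u"
proof -
  have pos: "1 \<le> ones n i" "1 \<le> ones n (Suc i)" using assms by (auto simp: ones_def)
  have wF: "wF (wt0 (ones n)) i = wt0 (wF (ones n) i)" using pos by (auto simp: wF_def wt0_def fun_eq_iff of_nat_diff)
  have "Fop (ones n) i = \<^bold>1 \<^bold>+ t (Suc i)"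
    using assms by (simp add: Fop_def psum_ones ones_def One_nat_def del: sum.lessThan_Suc)
  moreover have "Eop (wF (ones n) i) i = \<^bold>1"
    using assms by (simp add: Eop_def ones_def One_nat_def)
  ultimately show ?thesis
    using pos assms unfolding wF by (simp add: opE_def opF_def wt0_def)
qed

lemma all_words:
  assumes l: "composition n l" "dominated (ones n) l" and h: "h \<in> carrier H"
  shows "h \<cdot> m l \<in> WS True l (wt0 (ones n))"
proof -
  obtain I where I: "wtF (wt0 l) I = wt0 (ones n)" "\<forall>u\<in>carrier H. FV (wt0 l) u I = u"
    using split_merge [OF l] by blast
  have ml: "m l \<in> WS True l (wt0 (ones n))"
    using WS.WS_gen [of True "[]" l I "wt0 (ones n)"] I l by simp
  have step: "t i \<cdot> x \<in> WS True l (wt0 (ones n))" if x: "x \<in> WS True l (wt0 (ones n))" and i: "i \<in> {1..<n}" for i x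
  proof -
    obtain j where j: "i = Suc j" "Suc j < n" using i by (cases i) auto
    have xc: "x \<in> carrier H" using WS_closed x l by blast
    have "(\<^bold>1 \<^bold>+ t i) \<cdot> x \<in> WS True l (wt0 (ones n))"
      using WS_opE [OF WS_opF [OF x l(1), of j] l(1), of j] EF_ones [OF xc j(2)] by (simp add: wE_wF_same j)
    moreover have "\<iota> (\<ominus> \<one>) \<cdot> x \<in> WS True l (wt0 (ones n))" using x by (auto intro: WS.WS_smult)
    ultimately have "(\<^bold>1 \<^bold>+ t i) \<cdot> x \<^bold>+ \<iota> (\<ominus> \<one>) \<cdot> x \<in> WS True l (wt0 (ones n))" by (rule WS.WS_add)
    moreover have "(\<^bold>1 \<^bold>+ t i) \<cdot> x \<^bold>+ \<iota> (\<ominus> \<one>) \<cdot> x = t i \<cdot> x"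
      using xc by (simp add: \<iota>_uminus H.l_distr H.l_minus H.a_ac H.r_neg H.r_neg1 H.r_neg2)
    ultimately show ?thesis by simp
  qed
  have word: "Tw w \<cdot> m l \<in> WS True l (wt0 (ones n))" if "set w \<subseteq> {1..<n}" for w
    using that
  proof (induction w)
    case (Cons i w)
    then show ?case using step [of "Tw w \<cdot> m l" i] l by (simp add: H.m_assoc)
  qed (use ml l in simp)
  show ?thesis
    using h
  proof (induction rule: H_induct)
    case (add c w g)
    have "(\<iota> c \<cdot> Tw w \<^bold>+ g) \<cdot> m l = \<iota> c \<cdot> (Tw w \<cdot> m l) \<^bold>+ g \<cdot> m l"
      using add l by (simp add: H.l_distr H.m_assoc)
    then show ?case using add word [OF add(2)] by (simp only:) (intro WS.WS_add WS.WS_smult)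
  qed (use l in \<open>auto intro: WS.WS_zero\<close>)
qed

text \<open>Left multiplication by \<open>m l\<close> is a raising word at the weight of single
  boxes, and \<open>h \<cdot> m l\<close> is a combination of lowering words up to words that raise
  first. The raising word \<open>J\<close> serves all \<open>h\<close> simultaneously.\<close>

theorem highest_weight_form:
  assumes l: "composition n l" "dominated (ones n) l"
  shows "\<exists>J. wtE (wt0 (ones n)) J = wt0 l \<and>
    (\<forall>h\<in>carrier H. \<exists>a\<in>WS False l (wt0 l). \<exists>L. weighted (wt0 l) (wt0 (ones n)) L \<and>
       m l \<cdot> h \<cdot> m l = a \<^bold>+ \<iota> (klc (pr (wt0 l) J) L) \<cdot> m l)"
proof -
  obtain J where J: "wtE (wt0 (ones n)) J = wt0 l" "\<And>x. x \<in> carrier H \<Longrightarrow> EV (wt0 (ones n)) x J = m l \<cdot> x"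
    using split_merge [OF l] by blast
  have "\<exists>a\<in>WS False l (wt0 l). \<exists>L. weighted (wt0 l) (wt0 (ones n)) L \<and>
       m l \<cdot> h \<cdot> m l = a \<^bold>+ \<iota> (klc (pr (wt0 l) J) L) \<cdot> m l" if h: "h \<in> carrier H" for h
  proof -
    obtain b L where b: "b \<in> WS False l (wt0 (ones n))" "weighted (wt0 l) (wt0 (ones n)) L"
      "h \<cdot> m l = b \<^bold>+ lc (wt0 l) (m l) L"
      using WS_decomp [OF all_words [OF l h] l(1)] by blast
    have g: "good (wt0 l) (m l)" using good_m l by blast
    have bc: "b \<in> carrier H" "lc (wt0 l) (m l) L \<in> carrier H"
      using WS_closed [OF b(1) l(1)] lc_closed [OF g b(2)] by auto
    have b': "EV (wt0 (ones n)) b J \<in> WS False l (wt0 l)" using WS_EV [OF b(1) l(1), of J] J by simp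
    obtain a where a: "a \<in> WS False l (wt0 l)"
      "EV (wt0 (ones n)) (lc (wt0 l) (m l) L) J = a \<^bold>+ \<iota> (klc (pr (wt0 l) J) L) \<cdot> m l"
    proof -
      have "\<exists>a\<in>WS False l (wt0 l). EV (wt0 (ones n)) (FV (wt0 l) (m l) I) J = a \<^bold>+ \<iota> (pr (wt0 l) J I) \<cdot> m l"
        if "wtF (wt0 l) I = wt0 (ones n)" for I
        using EV_FV [OF l(1), of I J] J that by simp
      from EV_lc [OF l(1) b(2) this] show ?thesis using that by (auto simp del: lc_simps)
    qed
    have kc: "klc (pr (wt0 l) J) L \<in> carrier K" by (rule klc_closed [OF pr_closed b(2)])
    have "m l \<cdot> h \<cdot> m l = EV (wt0 (ones n)) (h \<cdot> m l) J" using J h l by (simp add: H.m_assoc)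
    also have "\<dots> = EV (wt0 (ones n)) b J \<^bold>+ EV (wt0 (ones n)) (lc (wt0 l) (m l) L) J"
      unfolding b(3) using bc by (simp add: linop_simps [OF linop_EV])
    also have "\<dots> = (EV (wt0 (ones n)) b J \<^bold>+ a) \<^bold>+ \<iota> (klc (pr (wt0 l) J) L) \<cdot> m l"
      unfolding a(2) using WS_closed [OF b' l(1)] WS_closed [OF a(1) l(1)] l kc by (simp add: H.a_assoc)
    finally show ?thesis using WS.WS_add [OF b' a(1)] b(2)
      by (intro bexI [of _ "EV (wt0 (ones n)) b J \<^bold>+ a"] exI [of _ L]) simp_all
  qed
  then show ?thesis using J by blast
qed

end

section \<open>The submodules of higher weight\<close>

context hecke begin

text \<open>The description in \<open>circ\<close> has a unique solution because x m y depends on x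
  m and m y alone.\<close>

lemma circ_eq:
  assumes k: "composition n k" and xy: "x \<in> carrier H" "y \<in> carrier H"
  shows "circ k (x \<cdot> m k) (m k \<cdot> y) = x \<cdot> m k \<cdot> y"
  unfolding circ_def
proof (rule the_equality)
  show "\<exists>x'\<in>carrier H. \<exists>y'\<in>carrier H. x \<cdot> m k = x' \<cdot> m k \<and> m k \<cdot> y = m k \<cdot> y' \<and> x \<cdot> m k \<cdot> y = x' \<cdot> m k \<cdot> y'"
    using xy by auto
  fix c assume "\<exists>x'\<in>carrier H. \<exists>y'\<in>carrier H. x \<cdot> m k = x' \<cdot> m k \<and> m k \<cdot> y = m k \<cdot> y' \<and> c = x' \<cdot> m k \<cdot> y'"
  then obtain x' y' where c: "x' \<in> carrier H" "y' \<in> carrier H" "x \<cdot> m k = x' \<cdot> m k" "m k \<cdot> y = m k \<cdot> y'" "c = x' \<cdot> m k \<cdot> y'"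
    by blast
  have "c = x' \<cdot> (m k \<cdot> y')" using c k by (simp add: H.m_assoc)
  also have "\<dots> = x' \<cdot> m k \<cdot> y" unfolding c(4) [symmetric] using c k xy by (simp add: H.m_assoc)
  also have "\<dots> = x \<cdot> m k \<cdot> y" unfolding c(3) ..
  finally show "c = x \<cdot> m k \<cdot> y" .
qed

lemma M_D: "a \<in> M l k \<Longrightarrow> \<exists>x\<in>carrier H. a = x \<cdot> m l" "a \<in> M l k \<Longrightarrow> \<exists>y\<in>carrier H. a = m k \<cdot> y"
  by (auto simp: M_def)

lemma M_I: "x \<in> carrier H \<Longrightarrow> y \<in> carrier H \<Longrightarrow> a = x \<cdot> m l \<Longrightarrow> a = m k \<cdot> y \<Longrightarrow> a \<in> M l k"
  by (auto simp: M_def)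

definition above :: "(nat \<Rightarrow> nat) \<Rightarrow> (nat \<Rightarrow> nat) \<Rightarrow> bool" where
  "above p p' \<longleftrightarrow> composition n p' \<and> dominated p p' \<and> p' \<noteq> p"

lemma through_closed:
  assumes "composition n p"
  shows "{circ p a b | a b. a \<in> M p k \<and> b \<in> M l p} \<subseteq> carrier H"
proof
  fix c assume "c \<in> {circ p a b | a b. a \<in> M p k \<and> b \<in> M l p}"
  then obtain a b where c: "c = circ p a b" "a \<in> M p k" "b \<in> M l p" by blast
  obtain x where x: "x \<in> carrier H" "a = x \<cdot> m p" using M_D(1) [OF c(2)] by blast
  obtain y where y: "y \<in> carrier H" "b = m p \<cdot> y" using M_D(2) [OF c(3)] by blast
  show "c \<in> carrier H" unfolding c x y circ_eq [OF assms x(1) y(1)] using x y assms by simp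
qed

lemma M_through_subgroup: "composition n p \<Longrightarrow> subgroup (M_through p l k) (add_monoid H)"
  unfolding M_through_def by (rule H.add.generate_is_subgroup) (use through_closed in simp)

lemma M_above_gens: "(\<Union>p'\<in>{p'. composition n p' \<and> dominated p p' \<and> p' \<noteq> p}. M_through p' l k) \<subseteq> carrier H"
  using M_through_subgroup by (fastforce dest: subgroup.subset)

lemma M_above_subgroup: "subgroup (M_above p l k) (add_monoid H)"
  unfolding M_above_def by (rule H.add.generate_is_subgroup) (use M_above_gens in simp)

lemma M_above_ops:
  "\<^bold>0 \<in> M_above p l k"
  "x \<in> M_above p l k \<Longrightarrow> y \<in> M_above p l k \<Longrightarrow> x \<^bold>+ y \<in> M_above p l k"
  "x \<in> M_above p l k \<Longrightarrow> \<ominus>\<^bsub>H\<^esub> x \<in> M_above p l k"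
  "x \<in> M_above p l k \<Longrightarrow> x \<in> carrier H"
  using subgroup.one_closed [OF M_above_subgroup] subgroup.m_closed [OF M_above_subgroup]
    subgroup.m_inv_closed [OF M_above_subgroup] subsetD [OF subgroup.subset [OF M_above_subgroup]]
  by (simp_all add: a_inv_def)

lemma M_above_gen:
  assumes "above p p'" "x \<in> carrier H" "y \<in> carrier H" "x \<cdot> m p' \<in> M p' k" "m p' \<cdot> y \<in> M l p'"
  shows "x \<cdot> m p' \<cdot> y \<in> M_above p l k"
proof -
  have p': "composition n p'" using assms(1) by (simp add: above_def)
  have "circ p' (x \<cdot> m p') (m p' \<cdot> y) \<in> M_through p' l k"
    unfolding M_through_def by (rule generate.incl) (use assms in blast)
  then have "x \<cdot> m p' \<cdot> y \<in> M_through p' l k" by (simp add: circ_eq [OF p' assms(2,3)])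
  then show ?thesis
    unfolding M_above_def by (intro generate.incl) (use assms(1) in \<open>auto simp: above_def\<close>)
qed

text \<open>Opens the two nested generated subgroups at once, so that the generators are products
  through a single higher symmetrizer.\<close>

lemma M_above_induct [consumes 1, case_names zero add inv gen]:
  assumes x: "x \<in> M_above p l k"
    and zero: "P \<^bold>0"
    and add: "\<And>x y. x \<in> carrier H \<Longrightarrow> y \<in> carrier H \<Longrightarrow> P x \<Longrightarrow> P y \<Longrightarrow> P (x \<^bold>+ y)"
    and inv: "\<And>x. x \<in> carrier H \<Longrightarrow> P x \<Longrightarrow> P (\<ominus>\<^bsub>H\<^esub> x)"
    and gen: "\<And>p' x y. above p p' \<Longrightarrow> x \<in> carrier H \<Longrightarrow> y \<in> carrier H \<Longrightarrow> x \<cdot> m p' \<in> M p' k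
      \<Longrightarrow> m p' \<cdot> y \<in> M l p' \<Longrightarrow> P (x \<cdot> m p' \<cdot> y)"
  shows "P x"
proof -
  have thr: "P z" if p': "above p p'" and z: "z \<in> M_through p' l k" for p' z
  proof -
    have c: "composition n p'" using p' by (simp add: above_def)
    have circ: "w \<in> carrier H \<and> P w" if w0: "w \<in> {circ p' a b | a b. a \<in> M p' k \<and> b \<in> M l p'}" for w
    proof -
      obtain a b where w: "w = circ p' a b" "a \<in> M p' k" "b \<in> M l p'" using w0 by blast
      obtain x where x: "x \<in> carrier H" "a = x \<cdot> m p'" using M_D(1) [OF w(2)] by blast
      obtain y where y: "y \<in> carrier H" "b = m p' \<cdot> y" using M_D(2) [OF w(3)] by blast
      have weq: "w = x \<cdot> m p' \<cdot> y" unfolding w(1) x(2) y(2) by (rule circ_eq [OF c x(1) y(1)])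
      show ?thesis unfolding weq using gen [OF p' x(1) y(1)] w x y c by simp
    qed
    have "z \<in> carrier H \<and> P z"
      using z unfolding M_through_def
    proof (induction rule: generate.induct)
      case one
      then show ?case using zero by simp
    next
      case (inv h)
      then show ?case using circ [OF inv] assms(4) by (simp add: a_inv_def [symmetric])
    next
      case (eng h1 h2)
      then show ?case using add by simp
    qed (use circ in blast)
    then show ?thesis by simp
  qed
  have thr': "w \<in> carrier H \<and> P w"
    if w0: "w \<in> (\<Union>p'\<in>{p'. composition n p' \<and> dominated p p' \<and> p' \<noteq> p}. M_through p' l k)" for w
  proof -
    obtain p' where p': "above p p'" "w \<in> M_through p' l k"
      using w0 unfolding above_def by blast
    show ?thesis using thr [OF p'] subsetD [OF M_above_gens w0] by simp
  qed
  have "x \<in> carrier H \<and> P x"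
    using x unfolding M_above_def
  proof (induction rule: generate.induct)
    case one
    then show ?case using zero by simp
  next
    case (inv h)
    then show ?case using thr' [OF inv] assms(4) by (simp add: a_inv_def [symmetric])
  next
    case (eng h1 h2)
    then show ?case using add by simp
  qed (use thr' in blast)
  then show ?thesis by simp
qed

lemma M_above_smult:
  assumes "x \<in> M_above p l k" "c \<in> carrier K" "composition n k"
  shows "\<iota> c \<cdot> x \<in> M_above p l k"
  using assms(1)
proof (induction rule: M_above_induct)
  case zero
  then show ?case using assms M_above_ops(1) by simp
next
  case (add x y)
  then show ?case using assms M_above_ops(2) by (simp add: H.r_distr)
next
  case (inv x)
  then show ?case using assms M_above_ops(3) by (simp add: H.r_minus)
next
  case (gen p' x y)
  have p': "composition n p'" using gen by (simp add: above_def)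
  obtain z where z: "z \<in> carrier H" "x \<cdot> m p' = m k \<cdot> z" using M_D(2) [OF gen(4)] by blast
  have "\<iota> c \<cdot> x \<cdot> m p' \<in> M p' k"
  proof (rule M_I [of "\<iota> c \<cdot> x" "\<iota> c \<cdot> z"])
    have "\<iota> c \<cdot> x \<cdot> m p' = \<iota> c \<cdot> (m k \<cdot> z)" using gen p' assms z(2) by (simp add: H.m_assoc)
    also have "\<dots> = m k \<cdot> (\<iota> c \<cdot> z)"
      using z assms \<iota>_central [of c "m k"] by (simp add: H.m_assoc [symmetric])
    finally show "\<iota> c \<cdot> x \<cdot> m p' = m k \<cdot> (\<iota> c \<cdot> z)" .
  qed (use gen z assms in simp_all)
  then have "\<iota> c \<cdot> x \<cdot> m p' \<cdot> y \<in> M_above p l k"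
    using gen assms by (intro M_above_gen) simp_all
  then show ?case using gen assms p' by (simp add: H.m_assoc)
qed

lemma M_above_right:
  assumes "x \<in> M_above p l k" "h \<in> carrier H" "composition n l" "composition n k"
  shows "x \<cdot> h \<in> M_above p (ones n) k"
  using assms(1)
proof (induction rule: M_above_induct)
  case zero
  then show ?case using assms M_above_ops(1) by simp
next
  case (add x y)
  then show ?case using assms M_above_ops(2) by (simp add: H.l_distr)
next
  case (inv x)
  then show ?case using assms M_above_ops(3) by (simp add: H.l_minus)
next
  case (gen p' x y)
  have p': "composition n p'" using gen by (simp add: above_def)
  have "m p' \<cdot> (y \<cdot> h) \<in> M (ones n) p'" using gen p' assms by (intro M_I [of "m p' \<cdot> (y \<cdot> h)" "y \<cdot> h"]) simp_all
  then have "x \<cdot> m p' \<cdot> (y \<cdot> h) \<in> M_above p (ones n) k"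
    using gen assms by (intro M_above_gen) simp_all
  then show ?case using gen assms p' by (simp add: H.m_assoc)
qed

text \<open>Multiplication by \<open>h \<cdot> m l\<close> puts the product into the left ideal of
  \<open>m l\<close>, whatever the first index \<open>l'\<close> was. This makes the form well
  defined on classes.\<close>

lemma M_above_right_m:
  assumes "x \<in> M_above p l' k" "h \<in> carrier H" "composition n l" "composition n k"
  shows "x \<cdot> (h \<cdot> m l) \<in> M_above p l k"
  using assms(1)
proof (induction rule: M_above_induct)
  case zero
  then show ?case using assms M_above_ops(1) by simp
next
  case (add x y)
  then show ?case using assms M_above_ops(2) by (simp add: H.l_distr)
next
  case (inv x)
  then show ?case using assms M_above_ops(3) by (simp add: H.l_minus)
next
  case (gen p' x y)
  have p': "composition n p'" using gen by (simp add: above_def)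
  have "m p' \<cdot> (y \<cdot> (h \<cdot> m l)) \<in> M l p'"
    using gen p' assms by (intro M_I [of "m p' \<cdot> (y \<cdot> h)" "y \<cdot> (h \<cdot> m l)"]) (simp_all add: H.m_assoc)
  then have "x \<cdot> m p' \<cdot> (y \<cdot> (h \<cdot> m l)) \<in> M_above p l k"
    using gen assms by (intro M_above_gen) simp_all
  then show ?case using gen assms p' by (simp add: H.m_assoc)
qed

lemma M_above_left_m:
  assumes "x \<in> M_above p l k'" "h \<in> carrier H" "composition n l" "composition n k"
  shows "m k \<cdot> h \<cdot> x \<in> M_above p l k"
  using assms(1)
proof (induction rule: M_above_induct)
  case zero
  then show ?case using assms M_above_ops(1) by simp
next
  case (add x y)
  then show ?case using assms M_above_ops(2) by (simp add: H.r_distr)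
next
  case (inv x)
  then show ?case using assms M_above_ops(3) by (simp add: H.r_minus)
next
  case (gen p' x y)
  have p': "composition n p'" using gen by (simp add: above_def)
  have "m k \<cdot> h \<cdot> x \<cdot> m p' \<in> M p' k"
    using gen p' assms by (intro M_I [of "m k \<cdot> h \<cdot> x" "h \<cdot> x \<cdot> m p'"]) (simp_all add: H.m_assoc)
  then have "m k \<cdot> h \<cdot> x \<cdot> m p' \<cdot> y \<in> M_above p l k"
    using gen assms by (intro M_above_gen) simp_all
  then show ?case using gen assms p' by (simp add: H.m_assoc)
qed

section \<open>Words with a raising operator factor through higher weights\<close>

lemma isum_wt0: "(\<Sum>i<k. wt0 l i) = int (psum l k)" by (simp add: wt0_def)

lemma valid_isum: "valid \<mu> \<Longrightarrow> (\<Sum>i<k. \<mu> i) = int (psum (nat \<circ> \<mu>) k)"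
  by (simp add: valid_def)

text \<open>A raising part that is not zero ends in a composition \<open>p\<close>, and as its word
  is nonempty some partial sum has grown, so \<open>p\<close> is strictly above \<open>l\<close>.
  The whole word is then a lowering part times \<open>m p\<close> times a right factor.\<close>

lemma WS_above:
  assumes x: "x \<in> WS False l \<mu>" and l: "composition n l" and \<mu>: "valid \<mu>" and k: "k = nat \<circ> \<mu>"
  shows "x \<in> M_above l l k"
  using x
proof (induction rule: WS.induct)
  case (WS_smult c x)
  then show ?case using M_above_smult \<mu> by (simp add: valid_def k comp_def)
next
  case (WS_gen J I)
  let ?\<nu> = "wtE (wt0 l) J" and ?u = "EV (wt0 l) (m l) J"
  have J: "J \<noteq> []" using WS_gen by simp
  have g: "good ?\<nu> ?u" by (rule good_EV [OF good_m [OF l]])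
  show ?case
  proof (cases "?u = \<^bold>0")
    case True
    then show ?thesis using linop_simps(4) [OF linop_FV] M_above_ops(1) by simp
  next
    case False
    define p where "p = nat \<circ> ?\<nu>"
    obtain y where v: "valid ?\<nu>" and y: "y \<in> carrier H" "?u = m p \<cdot> y"
      using g False by (auto simp: good_def p_def)
    have pc: "composition n p" using v by (simp add: valid_def p_def)
    have ps: "int (psum p (Suc k)) = int (psum l (Suc k)) + int (count_list J k)" for k
      using isum_wtE [of "wt0 l" J k] valid_isum [OF v, of "Suc k"] isum_wt0 [of l "Suc k"] unfolding p_def by simp
    have "psum l k \<le> psum p k" for k
    proof (cases k)
      case (Suc j)
      have "int (psum l k) \<le> int (psum p k)" using ps [of j] unfolding Suc by linarith
      then show ?thesis by (simp only: of_nat_le_iff)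
    qed simp
    moreover have "p \<noteq> l"
    proof
      assume "p = l"
      then have "count_list J (hd J) = 0" using ps [of "hd J"] by simp
      then show False using J by (cases J) auto
    qed
    ultimately have ab: "above l p" using pc by (simp add: above_def dominated_def)
    obtain z where z: "z \<in> carrier H" "\<And>u. u \<in> carrier H \<Longrightarrow> FV ?\<nu> u I = z \<cdot> u"
      using FV_left [of ?\<nu> I] by blast
    obtain x where x: "x \<in> carrier H" "?u = x \<cdot> m l"
      using EV_left [of "wt0 l" J] l by auto
    \<comment> \<open>The lowering word is also applied to \<open>m p\<close> itself. The result has
      weight \<mu>, which supplies the left factor \<open>m k\<close> required for membership in
      \<open>M p k\<close>.\<close>
    have gp: "good ?\<nu> (m p)" using v pc unfolding good_def p_def
      by (metis H.one_closed H.r_one m_closed)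
    have "z \<cdot> m p \<in> M p k"
    proof (cases "z \<cdot> m p = \<^bold>0")
      case True
      then show ?thesis using z \<mu> pc by (intro M_I [of z "\<^bold>0"]) (simp_all add: valid_def k)
    next
      case False
      then have "FV ?\<nu> (m p) I \<noteq> \<^bold>0" using z(2) [of "m p"] pc by simp
      then obtain y' where "y' \<in> carrier H" "FV ?\<nu> (m p) I = m (nat \<circ> wtF ?\<nu> I) \<cdot> y'"
        using good_FV [OF gp, of I] unfolding good_def by blast
      then show ?thesis using z pc WS_gen(2) by (intro M_I [of z y']) (simp_all add: k)
    qed
    moreover have "m p \<cdot> y \<in> M l p" using x y by (intro M_I [of x y]) simp_all
    ultimately have "z \<cdot> m p \<cdot> y \<in> M_above l l k"
      using ab z y by (intro M_above_gen) simp_all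
    moreover have "FV ?\<nu> ?u I = z \<cdot> m p \<cdot> y" using z y pc by (simp add: H.m_assoc)
    ultimately show ?thesis by simp
  qed
qed (simp_all add: M_above_ops)

section \<open>Evaluation on words\<close>

definition descending :: "(nat \<Rightarrow> 'b) \<Rightarrow> (nat \<Rightarrow> nat) \<Rightarrow> bool" where
  "descending st x \<longleftrightarrow> (\<forall>p p'. 1 \<le> p \<longrightarrow> p < p' \<longrightarrow> p' \<le> n \<longrightarrow> st p = st p' \<longrightarrow> x p' < x p)"

lemma st_word_perm:
  assumes "set w \<subseteq> {i. st i = st (Suc i)}"
  shows "st (word_perm w p) = st p"
  using assms
proof (induction w arbitrary: p)
  case (Cons a w)
  have "st (s a x) = st x" for x using Cons.prems by (auto simp: transpose_def)
  then show ?case using Cons by simp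
qed simp

text \<open>Along a reduced word of the Young subgroup each letter meets a strict descent of the
  word \<open>x\<close>, so the branch \<open>opN_gt\<close> with its single term is taken every
  time.\<close>

lemma opw_descending:
  assumes "set w \<subseteq> {1..<n}" "ln (word_perm w) = length w" "set w \<subseteq> {i. st i = st (Suc i)}"
    and x: "descending st x" and \<nu>: "\<nu> \<in> valued"
  shows "opw w \<nu> x = q [^] length w \<otimes> \<nu> (x \<circ> word_perm w)"
  using assms(1-3) \<nu>
proof (induction w arbitrary: \<nu> rule: rev_induct)
  case Nil
  then show ?case by simp
next
  case (snoc j w)
  let ?w = "word_perm w"
  have wp: "?w permutes {1..n}" using snoc.prems by (intro word_perm_permutes) auto
  have j: "1 \<le> j" "j < n" using snoc.prems by auto
  note r = reduced_snoc [OF snoc.prems(1,2)]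
  have st: "st (?w j) = st (?w (Suc j))" using snoc.prems by (simp add: st_word_perm)
  have "?w j \<in> {1..n}" "?w (Suc j) \<in> {1..n}"
    using permutes_in_image [OF wp, of j] permutes_in_image [OF wp, of "Suc j"] j by simp_all
  then have lt: "x (?w (Suc j)) < x (?w j)" using x r(2) st unfolding descending_def by auto
  have "opw (w @ [j]) \<nu> x = opw w (opN j \<nu>) x" by (simp add: opw_def)
  also have "\<dots> = q [^] length w \<otimes> opN j \<nu> (x \<circ> ?w)"
    using snoc.prems r(1) by (intro snoc.IH) auto
  also have "opN j \<nu> (x \<circ> ?w) = q \<otimes> \<nu> (x \<circ> ?w \<circ> s j)"
    using lt by (intro opN_gt) simp
  also have "x \<circ> ?w \<circ> s j = x \<circ> word_perm (w @ [j])" by (simp add: o_assoc)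
  finally show ?case using snoc.prems(4) by (simp add: m_assoc)
qed

lemma act_finsum:
  assumes "finite A" "\<And>a. a \<in> A \<Longrightarrow> f a \<in> carrier H" "\<nu> \<in> valued"
  shows "act (\<Oplus>\<^bsub>H\<^esub>a\<in>A. f a) \<nu> x = (\<Oplus>a\<in>A. act (f a) \<nu> x)"
  using assms(1,2)
proof (induction A rule: finite_induct)
  case empty
  then show ?case using assms(3) by (simp add: act_zero)
next
  case (insert a A)
  then show ?case using assms(3) by (simp add: act_add Pi_def H.finsum_closed)
qed

lemma act_symm:
  assumes st: "convex n st" and x: "descending st x" and \<nu>: "\<nu> \<in> valued"
  shows "act (symm st n) \<nu> x = (\<Oplus>w\<in>stab n st. q [^] ln w \<otimes> \<nu> (x \<circ> w))"
proof -
  have "act (symm st n) \<nu> x = (\<Oplus>w\<in>stab n st. act (Tw (nf n w)) \<nu> x)"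
    unfolding sum_stab [OF st, symmetric] using \<nu> by (intro act_finsum) (auto simp: finite_stab)
  also have "\<dots> = (\<Oplus>w\<in>stab n st. q [^] ln w \<otimes> \<nu> (x \<circ> w))"
  proof (rule finsum_cong')
    fix w assume w: "w \<in> stab n st"
    then have wp: "w permutes {1..n}" by (simp add: stab_def)
    note r = nf_reduced [OF wp]
    have "act (Tw (nf n w)) \<nu> x = opw (nf n w) \<nu> x" using r \<nu> by (simp add: act_Tw)
    also have "\<dots> = q [^] length (nf n w) \<otimes> \<nu> (x \<circ> word_perm (nf n w))"
      using r stab_nf_set [OF w st] by (intro opw_descending [OF _ _ _ x \<nu>]) (auto simp: ln_def)
    finally show "act (Tw (nf n w)) \<nu> x = q [^] ln w \<otimes> \<nu> (x \<circ> w)" using r by (simp add: ln_def)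
  qed (use \<nu> in auto)
  finally show ?thesis .
qed

text \<open>The word in which row \<open>i\<close> reads \<open>l i, \<dots>, 2, 1\<close>.\<close>

definition rw :: "(nat \<Rightarrow> nat) \<Rightarrow> nat \<Rightarrow> nat" where
  "rw l p = Suc (psum l (Suc (row l p)) - p)"

lemma rw_descending: "composition n l \<Longrightarrow> descending (row l) (rw l)"
  unfolding descending_def
proof (intro allI impI)
  fix p p' assume l: "composition n l" and p: "1 \<le> p" "p < p'" "p' \<le> n" "row l p = row l p'"
  have "p' \<le> psum l (Suc (row l p'))" using row_bounds(2) [OF l, of p'] p by simp
  then show "rw l p' < rw l p" using p by (simp add: rw_def del: sum.lessThan_Suc)
qed

lemma stab_rw:
  assumes l: "composition n l" and w: "w \<in> stab n (row l)" and eq: "rw l \<circ> w = rw l"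
  shows "w = id"
proof
  fix p
  have wp: "w permutes {1..n}" using w by (simp add: stab_def)
  show "w p = id p"
  proof (cases "p \<in> {1..n}")
    case True
    then have "w p \<in> {1..n}" using permutes_in_image [OF wp] by blast
    moreover have "row l (w p) = row l p" using w True by (simp add: stab_def)
    moreover have "rw l (w p) = rw l p" using eq by (metis comp_apply)
    ultimately show ?thesis
      using rw_descending [OF l] True unfolding descending_def
      by (metis atLeastAtMost_iff id_apply less_irrefl linorder_neqE_nat)
  next
    case False
    then show ?thesis using permutes_not_in [OF wp] by simp
  qed
qed

lemma ln_id: "ln id = 0" using ln_le [of "[]"] by simp

lemma id_stab: "id \<in> stab n st" by (simp add: stab_def permutes_id)

text \<open>The letters in a row of \<open>rw l\<close> are distinct, so the identity is the one row
  permutation that fixes this word.\<close>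

lemma act_m_delta:
  assumes l: "composition n l"
  shows "act (m l) (delta (rw l)) (rw l) = \<one>"
proof -
  have "act (m l) (delta (rw l)) (rw l) = (\<Oplus>w\<in>stab n (row l). q [^] ln w \<otimes> delta (rw l) (rw l \<circ> w))"
    unfolding m_symm [OF l] by (rule act_symm [OF convex_row [OF l] rw_descending [OF l]]) simp
  also have "\<dots> = (\<Oplus>w\<in>stab n (row l). if id = w then \<one> else \<zero>)"
    using stab_rw [OF l] ln_id by (intro finsum_cong') (auto simp: delta_def)
  also have "\<dots> = \<one>"
    using finsum_singleton [of id "stab n (row l)" "\<lambda>_. \<one>"] by (simp add: finite_stab id_stab)
  finally show ?thesis .
qed

text \<open>Where the letters differ, one order of the two expresses the eigenvalue equation by the
  single term of \<open>opN_gt\<close>, and the unit \<open>q\<close> can be cancelled.\<close>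

lemma act_eigen_swap:
  assumes \<nu>: "\<nu> \<in> valued" and j: "1 \<le> j" "j < n" and e: "opN j \<nu> = (\<lambda>x. q \<otimes> \<nu> x)" and ne: "y j \<noteq> y (Suc j)"
  shows "\<nu> (y \<circ> s j) = \<nu> y"
proof -
  have *: "\<nu> (z \<circ> s j) = \<nu> z" if "z (Suc j) < z j" for z
  proof -
    have "q \<otimes> \<nu> (z \<circ> s j) = q \<otimes> \<nu> z" using opN_gt [OF that, of \<nu>] e by metis
    then have "inv q \<otimes> (q \<otimes> \<nu> (z \<circ> s j)) = inv q \<otimes> (q \<otimes> \<nu> z)" by simp
    then show ?thesis using \<nu> q_unit by (simp add: m_assoc [symmetric])
  qed
  show ?thesis
  proof (cases "y (Suc j) < y j")
    case False
    then have "\<nu> (y \<circ> s j \<circ> s j) = \<nu> (y \<circ> s j)" using ne by (intro *) simp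
    then show ?thesis by simp
  qed (rule *)
qed

lemma act_m_opN:
  assumes l: "composition n l" and j: "psum l i < j" "j < psum l (Suc i)" and \<nu>: "\<nu> \<in> valued"
  shows "opN j (act (m l) \<nu>) = (\<lambda>x. q \<otimes> act (m l) \<nu> x)"
    and "\<exists>\<nu>'\<in>valued. act (m l) \<nu> = (\<lambda>x. \<nu>' x \<oplus> opN j \<nu>' x)"
proof -
  have j': "1 \<le> j" "j < n" using j composition_psum_le [OF l, of "Suc i"] by (simp_all del: sum.lessThan_Suc)
  have "act (t j \<cdot> m l) \<nu> = act (\<iota> q \<cdot> m l) \<nu>" using m_eigen(1) [OF l j] by simp
  then show "opN j (act (m l) \<nu>) = (\<lambda>x. q \<otimes> act (m l) \<nu> x)"
    using l \<nu> j' by (simp add: act_mult act_t act_iota)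
  obtain x where x: "x \<in> carrier H" "m l = (\<^bold>1 \<^bold>+ t j) \<cdot> x" using m_eigen(2) [OF l j] by blast
  show "\<exists>\<nu>'\<in>valued. act (m l) \<nu> = (\<lambda>x. \<nu>' x \<oplus> opN j \<nu>' x)"
    using x \<nu> j' by (intro bexI [of _ "act x \<nu>"]) (simp_all add: act_mult act_add act_one act_t)
qed

text \<open>Exchanging distinct neighbours does not change the value, so the two equal letters can
  be brought together. There the value is a sum of two opposite terms, because \<open>m l\<close> is
  a multiple of 1 + t_j and equal letters are negated.\<close>

lemma act_m_repeated:
  assumes l: "composition n l" and \<nu>: "\<nu> \<in> valued"
    and p: "psum l i < p" "p < p'" "p' \<le> psum l (Suc i)" "y p = y p'"
  shows "act (m l) \<nu> y = \<zero>"
  using p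
proof (induction "p' - p" arbitrary: p' y)
  case (Suc d)
  obtain j where j: "p' = Suc j" "p \<le> j" using Suc.prems by (cases p') auto
  have jr: "psum l i < j" "j < psum l (Suc i)" using Suc.prems j by linarith+
  have j': "1 \<le> j" "j < n" using jr composition_psum_le [OF l, of "Suc i"] by (simp_all del: sum.lessThan_Suc)
  show ?case
  proof (cases "y j = y (Suc j)")
    case True
    obtain \<nu>' where "\<nu>' \<in> valued" "act (m l) \<nu> = (\<lambda>x. \<nu>' x \<oplus> opN j \<nu>' x)" using act_m_opN(2) [OF l jr \<nu>] by blast
    then show ?thesis using opN_eq [OF True] by (simp add: r_neg)
  next
    case False
    then have "p \<noteq> j" using Suc.prems j by auto
    then have pj: "p < j" using j by simp
    have "act (m l) \<nu> (y \<circ> s j) = \<zero>"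
    proof (rule Suc.hyps(1) [of j])
      show "d = j - p" using Suc.hyps(2) j pj by simp
      show "(y \<circ> s j) p = (y \<circ> s j) j" using Suc.prems j pj by (simp add: transpose_def)
    qed (use Suc.prems jr pj in auto)
    then show ?thesis
      using act_eigen_swap [OF _ j' act_m_opN(1) [OF l jr \<nu>] False] l \<nu> by simp
  qed
qed simp

section \<open>Content of words and the vanishing of higher weights\<close>

definition cnt :: "(nat \<Rightarrow> nat) \<Rightarrow> nat \<Rightarrow> nat" where
  "cnt x c = card {p \<in> {1..n}. x p = c}"

lemma cnt_permutes: "w permutes {1..n} \<Longrightarrow> cnt (x \<circ> w) = cnt x"
proof
  fix c assume w: "w permutes {1..n}"
  have "bij_betw w {p \<in> {1..n}. (x \<circ> w) p = c} {p \<in> {1..n}. x p = c}"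
    unfolding bij_betw_def
  proof
    show "inj_on w {p \<in> {1..n}. (x \<circ> w) p = c}" using permutes_inj [OF w] by (rule inj_on_subset) simp
    show "w ` {p \<in> {1..n}. (x \<circ> w) p = c} = {p \<in> {1..n}. x p = c}"
    proof (rule equalityI; rule subsetI)
      fix y assume "y \<in> w ` {p \<in> {1..n}. (x \<circ> w) p = c}"
      then show "y \<in> {p \<in> {1..n}. x p = c}" using permutes_in_image [OF w] by auto
    next
      fix y assume y: "y \<in> {p \<in> {1..n}. x p = c}"
      then obtain p where "p \<in> {1..n}" "y = w p" using permutes_image [OF w] by blast
      then show "y \<in> w ` {p \<in> {1..n}. (x \<circ> w) p = c}" using y by auto
    qed
  qed
  then show "cnt (x \<circ> w) c = cnt x c" unfolding cnt_def by (rule bij_betw_same_card)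
qed

text \<open>The length of column \<open>c\<close>, that is, the conjugate partition. Columns are
  numbered from 1, in accordance with the letters of \<open>rw\<close>.\<close>

definition ht :: "(nat \<Rightarrow> nat) \<Rightarrow> nat \<Rightarrow> nat" where
  "ht l c = card {i. c \<le> l i}"

lemma ht_iff:
  assumes l: "composition n l" and anti: "antimono l" and c: "1 \<le> c"
  shows "c \<le> l i \<longleftrightarrow> i < ht l c"
proof -
  have fin: "finite {i. c \<le> l i}"
    by (rule finite_subset [of _ "{i. l i \<noteq> 0}"]) (use l c in \<open>auto simp: composition_def\<close>)
  have down: "{..i} \<subseteq> {i. c \<le> l i}" if "c \<le> l i" for i
    using that antimonoD [OF anti, of _ i] by (auto intro: order_trans)
  show ?thesis
  proof
    assume "c \<le> l i"
    then have "card {..i} \<le> ht l c" unfolding ht_def using fin down by (intro card_mono) auto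
    then show "i < ht l c" by simp
  next
    assume i: "i < ht l c"
    show "c \<le> l i"
    proof (rule ccontr)
      assume "\<not> c \<le> l i"
      then have "{i. c \<le> l i} \<subseteq> {..<i}"
        using down by (intro subsetI) (metis (no_types, lifting) atMost_iff lessThan_iff linorder_not_le mem_Collect_eq subsetD)
      then have "ht l c \<le> card {..<i}" unfolding ht_def by (intro card_mono) auto
      then show False using i by simp
    qed
  qed
qed

lemma rw_bounds:
  assumes l: "composition n l" and p: "1 \<le> p" "p \<le> n"
  shows "1 \<le> rw l p" "rw l p \<le> l (row l p)" "p = Suc (psum l (Suc (row l p))) - rw l p"
  using row_bounds [OF l p] by (auto simp: rw_def)

lemma cell_pos:
  assumes l: "composition n l" and c: "1 \<le> c" "c \<le> l i"
  defines "p \<equiv> Suc (psum l (Suc i)) - c"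
  shows "1 \<le> p" "p \<le> n" "row l p = i" "rw l p = c"
proof -
  have p: "psum l i < p" "p \<le> psum l (Suc i)" using c by (auto simp: p_def)
  then show "1 \<le> p" "p \<le> n" using composition_psum_le [OF l, of "Suc i"] by linarith+
  show r: "row l p = i" by (rule row_eq [OF p])
  show "rw l p = c" unfolding rw_def r using c p by (simp add: p_def del: sum.lessThan_Suc)
qed

lemma rw_inj:
  assumes l: "composition n l" and p: "1 \<le> p" "p \<le> n" "1 \<le> p'" "p' \<le> n" "row l p = row l p'" "rw l p = rw l p'"
  shows "p = p'"
  using rw_bounds(3) [OF l p(1,2)] rw_bounds(3) [OF l p(3,4)] p(5,6) by simp

lemma cnt_rw:
  assumes l: "composition n l" and anti: "antimono l"
  shows "cnt (rw l) c = (if 1 \<le> c then ht l c else 0)"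
proof (cases "1 \<le> c")
  case True
  have "bij_betw (row l) {p \<in> {1..n}. rw l p = c} {..<ht l c}"
    unfolding bij_betw_def
  proof
    show "inj_on (row l) {p \<in> {1..n}. rw l p = c}"
      using rw_inj [OF l] by (intro inj_onI) auto
    show "row l ` {p \<in> {1..n}. rw l p = c} = {..<ht l c}"
    proof (rule equalityI; rule subsetI)
      fix i assume "i \<in> row l ` {p \<in> {1..n}. rw l p = c}"
      then show "i \<in> {..<ht l c}" using rw_bounds(2) [OF l] ht_iff [OF l anti True] by fastforce
    next
      fix i assume "i \<in> {..<ht l c}"
      then have "c \<le> l i" using ht_iff [OF l anti True] by simp
      from cell_pos [OF l True this] show "i \<in> row l ` {p \<in> {1..n}. rw l p = c}"
        by (intro image_eqI [of _ _ "Suc (psum l (Suc i)) - c"]) (simp_all del: sum.lessThan_Suc)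
    qed
  qed
  then show ?thesis using True bij_betw_same_card by (fastforce simp: cnt_def)
next
  case False
  then have "{p \<in> {1..n}. rw l p = c} = {}" by (auto simp: rw_def)
  then show ?thesis using False by (simp add: cnt_def)
qed

text \<open>A filling without repetitions in the rows of \<open>p\<close> whose content is given by the column lengths of
  \<open>l\<close> shows that \<open>p\<close> is dominated by \<open>l\<close>.\<close>

lemma repetition:
  assumes l: "composition n l" and anti: "antimono l" and ab: "above l p" and y: "cnt y = cnt (rw l)"
  shows "\<exists>i a b. psum p i < a \<and> a < b \<and> b \<le> psum p (Suc i) \<and> y a = y b"
proof (rule ccontr)
  assume "\<not> ?thesis"
  then have inj: "y a \<noteq> y b" if "psum p i < a" "a < b" "b \<le> psum p (Suc i)" for i a b using that by blast
  have p: "composition n p" "dominated l p" "p \<noteq> l" using ab by (auto simp: above_def)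
  have "psum p k \<le> psum l k" for k
  proof -
    let ?P = "{1..psum p k}" and ?L = "{1..psum l k}"
    have pk: "psum p k \<le> n" and lk: "psum l k \<le> n" using composition_psum_le p l by auto
    have sumcard: "card A = (\<Sum>c\<in>{..N}. card {a \<in> A. z a = c})" if "finite A" "z ` A \<subseteq> {..N}" for A :: "nat set" and z and N :: nat
      using sum.group [OF that(1) finite_atMost that(2), of "\<lambda>_. 1::nat"] by simp
    define N where "N = Max (insert 0 (y ` {1..n} \<union> rw l ` {1..n}))"
    have N: "y a \<le> N" "rw l a \<le> N" if "a \<in> {1..n}" for a using that by (auto simp: N_def)
    \<comment> \<open>Without repetitions a letter occurs at most once in each of the first k rows
      of \<open>p\<close>, and in total at most as often as its column is long. The reading filling
      of \<open>l\<close> attains the minimum of these two bounds.\<close>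
    have "card {a \<in> ?P. y a = c} \<le> card {a \<in> ?L. rw l a = c}" for c
    proof -
      have "row p ` {a \<in> ?P. y a = c} \<subseteq> {..<k}"
      proof
        fix i assume "i \<in> row p ` {a \<in> ?P. y a = c}"
        then obtain a where a: "a \<in> ?P" "i = row p a" by blast
        show "i \<in> {..<k}"
        proof (rule ccontr)
          assume "i \<notin> {..<k}"
          then have "psum p k \<le> psum p i" by (intro psum_mono) simp
          then show False using row_bounds(1) [OF p(1), of a] a pk by simp
        qed
      qed
      moreover have "inj_on (row p) {a \<in> ?P. y a = c}"
      proof (rule inj_onI)
        fix a b assume ab: "a \<in> {a \<in> ?P. y a = c}" "b \<in> {a \<in> ?P. y a = c}" "row p a = row p b"
        have ba: "psum p (row p a) < a" "a \<le> psum p (Suc (row p a))" using row_bounds [OF p(1), of a] ab pk by auto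
        have bb: "psum p (row p a) < b" "b \<le> psum p (Suc (row p a))" using row_bounds [OF p(1), of b] ab pk by auto
        show "a = b" using inj [OF ba(1) _ bb(2)] inj [OF bb(1) _ ba(2)] ab by (metis (mono_tags, lifting) linorder_neqE_nat mem_Collect_eq)
      qed
      ultimately have le1: "card {a \<in> ?P. y a = c} \<le> k"
        using card_inj_on_le [of "row p" "{a \<in> ?P. y a = c}" "{..<k}"] by simp
      have "{a \<in> ?P. y a = c} \<subseteq> {a \<in> {1..n}. y a = c}" using pk by auto
      then have le2: "card {a \<in> ?P. y a = c} \<le> cnt (rw l) c"
        unfolding y [symmetric] cnt_def by (intro card_mono) auto
      show ?thesis
      proof (cases "1 \<le> c")
        case False
        then have "card {a \<in> ?P. y a = c} = 0" using le2 cnt_rw [OF l anti, of c] False by simp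
        then show ?thesis by (simp only: le0)
      next
        case True
        let ?f = "\<lambda>i. Suc (psum l (Suc i)) - c"
        have "?f ` {..<min k (ht l c)} \<subseteq> {a \<in> ?L. rw l a = c}"
        proof
          fix a assume "a \<in> ?f ` {..<min k (ht l c)}"
          then obtain i where i: "i < k" "i < ht l c" "a = ?f i" by auto
          have "c \<le> l i" using i ht_iff [OF l anti True] by blast
          note cp = cell_pos [OF l True this]
          have "psum l (Suc i) \<le> psum l k" using i by (intro psum_mono) simp
          then have "a \<le> psum l k" using i True by (simp del: sum.lessThan_Suc)
          then show "a \<in> {a \<in> ?L. rw l a = c}" using cp i by (simp del: sum.lessThan_Suc)
        qed
        moreover have "inj_on ?f {..<min k (ht l c)}"
        proof (rule inj_on_inverseI [of _ "row l"])
          fix i assume "i \<in> {..<min k (ht l c)}"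
          then have "c \<le> l i" using ht_iff [OF l anti True] by simp
          then show "row l (?f i) = i" by (rule cell_pos(3) [OF l True])
        qed
        ultimately have "card {..<min k (ht l c)} \<le> card {a \<in> ?L. rw l a = c}"
          by (intro card_inj_on_le) auto
        then show ?thesis using le1 le2 cnt_rw [OF l anti, of c] True by simp
      qed
    qed
    then have "(\<Sum>c\<in>{..N}. card {a \<in> ?P. y a = c}) \<le> (\<Sum>c\<in>{..N}. card {a \<in> ?L. rw l a = c})"
      by (rule sum_mono)
    moreover have "y ` ?P \<subseteq> {..N}" "rw l ` ?L \<subseteq> {..N}" using N pk lk by auto
    ultimately have "card ?P \<le> card ?L"
      using sumcard [of ?P y N] sumcard [of ?L "rw l" N] by simp
    then show ?thesis by simp
  qed
  then have eq: "psum p k = psum l k" for k using p(2) by (simp add: dominated_def le_antisym)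
  have "p k = l k" for k using eq [of k] eq [of "Suc k"] by simp
  then show False using p(3) by auto
qed

lemma act_m_above:
  assumes l: "composition n l" and anti: "antimono l" and ab: "above l p" and \<nu>: "\<nu> \<in> valued" and y: "cnt y = cnt (rw l)"
  shows "act (m p) \<nu> y = \<zero>"
proof -
  have p: "composition n p" using ab by (simp add: above_def)
  show ?thesis using repetition [OF l anti ab y] act_m_repeated [OF p \<nu>] by blast
qed

text \<open>The content of a word is invariant under the operators, so this condition is stable
  under \<open>H\<close>; by \<open>act_m_above\<close> it holds for everything that has passed
  through a higher weight.\<close>

definition van :: "(nat \<Rightarrow> nat) \<Rightarrow> ((nat \<Rightarrow> nat) \<Rightarrow> 'a) \<Rightarrow> bool" where
  "van l \<nu> \<longleftrightarrow> \<nu> \<in> valued \<and> (\<forall>y. cnt y = cnt (rw l) \<longrightarrow> \<nu> y = \<zero>)"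

lemma van_opN: "van l \<nu> \<Longrightarrow> 1 \<le> j \<Longrightarrow> j < n \<Longrightarrow> van l (opN j \<nu>)"
  using cnt_permutes [OF s_permutes [of j n]] by (auto simp: van_def opN_def)

lemma van_act:
  assumes "van l \<nu>" "h \<in> carrier H"
  shows "van l (act h \<nu>)"
  using assms(2)
proof (induction rule: H_induct)
  case zero
  then show ?case using assms by (auto simp: van_def act_zero)
next
  case (add c w g)
  have "van l (opw w \<nu>)"
    using add(2) by (induction w) (auto simp: assms(1) intro: van_opN)
  then show ?case
    using add assms(1) by (auto simp: van_def act_add act_mult act_iota act_Tw)
qed

lemma van_M_above:
  assumes l: "composition n l" and anti: "antimono l" and x: "x \<in> M_above l l' k" and \<nu>: "\<nu> \<in> valued"
  shows "van l (act x \<nu>)"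
  using x
proof (induction rule: M_above_induct)
  case zero
  then show ?case using \<nu> by (auto simp: van_def act_zero)
next
  case (add x y)
  then show ?case using \<nu> by (auto simp: van_def act_add)
next
  case (inv x)
  have "act (\<ominus>\<^bsub>H\<^esub> x) \<nu> = act (\<iota> (\<ominus> \<one>) \<cdot> x) \<nu>" using inv by (simp add: \<iota>_uminus H.l_minus)
  then show ?case using \<nu> inv by (auto simp: van_def act_mult act_iota)
next
  case (gen p' x y)
  have p': "composition n p'" using gen by (simp add: above_def)
  have "van l (act (m p') (act y \<nu>))"
    using act_m_above [OF l anti gen(1)] gen \<nu> p' by (simp add: van_def)
  from van_act [OF this gen(2)] show ?case using gen \<nu> p' by (simp add: act_mult H.m_assoc)
qed

text \<open>Evaluation at the reading word kills the higher part and sends \<open>m l\<close> to 1;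
  it is the coordinate function of \<open>m l\<close>, available over every ring.\<close>

lemma form_eval:
  assumes l: "composition n l" and anti: "antimono l" and a: "a \<in> M_above l l' k" and c: "c \<in> carrier K"
  shows "act (a \<^bold>+ \<iota> c \<cdot> m l) (delta (rw l)) (rw l) = c"
  using van_M_above [OF l anti a, of "delta (rw l)"] M_above_ops(4) [OF a] l c act_m_delta [OF l]
  by (simp add: van_def act_add act_mult act_iota)

theorem m_free:
  assumes l: "composition n l" and anti: "antimono l" and c: "c \<in> carrier K" and a: "\<iota> c \<cdot> m l \<in> M_above l l' k"
  shows "c = \<zero>"
proof -
  have "act (\<iota> c \<cdot> m l) (delta (rw l)) (rw l) = \<zero>"
    using van_M_above [OF l anti a, of "delta (rw l)"] by (simp add: van_def)
  then show ?thesis using form_eval [OF l anti M_above_ops(1) c] l c by simp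
qed

end

section \<open>The value of the form on the column reversal\<close>

context hecke begin

lemma Dn_eigen:
  assumes "u \<in> carrier H" "\<And>j. b < j + k \<Longrightarrow> j \<le> b \<Longrightarrow> t j \<cdot> u = \<iota> q \<cdot> u"
  shows "Dn b k \<cdot> u = \<iota> (qint (Suc k)) \<cdot> u"
  using assms(2)
proof (induction k arbitrary: b)
  case 0
  then show ?case using assms(1) by (simp add: qint_Suc)
next
  case (Suc k)
  have IH: "Dn (b - 1) k \<cdot> u = \<iota> (qint (Suc k)) \<cdot> u" using Suc.prems by (intro Suc.IH) auto
  have "Dn b (Suc k) \<cdot> u = u \<^bold>+ t b \<cdot> (Dn (b - 1) k \<cdot> u)" using assms(1) by (simp add: H.l_distr H.m_assoc)
  also have "\<dots> = u \<^bold>+ \<iota> (qint (Suc k)) \<cdot> (t b \<cdot> u)"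
    unfolding IH using assms(1) \<iota>_central [of "qint (Suc k)" "t b"] by (simp add: H.m_assoc [symmetric])
  also have "t b \<cdot> u = \<iota> q \<cdot> u" using Suc.prems by simp
  also have "u \<^bold>+ \<iota> (qint (Suc k)) \<cdot> (\<iota> q \<cdot> u) = \<iota> (\<one> \<oplus> q \<otimes> qint (Suc k)) \<cdot> u"
    using assms(1) by (simp add: \<iota>_add \<iota>_mult H.l_distr H.m_assoc [symmetric] m_comm [of q] del: \<iota>_mult [symmetric])
  finally show ?case by (simp add: qint_Suc [of "Suc k"])
qed

text \<open>Each factor \<open>Dn\<close> acts on a common eigenvector by a quantum integer; the
  product over all positions is the Poincare polynomial of the Young subgroup at q.\<close>

lemma symm_eigen:
  assumes st: "convex n st" and u: "u \<in> carrier H"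
    and e: "\<And>j. 1 \<le> j \<Longrightarrow> j < n \<Longrightarrow> st j = st (Suc j) \<Longrightarrow> t j \<cdot> u = \<iota> q \<cdot> u"
  shows "k \<le> n \<Longrightarrow> symm st k \<cdot> u = \<iota> (\<Otimes>p\<in>{1..k}. qint (Suc (off st p))) \<cdot> u"
proof (induction k)
  case 0
  then show ?case using u by simp
next
  case (Suc k)
  have cv: "convex (Suc k) st" using convex_mono [OF st Suc.prems] .
  note cl = convex_class [OF cv]
  have D: "Dn k (off st (Suc k)) \<cdot> u = \<iota> (qint (Suc (off st (Suc k)))) \<cdot> u"
  proof (rule Dn_eigen [OF u])
    fix j assume j: "k < j + off st (Suc k)" "j \<le> k"
    then have "j \<in> {Suc k - off st (Suc k)..Suc k}" "Suc j \<in> {Suc k - off st (Suc k)..Suc k}" by auto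
    then have "j \<in> {1..Suc k}" "st j = st (Suc j)" unfolding cl(1) [symmetric] by auto
    then show "t j \<cdot> u = \<iota> q \<cdot> u" using j Suc.prems by (intro e) auto
  qed
  let ?P = "\<Otimes>p\<in>{1..k}. qint (Suc (off st p))" and ?c = "qint (Suc (off st (Suc k)))"
  have P: "?P \<in> carrier K" by (intro finprod_closed) auto
  have IH: "symm st k \<cdot> u = \<iota> ?P \<cdot> u" using Suc by simp
  have "symm st (Suc k) \<cdot> u = symm st k \<cdot> (\<iota> ?c \<cdot> u)" using u D by (simp add: H.m_assoc)
  also have "\<dots> = \<iota> ?c \<cdot> (symm st k \<cdot> u)"
    using u \<iota>_central [of ?c "symm st k"] by (simp add: H.m_assoc [symmetric])
  also have "\<dots> = \<iota> (?c \<otimes> ?P) \<cdot> u" unfolding IH using u P by (simp add: \<iota>_mult H.m_assoc)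
  also have "?c \<otimes> ?P = (\<Otimes>p\<in>{1..Suc k}. qint (Suc (off st p)))"
    by (subst atLeastAtMostSuc_conv) (auto simp: finprod_insert)
  finally show ?case .
qed

text \<open>A statistic that separates the terms in the expansion of an operator word. For \<kappa>
  the row index will be taken; exchanging two neighbours changes the cost by a product of two
  differences (\<open>cost_swap\<close>).\<close>

definition cost :: "(nat \<Rightarrow> int) \<Rightarrow> (nat \<Rightarrow> nat) \<Rightarrow> int" where
  "cost \<kappa> y = (\<Sum>p\<in>{1..n}. \<kappa> p * int (y p))"

lemma cost_comp: "w permutes {1..n} \<Longrightarrow> cost (\<kappa> \<circ> w) (y \<circ> w) = cost \<kappa> y"
  unfolding cost_def by (subst sum.permute [of w]) (simp_all add: comp_def)

lemma cost_swap:
  assumes "1 \<le> j" "j < n"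
  shows "cost (\<kappa> \<circ> s j) y = cost \<kappa> y + (\<kappa> (Suc j) - \<kappa> j) * (int (y j) - int (y (Suc j)))"
proof -
  let ?R = "{1..n} - {j, Suc j}"
  have eq: "{1..n} = insert j (insert (Suc j) ?R)" using assms by auto
  have "(\<Sum>p\<in>?R. (\<kappa> \<circ> s j) p * int (y p)) = (\<Sum>p\<in>?R. \<kappa> p * int (y p))"
    by (intro sum.cong) (auto simp: transpose_def)
  moreover have "cost \<mu> y = \<mu> j * int (y j) + (\<mu> (Suc j) * int (y (Suc j)) + (\<Sum>p\<in>?R. \<mu> p * int (y p)))" for \<mu>
    unfolding cost_def by (subst eq) (simp del: Diff_insert)
  ultimately show ?thesis by (simp add: algebra_simps)
qed

lemma minus_unit: "u \<in> Units K \<Longrightarrow> x \<in> carrier K \<Longrightarrow> \<exists>v\<in>Units K. u \<otimes> (\<ominus> x) = v \<otimes> x"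
proof -
  assume u: "u \<in> Units K" and x: "x \<in> carrier K"
  have "(\<ominus> \<one>) \<otimes> (\<ominus> \<one>) = \<one>" by (simp add: l_minus)
  then have "\<ominus> \<one> \<in> Units K" unfolding Units_def by (intro CollectI conjI bexI [of _ "\<ominus> \<one>"]) simp_all
  then have "u \<otimes> (\<ominus> \<one>) \<in> Units K" using u by (rule Units_m_closed [rotated])
  moreover have "u \<otimes> (\<ominus> x) = u \<otimes> (\<ominus> \<one>) \<otimes> x" using u x by (simp add: l_minus r_minus Units_closed)
  ultimately show ?thesis by blast
qed

text \<open>Under the cost condition only one term of the expansion of a word in the operators \<open>opN\<close> survives.\<close>

lemma opw_leading_term:
  assumes "set w \<subseteq> {1..<n}" "ln (word_perm w) = length w" "Y \<in> valued"
    and "\<And>p p'. 1 \<le> p \<Longrightarrow> p < p' \<Longrightarrow> p' \<le> n \<Longrightarrow> word_perm w p' < word_perm w p \<Longrightarrow> \<kappa> (word_perm w p') < \<kappa> (word_perm w p)"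
    and "\<And>x. Y x \<noteq> \<zero> \<Longrightarrow> cost \<kappa> y \<le> cost (\<kappa> \<circ> word_perm w) x"
  shows "\<exists>u\<in>Units K. opw w Y y = u \<otimes> Y (y \<circ> word_perm w)"
  using assms
proof (induction w arbitrary: Y rule: rev_induct)
  case Nil
  show ?case by (rule bexI [of _ \<one>]) (use Nil in simp_all)
next
  case (snoc j w)
  define \<tau> where "\<tau> = word_perm w"
  have \<tau>j: "word_perm (w @ [j]) = \<tau> \<circ> s j" by (simp add: \<tau>_def)
  have Y: "Y \<in> valued" using snoc.prems by simp
  have wp: "\<tau> permutes {1..n}" unfolding \<tau>_def using snoc.prems(1) by (intro word_perm_permutes) auto
  have j: "1 \<le> j" "j < n" using snoc.prems by auto
  note r = reduced_snoc [OF snoc.prems(1,2), folded \<tau>_def]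
  note C = snoc.prems(4) [unfolded \<tau>j comp_apply] and hyp = snoc.prems(5) [unfolded \<tau>j]
  have \<kappa>j: "\<kappa> (\<tau> j) < \<kappa> (\<tau> (Suc j))" using C [of j "Suc j"] r(2) j by simp
  have swap: "cost (\<kappa> \<circ> (\<tau> \<circ> s j)) x = cost (\<kappa> \<circ> \<tau>) x + (\<kappa> (\<tau> (Suc j)) - \<kappa> (\<tau> j)) * (int (x j) - int (x (Suc j)))" for x
    using cost_swap [OF j, of "\<kappa> \<circ> \<tau>" x] by (simp add: o_assoc)
  have hyp': "cost \<kappa> y \<le> cost (\<kappa> \<circ> \<tau>) x" if "opN j Y x \<noteq> \<zero>" for x
  proof -
    have "Y (x \<circ> s j) \<noteq> \<zero> \<or> Y x \<noteq> \<zero> \<and> x j \<le> x (Suc j)"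
      using that by (cases "x j" "x (Suc j)" rule: linorder_cases) (auto simp: opN_gt opN_lt opN_eq)
    then show ?thesis
    proof
      assume "Y (x \<circ> s j) \<noteq> \<zero>"
      from hyp [OF this] show ?thesis
        using cost_comp [OF s_permutes [OF j], of "\<kappa> \<circ> \<tau>" x] by (simp add: comp_def)
    next
      assume x: "Y x \<noteq> \<zero> \<and> x j \<le> x (Suc j)"
      then have "(\<kappa> (\<tau> (Suc j)) - \<kappa> (\<tau> j)) * (int (x j) - int (x (Suc j))) \<le> 0"
        using \<kappa>j by (intro mult_nonneg_nonpos) auto
      then show ?thesis using hyp [of x] x swap [of x] by linarith
    qed
  qed
  \<comment> \<open>Applying the transposition to positions turns an inversion of the shorter word
    into one of the longer word; the pair j, j + 1 cannot occur, being an ascent of \<tau>.\<close>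
  have C': "\<kappa> (\<tau> p') < \<kappa> (\<tau> p)" if p: "1 \<le> p" "p < p'" "p' \<le> n" "\<tau> p' < \<tau> p" for p p'
  proof -
    have ne: "\<not> (p = j \<and> p' = Suc j)" using p r(2) by auto
    have "1 \<le> s j p" "s j p < s j p'" "s j p' \<le> n" using p ne j by (auto simp: transpose_def)
    from C [OF this] show ?thesis using p by simp
  qed
  have "\<exists>u\<in>Units K. opw w (opN j Y) y = u \<otimes> opN j Y (y \<circ> \<tau>)"
    unfolding \<tau>_def
  proof (rule snoc.IH)
    show "set w \<subseteq> {1..<n}" using snoc.prems(1) by simp
    show "ln (word_perm w) = length w" using r(1) by (simp add: \<tau>_def)
    show "opN j Y \<in> valued" using Y by simp
    show "cost \<kappa> y \<le> cost (\<kappa> \<circ> word_perm w) x" if "opN j Y x \<noteq> \<zero>" for x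
      using hyp' [OF that] by (simp add: \<tau>_def)
  qed (use C' in \<open>simp add: \<tau>_def\<close>)
  then obtain u where u: "u \<in> Units K" "opw w (opN j Y) y = u \<otimes> opN j Y (y \<circ> \<tau>)" by blast
  have val: "opw (w @ [j]) Y y = u \<otimes> opN j Y (y \<circ> \<tau>)" using u(2) by (simp add: opw_def)
  have yj: "y \<circ> word_perm (w @ [j]) = y \<circ> \<tau> \<circ> s j" unfolding \<tau>j by (simp add: o_assoc)
  show ?case
    unfolding val yj
  proof (cases "(y \<circ> \<tau>) j" "(y \<circ> \<tau>) (Suc j)" rule: linorder_cases)
    \<comment> \<open>Here the operator produces a second term with coefficient q - 1. Its word
      would have a cost strictly below the assumed bound, so \<open>Y\<close> is zero there.\<close>
    case less
    have "Y (y \<circ> \<tau>) = \<zero>"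
    proof (rule ccontr)
      assume "Y (y \<circ> \<tau>) \<noteq> \<zero>"
      from hyp [OF this] have "cost \<kappa> y \<le> cost \<kappa> y + (\<kappa> (\<tau> (Suc j)) - \<kappa> (\<tau> j)) * (int ((y \<circ> \<tau>) j) - int ((y \<circ> \<tau>) (Suc j)))"
        unfolding swap cost_comp [OF wp] .
      moreover have "(\<kappa> (\<tau> (Suc j)) - \<kappa> (\<tau> j)) * (int ((y \<circ> \<tau>) j) - int ((y \<circ> \<tau>) (Suc j))) < 0"
        using \<kappa>j less by (intro mult_pos_neg) auto
      ultimately show False by linarith
    qed
    then show "\<exists>v\<in>Units K. u \<otimes> opN j Y (y \<circ> \<tau>) = v \<otimes> Y (y \<circ> \<tau> \<circ> s j)"
      using u(1) Y q_closed less by (intro bexI [of _ u]) (simp_all add: opN_lt)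
  next
    case equal
    then have "y \<circ> \<tau> \<circ> s j = y \<circ> \<tau>" by (auto simp: fun_eq_iff transpose_def)
    then show "\<exists>v\<in>Units K. u \<otimes> opN j Y (y \<circ> \<tau>) = v \<otimes> Y (y \<circ> \<tau> \<circ> s j)"
      unfolding opN_eq [OF equal] using minus_unit [OF u(1)] Y by simp
  next
    case greater
    show "\<exists>v\<in>Units K. u \<otimes> opN j Y (y \<circ> \<tau>) = v \<otimes> Y (y \<circ> \<tau> \<circ> s j)"
      unfolding opN_gt [OF greater] using u(1) q_unit Y
      by (intro bexI [of _ "u \<otimes> q"]) (simp_all add: m_assoc Units_closed)
  qed
qed

text \<open>\<open>G\<close> is concave with slope about 2 \<open>h\<close>, and the inequality
  compares it with its tangent at \<open>a\<close>. Taking the two neighbouring heights as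
  increment, as in the trapezoidal rule, makes it strict in both directions as soon as the heights
  differ.\<close>

lemma antimono_gap:
  fixes h :: "nat \<Rightarrow> nat"
  assumes h: "\<And>a b. 1 \<le> a \<Longrightarrow> a \<le> b \<Longrightarrow> h b \<le> h a" and ab: "1 \<le> a" "1 \<le> b"
  defines "G \<equiv> \<lambda>c. (\<Sum>j<c. int (h j + h (Suc j)))"
  shows "G b - G a \<le> 2 * int (h a) * (int b - int a)"
    and "h a \<noteq> h b \<Longrightarrow> G b - G a < 2 * int (h a) * (int b - int a)"
proof -
  have up: "G (a + d) - G a \<le> 2 * int (h a) * int d \<and> (h (a + d) < h a \<longrightarrow> G (a + d) - G a < 2 * int (h a) * int d)"
    if a: "1 \<le> a" for a d
  proof (induction d)
    case (Suc d)
    have "h (a + d) \<le> h a" "h (Suc (a + d)) \<le> h (a + d)" using h [of a "a + d"] h [of "a + d" "Suc (a + d)"] a by auto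
    moreover have "G (a + Suc d) = G (a + d) + int (h (a + d)) + int (h (Suc (a + d)))" by (simp add: G_def)
    ultimately show ?case using Suc.IH by (auto simp: algebra_simps)
  qed simp
  have dn: "2 * int (h (b + d)) * int d \<le> G (b + d) - G b \<and> (h (b + d) < h b \<longrightarrow> 2 * int (h (b + d)) * int d < G (b + d) - G b)"
    if b: "1 \<le> b" for b d
    using b
  proof (induction d arbitrary: b)
    case (Suc d)
    have "h (b + Suc d) \<le> h (Suc b)" "h (Suc b) \<le> h b" using h [of "Suc b" "b + Suc d"] h [of b "Suc b"] Suc.prems by auto
    moreover have "G (Suc b) = G b + int (h b) + int (h (Suc b))" by (simp add: G_def)
    ultimately show ?case using Suc.IH [of "Suc b"] by (auto simp: algebra_simps)
  qed simp
  have "G b - G a \<le> 2 * int (h a) * (int b - int a) \<and> (h a \<noteq> h b \<longrightarrow> G b - G a < 2 * int (h a) * (int b - int a))"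
  proof (cases "a \<le> b")
    case True
    then obtain d where d: "b = a + d" using le_Suc_ex by blast
    show ?thesis using up [OF ab(1), of d] h [OF ab(1) True] unfolding d by auto
  next
    case False
    then obtain d where d: "a = b + d" using le_Suc_ex [of b a] by auto
    have "h a \<le> h b" using h [OF ab(2), of a] False by simp
    then show ?thesis using dn [OF ab(2), of d] unfolding d by (auto simp: algebra_simps)
  qed
  then show "G b - G a \<le> 2 * int (h a) * (int b - int a)"
    and "h a \<noteq> h b \<Longrightarrow> G b - G a < 2 * int (h a) * (int b - int a)" by auto
qed

text \<open>Normal forms of row permutations use generators inside rows, and each of these relates a
  word to itself and to one exchange of neighbours in a row.\<close>

lemma act_m_support:
  assumes l: "composition n l" and ne: "act (m l) (delta (rw l)) y \<noteq> \<zero>"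
  shows "\<exists>w\<in>stab n (row l). y = rw l \<circ> w"
proof (rule ccontr)
  assume no: "\<not> ?thesis"
  define Q where "Q \<nu> \<longleftrightarrow> \<nu> \<in> valued \<and> (\<forall>y. \<nu> y \<noteq> \<zero> \<longrightarrow> (\<exists>w\<in>stab n (row l). y = rw l \<circ> w))" for \<nu> :: "(nat \<Rightarrow> nat) \<Rightarrow> 'a"
  have Q0: "Q (delta (rw l))" using id_stab [of "row l"] by (auto simp: Q_def delta_def intro!: bexI [of _ id])
  have step: "Q (opN j \<nu>)" if "Q \<nu>" and j: "1 \<le> j" "j < n" "row l j = row l (Suc j)" for j \<nu>
    unfolding Q_def
  proof (intro conjI allI impI)
    show "opN j \<nu> \<in> valued" using that by (simp add: Q_def)
    fix y assume "opN j \<nu> y \<noteq> \<zero>"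
    then have "\<nu> (y \<circ> s j) \<noteq> \<zero> \<or> \<nu> y \<noteq> \<zero>"
      by (cases "y j" "y (Suc j)" rule: linorder_cases) (auto simp: opN_gt opN_lt opN_eq)
    then show "\<exists>w\<in>stab n (row l). y = rw l \<circ> w"
    proof
      assume "\<nu> (y \<circ> s j) \<noteq> \<zero>"
      then obtain w where w: "w \<in> stab n (row l)" "y \<circ> s j = rw l \<circ> w" using \<open>Q \<nu>\<close> by (auto simp: Q_def)
      have "w \<circ> s j \<in> stab n (row l)"
        using w(1) permutes_compose [OF s_permutes [OF j(1,2)]] j by (auto simp: stab_def transpose_def)
      moreover have "y = rw l \<circ> (w \<circ> s j)" using w(2) s_s [of y j] by (metis o_assoc)
      ultimately show ?thesis by blast
    qed (use \<open>Q \<nu>\<close> in \<open>auto simp: Q_def\<close>)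
  qed
  have word: "Q (opw w (delta (rw l)))" if "set w \<subseteq> {1..<n}" "set w \<subseteq> {i. row l i = row l (Suc i)}" for w
    using that by (induction w) (auto intro!: step Q0)
  have "act (m l) (delta (rw l)) y = (\<Oplus>w\<in>stab n (row l). act (Tw (nf n w)) (delta (rw l)) y)"
    unfolding m_symm [OF l] sum_stab [OF convex_row [OF l], symmetric] by (intro act_finsum) (simp_all add: finite_stab)
  also have "\<dots> = (\<Oplus>w\<in>stab n (row l). \<zero>)"
  proof (rule finsum_cong')
    fix w assume w: "w \<in> stab n (row l)"
    then have r: "set (nf n w) \<subseteq> {1..<n}" using nf_reduced by (auto simp: stab_def)
    have "Q (opw (nf n w) (delta (rw l)))" by (rule word) (use r stab_nf_set [OF w convex_row [OF l]] in auto)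
    then show "act (Tw (nf n w)) (delta (rw l)) y = \<zero>" using no r by (auto simp: Q_def act_Tw)
  qed simp_all
  finally show False using ne by simp
qed


text \<open>The column reversal: the box in row i of a column of length h goes to row h - 1 - i of
  the same column. Row i carries the letters l i, ..., 1, so that letter c of that row stands at
  position \<open>Suc (psum l (Suc i)) - c\<close>.\<close>

definition rev_col :: "(nat \<Rightarrow> nat) \<Rightarrow> nat \<Rightarrow> nat" where
  "rev_col l p = (if p \<in> {1..n} then Suc (psum l (Suc (ht l (rw l p) - 1 - row l p))) - rw l p else p)"

text \<open>The cells of a row that lie in columns of equal length. The reversal moves such a strip
  as a block, and its length is a difference of adjacent rows of \<open>l\<close>.\<close>

definition strip :: "(nat \<Rightarrow> nat) \<Rightarrow> nat \<Rightarrow> nat \<times> nat" where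
  "strip l p = (row l p, ht l (rw l p))"

context
  fixes l assumes l: "composition n l" and anti: "antimono l"
begin

lemma cell:
  assumes "p \<in> {1..n}"
  shows "1 \<le> rw l p" "rw l p \<le> l (row l p)" "row l p < ht l (rw l p)"
  using rw_bounds [OF l, of p] ht_iff [OF l anti, of "rw l p" "row l p"] assms by auto

lemma rev_col_cell:
  assumes "p \<in> {1..n}"
  shows "rev_col l p \<in> {1..n}" "row l (rev_col l p) = ht l (rw l p) - 1 - row l p" "rw l (rev_col l p) = rw l p"
proof -
  have "ht l (rw l p) - 1 - row l p < ht l (rw l p)" using cell [OF assms] by simp
  then have "rw l p \<le> l (ht l (rw l p) - 1 - row l p)" using ht_iff [OF l anti cell(1) [OF assms]] by blast
  from cell_pos [OF l cell(1) [OF assms] this] assms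
  show "rev_col l p \<in> {1..n}" "row l (rev_col l p) = ht l (rw l p) - 1 - row l p" "rw l (rev_col l p) = rw l p"
    by (auto simp: rev_col_def simp del: sum.lessThan_Suc)
qed

lemma rev_col_outside: "p \<notin> {1..n} \<Longrightarrow> rev_col l p = p"
  unfolding rev_col_def by (rule if_not_P)

lemma rev_col_rev_col: "rev_col l (rev_col l p) = p"
proof (cases "p \<in> {1..n}")
  case True
  note 1 = rev_col_cell [OF True] note 2 = rev_col_cell [OF 1(1)]
  show ?thesis
    by (rule rw_inj [OF l]) (use 1 2 True cell [OF True] in auto)
next
  case False
  from rev_col_outside [OF this] show ?thesis by metis
qed

lemma rev_col_permutes: "rev_col l permutes {1..n}"
proof (rule bij_imp_permutes)
  show "bij_betw (rev_col l) {1..n} {1..n}"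
    by (rule bij_betw_byWitness [of _ "rev_col l"]) (use rev_col_cell(1) rev_col_rev_col in auto)
  show "rev_col l p = p" if "p \<notin> {1..n}" for p using that by (rule rev_col_outside)
qed

lemma ht_mono: "1 \<le> a \<Longrightarrow> a \<le> b \<Longrightarrow> ht l b \<le> ht l a"
proof -
  assume ab: "1 \<le> a" "a \<le> b"
  have "finite {i. a \<le> l i}"
    by (rule finite_subset [of _ "{i. l i \<noteq> 0}"]) (use l ab in \<open>auto simp: composition_def\<close>)
  then show ?thesis unfolding ht_def using ab by (intro card_mono) auto
qed

lemma rw_less:
  assumes "1 \<le> p" "p < p'" "p' \<le> n" "row l p = row l p'" shows "rw l p' < rw l p"
  using rw_descending [OF l] assms unfolding descending_def by blast

text \<open>This is the condition on inversions in \<open>opw_leading_term\<close>, with the row as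
  \<kappa>. Among cells that end in the same row the column length decreases weakly as the letter
  grows, so their original rows are ordered in a way that rules out an inversion.\<close>

lemma rev_col_inversion:
  assumes p: "1 \<le> p" "p < p'" "p' \<le> n" and inv: "rev_col l p' < rev_col l p"
  shows "row l (rev_col l p') < row l (rev_col l p)"
proof (rule ccontr)
  assume n: "\<not> ?thesis"
  have p1: "p \<in> {1..n}" "p' \<in> {1..n}" using p by auto
  note r = rev_col_cell [OF p1(1)] rev_col_cell [OF p1(2)]
  have "row l (rev_col l p') \<le> row l (rev_col l p)" using r inv by (intro row_mono [OF l]) auto
  then have eq: "row l (rev_col l p') = row l (rev_col l p)" using n by simp
  have lt: "rw l p < rw l p'" using rw_less [OF _ inv] r eq by simp
  have "ht l (rw l p') \<le> ht l (rw l p)" using lt cell [OF p1(1)] by (intro ht_mono) auto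
  then have "row l p' \<le> row l p" using eq r cell(3) [OF p1(1)] cell(3) [OF p1(2)] by simp
  moreover have "row l p \<le> row l p'" using p by (intro row_mono [OF l]) auto
  ultimately show False using rw_less [OF p] lt by simp
qed

lemma convex_strip: "convex n (strip l)"
  unfolding convex_def
proof (intro allI impI)
  fix i j k assume *: "1 \<le> i" "i \<le> j" "j \<le> k" "k \<le> n" "strip l i = strip l k"
  have r: "row l j = row l i" using convexD [OF convex_row [OF l] *(1-4)] * by (simp add: strip_def)
  have r': "row l i = row l k" using * by (simp add: strip_def)
  have "rw l k \<le> rw l j" "rw l j \<le> rw l i"
  proof -
    show "rw l k \<le> rw l j"
    proof (cases "j = k")
      case False
      then show ?thesis using *(1-4) r r' by (intro less_imp_le [OF rw_less]) auto
    qed simp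
    show "rw l j \<le> rw l i"
    proof (cases "i = j")
      case False
      then show ?thesis using *(1-4) r by (intro less_imp_le [OF rw_less]) auto
    qed simp
  qed
  moreover have "1 \<le> rw l k" "1 \<le> rw l j" using cell(1) * by auto
  ultimately have "ht l (rw l i) \<le> ht l (rw l j)" "ht l (rw l j) \<le> ht l (rw l k)"
    by (auto intro!: ht_mono)
  then show "strip l j = strip l i" using * r by (simp add: strip_def)
qed

text \<open>Neighbours in a strip lie in adjacent columns of equal length and are sent to
  neighbours; so \<open>transport\<close> carries the generators of a strip across the
  reversal.\<close>

lemma rev_col_Suc:
  assumes j: "1 \<le> j" "j < n" "strip l j = strip l (Suc j)"
  shows "rev_col l (Suc j) = Suc (rev_col l j)"
proof -
  have r: "row l j = row l (Suc j)" and h: "ht l (rw l j) = ht l (rw l (Suc j))" using j by (simp_all add: strip_def)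
  have "Suc j \<le> psum l (Suc (row l j))" using row_bounds(2) [OF l, of "Suc j"] j r by simp
  then have c: "rw l j = Suc (rw l (Suc j))" using r by (simp add: rw_def)
  have "1 \<le> rev_col l j" using rev_col_cell(1) [of j] j by simp
  then show ?thesis using j h r unfolding rev_col_def c by simp
qed

lemma strip_eigen:
  assumes j: "1 \<le> j" "j < n" "strip l j = strip l (Suc j)"
  shows "t j \<cdot> (N (rev_col l) \<cdot> m l) = \<iota> q \<cdot> (N (rev_col l) \<cdot> m l)"
proof -
  define i where "i = rev_col l j"
  have jn: "j \<in> {1..n}" "Suc j \<in> {1..n}" using j by auto
  have Si: "rev_col l (Suc j) = Suc i" using rev_col_Suc [OF j] by (simp add: i_def)
  have i: "1 \<le> i" "i < n" using rev_col_cell(1) [OF jn(1)] rev_col_cell(1) [OF jn(2)] Si by (auto simp: i_def)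
  have ri: "rev_col l i = j" "rev_col l (Suc i) = Suc j"
    using rev_col_rev_col [of j] rev_col_rev_col [of "Suc j"] by (simp_all add: i_def [symmetric] Si)
  have row: "row l i = row l (Suc i)"
    using rev_col_cell(2) [OF jn(1)] rev_col_cell(2) [OF jn(2)] Si j(3) by (simp add: strip_def i_def [symmetric])
  have tr: "t j \<cdot> N (rev_col l) = N (rev_col l) \<cdot> t i"
    using transport [OF rev_col_permutes i] ri by simp
  have "t i \<cdot> m l = \<iota> q \<cdot> m l"
    using row_bounds(1) [OF l, of i] row_bounds(2) [OF l, of "Suc i"] i row by (intro m_eigen(1) [OF l, of "row l i"]) auto
  then have "t j \<cdot> (N (rev_col l) \<cdot> m l) = N (rev_col l) \<cdot> (\<iota> q \<cdot> m l)"
    using l tr by (simp add: H.m_assoc [symmetric]) (simp add: H.m_assoc)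
  then show ?thesis using l \<iota>_central [of q "N (rev_col l)"] by (simp add: H.m_assoc [symmetric])
qed

text \<open>A rearrangement inequality for column lengths against letters. Each summand is bounded
  below by an increment of the concave function \<open>G\<close>, and these increments add up to
  zero because \<open>w\<close> permutes the positions. Equality forces every letter to stay in
  columns of the same length.\<close>

lemma rearrangement:
  assumes w: "w \<in> stab n (row l)"
  defines "\<rho> \<equiv> \<lambda>p. int (row l p)"
  shows "cost \<rho> (rw l) \<le> cost (\<rho> \<circ> rev_col l) (rw l \<circ> w)"
    and "cost (\<rho> \<circ> rev_col l) (rw l \<circ> w) = cost \<rho> (rw l) \<Longrightarrow> w \<in> stab n (strip l)"
proof -
  let ?h = "ht l" and ?a = "rw l" and ?b = "\<lambda>p. rw l (w p)"
  define G where "G = (\<lambda>c. (\<Sum>j<c. int (?h j + ?h (Suc j))))"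
  have wp: "w permutes {1..n}" and wr: "\<And>p. p \<in> {1..n} \<Longrightarrow> row l (w p) = row l p"
    using w by (auto simp: stab_def)
  have pos: "1 \<le> ?a p" "1 \<le> ?b p" if "p \<in> {1..n}" for p
    using cell(1) that permutes_in_image [OF wp] by blast+
  have gap: "G b - G a \<le> 2 * int (?h a) * (int b - int a)"
    "?h a \<noteq> ?h b \<Longrightarrow> G b - G a < 2 * int (?h a) * (int b - int a)" if "1 \<le> a" "1 \<le> b" for a b
    unfolding G_def using that by - (rule antimono_gap; (rule ht_mono)?; assumption)+
  have perm: "(\<Sum>p\<in>{1..n}. f (w p)) = (\<Sum>p\<in>{1..n}. f p)" for f :: "nat \<Rightarrow> int"
    using sum.permute [OF wp, of f] by (simp add: comp_def)
  have rev: "cost (\<rho> \<circ> rev_col l) x = (\<Sum>p\<in>{1..n}. (int (?h (?a p)) - 1 - \<rho> p) * int (x p))" for x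
    unfolding cost_def
  proof (intro sum.cong refl)
    fix p assume p: "p \<in> {1..n}"
    have "int (?h (?a p) - 1 - row l p) = int (?h (?a p)) - 1 - int (row l p)"
      using cell(3) [OF p] by linarith
    then show "(\<rho> \<circ> rev_col l) p * int (x p) = (int (?h (?a p)) - 1 - \<rho> p) * int (x p)"
      using rev_col_cell(2) [OF p] by (simp add: \<rho>_def)
  qed
  have aa: "?a \<circ> rev_col l = ?a" using rev_col_cell(3) by (fastforce simp: rev_col_def)
  have same: "cost (\<rho> \<circ> rev_col l) ?a = cost \<rho> ?a"
    using cost_comp [OF rev_col_permutes, of \<rho> ?a] unfolding aa .
  have "(\<Sum>p\<in>{1..n}. (1 + \<rho> p) * int (?b p)) = (\<Sum>p\<in>{1..n}. (1 + \<rho> (w p)) * int (?b p))"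
    using wr by (intro sum.cong) (auto simp: \<rho>_def)
  also have "\<dots> = (\<Sum>p\<in>{1..n}. (1 + \<rho> p) * int (?a p))" by (rule perm)
  finally have zero: "(\<Sum>p\<in>{1..n}. (1 + \<rho> p) * int (?b p)) = (\<Sum>p\<in>{1..n}. (1 + \<rho> p) * int (?a p))" .
  \<comment> \<open>The contributions of the rows cancel since \<open>w\<close> preserves rows, and
    the column lengths remain.\<close>
  have D: "cost (\<rho> \<circ> rev_col l) (?a \<circ> w) - cost \<rho> ?a = (\<Sum>p\<in>{1..n}. int (?h (?a p)) * (int (?b p) - int (?a p)))"
  proof -
    have "cost (\<rho> \<circ> rev_col l) (?a \<circ> w) - cost (\<rho> \<circ> rev_col l) ?a
        = (\<Sum>p\<in>{1..n}. int (?h (?a p)) * (int (?b p) - int (?a p)))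
          - ((\<Sum>p\<in>{1..n}. (1 + \<rho> p) * int (?b p)) - (\<Sum>p\<in>{1..n}. (1 + \<rho> p) * int (?a p)))"
      unfolding rev sum_subtractf [symmetric] by (intro sum.cong) (auto simp: algebra_simps)
    then show ?thesis by (simp add: same zero)
  qed
  have G0: "(\<Sum>p\<in>{1..n}. G (?b p) - G (?a p)) = 0"
    using perm [of "\<lambda>p. G (?a p)"] by (simp add: sum_subtractf)
  have le: "G (?b p) - G (?a p) \<le> 2 * int (?h (?a p)) * (int (?b p) - int (?a p))" if "p \<in> {1..n}" for p
    using gap(1) [OF pos [OF that]] .
  have "0 \<le> (\<Sum>p\<in>{1..n}. 2 * int (?h (?a p)) * (int (?b p) - int (?a p)))"
    unfolding G0 [symmetric] using le by (rule sum_mono)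
  also have "\<dots> = 2 * (\<Sum>p\<in>{1..n}. int (?h (?a p)) * (int (?b p) - int (?a p)))"
    by (simp add: sum_distrib_left mult.assoc)
  finally show "cost \<rho> (rw l) \<le> cost (\<rho> \<circ> rev_col l) (rw l \<circ> w)" using D by simp
  assume eq: "cost (\<rho> \<circ> rev_col l) (rw l \<circ> w) = cost \<rho> (rw l)"
  have "?h (?b p) = ?h (?a p)" if p: "p \<in> {1..n}" for p
  proof (rule ccontr)
    assume "?h (?b p) \<noteq> ?h (?a p)"
    then have "G (?b p) - G (?a p) < 2 * int (?h (?a p)) * (int (?b p) - int (?a p))"
      using gap(2) [OF pos [OF p]] by simp
    then have "(\<Sum>p\<in>{1..n}. G (?b p) - G (?a p)) < (\<Sum>p\<in>{1..n}. 2 * int (?h (?a p)) * (int (?b p) - int (?a p)))"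
      using le p by (intro sum_strict_mono_ex1) auto
    also have "\<dots> = 2 * (\<Sum>p\<in>{1..n}. int (?h (?a p)) * (int (?b p) - int (?a p)))"
      by (simp add: sum_distrib_left mult.assoc)
    finally show False using D eq G0 by simp
  qed
  then show "w \<in> stab n (strip l)" using wp wr by (auto simp: stab_def strip_def)
qed

text \<open>The left symmetrizer is expanded over row permutations. Those that do not preserve
  strips contribute zero, and the others add up to the symmetrizer of the strips acting on a common
  eigenvector, whence the quantum integers. The unit is the leading coefficient of the reversal at
  the reading word.\<close>

lemma rev_col_value:
  "\<exists>u\<in>Units K. act (m l \<cdot> N (rev_col l) \<cdot> m l) (delta (rw l)) (rw l)
     = u \<otimes> (\<Otimes>p\<in>{1..n}. qint (Suc (off (strip l) p)))"
proof -
  define \<tau> where "\<tau> = rev_col l"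
  define \<rho> where "\<rho> = (\<lambda>p. int (row l p))"
  define Y where "Y = act (m l) (delta (rw l))"
  define Z where "Z = act (N \<tau>) Y"
  have Yv: "Y \<in> valued" using l by (simp add: Y_def)
  then have Zv: "Z \<in> valued" by (simp add: Z_def)
  note nf = nf_reduced [OF rev_col_permutes, folded \<tau>_def]
  have rt: "rw l \<circ> \<tau> = rw l" using rev_col_cell(3) by (fastforce simp: \<tau>_def rev_col_def)
  have Zop: "Z = opw (nf n \<tau>) Y" using nf Yv by (simp add: Z_def N_def act_Tw)
  have costw: "cost \<rho> (rw l \<circ> w) = cost \<rho> (rw l)" if "w \<in> stab n (row l)" for w
  proof -
    have "cost \<rho> (rw l \<circ> w) = cost (\<rho> \<circ> w) (rw l \<circ> w)"
      unfolding cost_def using that by (intro sum.cong) (auto simp: stab_def \<rho>_def)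
    then show ?thesis using that cost_comp [of w \<rho> "rw l"] by (simp add: stab_def)
  qed
  have lead: "\<exists>u\<in>Units K. Z (rw l \<circ> w) = u \<otimes> Y (rw l \<circ> w \<circ> \<tau>)" if w: "w \<in> stab n (row l)" for w
  proof -
    have "cost \<rho> (rw l \<circ> w) \<le> cost (\<rho> \<circ> \<tau>) x" if "Y x \<noteq> \<zero>" for x
      using act_m_support [OF l that [unfolded Y_def]] rearrangement(1) costw [OF w] by (auto simp: \<rho>_def \<tau>_def)
    then show ?thesis
      using opw_leading_term [of "nf n \<tau>" Y \<rho> "rw l \<circ> w"] nf Yv rev_col_inversion
      unfolding Zop by (simp add: ln_def \<rho>_def \<tau>_def [symmetric])
  qed
  \<comment> \<open>A nonzero value makes the reversed word a row rearrangement of minimal cost,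
    hence one within strips; undoing the reversal transfers this to \<open>w\<close>.\<close>
  have vanish: "Z (rw l \<circ> w) = \<zero>" if w: "w \<in> stab n (row l)" "w \<notin> stab n (strip l)" for w
  proof (rule ccontr)
    assume "Z (rw l \<circ> w) \<noteq> \<zero>"
    with lead [OF w(1)] have ne: "Y (rw l \<circ> w \<circ> \<tau>) \<noteq> \<zero>" by (auto simp: Units_closed)
    obtain v where v: "v \<in> stab n (row l)" "rw l \<circ> w \<circ> \<tau> = rw l \<circ> v" using act_m_support [OF l ne [unfolded Y_def]] by blast
    have "cost (\<rho> \<circ> \<tau>) (rw l \<circ> v) = cost \<rho> (rw l)"
      unfolding v(2) [symmetric] using cost_comp [OF rev_col_permutes, folded \<tau>_def] costw [OF w(1)] by simp
    then have vs: "v \<in> stab n (strip l)" using rearrangement(2) [OF v(1)] by (simp add: \<rho>_def \<tau>_def)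
    have "ht l (rw l (w p)) = ht l (rw l p)" if p: "p \<in> {1..n}" for p
    proof -
      have p': "\<tau> p \<in> {1..n}" "\<tau> (\<tau> p) = p" "rw l (\<tau> p) = rw l p"
        using rev_col_cell [OF p] rev_col_rev_col [of p] by (simp_all add: \<tau>_def)
      have "rw l (w (\<tau> (\<tau> p))) = rw l (v (\<tau> p))" using fun_cong [OF v(2), of "\<tau> p"] by simp
      moreover have "ht l (rw l (v (\<tau> p))) = ht l (rw l (\<tau> p))" using vs p' by (auto simp: stab_def strip_def)
      ultimately show ?thesis using p' by simp
    qed
    then show False using w by (auto simp: stab_def strip_def)
  qed
  have sub: "stab n (strip l) \<subseteq> stab n (row l)" by (auto simp: stab_def strip_def)
  let ?P = "\<Otimes>p\<in>{1..n}. qint (Suc (off (strip l) p))"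
  have P: "?P \<in> carrier K" by (intro finprod_closed) auto
  have desc: "descending (strip l) (rw l)" using rw_descending [OF l] by (auto simp: descending_def strip_def)
  have "act (m l \<cdot> N (rev_col l) \<cdot> m l) (delta (rw l)) (rw l) = act (m l) Z (rw l)"
    using l by (simp add: Z_def Y_def \<tau>_def act_mult H.m_assoc)
  also have "\<dots> = (\<Oplus>w\<in>stab n (row l). q [^] ln w \<otimes> Z (rw l \<circ> w))"
    unfolding m_symm [OF l] by (rule act_symm [OF convex_row [OF l] rw_descending [OF l] Zv])
  also have "\<dots> = (\<Oplus>w\<in>stab n (strip l). q [^] ln w \<otimes> Z (rw l \<circ> w))"
    by (rule add.finprod_mono_neutral_cong_right) (use finite_stab sub vanish Zv in auto)
  \<comment> \<open>The part of the row sum that is left is again a symmetrizer sum, because the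
    reading word also descends along strips.\<close>
  also have "\<dots> = act (symm (strip l) n) Z (rw l)"
    by (rule act_symm [OF convex_strip desc Zv, symmetric])
  also have "\<dots> = act (symm (strip l) n \<cdot> (N \<tau> \<cdot> m l)) (delta (rw l)) (rw l)"
    using l by (simp add: Z_def Y_def act_mult)
  also have "\<dots> = act (\<iota> ?P \<cdot> (N \<tau> \<cdot> m l)) (delta (rw l)) (rw l)"
    using symm_eigen [OF convex_strip, of "N \<tau> \<cdot> m l" n] strip_eigen l by (simp add: \<tau>_def)
  also have "\<dots> = ?P \<otimes> Z (rw l)" using l P by (simp add: Z_def Y_def act_mult act_iota)
  finally have eq: "act (m l \<cdot> N (rev_col l) \<cdot> m l) (delta (rw l)) (rw l) = ?P \<otimes> Z (rw l)" .
  obtain u where u: "u \<in> Units K" "Z (rw l) = u \<otimes> Y (rw l)"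
    using lead [OF id_stab] rt by (auto simp: comp_id)
  have "Y (rw l) = \<one>" using act_m_delta [OF l] by (simp add: Y_def)
  then show ?thesis unfolding eq using u P by (intro bexI [of _ u]) (simp_all add: Units_closed m_comm)
qed

text \<open>In a column of length h the letter lies between l h + 1 and l (h - 1), so the strip has
  at most l (h - 1) - l h cells; the row index sought is h - 1.\<close>

lemma off_strip:
  assumes p: "p \<in> {1..n}"
  shows "\<exists>i. Suc (off (strip l) p) \<le> l i - l (Suc i)"
proof -
  let ?h = "ht l (rw l p)"
  have h: "1 \<le> ?h" using cell(3) [OF p] by simp
  let ?A = "{j \<in> {1..<p}. strip l j = strip l p}"
  have "rw l ` insert p ?A \<subseteq> {l ?h<..l (?h - 1)}"
  proof
    fix c assume "c \<in> rw l ` insert p ?A"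
    then obtain j where "j \<in> insert p ?A" and c: "c = rw l j" by blast
    then have j: "j \<in> {1..n}" "ht l (rw l j) = ?h" "c = rw l j" using p by (auto simp: strip_def)
    show "c \<in> {l ?h<..l (?h - 1)}"
      using ht_iff [OF l anti cell(1) [OF j(1)], of "?h - 1"] ht_iff [OF l anti cell(1) [OF j(1)], of ?h] j h by auto
  qed
  moreover have "inj_on (rw l) (insert p ?A)"
    by (rule inj_onI, rule rw_inj [OF l]) (use p in \<open>auto simp: strip_def\<close>)
  ultimately have "card (insert p ?A) \<le> card {l ?h<..l (?h - 1)}" by (intro card_inj_on_le) auto
  then have "Suc (off (strip l) p) \<le> l (?h - 1) - l ?h" by (simp add: off_def)
  moreover have "?h = Suc (?h - 1)" using h by simp
  ultimately show ?thesis by metis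
qed

end

end

section \<open>The form modulo an ideal\<close>

context hecke begin

lemma partition_dominates_ones:
  assumes l: "composition n l" and anti: "antimono l"
  shows "dominated (ones n) l"
  unfolding dominated_def psum_ones
proof
  fix k
  show "min k n \<le> (\<Sum>i<k. l i)"
  proof (cases "\<exists>i\<ge>k. l i \<noteq> 0")
    case True
    then obtain i where "k \<le> i" "l i \<noteq> 0" by blast
    then have "1 \<le> l j" if "j < k" for j using antimonoD [OF anti, of j i] that by simp
    then have "(\<Sum>i<k. 1) \<le> (\<Sum>i<k. l i)" by (intro sum_mono) auto
    then show ?thesis by simp
  next
    case False
    obtain r0 where r0: "\<forall>r\<ge>r0. (\<Sum>i<r. l i) = n" using composition_psum [OF l] by blast
    have "(\<Sum>i<k + r0. l i) = (\<Sum>i<k. l i)"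
      using False by (intro sum.mono_neutral_right) auto
    then show ?thesis using r0 by simp
  qed
qed

text \<open>The vector of an impossible weight is zero, so its coefficient times \<open>m l\<close>
  lies in the higher part, and \<open>m_free\<close> makes the coefficient vanish. As
  \<open>pr\<close> is computed formally from weights, this is a statement about quantum
  integers.\<close>

lemma pr_invalid:
  assumes l: "composition n l" and anti: "antimono l"
    and I: "\<not> valid (wtF (wt0 l) I)" "wtE (wtF (wt0 l) I) J = wt0 l"
  shows "pr (wt0 l) J I = \<zero>"
proof -
  let ?c = "pr (wt0 l) J I"
  have g: "good (wt0 l) (m l)" using l good_m by blast
  have 0: "FV (wt0 l) (m l) I = \<^bold>0" using good_FV [OF g, of I] I(1) by (simp add: good_def)
  obtain a where a: "a \<in> WS False l (wt0 l)" "EV (wtF (wt0 l) I) (FV (wt0 l) (m l) I) J = a \<^bold>+ \<iota> ?c \<cdot> m l"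
    using EV_FV [OF l I(2)] by blast
  have ac: "a \<in> carrier H" using WS_closed [OF a(1) l] .
  have "a \<^bold>+ \<iota> ?c \<cdot> m l = \<^bold>0" using a(2) linopD(5) [OF linop_EV] by (simp add: 0)
  then have "\<iota> ?c \<cdot> m l = \<ominus>\<^bsub>H\<^esub> a" using ac l by (metis H.minus_equality H.m_closed H.a_comm \<iota>_closed m_closed pr_closed)
  moreover have "valid (wt0 l)" using l by (simp add: valid_def) (simp add: wt0_def)
  then have "a \<in> M_above l l l" using WS_above [OF a(1) l] by simp
  ultimately have "\<iota> ?c \<cdot> m l \<in> M_above l l l" using M_above_ops(3) by simp
  then show ?thesis using m_free [OF l anti] by simp
qed

text \<open>\<open>highest_weight_form\<close> provides some coefficient, and
  \<open>form_eval\<close> identifies it with a value that is independent of the words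
  chosen.\<close>

lemma form_decomposition:
  assumes l: "composition n l" and anti: "antimono l" and h: "h \<in> carrier H"
  shows "\<exists>a\<in>M_above l l l. m l \<cdot> h \<cdot> m l = a \<^bold>+ \<iota> (act (m l \<cdot> h \<cdot> m l) (delta (rw l)) (rw l)) \<cdot> m l"
proof -
  obtain J where "\<forall>h\<in>carrier H. \<exists>a\<in>WS False l (wt0 l). \<exists>L. weighted (wt0 l) (wt0 (ones n)) L \<and>
       m l \<cdot> h \<cdot> m l = a \<^bold>+ \<iota> (klc (pr (wt0 l) J) L) \<cdot> m l"
    using highest_weight_form [OF l partition_dominates_ones [OF l anti]] by blast
  then obtain a L where a: "a \<in> WS False l (wt0 l)" "weighted (wt0 l) (wt0 (ones n)) L"
    "m l \<cdot> h \<cdot> m l = a \<^bold>+ \<iota> (klc (pr (wt0 l) J) L) \<cdot> m l"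
    using h by meson
  have "valid (wt0 l)" using l by (simp add: valid_def) (simp add: wt0_def)
  then have aM: "a \<in> M_above l l l" using WS_above [OF a(1) l] by simp
  have kc: "klc (pr (wt0 l) J) L \<in> carrier K" by (rule klc_closed [OF pr_closed a(2)])
  show ?thesis
    unfolding a(3) form_eval [OF l anti aM kc] using aM by blast
qed

text \<open>The recursion \<open>qi_Suc\<close> propagates the congruence from the base [e] - [0]
  upwards by multiplication with q and downwards with its inverse.\<close>

lemma qi_shift:
  assumes Z: "ideal Z K" and e: "qint e \<in> Z"
  shows "qi z \<ominus> qi (z - int e) \<in> Z"
proof (induction z rule: int_induct [where k = "int e"])
  case base
  then show ?case using e qi_of_nat [of "int e"] qi_of_nat [of 0] by (simp add: a_minus_def)
next
  case (step1 z)
  have "qi (z + 1 - int e) = \<one> \<oplus> q \<otimes> qi (z - int e)" using qi_Suc [of "z - int e"] by (simp add: algebra_simps)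
  moreover have "(\<one> \<oplus> q \<otimes> x) \<ominus> (\<one> \<oplus> q \<otimes> y) = q \<otimes> (x \<ominus> y)" if "x \<in> carrier K" "y \<in> carrier K" for x y
    using that q_closed by algebra
  ultimately have "qi (z + 1) \<ominus> qi (z + 1 - int e) = q \<otimes> (qi z \<ominus> qi (z - int e))"
    using qi_Suc [of z] by simp
  then show ?case using ideal.I_l_closed [OF Z step1(2) q_closed] by simp
next
  case (step2 z)
  have "qi (z - int e) = \<one> \<oplus> q \<otimes> qi (z - 1 - int e)" using qi_Suc [of "z - 1 - int e"] by (simp add: algebra_simps)
  moreover have "inv q \<otimes> ((\<one> \<oplus> q \<otimes> x) \<ominus> (\<one> \<oplus> q \<otimes> y)) = x \<ominus> y" if xy: "x \<in> carrier K" "y \<in> carrier K" for x y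
  proof -
    have "(\<one> \<oplus> q \<otimes> x) \<ominus> (\<one> \<oplus> q \<otimes> y) = q \<otimes> (x \<ominus> y)"
      using xy q_closed by algebra
    then show ?thesis using xy q_unit by (simp add: m_assoc [symmetric])
  qed
  ultimately have "qi (z - 1) \<ominus> qi (z - 1 - int e) = inv q \<otimes> (qi z \<ominus> qi (z - int e))"
    using qi_Suc [of "z - 1"] by simp
  then show ?case using ideal.I_l_closed [OF Z step2(2) qinv_closed] by simp
qed

lemma klc_cong:
  assumes Z: "ideal Z K"
    and L: "list_all2 (\<lambda>x y. fst x \<in> carrier K \<and> fst y \<in> carrier K \<and> fst x \<ominus> fst y \<in> Z \<and> snd x = snd y) L L'"
    and f: "\<And>I. f I \<in> carrier K" "\<And>I. g I \<in> carrier K" "\<And>I. f I \<ominus> g I \<in> Z"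
  shows "klc f L \<in> carrier K \<and> klc g L' \<in> carrier K \<and> klc f L \<ominus> klc g L' \<in> Z"
  using L
proof (induction rule: list_all2_induct)
  case Nil
  then show ?case using additive_subgroup.zero_closed [OF ideal.axioms(1) [OF Z]] by (simp add: a_minus_def)
next
  case (Cons x L y L')
  define a b c d u v where ab: "a = fst x" "b = fst y" "c = f (snd x)" "d = g (snd x)" "u = klc f L" "v = klc g L'"
  have cl: "a \<in> carrier K" "b \<in> carrier K" "c \<in> carrier K" "d \<in> carrier K" "u \<in> carrier K" "v \<in> carrier K"
    using Cons f by (simp_all add: ab)
  have "a \<ominus> b \<in> Z" "c \<ominus> d \<in> Z" "u \<ominus> v \<in> Z" using Cons f by (simp_all add: ab)
  then have "(a \<otimes> (c \<ominus> d) \<oplus> (a \<ominus> b) \<otimes> d) \<oplus> (u \<ominus> v) \<in> Z"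
    using cl by (intro additive_subgroup.a_closed [OF ideal.axioms(1) [OF Z]] ideal.I_l_closed [OF Z] ideal.I_r_closed [OF Z]) auto
  moreover have "(a \<otimes> (c \<ominus> d) \<oplus> (a \<ominus> b) \<otimes> d) \<oplus> (u \<ominus> v) = (a \<otimes> c \<oplus> u) \<ominus> (b \<otimes> d \<oplus> v)"
    using cl by algebra
  ultimately show ?case using Cons cl by (simp add: ab)
qed

lemma cm_cong:
  assumes Z: "ideal Z K" and qs: "\<And>k z. qi (z + \<delta> k) \<ominus> qi z \<in> Z"
  shows "list_all2 (\<lambda>x y. fst x \<in> carrier K \<and> fst y \<in> carrier K \<and> fst x \<ominus> fst y \<in> Z \<and> snd x = snd y)
    (cm (\<lambda>k. \<mu> k + \<delta> k) j I) (cm \<mu> j I)"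
proof (induction I)
  case (Cons i I)
  let ?R = "\<lambda>x y. fst x \<in> carrier K \<and> fst y \<in> carrier K \<and> fst x \<ominus> fst y \<in> Z \<and> snd x = snd y"
  have prep: "list_all2 ?R (prep i (cm (\<lambda>k. \<mu> k + \<delta> k) j I)) (prep i (cm \<mu> j I))"
    using Cons by (simp add: prep_def list_all2_map1 list_all2_map2)
  have "(qi (x + \<delta> i) \<ominus> qi (y + \<delta> (Suc i))) \<ominus> (qi x \<ominus> qi y) \<in> Z" for x y
  proof -
    define a b c d where ab: "a = qi (x + \<delta> i)" "b = qi (y + \<delta> (Suc i))" "c = qi x" "d = qi y"
    have cl: "a \<in> carrier K" "b \<in> carrier K" "c \<in> carrier K" "d \<in> carrier K" by (simp_all add: ab)
    have "(a \<ominus> c) \<oplus> (\<ominus> \<one>) \<otimes> (b \<ominus> d) \<in> Z"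
      using qs [of x i] qs [of y "Suc i"] unfolding ab
      by (intro additive_subgroup.a_closed [OF ideal.axioms(1) [OF Z]] ideal.I_l_closed [OF Z]) auto
    moreover have "(a \<ominus> c) \<oplus> (\<ominus> \<one>) \<otimes> (b \<ominus> d) = (a \<ominus> b) \<ominus> (c \<ominus> d)"
      using cl by algebra
    ultimately show ?thesis by (simp add: ab)
  qed
  then show ?case using prep by (auto simp: wtF_add intro!: list_all2_appendI)
qed simp

text \<open>Weights enter \<open>pr\<close> through values of \<open>qi\<close> alone, so replacing
  these by congruent values changes the result by an element of the ideal.\<close>

lemma pr_cong:
  assumes Z: "ideal Z K" and qs: "\<And>k z. qi (z + \<delta> k) \<ominus> qi z \<in> Z"
  shows "pr (\<lambda>k. \<mu> k + \<delta> k) J I \<ominus> pr \<mu> J I \<in> Z"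
proof (induction J arbitrary: I)
  case Nil
  then show ?case using additive_subgroup.zero_closed [OF ideal.axioms(1) [OF Z]] by (simp add: a_minus_def r_neg)
next
  case (Cons j J)
  show ?case using klc_cong [OF Z cm_cong [OF Z qs] pr_closed pr_closed Cons] by simp
qed

lemma form_in_ideal:
  assumes l: "composition n l" and anti: "antimono l" and Z: "ideal Z K"
    and e: "2 \<le> e" "e \<le> l r - l (Suc r)" "qint e \<in> Z" and h: "h \<in> carrier H"
  shows "act (m l \<cdot> h \<cdot> m l) (delta (rw l)) (rw l) \<in> Z"
proof -
  \<comment> \<open>Takes away e columns of length r + 1. The bound on e keeps the rows decreasing;
    the result is a partition of a smaller number \<open>n'\<close>.\<close>
  define \<delta> where "\<delta> k = (if k \<le> r then - int e else 0)" for k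
  define l' where "l' k = (if k \<le> r then l k - e else l k)" for k
  have ge: "e \<le> l k" if "k \<le> r" for k using antimonoD [OF anti that] e by simp
  have wt: "(\<lambda>k. wt0 l k + \<delta> k) = wt0 l'" using ge by (auto simp: wt0_def l'_def \<delta>_def of_nat_diff)
  have anti': "antimono l'"
  proof (rule antimonoI)
    fix i j :: nat assume ij: "i \<le> j"
    have "l (Suc r) + e \<le> l i" if "i \<le> r" using antimonoD [OF anti that] e by simp
    moreover have "l j \<le> l (Suc r)" if "\<not> j \<le> r" using antimonoD [OF anti, of "Suc r" j] that by simp
    ultimately show "l' j \<le> l' i" using antimonoD [OF anti ij] ij by (auto simp: l'_def)
  qed
  define n' where "n' = (\<Sum>i | l' i \<noteq> 0. l' i)"
  have l': "composition n' l'"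
  proof -
    have "finite {i. l' i \<noteq> 0}"
      by (rule finite_subset [of _ "{i. l i \<noteq> 0}"]) (use l in \<open>auto simp: composition_def l'_def split: if_splits\<close>)
    then show ?thesis by (simp add: composition_def n'_def)
  qed
  \<comment> \<open>The shifted coefficient is interpreted in the Hecke algebra of rank
    \<open>n'\<close>; \<open>pr\<close> depends on the ring and \<open>q\<close> and is common to
    both algebras.\<close>
  interpret H': hecke K q n' by unfold_locales (rule q_unit)
  obtain J where J: "wtE (wt0 (ones n)) J = wt0 l" "\<forall>h\<in>carrier H. \<exists>a\<in>WS False l (wt0 l). \<exists>L. weighted (wt0 l) (wt0 (ones n)) L \<and>
       m l \<cdot> h \<cdot> m l = a \<^bold>+ \<iota> (klc (pr (wt0 l) J) L) \<cdot> m l"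
    using highest_weight_form [OF l partition_dominates_ones [OF l anti]] by blast
  then obtain a L where a: "a \<in> WS False l (wt0 l)" "weighted (wt0 l) (wt0 (ones n)) L"
    "m l \<cdot> h \<cdot> m l = a \<^bold>+ \<iota> (klc (pr (wt0 l) J) L) \<cdot> m l"
    using h by meson
  have qs: "qi (z + \<delta> k) \<ominus> qi z \<in> Z" for k z
  proof (cases "k \<le> r")
    case True
    have "(\<ominus> \<one>) \<otimes> (qi z \<ominus> qi (z - int e)) \<in> Z" by (intro ideal.I_l_closed [OF Z] qi_shift [OF Z e(3)]) simp
    moreover have "(\<ominus> \<one>) \<otimes> (x \<ominus> y) = y \<ominus> x" if "x \<in> carrier K" "y \<in> carrier K" for x y
      using that by algebra
    ultimately show ?thesis using True by (simp add: \<delta>_def)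
  next
    case False
    then show ?thesis using additive_subgroup.zero_closed [OF ideal.axioms(1) [OF Z]] by (simp add: \<delta>_def a_minus_def r_neg)
  qed
  have prZ: "pr (wt0 l) J I \<in> Z" if I: "wtF (wt0 l) I = wt0 (ones n)" for I
  proof -
    have F: "wtF (wt0 l') I = (\<lambda>k. wt0 (ones n) k + \<delta> k)" using wtF_add [of "wt0 l" \<delta> I] by (simp add: wt I)
    have E: "wtE (wtF (wt0 l') I) J = wt0 l'" using wtE_add [of "wt0 (ones n)" \<delta> J] by (simp add: F J(1) wt)
    \<comment> \<open>The first entry of the weight of single boxes is at most 1, so
      \<open>e \<ge> 2\<close> makes it negative.\<close>
    have "wtF (wt0 l') I 0 < 0" using e(1) by (simp add: F \<delta>_def wt0_def ones_def)
    then have "\<not> H'.valid (wtF (wt0 l') I)" by (auto simp: H'.valid_def not_le [symmetric])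
    from H'.pr_invalid [OF l' anti' this E] have "pr (wt0 l') J I = \<zero>" .
    then have "\<zero> \<ominus> pr (wt0 l) J I \<in> Z" using pr_cong [OF Z, of \<delta> "wt0 l" J I] qs by (simp add: wt)
    then have "(\<ominus> \<one>) \<otimes> (\<zero> \<ominus> pr (wt0 l) J I) \<in> Z" by (intro ideal.I_l_closed [OF Z]) auto
    then show ?thesis by (simp add: l_minus minus_eq del: pr.simps)
  qed
  have klcZ: "klc (pr (wt0 l) J) L \<in> Z" using a(2)
  proof (induction L)
    case Nil
    then show ?case using additive_subgroup.zero_closed [OF ideal.axioms(1) [OF Z]] by simp
  next
    case (Cons x L)
    then show ?case
      using prZ by (auto intro!: additive_subgroup.a_closed [OF ideal.axioms(1) [OF Z]] ideal.I_l_closed [OF Z] simp del: pr.simps)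
  qed
  have "valid (wt0 l)" using l by (simp add: valid_def) (simp add: wt0_def)
  then have aM: "a \<in> M_above l l l" using WS_above [OF a(1) l] by simp
  have kc: "klc (pr (wt0 l) J) L \<in> carrier K" by (rule klc_closed [OF pr_closed a(2)])
  show ?thesis
    unfolding a(3) form_eval [OF l anti aM kc] by (rule klcZ)
qed

text \<open>Lowering words alone reach weights dominated by \<open>l\<close>. For any other
  \<open>k\<close>, each contributing word has a raising part and lies in the higher part.\<close>

lemma cross_form:
  assumes l: "composition n l" "antimono l" and k: "composition n k" "antimono k"
    and nd: "\<not> dominated k l" and h: "h \<in> carrier H"
  shows "m k \<cdot> h \<cdot> m l \<in> M_above l l k"
proof -
  obtain J where J: "wtE (wt0 (ones n)) J = wt0 k" "\<And>x. x \<in> carrier H \<Longrightarrow> EV (wt0 (ones n)) x J = m k \<cdot> x"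
    using split_merge [OF k(1) partition_dominates_ones [OF k]] by blast
  have "h \<cdot> m l \<in> WS True l (wt0 (ones n))" by (rule all_words [OF l(1) partition_dominates_ones [OF l] h])
  from WS_EV [OF this l(1), of J] have "m k \<cdot> h \<cdot> m l \<in> WS True l (wt0 k)"
    using J h l k by (simp add: H.m_assoc)
  then obtain b L where b: "b \<in> WS False l (wt0 k)" "weighted (wt0 l) (wt0 k) L" "m k \<cdot> h \<cdot> m l = b \<^bold>+ lc (wt0 l) (m l) L"
    using WS_decomp l(1) by blast
  have "L = []"
  proof (rule ccontr)
    assume "L \<noteq> []"
    then obtain x L' where "L = x # L'" by (cases L) auto
    then have I: "wtF (wt0 l) (snd x) = wt0 k" using b(2) by simp
    have "psum k j \<le> psum l j" for j
    proof (cases j)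
      case (Suc i)
      have "int (psum k (Suc i)) = int (psum l (Suc i)) - int (count_list (snd x) i)"
        using isum_wtF [of "wt0 l" "snd x" i] unfolding I isum_wt0 .
      then have "int (psum k j) \<le> int (psum l j)" unfolding Suc by linarith
      then show ?thesis by (simp only: of_nat_le_iff)
    qed simp
    then show False using nd by (simp add: dominated_def)
  qed
  then have "m k \<cdot> h \<cdot> m l = b" using b(3) WS_closed [OF b(1) l(1)] by simp
  moreover have "valid (wt0 k)" using k by (simp add: valid_def) (simp add: wt0_def)
  ultimately show ?thesis using WS_above [OF b(1) l(1)] by simp
qed

end

section \<open>Exchanging adjacent rows\<close>

context hecke begin

text \<open>Exchanges two adjacent blocks of lengths \<open>a\<close> and \<open>b\<close> after
  position \<open>c\<close> and keeps the order inside each block, so that generators inside a block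
  are transported.\<close>

definition exch :: "nat \<Rightarrow> nat \<Rightarrow> nat \<Rightarrow> nat \<Rightarrow> nat" where
  "exch c a b p = (if c < p \<and> p \<le> c + a then p + b else if c + a < p \<and> p \<le> c + a + b then p - a else p)"

lemma exch_permutes: "c + a + b \<le> n \<Longrightarrow> exch c a b permutes {1..n}"
proof (rule bij_imp_permutes)
  assume "c + a + b \<le> n"
  then show "bij_betw (exch c a b) {1..n} {1..n}"
    by (intro bij_betw_byWitness [of _ "exch c b a"]) (auto simp: exch_def split: if_splits)
  show "exch c a b p = p" if "p \<notin> {1..n}" for p
    using that \<open>c + a + b \<le> n\<close> by (auto simp: exch_def)
qed

lemma exch_transport:
  assumes "c + a + b \<le> n" "exch c a b (Suc j) = Suc (exch c a b j)"
  shows "N (exch c a b) \<cdot> t j = t (exch c a b j) \<cdot> N (exch c a b)"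
proof (cases "1 \<le> j \<and> j < n")
  case True
  then show ?thesis using transport [OF exch_permutes [OF assms(1)], of j] assms by simp
next
  case False
  then have "exch c a b j = j" using assms by (auto simp: exch_def)
  moreover have "t j = \<^bold>1" using False by (auto simp: t_def)
  ultimately show ?thesis by simp
qed

lemma two_rows_exch:
  assumes l: "composition n l" and l': "l' i = l (Suc i)" "l' (Suc i) = l i" "\<And>k. k \<noteq> i \<Longrightarrow> k \<noteq> Suc i \<Longrightarrow> l' k = l k"
    and comp: "composition n l'"
  shows "N (exch (psum l i) (l i) (l (Suc i))) \<cdot> m l = m l' \<cdot> N (exch (psum l i) (l i) (l (Suc i)))"
proof -
  define a b c where abc: "a = l i" "b = l (Suc i)" "c = psum l i"
  define x where "x = N (exch c a b)"
  have le: "c + a + b \<le> n" using composition_psum_le [OF l, of "Suc (Suc i)"] by (simp add: abc)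
  have xc: "x \<in> carrier H" by (simp add: x_def)
  have pi: "psum l' i = c" unfolding abc using l'(3) by (intro sum.cong) auto
  have 1: "x \<cdot> sy c a = sy (c + b) a \<cdot> x"
    by (rule sy_shift [OF xc]) (use exch_transport [OF le] in \<open>simp add: x_def exch_def add.commute add.left_commute\<close>)
  have 2: "x \<cdot> sy (c + a) b = sy c b \<cdot> x"
  proof (rule sy_shift [OF xc])
    fix j assume j: "1 \<le> j" "j < b"
    show "x \<cdot> t (c + a + j) = t (c + j) \<cdot> x"
      using exch_transport [OF le, of "c + a + j"] j by (simp add: x_def exch_def)
  qed
  have cm: "sy (c + b) a \<cdot> sy c b = sy c b \<cdot> sy (c + b) a"
    by (rule gen_commute [OF sy_gen sy_gen, symmetric]) auto
  have rel: "x \<cdot> two_rows l i = two_rows l' i \<cdot> x"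
  proof -
    have "x \<cdot> (sy c a \<cdot> sy (c + a) b) = sy (c + b) a \<cdot> (x \<cdot> sy (c + a) b)"
      using xc by (simp add: H.m_assoc [symmetric] 1)
    also have "\<dots> = sy c b \<cdot> sy (c + b) a \<cdot> x" unfolding 2 using xc cm by (simp add: H.m_assoc [symmetric])
    finally show ?thesis using pi l' by (simp add: two_rows_def abc [symmetric])
  qed
  have far: "x \<cdot> t j = t j \<cdot> x" if "j < c \<or> j > c + a + b" for j
    using exch_transport [OF le, of j] that unfolding x_def by (auto simp: exch_def)
  have "x \<cdot> m l = m l' \<cdot> x"
  proof (rule two_rows_intertwine [OF l comp _ _ xc _ xc _ rel])
    show "psum l (Suc (Suc i)) = psum l' (Suc (Suc i))" using pi l' by (simp add: abc)
  qed (use l' far in \<open>auto simp: abc\<close>)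
  then show ?thesis by (simp add: x_def abc)
qed

text \<open>The quadratic relation reads (t + 1 - q) t = q, and q is a unit.\<close>

lemma N_left_inverse:
  assumes "w permutes {1..n}"
  shows "\<exists>y\<in>carrier H. y \<cdot> N w = \<^bold>1"
proof -
  have gen: "\<exists>y\<in>carrier H. y \<cdot> t i = \<^bold>1" if i: "i \<in> {1..<n}" for i
  proof -
    have "t i \<cdot> (\<^bold>1 \<^bold>+ t i) = \<iota> q \<cdot> (\<^bold>1 \<^bold>+ t i)" using t_quad i by simp
    then have "t i \<cdot> t i \<^bold>+ t i = \<iota> q \<^bold>+ \<iota> q \<cdot> t i" by (simp add: H.r_distr H.a_comm)
    then have "t i \<cdot> t i \<^bold>+ t i \<^bold>+ \<ominus>\<^bsub>H\<^esub> (\<iota> q \<cdot> t i) = \<iota> q"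
      using H.a_assoc H.r_neg by simp
    moreover have "(t i \<^bold>+ \<^bold>1 \<^bold>+ \<ominus>\<^bsub>H\<^esub> \<iota> q) \<cdot> t i = t i \<cdot> t i \<^bold>+ t i \<^bold>+ \<ominus>\<^bsub>H\<^esub> (\<iota> q \<cdot> t i)"
      by (simp add: H.l_distr H.l_minus)
    ultimately have "\<iota> (inv q) \<cdot> (t i \<^bold>+ \<^bold>1 \<^bold>+ \<ominus>\<^bsub>H\<^esub> \<iota> q) \<cdot> t i = \<iota> (inv q) \<cdot> \<iota> q" by (simp add: H.m_assoc)
    also have "\<dots> = \<^bold>1" using q_unit by (simp add: \<iota>_mult [symmetric])
    finally show ?thesis by (intro bexI [of _ "\<iota> (inv q) \<cdot> (t i \<^bold>+ \<^bold>1 \<^bold>+ \<ominus>\<^bsub>H\<^esub> \<iota> q)"]) simp_all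
  qed
  have "\<exists>y\<in>carrier H. y \<cdot> Tw w = \<^bold>1" if "set w \<subseteq> {1..<n}" for w
    using that
  proof (induction w)
    case (Cons i w)
    then obtain y z where y: "y \<in> carrier H" "y \<cdot> Tw w = \<^bold>1" "z \<in> carrier H" "z \<cdot> t i = \<^bold>1" using gen [of i] by auto
    have "y \<cdot> z \<cdot> Tw (i # w) = y \<cdot> (z \<cdot> t i) \<cdot> Tw w" using y(1,3) by (simp add: H.m_assoc)
    also have "y \<cdot> (z \<cdot> t i) = y" unfolding y(4) using y(1) by simp
    finally have "y \<cdot> z \<cdot> Tw (i # w) = \<^bold>1" unfolding y(2) .
    then show ?case by (rule bexI) (use y in simp)
  qed (auto intro: bexI [of _ "\<^bold>1"])
  then show ?thesis using nf_reduced [OF assms] by (simp add: N_def)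
qed

text \<open>Shows that \<open>m l\<close> factors through the symmetrizer with the longer row moved
  up, which is higher in dominance order. A maximal weight of a module is therefore a partition
  (\<open>exists_highest\<close>).\<close>

lemma exch_rows:
  assumes l: "composition n l" and lt: "l i < l (Suc i)"
  defines "l' \<equiv> l(i := l (Suc i), Suc i := l i)"
  shows "composition n l'" "\<exists>x\<in>carrier H. \<exists>y\<in>carrier H. m l = x \<cdot> m l' \<cdot> y"
    "\<And>k. psum l' k = psum l k + (if k = Suc i then l (Suc i) - l i else 0)"
proof -
  have ps: "psum l' k = psum l k + (if k = Suc i then l (Suc i) - l i else 0)" for k
  proof (induction k)
    case (Suc k)
    then show ?case using lt by (auto simp: l'_def)
  qed simp
  then show "\<And>k. psum l' k = psum l k + (if k = Suc i then l (Suc i) - l i else 0)" .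
  obtain r0 where "\<forall>r\<ge>r0. psum l r = n" using composition_psum [OF l] by blast
  then have "\<forall>r\<ge>r0 + Suc (Suc i). psum l' r = n" using ps by simp
  then have r1: "\<exists>r0. \<forall>r\<ge>r0. psum l' r = n" by blast
  show c: "composition n l'"
  proof -
    have "finite {k. l' k \<noteq> 0}"
      by (rule finite_subset [of _ "{k. l k \<noteq> 0} \<union> {i, Suc i}"]) (use l in \<open>auto simp: composition_def l'_def split: if_splits\<close>)
    then obtain r where r: "\<forall>k\<in>{k. l' k \<noteq> 0}. k < r" using finite_nat_set_iff_bounded by blast
    obtain r0 where r0: "\<forall>r\<ge>r0. psum l' r = n" using r1 by blast
    have "(\<Sum>k | l' k \<noteq> 0. l' k) = psum l' (r + r0)"
      by (rule sum.mono_neutral_left) (use r in \<open>auto intro: trans_less_add1\<close>)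
    then show ?thesis using r0 \<open>finite {k. l' k \<noteq> 0}\<close> by (simp add: composition_def)
  qed
  let ?d = "exch (psum l i) (l i) (l (Suc i))"
  have "psum l i + l i + l (Suc i) \<le> n" using composition_psum_le [OF l, of "Suc (Suc i)"] by simp
  then obtain y where y: "y \<in> carrier H" "y \<cdot> N ?d = \<^bold>1" using N_left_inverse [OF exch_permutes] by blast
  have "N ?d \<cdot> m l = m l' \<cdot> N ?d" by (rule two_rows_exch [OF l _ _ _ c]) (auto simp: l'_def)
  then have "y \<cdot> m l' \<cdot> N ?d = y \<cdot> N ?d \<cdot> m l" using y(1) c l by (simp add: H.m_assoc)
  also have "\<dots> = m l" unfolding y(2) using l by simp
  finally show "\<exists>x\<in>carrier H. \<exists>y\<in>carrier H. m l = x \<cdot> m l' \<cdot> y" using y(1) by (metis N_closed)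
qed

end

section \<open>Simple modules\<close>

lemma left_module_of_ops:
  assumes R: "ring R" and M: "abelian_group M"
    and "\<And>a x. a \<in> carrier R \<Longrightarrow> x \<in> carrier M \<Longrightarrow> a \<odot>\<^bsub>M\<^esub> x \<in> carrier M"
    and "\<And>a b x. a \<in> carrier R \<Longrightarrow> b \<in> carrier R \<Longrightarrow> x \<in> carrier M \<Longrightarrow>
      (a \<oplus>\<^bsub>R\<^esub> b) \<odot>\<^bsub>M\<^esub> x = a \<odot>\<^bsub>M\<^esub> x \<oplus>\<^bsub>M\<^esub> b \<odot>\<^bsub>M\<^esub> x"
    and "\<And>a x y. a \<in> carrier R \<Longrightarrow> x \<in> carrier M \<Longrightarrow> y \<in> carrier M \<Longrightarrow>
      a \<odot>\<^bsub>M\<^esub> (x \<oplus>\<^bsub>M\<^esub> y) = a \<odot>\<^bsub>M\<^esub> x \<oplus>\<^bsub>M\<^esub> a \<odot>\<^bsub>M\<^esub> y"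
    and "\<And>a b x. a \<in> carrier R \<Longrightarrow> b \<in> carrier R \<Longrightarrow> x \<in> carrier M \<Longrightarrow>
      (a \<otimes>\<^bsub>R\<^esub> b) \<odot>\<^bsub>M\<^esub> x = a \<odot>\<^bsub>M\<^esub> (b \<odot>\<^bsub>M\<^esub> x)"
    and "\<And>x. x \<in> carrier M \<Longrightarrow> \<one>\<^bsub>R\<^esub> \<odot>\<^bsub>M\<^esub> x = x"
  shows "left_module R M"
  using assms by (intro left_module.intro left_module_axioms.intro) auto

context left_module begin

lemma smult_r_zero [simp]: "a \<in> carrier R \<Longrightarrow> a \<odot>\<^bsub>M\<^esub> \<zero>\<^bsub>M\<^esub> = \<zero>\<^bsub>M\<^esub>"
  using smult_r_distr [of a "\<zero>\<^bsub>M\<^esub>" "\<zero>\<^bsub>M\<^esub>"] smult_closed [of a "\<zero>\<^bsub>M\<^esub>"]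
  by (metis M.add.l_cancel_one M.l_zero M.zero_closed)

lemma smult_l_zero [simp]: "x \<in> carrier M \<Longrightarrow> \<zero>\<^bsub>R\<^esub> \<odot>\<^bsub>M\<^esub> x = \<zero>\<^bsub>M\<^esub>"
  using smult_l_distr [of "\<zero>\<^bsub>R\<^esub>" "\<zero>\<^bsub>R\<^esub>" x] smult_closed [of "\<zero>\<^bsub>R\<^esub>" x]
  by (metis M.add.l_cancel_one R.l_zero R.zero_closed)

lemma smult_l_minus: "a \<in> carrier R \<Longrightarrow> x \<in> carrier M \<Longrightarrow> (\<ominus>\<^bsub>R\<^esub> a) \<odot>\<^bsub>M\<^esub> x = \<ominus>\<^bsub>M\<^esub> (a \<odot>\<^bsub>M\<^esub> x)"
  using smult_l_distr [of "\<ominus>\<^bsub>R\<^esub> a" a x] smult_closed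
  by (intro M.minus_equality [symmetric]) (simp_all add: R.l_neg)

lemma smult_r_minus: "a \<in> carrier R \<Longrightarrow> x \<in> carrier M \<Longrightarrow> a \<odot>\<^bsub>M\<^esub> (\<ominus>\<^bsub>M\<^esub> x) = \<ominus>\<^bsub>M\<^esub> (a \<odot>\<^bsub>M\<^esub> x)"
  using smult_r_distr [of a "\<ominus>\<^bsub>M\<^esub> x" x] smult_closed
  by (intro M.minus_equality [symmetric]) (simp_all add: M.l_neg)

lemma neg_smult: "x \<in> carrier M \<Longrightarrow> \<ominus>\<^bsub>M\<^esub> x = (\<ominus>\<^bsub>R\<^esub> \<one>\<^bsub>R\<^esub>) \<odot>\<^bsub>M\<^esub> x"
  by (simp add: smult_l_minus smult_one)

lemma submoduleI:
  assumes "S \<subseteq> carrier M" "\<zero>\<^bsub>M\<^esub> \<in> S" "\<And>x y. x \<in> S \<Longrightarrow> y \<in> S \<Longrightarrow> x \<oplus>\<^bsub>M\<^esub> y \<in> S"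
    "\<And>a x. a \<in> carrier R \<Longrightarrow> x \<in> S \<Longrightarrow> a \<odot>\<^bsub>M\<^esub> x \<in> S"
  shows "submodule S R M"
proof (intro submodule.intro subgroup.intro submodule_axioms.intro)
  fix x assume x: "x \<in> S"
  then have "\<ominus>\<^bsub>M\<^esub> x \<in> S" using assms(4) [of "\<ominus>\<^bsub>R\<^esub> \<one>\<^bsub>R\<^esub>" x] assms(1) neg_smult by auto
  then show "inv\<^bsub>add_monoid M\<^esub> x \<in> S" by (simp add: a_inv_def)
qed (use assms in auto)

lemma submoduleD:
  assumes "submodule S R M"
  shows "S \<subseteq> carrier M" "\<zero>\<^bsub>M\<^esub> \<in> S" "x \<in> S \<Longrightarrow> y \<in> S \<Longrightarrow> x \<oplus>\<^bsub>M\<^esub> y \<in> S"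
    "a \<in> carrier R \<Longrightarrow> x \<in> S \<Longrightarrow> a \<odot>\<^bsub>M\<^esub> x \<in> S"
  using subgroup.subset [OF submodule.axioms(1) [OF assms]] subgroup.one_closed [OF submodule.axioms(1) [OF assms]]
    subgroup.m_closed [OF submodule.axioms(1) [OF assms]] submodule.smult_closed [OF assms] by auto

lemma cyclic_submodule: "x \<in> carrier M \<Longrightarrow> submodule {a \<odot>\<^bsub>M\<^esub> x | a. a \<in> carrier R} R M"
proof (rule submoduleI)
  assume x: "x \<in> carrier M"
  show "{a \<odot>\<^bsub>M\<^esub> x | a. a \<in> carrier R} \<subseteq> carrier M" using x smult_closed by auto
  show "\<zero>\<^bsub>M\<^esub> \<in> {a \<odot>\<^bsub>M\<^esub> x | a. a \<in> carrier R}" using x by (auto intro!: exI [of _ "\<zero>\<^bsub>R\<^esub>"])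
  fix y z assume "y \<in> {a \<odot>\<^bsub>M\<^esub> x | a. a \<in> carrier R}" "z \<in> {a \<odot>\<^bsub>M\<^esub> x | a. a \<in> carrier R}"
  then obtain a b where "a \<in> carrier R" "b \<in> carrier R" "y = a \<odot>\<^bsub>M\<^esub> x" "z = b \<odot>\<^bsub>M\<^esub> x" by blast
  then show "y \<oplus>\<^bsub>M\<^esub> z \<in> {a \<odot>\<^bsub>M\<^esub> x | a. a \<in> carrier R}"
    using x smult_l_distr [of a b x] by (auto intro!: exI [of _ "a \<oplus>\<^bsub>R\<^esub> b"])
next
  fix b y assume x: "x \<in> carrier M" and b: "b \<in> carrier R" "y \<in> {a \<odot>\<^bsub>M\<^esub> x | a. a \<in> carrier R}"
  then obtain a where "a \<in> carrier R" "y = a \<odot>\<^bsub>M\<^esub> x" by blast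
  then show "b \<odot>\<^bsub>M\<^esub> y \<in> {a \<odot>\<^bsub>M\<^esub> x | a. a \<in> carrier R}"
    using x b smult_assoc [of b a x] by (auto intro!: exI [of _ "b \<otimes>\<^bsub>R\<^esub> a"])
qed

end

text \<open>With \<open>simple_moduleD\<close>, simplicity is used throughout in the form that every
  nonzero element generates the module.\<close>

lemma simple_moduleI:
  assumes M: "left_module R M" and ne: "x \<in> carrier M" "x \<noteq> \<zero>\<^bsub>M\<^esub>"
    and gen: "\<And>x y. x \<in> carrier M \<Longrightarrow> x \<noteq> \<zero>\<^bsub>M\<^esub> \<Longrightarrow> y \<in> carrier M \<Longrightarrow> \<exists>a\<in>carrier R. y = a \<odot>\<^bsub>M\<^esub> x"
  shows "simple_module R M"
  unfolding simple_module_def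
proof (intro conjI allI impI)
  interpret left_module R M by (rule M)
  show "carrier M \<noteq> {\<zero>\<^bsub>M\<^esub>}" using ne by auto
  fix S assume S: "submodule S R M"
  note D = submoduleD [OF S]
  show "S = {\<zero>\<^bsub>M\<^esub>} \<or> S = carrier M"
  proof (cases "S = {\<zero>\<^bsub>M\<^esub>}")
    case False
    then obtain z where z: "z \<in> S" "z \<noteq> \<zero>\<^bsub>M\<^esub>" using D(2) by blast
    have "carrier M \<subseteq> S" using gen [of z] z D(1,4) by blast
    then show ?thesis using D(1) by blast
  qed simp
qed (rule M)

lemma simple_moduleD:
  assumes "simple_module R M"
  shows "left_module R M" "\<exists>x\<in>carrier M. x \<noteq> \<zero>\<^bsub>M\<^esub>"
    "x \<in> carrier M \<Longrightarrow> x \<noteq> \<zero>\<^bsub>M\<^esub> \<Longrightarrow> y \<in> carrier M \<Longrightarrow> \<exists>a\<in>carrier R. y = a \<odot>\<^bsub>M\<^esub> x"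
proof -
  show M: "left_module R M" using assms by (simp add: simple_module_def)
  interpret left_module R M by (rule M)
  show "\<exists>x\<in>carrier M. x \<noteq> \<zero>\<^bsub>M\<^esub>" using assms M.zero_closed by (auto simp: simple_module_def)
  assume x: "x \<in> carrier M" "x \<noteq> \<zero>\<^bsub>M\<^esub>" and y: "y \<in> carrier M"
  let ?S = "{a \<odot>\<^bsub>M\<^esub> x | a. a \<in> carrier R}"
  have "x \<in> ?S" using x smult_one [of x] by (auto intro!: exI [of _ "\<one>\<^bsub>R\<^esub>"])
  then have "?S = carrier M" using assms cyclic_submodule [OF x(1)] x(2) unfolding simple_module_def by blast
  then show "\<exists>a\<in>carrier R. y = a \<odot>\<^bsub>M\<^esub> x" using y by blast
qed

lemma module_isoE:
  assumes "module_iso R M N"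
  obtains (iso) f where "bij_betw f (carrier M) (carrier N)"
    "\<And>x y. x \<in> carrier M \<Longrightarrow> y \<in> carrier M \<Longrightarrow> f (x \<oplus>\<^bsub>M\<^esub> y) = f x \<oplus>\<^bsub>N\<^esub> f y"
    "\<And>a x. a \<in> carrier R \<Longrightarrow> x \<in> carrier M \<Longrightarrow> f (a \<odot>\<^bsub>M\<^esub> x) = a \<odot>\<^bsub>N\<^esub> f x"
proof -
  obtain f where "bij_betw f (carrier M) (carrier N) \<and>
      (\<forall>x\<in>carrier M. \<forall>y\<in>carrier M. f (x \<oplus>\<^bsub>M\<^esub> y) = f x \<oplus>\<^bsub>N\<^esub> f y) \<and>
      (\<forall>a\<in>carrier R. \<forall>x\<in>carrier M. f (a \<odot>\<^bsub>M\<^esub> x) = a \<odot>\<^bsub>N\<^esub> f x)"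
    using assms unfolding module_iso_def by (elim exE)
  then show ?thesis by (intro iso [of f]) simp_all
qed

lemma module_iso_refl: "module_iso R M M"
  unfolding module_iso_def by (intro exI [of _ "\<lambda>x. x"]) (simp add: bij_betw_def)

lemma module_iso_sym:
  assumes M: "left_module R M" and MN: "module_iso R M N"
  shows "module_iso R N M"
proof -
  interpret left_module R M by (rule M)
  obtain f where b: "bij_betw f (carrier M) (carrier N)"
    and f: "\<And>x y. x \<in> carrier M \<Longrightarrow> y \<in> carrier M \<Longrightarrow> f (x \<oplus>\<^bsub>M\<^esub> y) = f x \<oplus>\<^bsub>N\<^esub> f y"
    "\<And>a x. a \<in> carrier R \<Longrightarrow> x \<in> carrier M \<Longrightarrow> f (a \<odot>\<^bsub>M\<^esub> x) = a \<odot>\<^bsub>N\<^esub> f x"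
    using MN by (rule module_isoE) blast
  let ?g = "inv_into (carrier M) f"
  have g: "?g y \<in> carrier M" "f (?g y) = y" if "y \<in> carrier N" for y
    using that b by (auto simp: bij_betw_def inv_into_into f_inv_into_f)
  have gf: "?g (f x) = x" if "x \<in> carrier M" for x using that b by (auto simp: bij_betw_def)
  show ?thesis
    unfolding module_iso_def
  proof (intro exI [of _ ?g] conjI ballI)
    show "bij_betw ?g (carrier N) (carrier M)" by (rule bij_betw_inv_into [OF b])
    fix x y assume xy: "x \<in> carrier N" "y \<in> carrier N"
    have "f (?g x \<oplus>\<^bsub>M\<^esub> ?g y) = x \<oplus>\<^bsub>N\<^esub> y" using f(1) g xy by simp
    then show "?g (x \<oplus>\<^bsub>N\<^esub> y) = ?g x \<oplus>\<^bsub>M\<^esub> ?g y" using gf g xy by (metis M.a_closed)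
  next
    fix a x assume ax: "a \<in> carrier R" "x \<in> carrier N"
    have "f (a \<odot>\<^bsub>M\<^esub> ?g x) = a \<odot>\<^bsub>N\<^esub> x" using f(2) g ax by simp
    then show "?g (a \<odot>\<^bsub>N\<^esub> x) = a \<odot>\<^bsub>M\<^esub> ?g x" using gf g ax smult_closed by metis
  qed
qed

lemma module_iso_trans:
  assumes "module_iso R M N" "module_iso R N P"
  shows "module_iso R M P"
proof -
  obtain f where f: "bij_betw f (carrier M) (carrier N)"
    "\<And>x y. x \<in> carrier M \<Longrightarrow> y \<in> carrier M \<Longrightarrow> f (x \<oplus>\<^bsub>M\<^esub> y) = f x \<oplus>\<^bsub>N\<^esub> f y"
    "\<And>a x. a \<in> carrier R \<Longrightarrow> x \<in> carrier M \<Longrightarrow> f (a \<odot>\<^bsub>M\<^esub> x) = a \<odot>\<^bsub>N\<^esub> f x"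
    using assms(1) by (rule module_isoE) blast
  obtain g where g: "bij_betw g (carrier N) (carrier P)"
    "\<And>x y. x \<in> carrier N \<Longrightarrow> y \<in> carrier N \<Longrightarrow> g (x \<oplus>\<^bsub>N\<^esub> y) = g x \<oplus>\<^bsub>P\<^esub> g y"
    "\<And>a x. a \<in> carrier R \<Longrightarrow> x \<in> carrier N \<Longrightarrow> g (a \<odot>\<^bsub>N\<^esub> x) = a \<odot>\<^bsub>P\<^esub> g x"
    using assms(2) by (rule module_isoE) blast
  have "f x \<in> carrier N" if "x \<in> carrier M" for x using f(1) that by (auto simp: bij_betw_def)
  then show ?thesis
    unfolding module_iso_def using f g bij_betw_trans [OF f(1) g(1)] by (intro exI [of _ "g \<circ> f"]) auto
qed

text \<open>Transport of the structure along the fibres of \<open>a \<mapsto> a v\<close>, where \<open>v\<close> is a generator, realizes a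
  simple module on subsets of the ring.\<close>

lemma transport_module:
  assumes M: "left_module R M" and f: "bij_betw f (carrier M) A"
  defines "g \<equiv> inv_into (carrier M) f"
  defines "N \<equiv> \<lparr>carrier = A, mult = undefined, one = undefined, ring.zero = f \<zero>\<^bsub>M\<^esub>,
    add = (\<lambda>x y. f (g x \<oplus>\<^bsub>M\<^esub> g y)), smult = (\<lambda>a x. f (a \<odot>\<^bsub>M\<^esub> g x))\<rparr>"
  shows "left_module R N" "module_iso R M N"
proof -
  interpret left_module R M by (rule M)
  have gc: "g y \<in> carrier M" "f (g y) = y" if "y \<in> A" for y
    using that f unfolding g_def by (auto simp: bij_betw_def inv_into_into f_inv_into_f)
  have gf: "g (f x) = x" "f x \<in> A" if "x \<in> carrier M" for x using that f unfolding g_def by (auto simp: bij_betw_def)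
  have sm: "a \<odot>\<^bsub>M\<^esub> g y \<in> carrier M" if "a \<in> carrier R" "y \<in> A" for a y using that gc smult_closed by simp
  have N: "carrier N = A" "\<zero>\<^bsub>N\<^esub> = f \<zero>\<^bsub>M\<^esub>" "x \<oplus>\<^bsub>N\<^esub> y = f (g x \<oplus>\<^bsub>M\<^esub> g y)" "a \<odot>\<^bsub>N\<^esub> x = f (a \<odot>\<^bsub>M\<^esub> g x)" for x y a
    by (simp_all add: N_def)
  have ab: "abelian_group N"
  proof (rule abelian_groupI)
    fix x assume "x \<in> carrier N"
    then show "\<exists>y\<in>carrier N. y \<oplus>\<^bsub>N\<^esub> x = \<zero>\<^bsub>N\<^esub>"
      using gc gf by (intro bexI [of _ "f (\<ominus>\<^bsub>M\<^esub> g x)"]) (simp_all add: N M.l_neg)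
  qed (use gc gf in \<open>simp_all add: N M.a_ac\<close>)
  show "left_module R N"
    by (rule left_module_of_ops [OF R.ring_axioms ab])
      (use gc gf sm in \<open>simp_all add: N smult_l_distr smult_r_distr smult_assoc smult_one\<close>)
  show "module_iso R M N"
    unfolding module_iso_def using f gf by (intro exI [of _ f]) (simp add: N)
qed

lemma simple_module_iso:
  assumes M: "simple_module R M" and N: "left_module R N" and MN: "module_iso R M N"
  shows "simple_module R N"
proof -
  note D = simple_moduleD [OF M]
  interpret M: left_module R M by (rule D(1))
  interpret N: left_module R N by (rule N)
  obtain f where f: "bij_betw f (carrier M) (carrier N)"
    "\<And>x y. x \<in> carrier M \<Longrightarrow> y \<in> carrier M \<Longrightarrow> f (x \<oplus>\<^bsub>M\<^esub> y) = f x \<oplus>\<^bsub>N\<^esub> f y"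
    "\<And>a x. a \<in> carrier R \<Longrightarrow> x \<in> carrier M \<Longrightarrow> f (a \<odot>\<^bsub>M\<^esub> x) = a \<odot>\<^bsub>N\<^esub> f x"
    using MN by (rule module_isoE) blast
  have fc: "f x \<in> carrier N" if "x \<in> carrier M" for x using f(1) that by (auto simp: bij_betw_def)
  have f0: "f \<zero>\<^bsub>M\<^esub> = \<zero>\<^bsub>N\<^esub>" using f(3) [of "\<zero>\<^bsub>R\<^esub>" "\<zero>\<^bsub>M\<^esub>"] fc by simp
  obtain x where x: "x \<in> carrier M" "x \<noteq> \<zero>\<^bsub>M\<^esub>" using D(2) by blast
  show ?thesis
  proof (rule simple_moduleI [OF N, of "f x"])
    show "f x \<in> carrier N" using fc x by simp
    show "f x \<noteq> \<zero>\<^bsub>N\<^esub>" using f(1) x f0 M.M.zero_closed by (metis bij_betw_def inj_on_eq_iff)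
    fix u v assume uv: "u \<in> carrier N" "u \<noteq> \<zero>\<^bsub>N\<^esub>" "v \<in> carrier N"
    obtain u' v' where "u' \<in> carrier M" "u = f u'" "v' \<in> carrier M" "v = f v'"
      using uv f(1) unfolding bij_betw_def by blast
    moreover have "u' \<noteq> \<zero>\<^bsub>M\<^esub>" using calculation uv f0 by auto
    ultimately show "\<exists>a\<in>carrier R. v = a \<odot>\<^bsub>N\<^esub> u" using D(3) [of u' v'] f(3) by auto
  qed
qed

lemma simple_module_realization:
  assumes M: "simple_module R M"
  shows "\<exists>N :: ('r, 'r set) module. simple_module (R :: ('r, 'x) ring_scheme) N \<and> module_iso R M N"
proof -
  note D = simple_moduleD [OF M]
  obtain v where v: "v \<in> carrier M" "v \<noteq> \<zero>\<^bsub>M\<^esub>" using D(2) by blast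
  define f where "f x = {a \<in> carrier R. a \<odot>\<^bsub>M\<^esub> v = x}" for x
  have "inj_on f (carrier M)"
  proof (rule inj_onI)
    fix x y assume xy: "x \<in> carrier M" "y \<in> carrier M" "f x = f y"
    obtain a where a: "a \<in> carrier R" "x = a \<odot>\<^bsub>M\<^esub> v" using D(3) [OF v xy(1)] by blast
    then have "a \<in> f y" using xy(3) by (auto simp: f_def)
    then show "x = y" using a by (simp add: f_def)
  qed
  then have b: "bij_betw f (carrier M) (f ` carrier M)" by (rule inj_on_imp_bij_betw)
  from transport_module [OF D(1) b] show ?thesis using simple_module_iso [OF M] by blast
qed

section \<open>Maps out of the tensor product\<close>

lemma hom_frag_minus:
  assumes G: "comm_group G" and h: "h \<in> hom (free_Abelian_group S) G"
    and k: "Poly_Mapping.keys a \<subseteq> S" "Poly_Mapping.keys b \<subseteq> S"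
  shows "h (a - b) = h a \<otimes>\<^bsub>G\<^esub> inv\<^bsub>G\<^esub> h b"
proof -
  interpret G: comm_group G by (rule G)
  interpret group_hom "free_Abelian_group S" G h
    by (intro group_hom.intro group_hom_axioms.intro h G.group_axioms) simp
  have "h (a \<otimes>\<^bsub>free_Abelian_group S\<^esub> inv\<^bsub>free_Abelian_group S\<^esub> b) = h a \<otimes>\<^bsub>G\<^esub> inv\<^bsub>G\<^esub> h b"
    using k by (simp only: hom_mult hom_inv G.inv_closed carrier_free_Abelian_group_iff inv_free_Abelian_group
        keys_minus mult_free_Abelian_group) (use hom_mult [of a "- b"] hom_inv [of b] in simp)
  then show ?thesis using k by simp
qed

text \<open>Identifies the image as the subgroup generated by the values on pure tensors; in this
  form the map of the theorem is used from here on.\<close>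

lemma tensor_lift:
  assumes C: "comm_group (add_monoid C)"
    and A: "\<And>x y. x \<in> carrier A \<Longrightarrow> y \<in> carrier A \<Longrightarrow> x \<oplus>\<^bsub>A\<^esub> y \<in> carrier A"
      "\<And>c x. c \<in> carrier K \<Longrightarrow> x \<in> carrier A \<Longrightarrow> c \<odot>\<^bsub>A\<^esub> x \<in> carrier A"
    and B: "\<And>x y. x \<in> carrier B \<Longrightarrow> y \<in> carrier B \<Longrightarrow> x \<oplus>\<^bsub>B\<^esub> y \<in> carrier B"
      "\<And>c x. c \<in> carrier K \<Longrightarrow> x \<in> carrier B \<Longrightarrow> c \<odot>\<^bsub>B\<^esub> x \<in> carrier B"
    and \<beta>: "\<And>x v. x \<in> carrier A \<Longrightarrow> v \<in> carrier B \<Longrightarrow> \<beta> x v \<in> carrier C"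
      "\<And>x y v. x \<in> carrier A \<Longrightarrow> y \<in> carrier A \<Longrightarrow> v \<in> carrier B \<Longrightarrow> \<beta> (x \<oplus>\<^bsub>A\<^esub> y) v = \<beta> x v \<oplus>\<^bsub>C\<^esub> \<beta> y v"
      "\<And>x v w. x \<in> carrier A \<Longrightarrow> v \<in> carrier B \<Longrightarrow> w \<in> carrier B \<Longrightarrow> \<beta> x (v \<oplus>\<^bsub>B\<^esub> w) = \<beta> x v \<oplus>\<^bsub>C\<^esub> \<beta> x w"
      "\<And>c x v. c \<in> carrier K \<Longrightarrow> x \<in> carrier A \<Longrightarrow> v \<in> carrier B \<Longrightarrow> \<beta> (c \<odot>\<^bsub>A\<^esub> x) v = \<beta> x (c \<odot>\<^bsub>B\<^esub> v)"
  shows "tensor_lift K A B C \<beta> ` carrier (tensor K A B)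
    = generate (add_monoid C) {\<beta> x v | x v. x \<in> carrier A \<and> v \<in> carrier B}"
proof -
  let ?S = "carrier A \<times> carrier B"
  let ?F = "free_Abelian_group ?S" and ?G = "add_monoid C" and ?N = "tensor_kernel K A B" and ?T = "tensor K A B"
  interpret G: comm_group ?G by (rule C)
  interpret F: comm_group ?F by (rule abelian_free_Abelian_group)
  have "(\<lambda>(x, v). \<beta> x v) ` ?S \<subseteq> carrier ?G" using \<beta>(1) by auto
  then obtain h where h: "h \<in> hom ?F ?G" and hf: "\<And>p. p \<in> ?S \<Longrightarrow> h (frag_of p) = (\<lambda>(x, v). \<beta> x v) p"
    using G.free_Abelian_group_universal by blast
  interpret h: group_hom ?F ?G h
    by (intro group_hom.intro group_hom_axioms.intro h G.group_axioms F.group_axioms)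
  note hm = hom_frag_minus [OF C h]
  have rel: "tensor_relations K A B \<subseteq> kernel ?F ?G h"
  proof
    fix r assume "r \<in> tensor_relations K A B"
    then consider
      x y v where "r = frag_of (x \<oplus>\<^bsub>A\<^esub> y, v) - frag_of (x, v) - frag_of (y, v)" "x \<in> carrier A" "y \<in> carrier A" "v \<in> carrier B"
    | x v w where "r = frag_of (x, v \<oplus>\<^bsub>B\<^esub> w) - frag_of (x, v) - frag_of (x, w)" "x \<in> carrier A" "v \<in> carrier B" "w \<in> carrier B"
    | c x v where "r = frag_of (c \<odot>\<^bsub>A\<^esub> x, v) - frag_of (x, c \<odot>\<^bsub>B\<^esub> v)" "c \<in> carrier K" "x \<in> carrier A" "v \<in> carrier B"
      unfolding tensor_relations_def by blast
    then show "r \<in> kernel ?F ?G h"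
    proof cases
      case 1
      have k: "Poly_Mapping.keys (frag_of (x \<oplus>\<^bsub>A\<^esub> y, v) - frag_of (x, v)) \<subseteq> ?S"
        using 1 A by (intro order_trans [OF keys_diff]) auto
      then have kr: "Poly_Mapping.keys r \<subseteq> ?S" unfolding 1 using 1 by (intro order_trans [OF keys_diff]) auto
      have "h r = (\<beta> x v \<otimes>\<^bsub>?G\<^esub> \<beta> y v) \<otimes>\<^bsub>?G\<^esub> inv\<^bsub>?G\<^esub> \<beta> x v \<otimes>\<^bsub>?G\<^esub> inv\<^bsub>?G\<^esub> \<beta> y v"
        unfolding 1(1) using 1 A k \<beta>(2) by (simp add: hm hf)
      also have "\<dots> = \<one>\<^bsub>?G\<^esub>"
      proof -
        have c: "\<beta> x v \<in> carrier ?G" "\<beta> y v \<in> carrier ?G" using \<beta>(1) 1 by auto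
        then have "(\<beta> x v \<otimes>\<^bsub>?G\<^esub> \<beta> y v) \<otimes>\<^bsub>?G\<^esub> inv\<^bsub>?G\<^esub> \<beta> x v = \<beta> y v"
          by (metis G.inv_closed G.m_assoc G.m_comm G.m_closed G.r_inv G.r_one)
        then show ?thesis using c G.r_inv by simp
      qed
      finally show ?thesis using kr by (simp add: kernel_def)
    next
      case 2
      have k: "Poly_Mapping.keys (frag_of (x, v \<oplus>\<^bsub>B\<^esub> w) - frag_of (x, v)) \<subseteq> ?S"
        using 2 B by (intro order_trans [OF keys_diff]) auto
      then have kr: "Poly_Mapping.keys r \<subseteq> ?S" unfolding 2 using 2 by (intro order_trans [OF keys_diff]) auto
      have "h r = (\<beta> x v \<otimes>\<^bsub>?G\<^esub> \<beta> x w) \<otimes>\<^bsub>?G\<^esub> inv\<^bsub>?G\<^esub> \<beta> x v \<otimes>\<^bsub>?G\<^esub> inv\<^bsub>?G\<^esub> \<beta> x w"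
        unfolding 2(1) using 2 B k \<beta>(3) by (simp add: hm hf)
      also have "\<dots> = \<one>\<^bsub>?G\<^esub>"
      proof -
        have c: "\<beta> x v \<in> carrier ?G" "\<beta> x w \<in> carrier ?G" using \<beta>(1) 2 by auto
        then have "(\<beta> x v \<otimes>\<^bsub>?G\<^esub> \<beta> x w) \<otimes>\<^bsub>?G\<^esub> inv\<^bsub>?G\<^esub> \<beta> x v = \<beta> x w"
          by (metis G.inv_closed G.m_assoc G.m_comm G.m_closed G.r_inv G.r_one)
        then show ?thesis using c G.r_inv by simp
      qed
      finally show ?thesis using kr by (simp add: kernel_def)
    next
      case 3
      have kr: "Poly_Mapping.keys r \<subseteq> ?S"
        unfolding 3(1) using 3 A B by (intro order_trans [OF keys_diff]) auto
      have "h r = \<beta> x (c \<odot>\<^bsub>B\<^esub> v) \<otimes>\<^bsub>?G\<^esub> inv\<^bsub>?G\<^esub> \<beta> x (c \<odot>\<^bsub>B\<^esub> v)"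
        unfolding 3(1) using 3 A B \<beta>(4) by (simp add: hm hf)
      also have "\<dots> = \<one>\<^bsub>?G\<^esub>" using \<beta>(1) 3 B by (intro G.r_inv) simp
      finally show ?thesis using kr by (simp add: kernel_def)
    qed
  qed
  then have relF: "tensor_relations K A B \<subseteq> carrier ?F" by (auto simp: kernel_def)
  have Nsub: "subgroup ?N ?F" unfolding tensor_kernel_def by (rule F.generate_is_subgroup [OF relF])
  then have N: "?N \<lhd> ?F" by (simp add: F.normal_iff_subgroup)
  have Nker: "?N \<subseteq> kernel ?F ?G h"
    unfolding tensor_kernel_def by (rule F.generate_subgroup_incl [OF rel h.subgroup_kernel])
  obtain g where g: "g \<in> hom (?F Mod ?N) ?G" and gh: "\<And>x. x \<in> carrier ?F \<Longrightarrow> g (?N #>\<^bsub>?F\<^esub> x) = h x"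
    using h.FactGroup_universal_kernel [OF N Nker] by blast
  have carT: "carrier ?T = (\<lambda>x. ?N #>\<^bsub>?F\<^esub> x) ` carrier ?F" by (simp add: tensor_def carrier_FactGroup)
  have mulT: "(?N #>\<^bsub>?F\<^esub> x) \<otimes>\<^bsub>?T\<^esub> (?N #>\<^bsub>?F\<^esub> y) = ?N #>\<^bsub>?F\<^esub> (x + y)" if "x \<in> carrier ?F" "y \<in> carrier ?F" for x y
    using normal.rcos_sum [OF N that] by (simp add: tensor_def)
  have grT: "group ?T" unfolding tensor_def by (rule normal.factorgroup_is_group [OF N])
  define g' where "g' = restrict g (carrier ?T)"
  have g'h: "g' (?N #>\<^bsub>?F\<^esub> x) = h x" if "x \<in> carrier ?F" for x using gh that carT by (simp add: g'_def)
  have pure: "pure_tensor K A B x v = ?N #>\<^bsub>?F\<^esub> frag_of (x, v)" for x v by (simp add: pure_tensor_def)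
  have "tensor_lift K A B C \<beta> = g'"
    unfolding tensor_lift_def
  proof (rule the_equality, intro conjI ballI)
    show "g' \<in> hom ?T ?G"
    proof (rule homI)
      fix X Y assume XY: "X \<in> carrier ?T" "Y \<in> carrier ?T"
      then have "X \<otimes>\<^bsub>?T\<^esub> Y \<in> carrier ?T" using grT by (simp add: group.is_monoid monoid.m_closed)
      then show "g' (X \<otimes>\<^bsub>?T\<^esub> Y) = g' X \<otimes>\<^bsub>?G\<^esub> g' Y"
        using XY hom_mult [OF g, of X Y] by (simp add: g'_def tensor_def)
    next
      fix X assume "X \<in> carrier ?T"
      then show "g' X \<in> carrier ?G" using hom_in_carrier [OF g, of X] by (simp add: g'_def tensor_def)
    qed
    show "g' \<in> extensional (carrier ?T)" by (simp add: g'_def)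
    fix x v assume "x \<in> carrier A" "v \<in> carrier B"
    then show "g' (pure_tensor K A B x v) = \<beta> x v" using g'h [of "frag_of (x, v)"] hf [of "(x, v)"] by (simp add: pure)
  next
    fix k assume k: "k \<in> hom ?T ?G \<and> k \<in> extensional (carrier ?T) \<and>
      (\<forall>x\<in>carrier A. \<forall>v\<in>carrier B. k (pure_tensor K A B x v) = \<beta> x v)"
    \<comment> \<open>Uniqueness for the description in \<open>tensor_lift\<close>: pulled back to
      the free group, a homomorphism is determined by its values on generators.\<close>
    have kF: "(\<lambda>x. k (?N #>\<^bsub>?F\<^esub> x)) \<in> hom ?F ?G"
      using k carT mulT by (auto simp: hom_def Pi_def)
    have eq: "k (?N #>\<^bsub>?F\<^esub> x) = h x" if "Poly_Mapping.keys x \<subseteq> ?S" for x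
    proof (rule free_Abelian_group_induct [OF that])
      show "k (?N #>\<^bsub>?F\<^esub> 0) = h 0"
        using hom_one [OF kF F.group_axioms G.group_axioms] hom_one [OF h F.group_axioms G.group_axioms] by simp
      show "k (?N #>\<^bsub>?F\<^esub> (x - y)) = h (x - y)"
        if "Poly_Mapping.keys x \<subseteq> ?S" "Poly_Mapping.keys y \<subseteq> ?S"
          "k (?N #>\<^bsub>?F\<^esub> x) = h x" "k (?N #>\<^bsub>?F\<^esub> y) = h y" for x y
        using hom_frag_minus [OF C kF, of x y] hm [of x y] that by simp
      show "k (?N #>\<^bsub>?F\<^esub> frag_of p) = h (frag_of p)" if "p \<in> ?S" for p
        using k hf [OF that] that by (cases p) (auto simp: pure)
    qed
    show "k = g'"
    proof (rule extensionalityI [of _ "carrier ?T"])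
      fix X assume "X \<in> carrier ?T"
      then obtain x where "X = ?N #>\<^bsub>?F\<^esub> x" "x \<in> carrier ?F" using carT by blast
      then show "k X = g' X" using eq [of x] g'h [of x] by simp
    qed (use k in \<open>auto simp: g'_def\<close>)
  qed
  then have im: "tensor_lift K A B C \<beta> ` carrier ?T = h ` carrier ?F"
    using g'h by (simp add: carT image_image)
  let ?X = "{\<beta> x v | x v. x \<in> carrier A \<and> v \<in> carrier B}"
  have Xc: "?X \<subseteq> carrier ?G" using \<beta>(1) by auto
  note gs = G.generate_is_subgroup [OF Xc]
  have "h x \<in> generate ?G ?X" if "Poly_Mapping.keys x \<subseteq> ?S" for x
  proof (rule free_Abelian_group_induct [OF that])
    show "h 0 \<in> generate ?G ?X" using hom_one [OF h F.group_axioms G.group_axioms] subgroup.one_closed [OF gs] by simp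
    show "h (x - y) \<in> generate ?G ?X"
      if "Poly_Mapping.keys x \<subseteq> ?S" "Poly_Mapping.keys y \<subseteq> ?S" "h x \<in> generate ?G ?X" "h y \<in> generate ?G ?X" for x y
      using hm [of x y] subgroup.m_closed [OF gs] subgroup.m_inv_closed [OF gs] that by simp
    show "h (frag_of p) \<in> generate ?G ?X" if "p \<in> ?S" for p
      using hf [OF that] that by (cases p) (auto intro!: generate.incl)
  qed
  moreover have "?X \<subseteq> h ` carrier ?F"
  proof
    fix z assume "z \<in> ?X"
    then obtain x v where "z = \<beta> x v" "x \<in> carrier A" "v \<in> carrier B" by blast
    then show "z \<in> h ` carrier ?F" using hf [of "(x, v)"] by (intro image_eqI [of _ _ "frag_of (x, v)"]) simp_all
  qed
  then have "generate ?G ?X \<subseteq> h ` carrier ?F"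
    by (rule G.generate_subgroup_incl [OF _ h.img_is_subgroup])
  ultimately show ?thesis unfolding im by auto
qed

section \<open>The bilinear form and the image of the Specht module\<close>

text \<open>The axioms are inherited along the surjection \<open>f\<close> from the ring; the
  structure is the cyclic module generated by the image of 1.\<close>

lemma image_left_module:
  assumes R: "ring R" and car: "carrier M = f ` carrier R"
    and zero: "f \<zero>\<^bsub>R\<^esub> = \<zero>\<^bsub>M\<^esub>"
    and add: "\<And>x y. x \<in> carrier R \<Longrightarrow> y \<in> carrier R \<Longrightarrow> f x \<oplus>\<^bsub>M\<^esub> f y = f (x \<oplus>\<^bsub>R\<^esub> y)"
    and smult: "\<And>a x. a \<in> carrier R \<Longrightarrow> x \<in> carrier R \<Longrightarrow> a \<odot>\<^bsub>M\<^esub> f x = f (a \<otimes>\<^bsub>R\<^esub> x)"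
  shows "left_module R M"
proof -
  interpret ring R by (rule R)
  have ab: "abelian_group M"
  proof (rule abelian_groupI)
    fix x assume "x \<in> carrier M"
    then obtain u where "u \<in> carrier R" "x = f u" using car by blast
    then show "\<exists>y\<in>carrier M. y \<oplus>\<^bsub>M\<^esub> x = \<zero>\<^bsub>M\<^esub>"
      using car add zero by (intro bexI [of _ "f (\<ominus>\<^bsub>R\<^esub> u)"]) (simp_all add: l_neg)
  qed (auto simp: car zero [symmetric] add a_ac)
  show ?thesis
    by (rule left_module_of_ops [OF R ab]) (auto simp: car smult add l_distr r_distr m_assoc)
qed

lemma hom_module_abelian_group:
  assumes B: "left_module K B"
    and A: "\<And>x y. x \<in> carrier A \<Longrightarrow> y \<in> carrier A \<Longrightarrow> x \<oplus>\<^bsub>A\<^esub> y \<in> carrier A"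
      "\<And>c x. c \<in> carrier K \<Longrightarrow> x \<in> carrier A \<Longrightarrow> c \<odot>\<^bsub>A\<^esub> x \<in> carrier A"
  shows "abelian_group (hom_module K A r B)"
proof -
  interpret left_module K B by (rule B)
  let ?L = "linear_maps K A B"
  have car: "\<phi> \<in> ?L \<longleftrightarrow> \<phi> \<in> carrier A \<rightarrow>\<^sub>E carrier B \<and>
        (\<forall>x\<in>carrier A. \<forall>y\<in>carrier A. \<phi> (x \<oplus>\<^bsub>A\<^esub> y) = \<phi> x \<oplus>\<^bsub>B\<^esub> \<phi> y) \<and>
        (\<forall>c\<in>carrier K. \<forall>x\<in>carrier A. \<phi> (c \<odot>\<^bsub>A\<^esub> x) = c \<odot>\<^bsub>B\<^esub> \<phi> x)" for \<phi>
    by (simp add: linear_maps_def)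
  have val: "\<phi> x \<in> carrier B" if "\<phi> \<in> ?L" "x \<in> carrier A" for \<phi> x using that by (auto simp: car)
  have H: "carrier (hom_module K A r B) = ?L" "\<zero>\<^bsub>hom_module K A r B\<^esub> = (\<lambda>y\<in>carrier A. \<zero>\<^bsub>B\<^esub>)"
    "\<phi> \<oplus>\<^bsub>hom_module K A r B\<^esub> \<psi> = (\<lambda>y\<in>carrier A. \<phi> y \<oplus>\<^bsub>B\<^esub> \<psi> y)" for \<phi> \<psi>
    by (simp_all add: hom_module_def)
  show ?thesis
  proof (rule abelian_groupI; unfold H)
    fix \<phi> \<psi> assume "\<phi> \<in> ?L" "\<psi> \<in> ?L"
    then show "(\<lambda>y\<in>carrier A. \<phi> y \<oplus>\<^bsub>B\<^esub> \<psi> y) \<in> ?L"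
      using A val [of \<phi>] val [of \<psi>] by (auto simp: car smult_r_distr M.a_ac)
    show "(\<lambda>y\<in>carrier A. \<phi> y \<oplus>\<^bsub>B\<^esub> \<psi> y) = (\<lambda>y\<in>carrier A. \<psi> y \<oplus>\<^bsub>B\<^esub> \<phi> y)"
      using val \<open>\<phi> \<in> ?L\<close> \<open>\<psi> \<in> ?L\<close> by (intro restrict_ext) (simp add: M.a_comm)
  next
    show "(\<lambda>y\<in>carrier A. \<zero>\<^bsub>B\<^esub>) \<in> ?L" using A by (auto simp: car)
  next
    fix \<phi> \<psi> \<chi> assume "\<phi> \<in> ?L" "\<psi> \<in> ?L" "\<chi> \<in> ?L"
    then show "(\<lambda>y\<in>carrier A. (\<lambda>y\<in>carrier A. \<phi> y \<oplus>\<^bsub>B\<^esub> \<psi> y) y \<oplus>\<^bsub>B\<^esub> \<chi> y)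
        = (\<lambda>y\<in>carrier A. \<phi> y \<oplus>\<^bsub>B\<^esub> (\<lambda>y\<in>carrier A. \<psi> y \<oplus>\<^bsub>B\<^esub> \<chi> y) y)"
      using val by (intro restrict_ext) (simp add: M.a_assoc)
  next
    fix \<phi> assume p: "\<phi> \<in> ?L"
    then have ext: "\<phi> \<in> extensional (carrier A)" by (auto simp: car PiE_def)
    show "(\<lambda>y\<in>carrier A. (\<lambda>y\<in>carrier A. \<zero>\<^bsub>B\<^esub>) y \<oplus>\<^bsub>B\<^esub> \<phi> y) = \<phi>"
      by (rule extensionalityI [OF _ ext]) (use val [OF p] in auto)
    have "(\<lambda>y\<in>carrier A. \<ominus>\<^bsub>B\<^esub> \<phi> y) \<in> ?L"
      using p A val [OF p] by (auto simp: car smult_r_minus M.minus_add)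
    moreover have "(\<lambda>y\<in>carrier A. (\<lambda>y\<in>carrier A. \<ominus>\<^bsub>B\<^esub> \<phi> y) y \<oplus>\<^bsub>B\<^esub> \<phi> y) = (\<lambda>y\<in>carrier A. \<zero>\<^bsub>B\<^esub>)"
      using val [OF p] by (intro restrict_ext) (simp add: M.l_neg)
    ultimately show "\<exists>\<psi>\<in>?L. (\<lambda>y\<in>carrier A. \<psi> y \<oplus>\<^bsub>B\<^esub> \<phi> y) = (\<lambda>y\<in>carrier A. \<zero>\<^bsub>B\<^esub>)" by blast
  qed
qed

context hecke begin

text \<open>The form B of the overview. Defined by evaluation it is additive without any choice of a
  decomposition; \<open>bil_eqI\<close> identifies it with the coefficient of
  \<open>m l\<close>.\<close>

definition bil :: "(nat \<Rightarrow> nat) \<Rightarrow> (nat list \<Rightarrow> 'a) set \<Rightarrow> 'a" where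
  "bil l h = act (m l \<cdot> h \<cdot> m l) (delta (rw l)) (rw l)"

lemma above_abelian_subgroup: "abelian_subgroup (M_above p l k) H"
  by (intro abelian_subgroupI3 additive_subgroup.intro M_above_subgroup H.abelian_group_axioms)

lemma above_smult_coset:
  assumes k: "composition n k" and c: "c \<in> carrier K" and x: "x \<in> carrier H"
  shows "(\<Union>z\<in>M_above p l k +>\<^bsub>H\<^esub> x. M_above p l k +>\<^bsub>H\<^esub> (c \<odot>\<^bsub>H\<^esub> z)) = M_above p l k +>\<^bsub>H\<^esub> (\<iota> c \<cdot> x)"
proof -
  interpret A: abelian_subgroup "M_above p l k" H by (rule above_abelian_subgroup)
  have "M_above p l k +>\<^bsub>H\<^esub> (c \<odot>\<^bsub>H\<^esub> z) = M_above p l k +>\<^bsub>H\<^esub> (\<iota> c \<cdot> x)" if "z \<in> M_above p l k +>\<^bsub>H\<^esub> x" for z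
  proof -
    obtain a where a: "a \<in> M_above p l k" "z = a \<^bold>+ x" using \<open>z \<in> _\<close> by (auto simp: a_r_coset_def')
    have "c \<odot>\<^bsub>H\<^esub> z = \<iota> c \<cdot> a \<^bold>+ \<iota> c \<cdot> x" using a c x M_above_ops(4) [OF a(1)] by (simp add: H_smult H.r_distr)
    then have "c \<odot>\<^bsub>H\<^esub> z \<in> M_above p l k +>\<^bsub>H\<^esub> (\<iota> c \<cdot> x)"
      using M_above_smult [OF a(1) c k] by (auto simp: a_r_coset_def')
    then show ?thesis using c x by (intro A.a_repr_independence' [symmetric]) simp_all
  qed
  moreover have "x \<in> M_above p l k +>\<^bsub>H\<^esub> x" using x by (rule A.a_rcos_self)
  ultimately show ?thesis by blast
qed

lemma coset_eq_iff:
  assumes "x \<in> carrier H" "y \<in> carrier H"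
  shows "M_above p l k +>\<^bsub>H\<^esub> x = M_above p l k +>\<^bsub>H\<^esub> y \<longleftrightarrow> x \<ominus>\<^bsub>H\<^esub> y \<in> M_above p l k"
proof -
  interpret A: abelian_subgroup "M_above p l k" H by (rule above_abelian_subgroup)
  show ?thesis
    using A.a_rcos_module_minus [OF H.ring_axioms assms(2,1)] A.a_repr_independence' [of x y] A.a_rcos_self [of x] assms by auto
qed

context
  fixes l assumes l: "composition n l" and anti: "antimono l"
begin

lemma bil_closed [simp]: "h \<in> carrier H \<Longrightarrow> bil l h \<in> carrier K"
  using l by (simp add: bil_def)

lemma bil_decomp: "h \<in> carrier H \<Longrightarrow> \<exists>a\<in>M_above l l l. m l \<cdot> h \<cdot> m l = a \<^bold>+ \<iota> (bil l h) \<cdot> m l"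
  using form_decomposition [OF l anti] by (simp add: bil_def)

lemma bil_eqI: "a \<in> M_above l l l \<Longrightarrow> c \<in> carrier K \<Longrightarrow> m l \<cdot> h \<cdot> m l = a \<^bold>+ \<iota> c \<cdot> m l \<Longrightarrow> bil l h = c"
  using form_eval [OF l anti] by (simp add: bil_def)

lemma bil_add: "g \<in> carrier H \<Longrightarrow> h \<in> carrier H \<Longrightarrow> bil l (g \<^bold>+ h) = bil l g \<oplus> bil l h"
  using l by (simp add: bil_def H.r_distr H.l_distr act_add)

lemma bil_smult:
  assumes "c \<in> carrier K" "h \<in> carrier H" shows "bil l (\<iota> c \<cdot> h) = c \<otimes> bil l h"
proof -
  have "m l \<cdot> (\<iota> c \<cdot> h) \<cdot> m l = \<iota> c \<cdot> (m l \<cdot> h \<cdot> m l)"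
    using assms l \<iota>_central [of c "m l"] by (simp add: H.m_assoc [symmetric])
  then show ?thesis using assms l by (simp add: bil_def act_mult [of "\<iota> c"] act_iota)
qed

lemma bil_zero: "bil l \<^bold>0 = \<zero>" using l by (simp add: bil_def act_zero)

lemma bil_above:
  assumes p: "above l p" and gh: "g \<in> carrier H" "h \<in> carrier H"
  shows "bil l (g \<cdot> m p \<cdot> h) = \<zero>"
proof (rule bil_eqI)
  have pc: "composition n p" using p by (simp add: above_def)
  have "m l \<cdot> g \<cdot> m p \<in> M p l" "m p \<cdot> (h \<cdot> m l) \<in> M l p"
    using gh l pc by (simp_all add: M_I [of "m l \<cdot> g" "g \<cdot> m p"] M_I [of "m p \<cdot> h" "h \<cdot> m l"] H.m_assoc)
  then have "m l \<cdot> g \<cdot> m p \<cdot> (h \<cdot> m l) \<in> M_above l l l"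
    using gh l by (intro M_above_gen [OF p]) simp_all
  then show "m l \<cdot> (g \<cdot> m p \<cdot> h) \<cdot> m l \<in> M_above l l l" using gh l pc by (simp add: H.m_assoc)
  then show "m l \<cdot> (g \<cdot> m p \<cdot> h) \<cdot> m l = m l \<cdot> (g \<cdot> m p \<cdot> h) \<cdot> m l \<^bold>+ \<iota> \<zero> \<cdot> m l"
    using M_above_ops(4) l by simp
qed simp

text \<open>Modulo higher weights both \<open>m l \<cdot> g \<cdot> m l\<close> and
  \<open>m l \<cdot> h \<cdot> m l\<close> may be replaced by multiples of \<open>m l\<close>. This
  is the multiplicativity behind the Morita context.\<close>

lemma bil_mult:
  assumes gh: "g \<in> carrier H" "h \<in> carrier H"
  shows "bil l (g \<cdot> m l \<cdot> h) = bil l g \<otimes> bil l h"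
proof -
  obtain a where a: "a \<in> M_above l l l" "m l \<cdot> g \<cdot> m l = a \<^bold>+ \<iota> (bil l g) \<cdot> m l" using bil_decomp gh by blast
  obtain b where b: "b \<in> M_above l l l" "m l \<cdot> h \<cdot> m l = b \<^bold>+ \<iota> (bil l h) \<cdot> m l" using bil_decomp gh by blast
  have c: "a \<in> carrier H" "b \<in> carrier H" using a b M_above_ops(4) by auto
  show ?thesis
  proof (rule bil_eqI)
    show "a \<cdot> (h \<cdot> m l) \<^bold>+ \<iota> (bil l g) \<cdot> b \<in> M_above l l l"
      using M_above_right_m [OF a(1) gh(2) l l] M_above_smult [OF b(1) _ l] gh by (intro M_above_ops(2)) simp_all
    have "m l \<cdot> (g \<cdot> m l \<cdot> h) \<cdot> m l = (m l \<cdot> g \<cdot> m l) \<cdot> (h \<cdot> m l)" using gh l by (simp add: H.m_assoc)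
    also have "\<dots> = a \<cdot> (h \<cdot> m l) \<^bold>+ \<iota> (bil l g) \<cdot> (m l \<cdot> h \<cdot> m l)"
      unfolding a(2) using gh l c by (simp add: H.l_distr H.m_assoc)
    also have "\<dots> = a \<cdot> (h \<cdot> m l) \<^bold>+ \<iota> (bil l g) \<cdot> b \<^bold>+ \<iota> (bil l g \<otimes> bil l h) \<cdot> m l"
      unfolding b(2) using gh l c by (simp add: H.r_distr \<iota>_mult H.m_assoc H.a_assoc)
    finally show "m l \<cdot> (g \<cdot> m l \<cdot> h) \<cdot> m l = a \<cdot> (h \<cdot> m l) \<^bold>+ \<iota> (bil l g) \<cdot> b \<^bold>+ \<iota> (bil l g \<otimes> bil l h) \<cdot> m l" .
  qed (use gh in simp)
qed

text \<open>Parametrizes the Specht module by the whole algebra, x standing for the class of x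
  m_\<lambda>; likewise \<open>dcls\<close> for the dual. All later computations take place on these
  parameters.\<close>

definition cls :: "(nat list \<Rightarrow> 'a) set \<Rightarrow> (nat list \<Rightarrow> 'a) set set" where
  "cls x = M_above l l (ones n) +>\<^bsub>H\<^esub> (x \<cdot> m l)"

definition dcls :: "(nat list \<Rightarrow> 'a) set \<Rightarrow> (nat list \<Rightarrow> 'a) set set" where
  "dcls y = M_above l (ones n) l +>\<^bsub>H\<^esub> (m l \<cdot> y)"

lemma specht_carrier: "carrier (specht l) = cls ` carrier H"
proof -
  have "x \<cdot> m l \<in> M l (ones n)" if "x \<in> carrier H" for x using l that by (intro M_I [of x "x \<cdot> m l"]) simp_all
  then have "M l (ones n) = {x \<cdot> m l | x. x \<in> carrier H}" using M_D(1) by blast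
  then show ?thesis by (auto simp: specht_def M_quot_def cls_def)
qed

lemma dual_carrier: "carrier (dual_specht l) = dcls ` carrier H"
proof -
  have "m l \<cdot> y \<in> M (ones n) l" if "y \<in> carrier H" for y using l that by (intro M_I [of "m l \<cdot> y" y]) simp_all
  then have "M (ones n) l = {m l \<cdot> y | y. y \<in> carrier H}" using M_D(2) by blast
  then show ?thesis by (auto simp: dual_specht_def M_quot_def dcls_def)
qed

lemma cls_add: "x \<in> carrier H \<Longrightarrow> y \<in> carrier H \<Longrightarrow> cls x \<oplus>\<^bsub>specht l\<^esub> cls y = cls (x \<^bold>+ y)"
  using abelian_subgroup.a_rcos_sum [OF above_abelian_subgroup] l
  by (simp add: specht_def M_quot_def cls_def H.l_distr)

lemma dcls_add: "x \<in> carrier H \<Longrightarrow> y \<in> carrier H \<Longrightarrow> dcls x \<oplus>\<^bsub>dual_specht l\<^esub> dcls y = dcls (x \<^bold>+ y)"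
  using abelian_subgroup.a_rcos_sum [OF above_abelian_subgroup] l
  by (simp add: dual_specht_def M_quot_def dcls_def H.r_distr)

lemma cls_smult: "c \<in> carrier K \<Longrightarrow> x \<in> carrier H \<Longrightarrow> c \<odot>\<^bsub>specht l\<^esub> cls x = cls (\<iota> c \<cdot> x)"
  using above_smult_coset [OF composition_ones, of c "x \<cdot> m l"] l
  by (simp add: specht_def M_quot_def cls_def H.m_assoc)

lemma dcls_smult: "c \<in> carrier K \<Longrightarrow> x \<in> carrier H \<Longrightarrow> c \<odot>\<^bsub>dual_specht l\<^esub> dcls x = dcls (\<iota> c \<cdot> x)"
  using above_smult_coset [OF l, of c "m l \<cdot> x"] l \<iota>_central [of c "m l"]
  by (simp add: dual_specht_def M_quot_def dcls_def H.m_assoc [symmetric])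

lemma dcls_act:
  assumes y: "y \<in> carrier H" and h: "h \<in> carrier H"
  shows "dual_specht_act l (dcls y) h = dcls (y \<cdot> h)"
proof -
  let ?A = "M_above l (ones n) l"
  interpret A: abelian_subgroup ?A H by (rule above_abelian_subgroup)
  have "?A +>\<^bsub>H\<^esub> (z \<cdot> h) = dcls (y \<cdot> h)" if "z \<in> dcls y" for z
  proof -
    obtain a where a: "a \<in> ?A" "z = a \<^bold>+ m l \<cdot> y" using \<open>z \<in> _\<close> by (auto simp: dcls_def a_r_coset_def')
    have "z \<cdot> h = a \<cdot> h \<^bold>+ m l \<cdot> (y \<cdot> h)" using a h y l M_above_ops(4) [OF a(1)] by (simp add: H.l_distr H.m_assoc)
    then have "z \<cdot> h \<in> ?A +>\<^bsub>H\<^esub> (m l \<cdot> (y \<cdot> h))"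
      using M_above_right [OF a(1) h composition_ones l] by (auto simp: a_r_coset_def')
    then show ?thesis using h y l unfolding dcls_def by (intro A.a_repr_independence' [symmetric]) simp_all
  qed
  moreover have "m l \<cdot> y \<in> dcls y" unfolding dcls_def using l y by (intro A.a_rcos_self) simp
  ultimately show ?thesis unfolding dual_specht_act_def by blast
qed

text \<open>Lets a higher term be written with \<open>m l\<close> at its right end, as
  \<open>M_above_right_m\<close> requires when two higher terms are multiplied.\<close>

lemma above_right_ideal: "a \<in> M_above l l k \<Longrightarrow> \<exists>z\<in>carrier H. a = z \<cdot> m l"
proof (induction rule: M_above_induct)
  case zero
  then show ?case using l by (intro bexI [of _ "\<^bold>0"]) simp_all
next
  case (add x y)
  then obtain u v where "u \<in> carrier H" "v \<in> carrier H" "x = u \<cdot> m l" "y = v \<cdot> m l" by blast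
  then show ?case using l by (intro bexI [of _ "u \<^bold>+ v"]) (simp_all add: H.l_distr)
next
  case (inv x)
  then obtain u where "u \<in> carrier H" "x = u \<cdot> m l" by blast
  then show ?case using l by (intro bexI [of _ "\<ominus>\<^bsub>H\<^esub> u"]) (simp_all add: H.l_minus)
next
  case (gen p' x y)
  have p': "composition n p'" using gen by (simp add: above_def)
  obtain z where "z \<in> carrier H" "m p' \<cdot> y = z \<cdot> m l" using M_D(1) [OF gen(5)] by blast
  then show ?case using gen p' l by (intro bexI [of _ "x \<cdot> z"]) (simp_all add: H.m_assoc)
qed

text \<open>Representatives of the two classes multiply to m_\<lambda> y x m_\<lambda> up to terms
  absorbed on either side by the higher part. The scalar demanded by \<open>rho\<close> exists by
  \<open>bil_decomp\<close> and is unique by \<open>m_free\<close>.\<close>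

lemma rho_eq:
  assumes x: "x \<in> carrier H" and y: "y \<in> carrier H"
  shows "rho l (dcls y) (cls x) = bil l (y \<cdot> x)"
proof -
  let ?A = "M_above l l l"
  interpret A: abelian_subgroup ?A H by (rule above_abelian_subgroup)
  interpret A1: abelian_subgroup "M_above l l (ones n)" H by (rule above_abelian_subgroup)
  interpret A2: abelian_subgroup "M_above l (ones n) l" H by (rule above_abelian_subgroup)
  obtain b where b: "b \<in> ?A" "m l \<cdot> (y \<cdot> x) \<cdot> m l = b \<^bold>+ \<iota> (bil l (y \<cdot> x)) \<cdot> m l"
    using bil_decomp [of "y \<cdot> x"] x y by auto
  have prod: "?A +>\<^bsub>H\<^esub> (v \<cdot> u) = ?A +>\<^bsub>H\<^esub> (\<iota> (bil l (y \<cdot> x)) \<cdot> m l)" if v: "v \<in> dcls y" and u: "u \<in> cls x" for u v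
  proof -
    obtain a' where a': "a' \<in> M_above l (ones n) l" "v = a' \<^bold>+ m l \<cdot> y" using v by (auto simp: dcls_def a_r_coset_def')
    obtain a where a: "a \<in> M_above l l (ones n)" "u = a \<^bold>+ x \<cdot> m l" using u by (auto simp: cls_def a_r_coset_def')
    obtain z where z: "z \<in> carrier H" "a = z \<cdot> m l" using above_right_ideal [OF a(1)] by blast
    have c: "a' \<in> carrier H" "a \<in> carrier H" "b \<in> carrier H" using a' a b M_above_ops(4) by auto
    have "v \<cdot> u = a' \<cdot> ((z \<^bold>+ x) \<cdot> m l) \<^bold>+ m l \<cdot> y \<cdot> a \<^bold>+ m l \<cdot> (y \<cdot> x) \<cdot> m l"
      unfolding a'(2) a(2) using z c x y l by (simp add: H.l_distr H.r_distr H.m_assoc H.a_ac)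
    also have "\<dots> = (a' \<cdot> ((z \<^bold>+ x) \<cdot> m l) \<^bold>+ m l \<cdot> y \<cdot> a \<^bold>+ b) \<^bold>+ \<iota> (bil l (y \<cdot> x)) \<cdot> m l"
      unfolding b(2) using z c x y l by (simp add: H.a_assoc)
    finally have eq: "v \<cdot> u = (a' \<cdot> ((z \<^bold>+ x) \<cdot> m l) \<^bold>+ m l \<cdot> y \<cdot> a \<^bold>+ b) \<^bold>+ \<iota> (bil l (y \<cdot> x)) \<cdot> m l" .
    have "a' \<cdot> ((z \<^bold>+ x) \<cdot> m l) \<^bold>+ m l \<cdot> y \<cdot> a \<^bold>+ b \<in> ?A"
      using M_above_right_m [OF a'(1) _ l l, of "z \<^bold>+ x"] M_above_left_m [OF a(1) y l l] b(1) z x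
      by (intro M_above_ops(2)) simp_all
    then have "v \<cdot> u \<in> ?A +>\<^bsub>H\<^esub> (\<iota> (bil l (y \<cdot> x)) \<cdot> m l)" unfolding eq by (auto simp: a_r_coset_def')
    then show ?thesis using x y l by (intro A.a_repr_independence' [symmetric]) simp_all
  qed
  have "m l \<cdot> y \<in> dcls y" "x \<cdot> m l \<in> cls x"
    unfolding cls_def dcls_def using x y l by (auto intro!: A1.a_rcos_self A2.a_rcos_self)
  then have U: "(\<Union>v\<in>dcls y. \<Union>u\<in>cls x. ?A +>\<^bsub>H\<^esub> (v \<cdot> u)) = ?A +>\<^bsub>H\<^esub> (\<iota> (bil l (y \<cdot> x)) \<cdot> m l)"
    using prod by blast
  have S: "c \<odot>\<^bsub>M_quot l l l\<^esub> (?A +>\<^bsub>H\<^esub> m l) = ?A +>\<^bsub>H\<^esub> (\<iota> c \<cdot> m l)" if "c \<in> carrier K" for c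
    using above_smult_coset [OF l that m_closed [OF l]] by (simp add: M_quot_def)
  show ?thesis
    unfolding rho_def U
  proof (rule the_equality)
    show "bil l (y \<cdot> x) \<in> carrier K \<and> ?A +>\<^bsub>H\<^esub> (\<iota> (bil l (y \<cdot> x)) \<cdot> m l) = bil l (y \<cdot> x) \<odot>\<^bsub>M_quot l l l\<^esub> (?A +>\<^bsub>H\<^esub> m l)"
      using x y by (simp add: S)
    fix c assume c: "c \<in> carrier K \<and> ?A +>\<^bsub>H\<^esub> (\<iota> (bil l (y \<cdot> x)) \<cdot> m l) = c \<odot>\<^bsub>M_quot l l l\<^esub> (?A +>\<^bsub>H\<^esub> m l)"
    have bc: "bil l (y \<cdot> x) \<in> carrier K" using x y by simp
    have "\<iota> (bil l (y \<cdot> x)) \<cdot> m l \<ominus>\<^bsub>H\<^esub> \<iota> c \<cdot> m l \<in> ?A"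
      using c bc l coset_eq_iff [of "\<iota> (bil l (y \<cdot> x)) \<cdot> m l" "\<iota> c \<cdot> m l" l l l] by (simp add: S)
    moreover have "\<iota> (bil l (y \<cdot> x)) \<cdot> m l \<ominus>\<^bsub>H\<^esub> \<iota> c \<cdot> m l = \<iota> (bil l (y \<cdot> x) \<ominus> c) \<cdot> m l"
      using c bc l by (simp add: \<iota>_minus H.l_distr H.minus_eq H.l_minus)
    ultimately have "\<iota> (bil l (y \<cdot> x) \<ominus> c) \<cdot> m l \<in> ?A" by simp
    then have "bil l (y \<cdot> x) \<ominus> c = \<zero>" using m_free [OF l anti] bc c by simp
    then have "bil l (y \<cdot> x) = c" by (rule eq_of_minus_zero) (use bc c in simp_all)
    then show "c = bil l (y \<cdot> x)" ..
  qed
qed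

end

end

text \<open>Cyclic modules are compared through their surjections from the ring; equality of the
  fibres makes the choice of a preimage in \<open>f\<close> harmless.\<close>

lemma module_iso_common_cover:
  assumes L: "carrier L = F ` carrier R" and D: "carrier D = G ` carrier R"
    and eq: "\<And>x y. x \<in> carrier R \<Longrightarrow> y \<in> carrier R \<Longrightarrow> F x = F y \<longleftrightarrow> G x = G y"
    and R: "ring R"
    and add: "\<And>x y. x \<in> carrier R \<Longrightarrow> y \<in> carrier R \<Longrightarrow> F x \<oplus>\<^bsub>L\<^esub> F y = F (x \<oplus>\<^bsub>R\<^esub> y)"
      "\<And>x y. x \<in> carrier R \<Longrightarrow> y \<in> carrier R \<Longrightarrow> G x \<oplus>\<^bsub>D\<^esub> G y = G (x \<oplus>\<^bsub>R\<^esub> y)"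
    and smult: "\<And>a x. a \<in> carrier R \<Longrightarrow> x \<in> carrier R \<Longrightarrow> a \<odot>\<^bsub>L\<^esub> F x = F (a \<otimes>\<^bsub>R\<^esub> x)"
      "\<And>a x. a \<in> carrier R \<Longrightarrow> x \<in> carrier R \<Longrightarrow> a \<odot>\<^bsub>D\<^esub> G x = G (a \<otimes>\<^bsub>R\<^esub> x)"
  shows "module_iso R L D"
proof -
  interpret ring R by (rule R)
  define f where "f z = G (SOME x. x \<in> carrier R \<and> F x = z)" for z
  have fF: "f (F x) = G x" if x: "x \<in> carrier R" for x
  proof -
    let ?y = "SOME y. y \<in> carrier R \<and> F y = F x"
    have "?y \<in> carrier R \<and> F ?y = F x" by (rule someI [of _ x]) (simp add: x)
    then show ?thesis using eq x by (auto simp: f_def)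
  qed
  have "bij_betw f (carrier L) (carrier D)"
    unfolding bij_betw_def inj_on_def L D using eq by (auto simp: fF image_image)
  then show ?thesis
    unfolding module_iso_def L by (intro exI [of _ f]) (auto simp: fF add smult)
qed

context hecke begin

section \<open>Scalars acting on simple modules and the condition imposed by
  \<open>f_prod\<close>\<close>

definition acts :: "'a \<Rightarrow> ('a, 'v) module \<Rightarrow> bool" where
  "acts c V \<longleftrightarrow> (\<exists>v\<in>carrier V. c \<odot>\<^bsub>V\<^esub> v \<noteq> \<zero>\<^bsub>V\<^esub>)"

text \<open>Over a commutative ring, the elements killed by a scalar form a submodule, so on a
  simple module a scalar is either zero or injective.\<close>

lemma actsD:
  assumes V: "simple_module K V" and c: "c \<in> carrier K" "acts c V" and v: "v \<in> carrier V" "v \<noteq> \<zero>\<^bsub>V\<^esub>"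
  shows "c \<odot>\<^bsub>V\<^esub> v \<noteq> \<zero>\<^bsub>V\<^esub>"
proof
  assume 0: "c \<odot>\<^bsub>V\<^esub> v = \<zero>\<^bsub>V\<^esub>"
  interpret V: left_module K V by (rule simple_moduleD(1) [OF V])
  obtain u where u: "u \<in> carrier V" "c \<odot>\<^bsub>V\<^esub> u \<noteq> \<zero>\<^bsub>V\<^esub>" using c by (auto simp: acts_def)
  obtain a where a: "a \<in> carrier K" "u = a \<odot>\<^bsub>V\<^esub> v" using simple_moduleD(3) [OF V v u(1)] by blast
  have "c \<odot>\<^bsub>V\<^esub> u = a \<odot>\<^bsub>V\<^esub> (c \<odot>\<^bsub>V\<^esub> v)" using a c v by (simp add: V.smult_assoc [symmetric] m_comm)
  then show False using u a 0 by simp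
qed

text \<open>The annihilator of a simple module is a prime ideal. This reduces conditions on products
  of quantum integers to their factors.\<close>

lemma acts_mult:
  assumes V: "simple_module K V" and ab: "a \<in> carrier K" "b \<in> carrier K"
  shows "acts (a \<otimes> b) V \<longleftrightarrow> acts a V \<and> acts b V"
proof -
  interpret V: left_module K V by (rule simple_moduleD(1) [OF V])
  obtain v where v: "v \<in> carrier V" "v \<noteq> \<zero>\<^bsub>V\<^esub>" using simple_moduleD(2) [OF V] by blast
  show ?thesis
  proof
    assume "acts (a \<otimes> b) V"
    then obtain u where u: "u \<in> carrier V" "a \<odot>\<^bsub>V\<^esub> (b \<odot>\<^bsub>V\<^esub> u) \<noteq> \<zero>\<^bsub>V\<^esub>" using ab by (auto simp: acts_def V.smult_assoc)
    then show "acts a V \<and> acts b V" using ab V.smult_closed by (force simp: acts_def)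
  next
    assume "acts a V \<and> acts b V"
    then have "b \<odot>\<^bsub>V\<^esub> v \<noteq> \<zero>\<^bsub>V\<^esub>" "a \<odot>\<^bsub>V\<^esub> (b \<odot>\<^bsub>V\<^esub> v) \<noteq> \<zero>\<^bsub>V\<^esub>" using actsD [OF V] ab v V.smult_closed by blast+
    then show "acts (a \<otimes> b) V" using v ab by (auto simp: acts_def V.smult_assoc)
  qed
qed

lemma acts_one: "simple_module K V \<Longrightarrow> acts \<one> V"
  using simple_moduleD(1,2) [of K V] by (auto simp: acts_def left_module.smult_one)

lemma acts_unit: "simple_module K V \<Longrightarrow> u \<in> Units K \<Longrightarrow> acts u V"
  using acts_mult [of V u "inv u"] acts_one [of V] by (simp add: Units_closed)

lemma acts_finprod:
  assumes V: "simple_module K V" and "finite A" "\<And>i. i \<in> A \<Longrightarrow> f i \<in> carrier K"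
  shows "acts (finprod K f A) V \<longleftrightarrow> (\<forall>i\<in>A. acts (f i) V)"
  using assms(2,3)
proof (induction A rule: finite_induct)
  case empty
  then show ?case using acts_one [OF V] by simp
next
  case (insert a A)
  then show ?case using acts_mult [OF V] by (simp add: Pi_def)
qed

text \<open>If f does not annihilate V, then f v generates V for any nonzero v, so already the
  single products of elements of the ideal with v exhaust V.\<close>

lemma ideal_smult_iff:
  assumes V: "simple_module K V" and f: "f \<in> carrier K"
  shows "ideal_smult (PIdl f) V = carrier V \<longleftrightarrow> acts f V"
proof -
  interpret V: left_module K V by (rule simple_moduleD(1) [OF V])
  let ?X = "{a \<odot>\<^bsub>V\<^esub> x | a x. a \<in> PIdl f \<and> x \<in> carrier V}"
  have X: "?X \<subseteq> carrier V" using f V.smult_closed by (auto simp: cgenideal_def)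
  show ?thesis
  proof
    assume eq: "ideal_smult (PIdl f) V = carrier V"
    show "acts f V"
    proof (rule ccontr)
      assume "\<not> acts f V"
      then have "?X \<subseteq> {\<zero>\<^bsub>V\<^esub>}" using f by (auto simp: acts_def cgenideal_def V.smult_assoc)
      moreover have "subgroup {\<zero>\<^bsub>V\<^esub>} (add_monoid V)" using V.M.add.triv_subgroup by simp
      ultimately have "ideal_smult (PIdl f) V \<subseteq> {\<zero>\<^bsub>V\<^esub>}"
        unfolding ideal_smult_def by (rule V.M.add.generate_subgroup_incl)
      then show False using eq simple_moduleD(2) [OF V] by auto
    qed
  next
    assume a: "acts f V"
    obtain v where v: "v \<in> carrier V" "v \<noteq> \<zero>\<^bsub>V\<^esub>" using simple_moduleD(2) [OF V] by blast
    have "carrier V \<subseteq> ?X"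
    proof
      fix x assume "x \<in> carrier V"
      then obtain c where c: "c \<in> carrier K" "x = c \<odot>\<^bsub>V\<^esub> (f \<odot>\<^bsub>V\<^esub> v)"
        using simple_moduleD(3) [OF V _ actsD [OF V f a v]] f v V.smult_closed by blast
      then have "c \<otimes> f \<in> PIdl f" "x = (c \<otimes> f) \<odot>\<^bsub>V\<^esub> v" using f v by (auto simp: cgenideal_def V.smult_assoc)
      then show "x \<in> ?X" using v(1) by blast
    qed
    moreover have "?X \<subseteq> ideal_smult (PIdl f) V" unfolding ideal_smult_def by (auto intro: generate.incl)
    moreover have "ideal_smult (PIdl f) V \<subseteq> carrier V"
      unfolding ideal_smult_def using V.M.add.generate_in_carrier [of ?X] X by auto
    ultimately show "ideal_smult (PIdl f) V = carrier V" by blast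
  qed
qed

lemma qfact_acts:
  assumes V: "simple_module K V"
  shows "acts (qfact k) V \<longleftrightarrow> (\<forall>e. 1 \<le> e \<and> e \<le> k \<longrightarrow> acts (qint e) V)"
  unfolding qfact_def by (subst acts_finprod [OF V]) auto

lemma f_prod_acts:
  assumes V: "simple_module K V" and l: "composition n l"
  shows "acts (f_prod l) V \<longleftrightarrow> (\<forall>i e. 1 \<le> e \<and> e \<le> l i - l (Suc i) \<longrightarrow> acts (qint e) V)"
proof -
  have c: "qfact k \<in> carrier K" for k unfolding qfact_def by (intro finprod_closed) auto
  have "acts (f_prod l) V \<longleftrightarrow> (\<forall>i\<in>{i. l i \<noteq> 0}. acts (qfact (l i - l (Suc i))) V)"
    unfolding f_prod_def by (rule acts_finprod [OF V]) (use l c in \<open>auto simp: composition_def\<close>)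
  also have "\<dots> \<longleftrightarrow> (\<forall>i e. 1 \<le> e \<and> e \<le> l i - l (Suc i) \<longrightarrow> acts (qint e) V)"
    unfolding qfact_acts [OF V]
  proof (intro iffI allI impI)
    fix i e assume a: "\<forall>i\<in>{i. l i \<noteq> 0}. \<forall>e. 1 \<le> e \<and> e \<le> l i - l (Suc i) \<longrightarrow> acts (qint e) V"
      and e: "1 \<le> e \<and> e \<le> l i - l (Suc i)"
    then have "l i \<noteq> 0" by auto
    with a e show "acts (qint e) V" by simp
  qed blast
  finally show ?thesis .
qed

lemma f_prod_closed: "f_prod l \<in> carrier K"
proof -
  have "qfact k \<in> carrier K" for k unfolding qfact_def by (intro finprod_closed) auto
  then show ?thesis unfolding f_prod_def by (intro finprod_closed) auto
qed

section \<open>Highest weights, weight modules and the image attached to a simple module\<close>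

definition highest :: "(nat \<Rightarrow> nat) \<Rightarrow> ((nat list \<Rightarrow> 'a) set, 'd) module \<Rightarrow> bool" where
  "highest l L \<longleftrightarrow> (\<exists>v\<in>carrier L. m l \<odot>\<^bsub>L\<^esub> v \<noteq> \<zero>\<^bsub>L\<^esub>) \<and>
     (\<forall>p v. above l p \<longrightarrow> v \<in> carrier L \<longrightarrow> m p \<odot>\<^bsub>L\<^esub> v = \<zero>\<^bsub>L\<^esub>)"

definition weight_module :: "(nat \<Rightarrow> nat) \<Rightarrow> ((nat list \<Rightarrow> 'a) set, 'd) module \<Rightarrow> ('a, 'd) module" where
  "weight_module l L = \<lparr>carrier = (\<lambda>v. m l \<odot>\<^bsub>L\<^esub> v) ` carrier L, mult = undefined, one = undefined,
     ring.zero = \<zero>\<^bsub>L\<^esub>, add = ring.add L, smult = (\<lambda>c x. \<iota> c \<odot>\<^bsub>L\<^esub> x)\<rparr>"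

context
  fixes l :: "nat \<Rightarrow> nat" and V :: "('a, 'v) module"
  assumes l: "composition n l" and anti: "antimono l" and V: "simple_module K V"
begin

interpretation V: left_module K V by (rule simple_moduleD(1) [OF V])

text \<open>The image of the tensor of the class of x with w under the map of the theorem, as a
  function on the dual Specht module.\<close>

definition phi :: "'v \<Rightarrow> (nat list \<Rightarrow> 'a) set \<Rightarrow> (nat list \<Rightarrow> 'a) set set \<Rightarrow> 'v" where
  "phi w x = (\<lambda>D\<in>carrier (dual_specht l). rho l D (cls l x) \<odot>\<^bsub>V\<^esub> w)"

lemma dcls_in: "y \<in> carrier H \<Longrightarrow> dcls l y \<in> carrier (dual_specht l)"
  by (simp add: dual_carrier [OF l anti])

lemma dualE:
  assumes "D \<in> carrier (dual_specht l)"
  obtains y where "y \<in> carrier H" "D = dcls l y"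
  using assms unfolding dual_carrier [OF l anti] by (elim imageE)

lemma phi_cls: "(\<lambda>y\<in>carrier (dual_specht l). rho l y (cls l x) \<odot>\<^bsub>V\<^esub> v) = phi v x"
  by (simp add: phi_def)

lemma phi_dcls: "x \<in> carrier H \<Longrightarrow> y \<in> carrier H \<Longrightarrow> phi w x (dcls l y) = bil l (y \<cdot> x) \<odot>\<^bsub>V\<^esub> w"
  by (simp add: phi_def dcls_in rho_eq [OF l anti])

lemma dual_extI:
  assumes "f \<in> extensional (carrier (dual_specht l))" "g \<in> extensional (carrier (dual_specht l))"
    "\<And>y. y \<in> carrier H \<Longrightarrow> f (dcls l y) = g (dcls l y)"
  shows "f = g"
  by (rule extensionalityI [OF assms(1,2)]) (use assms(3) in \<open>auto simp: dual_carrier [OF l anti]\<close>)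

lemma phi_ext: "phi w x \<in> extensional (carrier (dual_specht l))" by (simp add: phi_def)

lemma hom_simps:
  "carrier (specht_hom l V) = linear_maps K (dual_specht l) V"
  "\<zero>\<^bsub>specht_hom l V\<^esub> = (\<lambda>y\<in>carrier (dual_specht l). \<zero>\<^bsub>V\<^esub>)"
  "f \<oplus>\<^bsub>specht_hom l V\<^esub> g = (\<lambda>y\<in>carrier (dual_specht l). f y \<oplus>\<^bsub>V\<^esub> g y)"
  "h \<odot>\<^bsub>specht_hom l V\<^esub> f = (\<lambda>y\<in>carrier (dual_specht l). f (dual_specht_act l y h))"
  by (simp_all add: specht_hom_def hom_module_def)

lemma phi_add: "x \<in> carrier H \<Longrightarrow> x' \<in> carrier H \<Longrightarrow> w \<in> carrier V \<Longrightarrow> phi w x \<oplus>\<^bsub>specht_hom l V\<^esub> phi w x' = phi w (x \<^bold>+ x')"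
  by (rule dual_extI) (simp_all add: hom_simps phi_ext phi_dcls dcls_in H.r_distr bil_add [OF l anti] V.smult_l_distr bil_closed [OF l anti])

lemma phi_add_right: "x \<in> carrier H \<Longrightarrow> w \<in> carrier V \<Longrightarrow> w' \<in> carrier V \<Longrightarrow> phi w x \<oplus>\<^bsub>specht_hom l V\<^esub> phi w' x = phi (w \<oplus>\<^bsub>V\<^esub> w') x"
  by (rule dual_extI) (simp_all add: hom_simps phi_ext phi_dcls dcls_in V.smult_r_distr bil_closed [OF l anti])

lemma phi_smult: "c \<in> carrier K \<Longrightarrow> x \<in> carrier H \<Longrightarrow> w \<in> carrier V \<Longrightarrow> phi (c \<odot>\<^bsub>V\<^esub> w) x = phi w (\<iota> c \<cdot> x)"
proof (rule dual_extI; (rule phi_ext)?)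
  fix y assume c: "c \<in> carrier K" "x \<in> carrier H" "w \<in> carrier V" "y \<in> carrier H"
  have "y \<cdot> (\<iota> c \<cdot> x) = \<iota> c \<cdot> (y \<cdot> x)" using c \<iota>_central [of c y] by (simp add: H.m_assoc [symmetric])
  then show "phi (c \<odot>\<^bsub>V\<^esub> w) x (dcls l y) = phi w (\<iota> c \<cdot> x) (dcls l y)"
    using c by (simp add: phi_dcls bil_smult [OF l anti] V.smult_assoc [symmetric] bil_closed [OF l anti] m_comm)
qed

lemma phi_zero: "w \<in> carrier V \<Longrightarrow> phi w \<^bold>0 = \<zero>\<^bsub>specht_hom l V\<^esub>"
  by (rule dual_extI) (simp_all add: hom_simps phi_ext phi_dcls dcls_in bil_zero [OF l anti])

lemma phi_act: "h \<in> carrier H \<Longrightarrow> x \<in> carrier H \<Longrightarrow> w \<in> carrier V \<Longrightarrow> h \<odot>\<^bsub>specht_hom l V\<^esub> phi w x = phi w (h \<cdot> x)"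
  by (rule dual_extI) (simp_all add: hom_simps phi_ext phi_dcls dcls_in dcls_act [OF l anti] H.m_assoc)

lemma phi_linear: "x \<in> carrier H \<Longrightarrow> w \<in> carrier V \<Longrightarrow> phi w x \<in> linear_maps K (dual_specht l) V"
  unfolding linear_maps_def
proof (intro CollectI conjI ballI)
  assume x: "x \<in> carrier H" and w: "w \<in> carrier V"
  show "phi w x \<in> carrier (dual_specht l) \<rightarrow>\<^sub>E carrier V"
  proof (rule PiE_I)
    fix D assume "D \<in> carrier (dual_specht l)"
    then show "phi w x D \<in> carrier V"
      using x w by (elim dualE) (simp add: phi_dcls bil_closed [OF l anti] V.smult_closed)
  qed (simp add: phi_def)
  fix D D' assume D: "D \<in> carrier (dual_specht l)" "D' \<in> carrier (dual_specht l)"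
  obtain y where "y \<in> carrier H" "D = dcls l y" using D(1) by (rule dualE)
  moreover obtain y' where "y' \<in> carrier H" "D' = dcls l y'" using D(2) by (rule dualE)
  ultimately show "phi w x (D \<oplus>\<^bsub>dual_specht l\<^esub> D') = phi w x D \<oplus>\<^bsub>V\<^esub> phi w x D'"
    using x w by (simp add: dcls_add [OF l anti] phi_dcls H.l_distr bil_add [OF l anti] V.smult_l_distr bil_closed [OF l anti])
next
  fix c D assume x: "x \<in> carrier H" and w: "w \<in> carrier V" and c: "c \<in> carrier K" and D: "D \<in> carrier (dual_specht l)"
  obtain y where "y \<in> carrier H" "D = dcls l y" using D by (rule dualE)
  then show "phi w x (c \<odot>\<^bsub>dual_specht l\<^esub> D) = c \<odot>\<^bsub>V\<^esub> phi w x D"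
    using x w c by (simp add: dcls_smult [OF l anti] phi_dcls H.m_assoc bil_smult [OF l anti] V.smult_assoc bil_closed [OF l anti])
qed

lemma specht_hom_group: "abelian_group (specht_hom l V)"
  unfolding specht_hom_def
  by (rule hom_module_abelian_group [OF V.left_module_axioms])
    (auto simp: dual_carrier [OF l anti] dcls_add [OF l anti] dcls_smult [OF l anti])

text \<open>Every vector of V is a scalar multiple of w, and scalars can be moved into x. So a
  single nonzero w suffices, and the image is a cyclic module over the Hecke algebra.\<close>

lemma specht_image_carrier:
  assumes w: "w \<in> carrier V" "w \<noteq> \<zero>\<^bsub>V\<^esub>"
  shows "carrier (specht_image l V) = phi w ` carrier H"
proof -
  let ?C = "specht_hom l V"
  interpret C: abelian_group ?C by (rule specht_hom_group)
  let ?X = "{phi v x | x v. x \<in> carrier H \<and> v \<in> carrier V}"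
  have "carrier (specht_image l V) = tensor_lift K (specht l) V ?C
      (\<lambda>x v. \<lambda>y\<in>carrier (dual_specht l). rho l y x \<odot>\<^bsub>V\<^esub> v) ` carrier (tensor K (specht l) V)"
    by (simp add: specht_image_def specht_map_def)
  also have "\<dots> = generate (add_monoid ?C) {(\<lambda>y\<in>carrier (dual_specht l). rho l y x \<odot>\<^bsub>V\<^esub> v) | x v.
      x \<in> carrier (specht l) \<and> v \<in> carrier V}"
  proof (rule tensor_lift)
    show "comm_group (add_monoid ?C)" by (rule C.a_comm_group)
  qed (auto simp: specht_carrier [OF l anti] cls_add [OF l anti] cls_smult [OF l anti] phi_def [symmetric]
      phi_add phi_add_right phi_smult hom_simps(1) phi_linear V.smult_closed)
  also have "{(\<lambda>y\<in>carrier (dual_specht l). rho l y x \<odot>\<^bsub>V\<^esub> v) | x v. x \<in> carrier (specht l) \<and> v \<in> carrier V} = ?X"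
  proof (rule equalityI; rule subsetI)
    fix z assume "z \<in> {(\<lambda>y\<in>carrier (dual_specht l). rho l y x \<odot>\<^bsub>V\<^esub> v) | x v. x \<in> carrier (specht l) \<and> v \<in> carrier V}"
    then obtain x v where z: "z = (\<lambda>y\<in>carrier (dual_specht l). rho l y x \<odot>\<^bsub>V\<^esub> v)" "x \<in> carrier (specht l)" "v \<in> carrier V"
      by blast
    then obtain x' where "x' \<in> carrier H" "x = cls l x'" using specht_carrier [OF l anti] by blast
    then have "z = phi v x'" unfolding z(1) by (simp only: phi_cls)
    then show "z \<in> ?X" using \<open>x' \<in> carrier H\<close> z(3) by blast
  next
    fix z assume "z \<in> ?X"
    then obtain x v where z: "z = phi v x" "x \<in> carrier H" "v \<in> carrier V" by blast
    then have "z = (\<lambda>y\<in>carrier (dual_specht l). rho l y (cls l x) \<odot>\<^bsub>V\<^esub> v)" by (simp only: phi_cls)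
    moreover have "cls l x \<in> carrier (specht l)" using specht_carrier [OF l anti] z(2) by blast
    ultimately show "z \<in> {(\<lambda>y\<in>carrier (dual_specht l). rho l y x \<odot>\<^bsub>V\<^esub> v) | x v. x \<in> carrier (specht l) \<and> v \<in> carrier V}"
      using z(3) by blast
  qed
  also have "generate (add_monoid ?C) ?X = phi w ` carrier H"
  proof (rule equalityI)
    have "?X \<subseteq> phi w ` carrier H"
    proof
      fix z assume "z \<in> ?X"
      then obtain x v where z: "z = phi v x" "x \<in> carrier H" "v \<in> carrier V" by blast
      then obtain c where "c \<in> carrier K" "v = c \<odot>\<^bsub>V\<^esub> w" using simple_moduleD(3) [OF V w] by blast
      then show "z \<in> phi w ` carrier H" using z w by (auto simp: phi_smult)
    qed
    moreover have "subgroup (phi w ` carrier H) (add_monoid ?C)"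
    proof (rule C.add.subgroupI)
      show "phi w ` carrier H \<subseteq> carrier ?C" using w by (auto simp: hom_simps(1) phi_linear)
      show "phi w ` carrier H \<noteq> {}" by auto
      fix a assume "a \<in> phi w ` carrier H"
      then obtain x where x: "x \<in> carrier H" "a = phi w x" by blast
      have "\<ominus>\<^bsub>?C\<^esub> a = phi w (\<ominus>\<^bsub>H\<^esub> x)"
        using x w by (intro C.minus_equality) (simp_all add: phi_add phi_zero H.l_neg hom_simps(1) phi_linear)
      then show "\<ominus>\<^bsub>?C\<^esub> a \<in> phi w ` carrier H" using x by simp
      fix b assume "b \<in> phi w ` carrier H"
      then show "a \<oplus>\<^bsub>?C\<^esub> b \<in> phi w ` carrier H" using x w by (auto simp: phi_add)
    qed
    ultimately show "generate (add_monoid ?C) ?X \<subseteq> phi w ` carrier H" by (rule C.add.generate_subgroup_incl)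
    show "phi w ` carrier H \<subseteq> generate (add_monoid ?C) ?X" using w by (auto intro!: generate.incl)
  qed
  finally show ?thesis .
qed

lemma image_simps:
  "\<zero>\<^bsub>specht_image l V\<^esub> = \<zero>\<^bsub>specht_hom l V\<^esub>" "ring.add (specht_image l V) = ring.add (specht_hom l V)"
  "module.smult (specht_image l V) = module.smult (specht_hom l V)"
  by (simp_all add: specht_image_def)

lemma specht_image_module: "left_module H (specht_image l V)"
proof -
  obtain w where w: "w \<in> carrier V" "w \<noteq> \<zero>\<^bsub>V\<^esub>" using simple_moduleD(2) [OF V] by blast
  show ?thesis
    by (rule image_left_module [of H _ "phi w"])
      (use w in \<open>simp_all add: H.ring_axioms specht_image_carrier image_simps phi_zero phi_add phi_act\<close>)
qed

context
  fixes g assumes g: "g \<in> carrier H" "acts (bil l g) V"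
begin

lemma specht_image_simple: "simple_module H (specht_image l V)"
proof -
  obtain w where w: "w \<in> carrier V" "w \<noteq> \<zero>\<^bsub>V\<^esub>" using simple_moduleD(2) [OF V] by blast
  note car = specht_image_carrier [OF w]
  have ne: "bil l g \<odot>\<^bsub>V\<^esub> w \<noteq> \<zero>\<^bsub>V\<^esub>" using actsD [OF V _ g(2) w] g(1) bil_closed [OF l anti] by simp
  show ?thesis
  proof (rule simple_moduleI [OF specht_image_module, of "phi w g"])
    show "phi w g \<in> carrier (specht_image l V)" using g by (simp add: car)
    show "phi w g \<noteq> \<zero>\<^bsub>specht_image l V\<^esub>"
    proof
      assume "phi w g = \<zero>\<^bsub>specht_image l V\<^esub>"
      then have "phi w g (dcls l \<^bold>1) = \<zero>\<^bsub>V\<^esub>" by (simp add: image_simps hom_simps dcls_in)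
      then show False using g ne by (simp add: phi_dcls)
    qed
    fix a b assume a: "a \<in> carrier (specht_image l V)" "a \<noteq> \<zero>\<^bsub>specht_image l V\<^esub>" and b: "b \<in> carrier (specht_image l V)"
    obtain x where x: "x \<in> carrier H" "a = phi w x" using a car by blast
    obtain z where z: "z \<in> carrier H" "b = phi w z" using b car by blast
    have "\<exists>y\<in>carrier H. bil l (y \<cdot> x) \<odot>\<^bsub>V\<^esub> w \<noteq> \<zero>\<^bsub>V\<^esub>"
    proof (rule ccontr)
      assume "\<not> ?thesis"
      then have "phi w x = \<zero>\<^bsub>specht_hom l V\<^esub>"
        by (intro dual_extI) (auto simp: phi_ext hom_simps phi_dcls x dcls_in)
      then show False using a x by (simp add: image_simps)
    qed
    then obtain y where y: "y \<in> carrier H" "bil l (y \<cdot> x) \<odot>\<^bsub>V\<^esub> w \<noteq> \<zero>\<^bsub>V\<^esub>" by blast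
    have bc: "bil l (y \<cdot> x) \<in> carrier K" using x y bil_closed [OF l anti] by simp
    obtain c where c: "c \<in> carrier K" "w = c \<odot>\<^bsub>V\<^esub> (bil l (y \<cdot> x) \<odot>\<^bsub>V\<^esub> w)"
      using simple_moduleD(3) [OF V _ y(2) w(1)] bc w V.smult_closed by blast
    \<comment> \<open>By \<open>bil_mult\<close>, \<open>z \<cdot> m l \<cdot> y\<close> takes the
      vector of x to the scalar B(y x) times the vector of z, and \<open>c\<close> undoes this
      scalar on w.\<close>
    have "phi w (\<iota> c \<cdot> z \<cdot> m l \<cdot> y \<cdot> x) = phi w z"
    proof (rule dual_extI; (rule phi_ext)?)
      fix u assume u: "u \<in> carrier H"
      have uc: "bil l (u \<cdot> z) \<in> carrier K" using u z bil_closed [OF l anti] by simp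
      have "u \<cdot> (\<iota> c \<cdot> z \<cdot> m l \<cdot> y \<cdot> x) = \<iota> c \<cdot> ((u \<cdot> z) \<cdot> m l \<cdot> (y \<cdot> x))"
        using u x y z c(1) l \<iota>_central [of c u] by (simp add: H.m_assoc [symmetric])
      then have "phi w (\<iota> c \<cdot> z \<cdot> m l \<cdot> y \<cdot> x) (dcls l u) = (c \<otimes> (bil l (u \<cdot> z) \<otimes> bil l (y \<cdot> x))) \<odot>\<^bsub>V\<^esub> w"
        using u x y z c(1) l by (simp add: phi_dcls bil_smult [OF l anti] bil_mult [OF l anti])
      also have "c \<otimes> (bil l (u \<cdot> z) \<otimes> bil l (y \<cdot> x)) = bil l (u \<cdot> z) \<otimes> (c \<otimes> bil l (y \<cdot> x))"
        using c(1) bc uc by (simp add: m_lcomm)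
      also have "\<dots> \<odot>\<^bsub>V\<^esub> w = bil l (u \<cdot> z) \<odot>\<^bsub>V\<^esub> (c \<odot>\<^bsub>V\<^esub> (bil l (y \<cdot> x) \<odot>\<^bsub>V\<^esub> w))"
        using c(1) bc uc w by (simp add: V.smult_assoc V.smult_closed)
      also have "\<dots> = phi w z (dcls l u)" unfolding c(2) [symmetric] using u z by (simp add: phi_dcls)
      finally show "phi w (\<iota> c \<cdot> z \<cdot> m l \<cdot> y \<cdot> x) (dcls l u) = phi w z (dcls l u)" .
    qed
    then have "b = (\<iota> c \<cdot> z \<cdot> m l \<cdot> y) \<odot>\<^bsub>specht_image l V\<^esub> a"
      using x y z c(1) l w by (simp add: image_simps phi_act)
    moreover have "\<iota> c \<cdot> z \<cdot> m l \<cdot> y \<in> carrier H" using y z c(1) l by simp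
    ultimately show "\<exists>h\<in>carrier H. b = h \<odot>\<^bsub>specht_image l V\<^esub> a" by (intro bexI)
  qed
qed

lemma m_phi:
  assumes "w \<in> carrier V" "x \<in> carrier H"
  shows "m l \<odot>\<^bsub>specht_image l V\<^esub> phi w x = phi (bil l x \<odot>\<^bsub>V\<^esub> w) \<^bold>1"
proof -
  have "phi w (m l \<cdot> x) = phi (bil l x \<odot>\<^bsub>V\<^esub> w) \<^bold>1"
  proof (rule dual_extI; (rule phi_ext)?)
    fix y assume y: "y \<in> carrier H"
    have "y \<cdot> (m l \<cdot> x) = y \<cdot> m l \<cdot> x" using assms y l by (simp add: H.m_assoc)
    then show "phi w (m l \<cdot> x) (dcls l y) = phi (bil l x \<odot>\<^bsub>V\<^esub> w) \<^bold>1 (dcls l y)"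
      using assms y l by (simp add: phi_dcls bil_mult [OF l anti] V.smult_assoc bil_closed [OF l anti])
  qed
  then show ?thesis using assms l by (simp add: image_simps phi_act)
qed

text \<open>Evaluation at the class of \<open>g\<close> returns B(g) v, and B(g) acts injectively on
  the simple module V.\<close>

lemma phi_one_inj:
  assumes v: "v \<in> carrier V" "v' \<in> carrier V" and eq: "phi v \<^bold>1 = phi v' \<^bold>1"
  shows "v = v'"
proof (rule ccontr)
  assume "v \<noteq> v'"
  have c: "bil l g \<in> carrier K" using g bil_closed [OF l anti] by simp
  have "v \<ominus>\<^bsub>V\<^esub> v' \<noteq> \<zero>\<^bsub>V\<^esub>" using V.M.eq_of_minus_zero [of v v'] \<open>v \<noteq> v'\<close> v by blast
  then have "bil l g \<odot>\<^bsub>V\<^esub> (v \<ominus>\<^bsub>V\<^esub> v') \<noteq> \<zero>\<^bsub>V\<^esub>" using actsD [OF V c g(2)] v by simp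
  moreover have "bil l g \<odot>\<^bsub>V\<^esub> v = bil l g \<odot>\<^bsub>V\<^esub> v'"
    using fun_cong [OF eq, of "dcls l g"] g by (simp add: phi_dcls)
  ultimately show False
    using v c by (simp add: a_minus_def V.smult_r_distr V.smult_r_minus V.M.r_neg V.smult_closed)
qed

lemma specht_image_highest: "highest l (specht_image l V)"
  unfolding highest_def
proof (intro conjI allI impI)
  obtain w where w: "w \<in> carrier V" "w \<noteq> \<zero>\<^bsub>V\<^esub>" using simple_moduleD(2) [OF V] by blast
  note car = specht_image_carrier [OF w]
  have c: "bil l g \<in> carrier K" using g bil_closed [OF l anti] by simp
  have z: "phi \<zero>\<^bsub>V\<^esub> \<^bold>1 = \<zero>\<^bsub>specht_hom l V\<^esub>"
    by (rule dual_extI) (simp_all add: hom_simps phi_ext phi_dcls dcls_in bil_closed [OF l anti])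
  have "bil l g \<odot>\<^bsub>V\<^esub> w \<noteq> \<zero>\<^bsub>V\<^esub>" by (rule actsD [OF V c g(2) w])
  then have "m l \<odot>\<^bsub>specht_image l V\<^esub> phi w g \<noteq> \<zero>\<^bsub>specht_image l V\<^esub>"
    unfolding m_phi [OF w(1) g(1)] unfolding image_simps z [symmetric]
    using phi_one_inj [of "bil l g \<odot>\<^bsub>V\<^esub> w" "\<zero>\<^bsub>V\<^esub>"] w c by (auto simp: V.smult_closed)
  then show "\<exists>v\<in>carrier (specht_image l V). m l \<odot>\<^bsub>specht_image l V\<^esub> v \<noteq> \<zero>\<^bsub>specht_image l V\<^esub>"
    using g by (intro bexI [of _ "phi w g"]) (simp_all add: car)
  fix p v assume p: "above l p" and v: "v \<in> carrier (specht_image l V)"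
  have pc: "composition n p" using p by (simp add: above_def)
  obtain x where x: "x \<in> carrier H" "v = phi w x" using v car by blast
  have "phi w (m p \<cdot> x) = \<zero>\<^bsub>specht_hom l V\<^esub>"
  proof (rule dual_extI)
    fix y assume y: "y \<in> carrier H"
    have "y \<cdot> (m p \<cdot> x) = y \<cdot> m p \<cdot> x" using x y pc by (simp add: H.m_assoc)
    then show "phi w (m p \<cdot> x) (dcls l y) = \<zero>\<^bsub>specht_hom l V\<^esub> (dcls l y)"
      using x y pc w by (simp add: phi_dcls bil_above [OF l anti p] hom_simps dcls_in)
  qed (simp_all add: phi_ext hom_simps)
  then show "m p \<odot>\<^bsub>specht_image l V\<^esub> v = \<zero>\<^bsub>specht_image l V\<^esub>"
    using x pc w by (simp add: image_simps phi_act)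
qed

text \<open>V is recovered by sending v to \<open>phi v\<close> at 1: by \<open>m_phi\<close> the
  weight vectors are those with v = B(x) w, and these exhaust V because B(g) w generates it.\<close>

lemma specht_image_weight: "module_iso K V (weight_module l (specht_image l V))"
proof -
  obtain w where w: "w \<in> carrier V" "w \<noteq> \<zero>\<^bsub>V\<^esub>" using simple_moduleD(2) [OF V] by blast
  note car = specht_image_carrier [OF w]
  have c: "bil l g \<in> carrier K" using g bil_closed [OF l anti] by simp
  have ne: "bil l g \<odot>\<^bsub>V\<^esub> w \<noteq> \<zero>\<^bsub>V\<^esub>" by (rule actsD [OF V c g(2) w])
  have "(\<lambda>v. phi v \<^bold>1) ` carrier V = carrier (weight_module l (specht_image l V))"
  proof (rule equalityI; rule subsetI)
    fix z assume "z \<in> (\<lambda>v. phi v \<^bold>1) ` carrier V"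
    then obtain v where v: "v \<in> carrier V" "z = phi v \<^bold>1" by blast
    obtain a where a: "a \<in> carrier K" "v = a \<odot>\<^bsub>V\<^esub> (bil l g \<odot>\<^bsub>V\<^esub> w)"
      using simple_moduleD(3) [OF V _ ne v(1)] c w V.smult_closed by blast
    have "m l \<odot>\<^bsub>specht_image l V\<^esub> phi w (\<iota> a \<cdot> g) = z"
      using a v w g c by (simp add: m_phi bil_smult [OF l anti] V.smult_assoc)
    then show "z \<in> carrier (weight_module l (specht_image l V))"
      using a g by (auto simp: weight_module_def car)
  next
    fix z assume "z \<in> carrier (weight_module l (specht_image l V))"
    then obtain x where "x \<in> carrier H" "z = m l \<odot>\<^bsub>specht_image l V\<^esub> phi w x"
      by (auto simp: weight_module_def car)
    then show "z \<in> (\<lambda>v. phi v \<^bold>1) ` carrier V"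
      using w bil_closed [OF l anti] V.smult_closed by (auto simp: m_phi)
  qed
  then have "bij_betw (\<lambda>v. phi v \<^bold>1) (carrier V) (carrier (weight_module l (specht_image l V)))"
    using phi_one_inj by (auto simp: bij_betw_def inj_on_def)
  then show ?thesis
    unfolding module_iso_def
    by (intro exI [of _ "\<lambda>v. phi v \<^bold>1"])
      (simp add: weight_module_def image_simps phi_add_right phi_smult phi_act)
qed

end

end

end

section \<open>Highest weights\<close>

context hecke begin

lemma weight_simps:
  "carrier (weight_module l L) = (\<lambda>v. m l \<odot>\<^bsub>L\<^esub> v) ` carrier L"
  "\<zero>\<^bsub>weight_module l L\<^esub> = \<zero>\<^bsub>L\<^esub>" "ring.add (weight_module l L) = ring.add L"
  "c \<odot>\<^bsub>weight_module l L\<^esub> x = \<iota> c \<odot>\<^bsub>L\<^esub> x"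
  by (simp_all add: weight_module_def)

lemma highest_kills:
  assumes L: "left_module H L" and h: "highest l L" and a: "a \<in> M_above l l' k" and v: "v \<in> carrier L"
  shows "a \<odot>\<^bsub>L\<^esub> v = \<zero>\<^bsub>L\<^esub>"
  using a v
proof -
  interpret L: left_module H L by (rule L)
  have "\<forall>v\<in>carrier L. a \<odot>\<^bsub>L\<^esub> v = \<zero>\<^bsub>L\<^esub>"
    using a
  proof (induction rule: M_above_induct)
    case (gen p x y)
    then have "composition n p" by (simp add: above_def)
    then show ?case using gen h by (auto simp: highest_def H.m_assoc L.smult_assoc L.smult_closed)
  qed (auto simp: L.smult_l_distr L.smult_l_minus L.smult_closed)
  then show ?thesis using v by blast
qed

context
  fixes l :: "nat \<Rightarrow> nat" and L :: "((nat list \<Rightarrow> 'a) set, 'd) module"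
  assumes l: "composition n l" and anti: "antimono l" and L: "simple_module H L" and h: "highest l L"
begin

interpretation L: left_module H L by (rule simple_moduleD(1) [OF L])

text \<open>The higher term of the decomposition acts as zero on a module of highest weight
  \<open>l\<close>, and the scalar B(x) is left.\<close>

lemma weight_form:
  assumes x: "x \<in> carrier H" and u: "u \<in> carrier L"
  shows "m l \<odot>\<^bsub>L\<^esub> (x \<odot>\<^bsub>L\<^esub> (m l \<odot>\<^bsub>L\<^esub> u)) = \<iota> (bil l x) \<odot>\<^bsub>L\<^esub> (m l \<odot>\<^bsub>L\<^esub> u)"
proof -
  obtain a where a: "a \<in> M_above l l l" "m l \<cdot> x \<cdot> m l = a \<^bold>+ \<iota> (bil l x) \<cdot> m l"
    using bil_decomp [OF l anti x] by blast
  have "m l \<odot>\<^bsub>L\<^esub> (x \<odot>\<^bsub>L\<^esub> (m l \<odot>\<^bsub>L\<^esub> u)) = (m l \<cdot> x \<cdot> m l) \<odot>\<^bsub>L\<^esub> u"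
    using x u l by (simp add: L.smult_assoc L.smult_closed)
  also have "\<dots> = a \<odot>\<^bsub>L\<^esub> u \<oplus>\<^bsub>L\<^esub> \<iota> (bil l x) \<odot>\<^bsub>L\<^esub> (m l \<odot>\<^bsub>L\<^esub> u)"
    unfolding a(2) using a(1) x u l M_above_ops(4) [OF a(1)] bil_closed [OF l anti x]
    by (simp add: L.smult_l_distr L.smult_assoc)
  also have "a \<odot>\<^bsub>L\<^esub> u = \<zero>\<^bsub>L\<^esub>" by (rule highest_kills [OF L.left_module_axioms h a(1) u])
  finally show ?thesis using x u l bil_closed [OF l anti x] by (simp add: L.smult_closed)
qed

lemma weight_left_module: "left_module K (weight_module l L)"
proof -
  have W: "m l \<odot>\<^bsub>L\<^esub> v \<in> carrier L" if "v \<in> carrier L" for v using that l L.smult_closed by simp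
  have add: "m l \<odot>\<^bsub>L\<^esub> v \<oplus>\<^bsub>L\<^esub> m l \<odot>\<^bsub>L\<^esub> w = m l \<odot>\<^bsub>L\<^esub> (v \<oplus>\<^bsub>L\<^esub> w)" if "v \<in> carrier L" "w \<in> carrier L" for v w
    using that l by (simp add: L.smult_r_distr)
  have ab: "abelian_group (weight_module l L)"
  proof (rule abelian_groupI; unfold weight_simps)
    fix x assume "x \<in> (\<lambda>v. m l \<odot>\<^bsub>L\<^esub> v) ` carrier L"
    then obtain v where v: "v \<in> carrier L" "x = m l \<odot>\<^bsub>L\<^esub> v" by blast
    then have "m l \<odot>\<^bsub>L\<^esub> (\<ominus>\<^bsub>L\<^esub> v) \<oplus>\<^bsub>L\<^esub> x = \<zero>\<^bsub>L\<^esub>" using l by (simp add: L.smult_r_minus L.M.l_neg L.smult_closed)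
    then show "\<exists>y\<in>(\<lambda>v. m l \<odot>\<^bsub>L\<^esub> v) ` carrier L. y \<oplus>\<^bsub>L\<^esub> x = \<zero>\<^bsub>L\<^esub>" using v by blast
  next
    show "\<zero>\<^bsub>L\<^esub> \<in> (\<lambda>v. m l \<odot>\<^bsub>L\<^esub> v) ` carrier L"
      using l by (intro image_eqI [of _ _ "\<zero>\<^bsub>L\<^esub>"]) simp_all
  next
    fix x y assume "x \<in> (\<lambda>v. m l \<odot>\<^bsub>L\<^esub> v) ` carrier L" "y \<in> (\<lambda>v. m l \<odot>\<^bsub>L\<^esub> v) ` carrier L"
    then obtain v w where vw: "v \<in> carrier L" "w \<in> carrier L" "x = m l \<odot>\<^bsub>L\<^esub> v" "y = m l \<odot>\<^bsub>L\<^esub> w" by blast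
    show "x \<oplus>\<^bsub>L\<^esub> y \<in> (\<lambda>v. m l \<odot>\<^bsub>L\<^esub> v) ` carrier L"
      unfolding vw(3,4) add [OF vw(1,2)] using vw(1,2) by simp
    show "x \<oplus>\<^bsub>L\<^esub> y = y \<oplus>\<^bsub>L\<^esub> x" using vw W by (simp add: L.M.a_comm)
  next
    fix x y z assume "x \<in> (\<lambda>v. m l \<odot>\<^bsub>L\<^esub> v) ` carrier L" "y \<in> (\<lambda>v. m l \<odot>\<^bsub>L\<^esub> v) ` carrier L"
      "z \<in> (\<lambda>v. m l \<odot>\<^bsub>L\<^esub> v) ` carrier L"
    then have "x \<in> carrier L" "y \<in> carrier L" "z \<in> carrier L" using W by blast+
    then show "x \<oplus>\<^bsub>L\<^esub> y \<oplus>\<^bsub>L\<^esub> z = x \<oplus>\<^bsub>L\<^esub> (y \<oplus>\<^bsub>L\<^esub> z)" by (rule L.M.a_assoc)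
  next
    fix x assume "x \<in> (\<lambda>v. m l \<odot>\<^bsub>L\<^esub> v) ` carrier L"
    then have "x \<in> carrier L" using W by blast
    then show "\<zero>\<^bsub>L\<^esub> \<oplus>\<^bsub>L\<^esub> x = x" by simp
  qed
  have sm: "\<iota> c \<odot>\<^bsub>L\<^esub> (m l \<odot>\<^bsub>L\<^esub> v) = m l \<odot>\<^bsub>L\<^esub> (\<iota> c \<odot>\<^bsub>L\<^esub> v)" if "c \<in> carrier K" "v \<in> carrier L" for c v
    using that l \<iota>_central [of c "m l"] by (simp add: L.smult_assoc [symmetric])
  show ?thesis
  proof (rule left_module_of_ops [OF ring_axioms ab]; unfold weight_simps)
    fix a x assume "a \<in> carrier K" "x \<in> (\<lambda>v. m l \<odot>\<^bsub>L\<^esub> v) ` carrier L"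
    then obtain v where "v \<in> carrier L" "x = m l \<odot>\<^bsub>L\<^esub> v" "\<iota> a \<odot>\<^bsub>L\<^esub> v \<in> carrier L"
      using L.smult_closed by auto
    then show "\<iota> a \<odot>\<^bsub>L\<^esub> x \<in> (\<lambda>v. m l \<odot>\<^bsub>L\<^esub> v) ` carrier L" using sm \<open>a \<in> carrier K\<close> by auto
  next
    fix a b x assume "a \<in> carrier K" "b \<in> carrier K" "x \<in> (\<lambda>v. m l \<odot>\<^bsub>L\<^esub> v) ` carrier L"
    then have "a \<in> carrier K" "b \<in> carrier K" "x \<in> carrier L" using W by blast+
    then show "\<iota> (a \<oplus> b) \<odot>\<^bsub>L\<^esub> x = \<iota> a \<odot>\<^bsub>L\<^esub> x \<oplus>\<^bsub>L\<^esub> \<iota> b \<odot>\<^bsub>L\<^esub> x"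
      "\<iota> (a \<otimes> b) \<odot>\<^bsub>L\<^esub> x = \<iota> a \<odot>\<^bsub>L\<^esub> (\<iota> b \<odot>\<^bsub>L\<^esub> x)"
      by (simp_all add: \<iota>_add \<iota>_mult L.smult_l_distr L.smult_assoc)
  next
    fix a x y assume "a \<in> carrier K" "x \<in> (\<lambda>v. m l \<odot>\<^bsub>L\<^esub> v) ` carrier L" "y \<in> (\<lambda>v. m l \<odot>\<^bsub>L\<^esub> v) ` carrier L"
    then have "a \<in> carrier K" "x \<in> carrier L" "y \<in> carrier L" using W by blast+
    then show "\<iota> a \<odot>\<^bsub>L\<^esub> (x \<oplus>\<^bsub>L\<^esub> y) = \<iota> a \<odot>\<^bsub>L\<^esub> x \<oplus>\<^bsub>L\<^esub> \<iota> a \<odot>\<^bsub>L\<^esub> y"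
      by (simp add: L.smult_r_distr)
  next
    fix x assume "x \<in> (\<lambda>v. m l \<odot>\<^bsub>L\<^esub> v) ` carrier L"
    then have "x \<in> carrier L" using W by blast
    then show "\<iota> \<one> \<odot>\<^bsub>L\<^esub> x = x" by (simp add: L.smult_one)
  qed
qed

text \<open>Write the target as m_\<lambda> w and let a in \<open>H\<close> take the given weight
  vector to w. Then m_\<lambda> a acts on that vector as the scalar B(a), so transitivity over
  \<open>H\<close> yields transitivity over the ground ring.\<close>

lemma weight_simple: "simple_module K (weight_module l L)"
proof -
  obtain u where u: "u \<in> carrier L" "m l \<odot>\<^bsub>L\<^esub> u \<noteq> \<zero>\<^bsub>L\<^esub>" using h by (auto simp: highest_def)
  show ?thesis
  proof (rule simple_moduleI [OF weight_left_module, of "m l \<odot>\<^bsub>L\<^esub> u"]; unfold weight_simps)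
    show "m l \<odot>\<^bsub>L\<^esub> u \<in> (\<lambda>v. m l \<odot>\<^bsub>L\<^esub> v) ` carrier L" using u by blast
    fix x y assume x: "x \<in> (\<lambda>v. m l \<odot>\<^bsub>L\<^esub> v) ` carrier L" "x \<noteq> \<zero>\<^bsub>L\<^esub>" and y: "y \<in> (\<lambda>v. m l \<odot>\<^bsub>L\<^esub> v) ` carrier L"
    obtain v where v: "v \<in> carrier L" "x = m l \<odot>\<^bsub>L\<^esub> v" using x by blast
    obtain w where w: "w \<in> carrier L" "y = m l \<odot>\<^bsub>L\<^esub> w" using y by blast
    have "x \<in> carrier L" using v l L.smult_closed by simp
    then obtain a where a: "a \<in> carrier H" "w = a \<odot>\<^bsub>L\<^esub> x" using simple_moduleD(3) [OF L _ x(2) w(1)] by blast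
    have "y = \<iota> (bil l a) \<odot>\<^bsub>L\<^esub> x" using weight_form [OF a(1) v(1)] by (simp add: w a v)
    then show "\<exists>a\<in>carrier K. y = \<iota> a \<odot>\<^bsub>L\<^esub> x" using bil_closed [OF l anti a(1)] by blast
  qed (use u in simp_all)
qed

lemma weight_bil_acts: "\<exists>g\<in>carrier H. acts (bil l g) (weight_module l L)"
proof -
  obtain u where u: "u \<in> carrier L" "m l \<odot>\<^bsub>L\<^esub> u \<noteq> \<zero>\<^bsub>L\<^esub>" using h by (auto simp: highest_def)
  have mu: "m l \<odot>\<^bsub>L\<^esub> u \<in> carrier L" using u l L.smult_closed by simp
  obtain a where a: "a \<in> carrier H" "u = a \<odot>\<^bsub>L\<^esub> (m l \<odot>\<^bsub>L\<^esub> u)" using simple_moduleD(3) [OF L mu u(2) u(1)] by blast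
  have "\<iota> (bil l a) \<odot>\<^bsub>L\<^esub> (m l \<odot>\<^bsub>L\<^esub> u) \<noteq> \<zero>\<^bsub>L\<^esub>"
    using weight_form [OF a(1) u(1)] u(2) a(2) by metis
  then show ?thesis using a u by (intro bexI [of _ a]) (auto simp: acts_def weight_simps)
qed

text \<open>If some [e] annihilated the weight module, its annihilator would contain all B(g) by
  \<open>form_in_ideal\<close>, against \<open>weight_bil_acts\<close>.\<close>

lemma weight_f_prod: "acts (f_prod l) (weight_module l L)"
  unfolding f_prod_acts [OF weight_simple l]
proof (intro allI impI, rule ccontr)
  let ?W = "weight_module l L"
  interpret W: left_module K ?W by (rule weight_left_module)
  fix i e assume e: "1 \<le> e \<and> e \<le> l i - l (Suc i)" and na: "\<not> acts (qint e) ?W"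
  define Z where "Z = {c \<in> carrier K. \<not> acts c ?W}"
  have Z: "ideal Z K"
  proof (rule idealI)
    show "subgroup Z (add_monoid K)"
    proof (rule add.subgroupI)
      show "Z \<subseteq> carrier K" by (auto simp: Z_def)
      show "Z \<noteq> {}" by (auto simp: Z_def acts_def intro!: exI [of _ \<zero>])
      fix a assume "a \<in> Z"
      then show "\<ominus> a \<in> Z" by (auto simp: Z_def acts_def W.smult_l_minus)
      fix b assume "b \<in> Z"
      then show "a \<oplus> b \<in> Z" using \<open>a \<in> Z\<close> by (auto simp: Z_def acts_def W.smult_l_distr)
    qed
  qed (use weight_simple in \<open>auto simp: Z_def acts_mult ring_axioms\<close>)
  \<comment> \<open>As [1] = 1 acts nontrivially, e is at least 2, which
    \<open>form_in_ideal\<close> demands.\<close>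
  have "qint (Suc 0) = \<one>" using qint_Suc [of 0] by simp
  then have "e \<noteq> 1" using na acts_one [OF weight_simple] by (auto simp: One_nat_def)
  then have "2 \<le> e" using e by simp
  moreover have "qint e \<in> Z" using na by (simp add: Z_def)
  ultimately have "bil l g \<in> Z" if "g \<in> carrier H" for g
    using form_in_ideal [OF l anti Z _ _ _ that] e by (simp add: bil_def)
  then show False using weight_bil_acts by (auto simp: Z_def)
qed

text \<open>Both modules are cyclic, generated by a weight vector z and by the function belonging to
  w and 1. Their relations agree: by simplicity an element of \<open>L\<close> is zero once
  m_\<lambda> g kills it for all g, and on multiples of z these values are given by the
  form.\<close>

lemma iso_specht_image:
  assumes V: "simple_module K V" and iso: "module_iso K (weight_module l L) V"
  shows "module_iso H L (specht_image l V)"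
proof -
  interpret V: left_module K V by (rule simple_moduleD(1) [OF V])
  obtain \<psi> where \<psi>: "bij_betw \<psi> (carrier (weight_module l L)) (carrier V)"
    "\<And>x y. x \<in> carrier (weight_module l L) \<Longrightarrow> y \<in> carrier (weight_module l L) \<Longrightarrow> \<psi> (x \<oplus>\<^bsub>weight_module l L\<^esub> y) = \<psi> x \<oplus>\<^bsub>V\<^esub> \<psi> y"
    "\<And>a x. a \<in> carrier K \<Longrightarrow> x \<in> carrier (weight_module l L) \<Longrightarrow> \<psi> (a \<odot>\<^bsub>weight_module l L\<^esub> x) = a \<odot>\<^bsub>V\<^esub> \<psi> x"
    using iso by (rule module_isoE) blast
  obtain u where u: "u \<in> carrier L" "m l \<odot>\<^bsub>L\<^esub> u \<noteq> \<zero>\<^bsub>L\<^esub>" using h by (auto simp: highest_def)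
  define z where "z = m l \<odot>\<^bsub>L\<^esub> u"
  have z: "z \<in> carrier L" "z \<noteq> \<zero>\<^bsub>L\<^esub>" "z \<in> carrier (weight_module l L)"
    using u l L.smult_closed by (auto simp: z_def weight_simps)
  define w where "w = \<psi> z"
  interpret W: left_module K "weight_module l L" by (rule weight_left_module)
  have wc: "w \<in> carrier V" using \<psi>(1) z by (auto simp: w_def bij_betw_def)
  have inj: "\<psi> x = \<psi> y \<longleftrightarrow> x = y" if "x \<in> carrier (weight_module l L)" "y \<in> carrier (weight_module l L)" for x y
    using \<psi>(1) that by (auto simp: bij_betw_def inj_on_def)
  have \<psi>0: "\<psi> \<zero>\<^bsub>L\<^esub> = \<zero>\<^bsub>V\<^esub>"
    using \<psi>(3) [of \<zero> z] z wc W.smult_l_zero [of z] by (simp add: weight_simps(2) w_def)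
  have w: "w \<noteq> \<zero>\<^bsub>V\<^esub>"
    using inj [of z "\<zero>\<^bsub>L\<^esub>"] z \<psi>0 W.M.zero_closed by (auto simp: w_def weight_simps(2))
  have bw: "\<psi> (m l \<odot>\<^bsub>L\<^esub> (x \<odot>\<^bsub>L\<^esub> z)) = bil l x \<odot>\<^bsub>V\<^esub> w" if "x \<in> carrier H" for x
    using weight_form [OF that u(1)] \<psi>(3) [OF bil_closed [OF l anti that] z(3)] by (simp add: z_def [symmetric] weight_simps w_def)
  have wt: "m l \<odot>\<^bsub>L\<^esub> (x \<odot>\<^bsub>L\<^esub> z) \<in> carrier (weight_module l L)" if "x \<in> carrier H" for x
    using that z L.smult_closed by (auto simp: weight_simps)
  have key: "x \<odot>\<^bsub>L\<^esub> z = y \<odot>\<^bsub>L\<^esub> z \<longleftrightarrow> phi l V w x = phi l V w y" if xy: "x \<in> carrier H" "y \<in> carrier H" for x y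
  proof
    assume eq: "x \<odot>\<^bsub>L\<^esub> z = y \<odot>\<^bsub>L\<^esub> z"
    show "phi l V w x = phi l V w y"
    proof (rule dual_extI [OF l anti V phi_ext [OF l anti V] phi_ext [OF l anti V]])
      fix g assume g: "g \<in> carrier H"
      have "bil l (g \<cdot> x) \<odot>\<^bsub>V\<^esub> w = bil l (g \<cdot> y) \<odot>\<^bsub>V\<^esub> w"
        using bw [of "g \<cdot> x"] bw [of "g \<cdot> y"] g xy z eq by (simp add: L.smult_assoc)
      then show "phi l V w x (dcls l g) = phi l V w y (dcls l g)" using g xy by (simp add: phi_dcls [OF l anti V])
    qed
  next
    assume eq: "phi l V w x = phi l V w y"
    have 0: "m l \<odot>\<^bsub>L\<^esub> (g \<odot>\<^bsub>L\<^esub> (x \<odot>\<^bsub>L\<^esub> z \<ominus>\<^bsub>L\<^esub> y \<odot>\<^bsub>L\<^esub> z)) = \<zero>\<^bsub>L\<^esub>" if g: "g \<in> carrier H" for g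
    proof -
      have "bil l (g \<cdot> x) \<odot>\<^bsub>V\<^esub> w = bil l (g \<cdot> y) \<odot>\<^bsub>V\<^esub> w"
        using fun_cong [OF eq, of "dcls l g"] g xy by (simp add: phi_dcls [OF l anti V])
      then have "\<psi> (m l \<odot>\<^bsub>L\<^esub> ((g \<cdot> x) \<odot>\<^bsub>L\<^esub> z)) = \<psi> (m l \<odot>\<^bsub>L\<^esub> ((g \<cdot> y) \<odot>\<^bsub>L\<^esub> z))"
        using bw g xy by simp
      then have "m l \<odot>\<^bsub>L\<^esub> ((g \<cdot> x) \<odot>\<^bsub>L\<^esub> z) = m l \<odot>\<^bsub>L\<^esub> ((g \<cdot> y) \<odot>\<^bsub>L\<^esub> z)"
        using inj [OF wt wt] g xy by simp
      then show ?thesis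
        using g xy z l by (simp add: a_minus_def L.smult_r_distr L.smult_r_minus L.smult_assoc L.smult_closed L.M.r_neg)
    qed
    let ?d = "x \<odot>\<^bsub>L\<^esub> z \<ominus>\<^bsub>L\<^esub> y \<odot>\<^bsub>L\<^esub> z"
    have dc: "?d \<in> carrier L" using xy z L.smult_closed by simp
    have "?d = \<zero>\<^bsub>L\<^esub>"
    proof (rule ccontr)
      assume "?d \<noteq> \<zero>\<^bsub>L\<^esub>"
      then obtain g where "g \<in> carrier H" "u = g \<odot>\<^bsub>L\<^esub> ?d" using simple_moduleD(3) [OF L dc _ u(1)] by blast
      then show False using 0 [of g] u(2) by simp
    qed
    then show "x \<odot>\<^bsub>L\<^esub> z = y \<odot>\<^bsub>L\<^esub> z" by (rule L.M.eq_of_minus_zero) (use xy z L.smult_closed in simp_all)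
  qed
  show ?thesis
  proof (rule module_iso_common_cover [of L "\<lambda>x. x \<odot>\<^bsub>L\<^esub> z" H "specht_image l V" "phi l V w"])
    show "carrier L = (\<lambda>x. x \<odot>\<^bsub>L\<^esub> z) ` carrier H"
      using simple_moduleD(3) [OF L z(1,2)] z L.smult_closed by auto
    show "carrier (specht_image l V) = phi l V w ` carrier H" by (rule specht_image_carrier [OF l anti V wc w])
    show "x \<odot>\<^bsub>L\<^esub> z = y \<odot>\<^bsub>L\<^esub> z \<longleftrightarrow> phi l V w x = phi l V w y" if "x \<in> carrier H" "y \<in> carrier H" for x y
      by (rule key [OF that])
    show "ring H" by (rule H.ring_axioms)
  qed (use z(1) wc in \<open>simp_all add: L.smult_l_distr L.smult_assoc image_simps [OF l anti V]
      phi_add [OF l anti V] phi_act [OF l anti V]\<close>)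
qed

end

lemma rev_col_acts:
  assumes l: "composition n l" and anti: "antimono l" and V: "simple_module K V" and f: "acts (f_prod l) V"
  shows "acts (bil l (N (rev_col l))) V"
proof -
  obtain u where u: "u \<in> Units K" "bil l (N (rev_col l)) = u \<otimes> (\<Otimes>p\<in>{1..n}. qint (Suc (off (strip l) p)))"
    using rev_col_value [OF l anti] by (auto simp: bil_def)
  have "acts (qint (Suc (off (strip l) p))) V" if "p \<in> {1..n}" for p
    using off_strip [OF l anti that] f unfolding f_prod_acts [OF V l] by auto
  then have "acts (\<Otimes>p\<in>{1..n}. qint (Suc (off (strip l) p))) V" by (subst acts_finprod [OF V]) auto
  then show ?thesis unfolding u(2) using u(1) acts_unit [OF V u(1)] by (subst acts_mult [OF V]) (auto intro: finprod_closed)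
qed

text \<open>The highest weight is found by maximizing the sum of partial sums among the compositions
  whose symmetrizer does not annihilate \<open>L\<close>.\<close>

lemma exists_highest:
  assumes L: "simple_module H L"
  shows "\<exists>l. is_partition n l \<and> highest l L"
proof -
  interpret L: left_module H L by (rule simple_moduleD(1) [OF L])
  \<comment> \<open>Dominating single boxes forces all partial sums from index n on to be n, so
    \<open>wt\<close>, with its finitely many summands, registers every strict increase.\<close>
  define S where "S = {p. composition n p \<and> dominated (ones n) p \<and> (\<exists>v\<in>carrier L. m p \<odot>\<^bsub>L\<^esub> v \<noteq> \<zero>\<^bsub>L\<^esub>)}"
  define wt where "wt p = (\<Sum>k<Suc n. psum p k)" for p
  have psn: "psum p k = n" if p: "p \<in> S" and k: "n \<le> k" for p k
  proof -
    have "psum (ones n) k \<le> psum p k" "psum p k \<le> n" using p composition_psum_le by (auto simp: S_def dominated_def)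
    then show ?thesis using k by (simp add: psum_ones)
  qed
  have "ones n \<in> S"
    using simple_moduleD(2) [OF L] by (auto simp: S_def composition_ones dominated_def L.smult_one)
  moreover have "wt p \<le> Suc n * n" if "p \<in> S" for p
  proof -
    have "wt p \<le> (\<Sum>k<Suc n. n)" unfolding wt_def using that composition_psum_le by (intro sum_mono) (auto simp: S_def)
    then show ?thesis by simp
  qed
  ultimately obtain l where lS: "l \<in> S" and max: "\<And>p. p \<in> S \<Longrightarrow> wt p \<le> wt l"
    using ex_has_greatest_nat [of "\<lambda>p. p \<in> S" "ones n" wt "Suc (Suc n * n)"] by (auto simp: less_Suc_eq_le)
  have l: "composition n l" "dominated (ones n) l" using lS by (auto simp: S_def)
  have bigger: "wt l < wt p" if d: "\<And>k. psum l k \<le> psum p k" and k: "k \<le> n" "psum l k < psum p k" for p k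
    unfolding wt_def using d k by (intro sum_strict_mono_ex1) (auto intro: bexI [of _ k])
  have anti: "antimono l"
  proof (rule ccontr)
    assume "\<not> antimono l"
    \<comment> \<open>Exchanging a row with a longer one below it would increase a partial sum, and
      by \<open>exch_rows\<close> the new symmetrizer would still act nontrivially.\<close>
    then obtain i where i: "l i < l (Suc i)" unfolding antimono_iff_le_Suc by (auto simp: not_le)
    define l' where "l' = l(i := l (Suc i), Suc i := l i)"
    note e = exch_rows [OF l(1) i, folded l'_def]
    have d: "psum l k \<le> psum l' k" for k using e(3) [of k] by simp
    have "Suc i \<le> n"
    proof (rule ccontr)
      assume "\<not> Suc i \<le> n"
      then have "psum l (Suc i) = n" "psum l (Suc (Suc i)) = n" by (auto intro: psn [OF lS] simp del: sum.lessThan_Suc)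
      moreover have "psum l (Suc (Suc i)) = psum l (Suc i) + l (Suc i)" by (rule sum.lessThan_Suc)
      ultimately show False using i by linarith
    qed
    moreover have "psum l (Suc i) < psum l' (Suc i)" using e(3) [of "Suc i"] i by simp
    ultimately have lt: "wt l < wt l'" by (rule bigger [OF d])
    obtain v where v: "v \<in> carrier L" "m l \<odot>\<^bsub>L\<^esub> v \<noteq> \<zero>\<^bsub>L\<^esub>" using lS by (auto simp: S_def)
    obtain x y where xy: "x \<in> carrier H" "y \<in> carrier H" "m l = x \<cdot> m l' \<cdot> y" using e(2) by blast
    have "m l' \<odot>\<^bsub>L\<^esub> (y \<odot>\<^bsub>L\<^esub> v) \<noteq> \<zero>\<^bsub>L\<^esub>"
      using v xy e(1) by (auto simp: L.smult_assoc L.smult_closed)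
    moreover have "dominated (ones n) l'" using l(2) d unfolding dominated_def by (meson order_trans)
    ultimately have "l' \<in> S" using e(1) v xy L.smult_closed unfolding S_def by blast
    then show False using max lt by fastforce
  qed
  have "m p \<odot>\<^bsub>L\<^esub> v = \<zero>\<^bsub>L\<^esub>" if p: "above l p" and v: "v \<in> carrier L" for p v
  proof (rule ccontr)
    assume "m p \<odot>\<^bsub>L\<^esub> v \<noteq> \<zero>\<^bsub>L\<^esub>"
    moreover have d: "psum l k \<le> psum p k" for k using p by (simp add: above_def dominated_def)
    moreover have "dominated (ones n) p" using l(2) d unfolding dominated_def by (meson order_trans)
    ultimately have pS: "p \<in> S" using p v by (auto simp: S_def above_def)
    have "\<exists>k. psum l k \<noteq> psum p k"
    proof (rule ccontr)
      assume "\<not> ?thesis"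
      then have eq: "psum l k = psum p k" for k by blast
      have "l k = p k" for k using eq [of k] eq [of "Suc k"] by simp
      then show False using p by (auto simp: above_def)
    qed
    then obtain k where k: "psum l k < psum p k" using d by (metis le_neq_implies_less)
    have "k \<le> n"
    proof (rule ccontr)
      assume "\<not> k \<le> n"
      then show False using k psn [OF lS, of k] psn [OF pS, of k] by simp
    qed
    from bigger [OF d this k] max [OF pS] show False by simp
  qed
  then have "highest l L" using lS by (auto simp: highest_def S_def)
  then show ?thesis using l(1) anti by (auto simp: is_partition_def)
qed

text \<open>Simplicity of \<open>L\<close> yields an h such that m_k h m_l is nonzero on
  \<open>L\<close>; by \<open>cross_form\<close> it would act as zero if k were not dominated by
  l.\<close>

lemma highest_unique_aux:
  assumes L: "simple_module H L" and l: "composition n l" "antimono l" "highest l L"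
    and k: "composition n k" "antimono k" "highest k L"
  shows "dominated k l"
proof (rule ccontr)
  assume nd: "\<not> dominated k l"
  interpret L: left_module H L by (rule simple_moduleD(1) [OF L])
  obtain u where u: "u \<in> carrier L" "m l \<odot>\<^bsub>L\<^esub> u \<noteq> \<zero>\<^bsub>L\<^esub>" using l by (auto simp: highest_def)
  obtain v where v: "v \<in> carrier L" "m k \<odot>\<^bsub>L\<^esub> v \<noteq> \<zero>\<^bsub>L\<^esub>" using k by (auto simp: highest_def)
  have "m l \<odot>\<^bsub>L\<^esub> u \<in> carrier L" using u l L.smult_closed by simp
  then obtain h where h: "h \<in> carrier H" "v = h \<odot>\<^bsub>L\<^esub> (m l \<odot>\<^bsub>L\<^esub> u)" using simple_moduleD(3) [OF L _ u(2) v(1)] by blast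
  have "m k \<odot>\<^bsub>L\<^esub> v = (m k \<cdot> h \<cdot> m l) \<odot>\<^bsub>L\<^esub> u" using h u l k by (simp add: L.smult_assoc L.smult_closed)
  also have "\<dots> = \<zero>\<^bsub>L\<^esub>"
    by (rule highest_kills [OF L.left_module_axioms l(3) cross_form [OF l(1,2) k(1,2) nd h(1)] u(1)])
  finally show False using v by simp
qed

lemma highest_unique:
  assumes "simple_module H L" "is_partition n l" "highest l L" "is_partition n k" "highest k L"
  shows "l = k"
proof
  fix i
  have "dominated k l" "dominated l k" using highest_unique_aux assms by (auto simp: is_partition_def)
  then have eq: "psum l i = psum k i" for i by (auto simp: dominated_def intro: antisym)
  show "l i = k i" using eq [of i] eq [of "Suc i"] by simp
qed

lemma highest_iso:
  assumes L: "left_module H L" and L': "left_module H L'" and iso: "module_iso H L L'" and l: "composition n l" and h: "highest l L"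
  shows "highest l L'" "module_iso K (weight_module l L) (weight_module l L')"
proof -
  interpret L: left_module H L by (rule L)
  interpret L': left_module H L' by (rule L')
  obtain f where f: "bij_betw f (carrier L) (carrier L')"
    "\<And>x y. x \<in> carrier L \<Longrightarrow> y \<in> carrier L \<Longrightarrow> f (x \<oplus>\<^bsub>L\<^esub> y) = f x \<oplus>\<^bsub>L'\<^esub> f y"
    "\<And>a x. a \<in> carrier H \<Longrightarrow> x \<in> carrier L \<Longrightarrow> f (a \<odot>\<^bsub>L\<^esub> x) = a \<odot>\<^bsub>L'\<^esub> f x"
    using iso by (rule module_isoE) blast
  have inj: "inj_on f (carrier L)" and im: "f ` carrier L = carrier L'" using f(1) by (auto simp: bij_betw_def)
  have "f \<zero>\<^bsub>L\<^esub> \<in> carrier L'" using im L.M.zero_closed by blast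
  then have f0: "f \<zero>\<^bsub>L\<^esub> = \<zero>\<^bsub>L'\<^esub>" using f(3) [of "\<^bold>0" "\<zero>\<^bsub>L\<^esub>"] by simp
  show "highest l L'"
    unfolding highest_def
  proof (intro conjI allI impI)
    obtain v where v: "v \<in> carrier L" "m l \<odot>\<^bsub>L\<^esub> v \<noteq> \<zero>\<^bsub>L\<^esub>" using h by (auto simp: highest_def)
    have "f (m l \<odot>\<^bsub>L\<^esub> v) \<noteq> f \<zero>\<^bsub>L\<^esub>" using inj v l L.smult_closed by (auto simp: inj_on_def)
    then have "m l \<odot>\<^bsub>L'\<^esub> f v \<noteq> \<zero>\<^bsub>L'\<^esub>" using f(3) v l f0 by simp
    moreover have "f v \<in> carrier L'" using v im by blast
    ultimately show "\<exists>v\<in>carrier L'. m l \<odot>\<^bsub>L'\<^esub> v \<noteq> \<zero>\<^bsub>L'\<^esub>" by blast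
    fix p v assume p: "above l p" and v: "v \<in> carrier L'"
    obtain u where u: "u \<in> carrier L" "v = f u" using v im by blast
    have "m p \<odot>\<^bsub>L\<^esub> u = \<zero>\<^bsub>L\<^esub>" using h p u by (auto simp: highest_def)
    then show "m p \<odot>\<^bsub>L'\<^esub> v = \<zero>\<^bsub>L'\<^esub>" using f(3) [of "m p" u] u p f0 by (simp add: above_def)
  qed
  have im2: "f ` carrier (weight_module l L) = carrier (weight_module l L')"
    unfolding weight_simps image_image im [symmetric] using f(3) l by (intro image_cong) simp_all
  have sub: "carrier (weight_module l L) \<subseteq> carrier L" using l L.smult_closed by (auto simp: weight_simps)
  have "bij_betw f (carrier (weight_module l L)) (carrier (weight_module l L'))"
    unfolding bij_betw_def using im2 inj_on_subset [OF inj sub] by blast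
  then show "module_iso K (weight_module l L) (weight_module l L')"
    unfolding module_iso_def weight_simps(3,4)
  proof (intro exI [of _ f] conjI ballI)
    fix x y assume "x \<in> carrier (weight_module l L)" "y \<in> carrier (weight_module l L)"
    then have "x \<in> carrier L" "y \<in> carrier L" using sub by blast+
    then show "f (x \<oplus>\<^bsub>L\<^esub> y) = f x \<oplus>\<^bsub>L'\<^esub> f y" by (rule f(2))
  next
    fix a x assume "a \<in> carrier K" "x \<in> carrier (weight_module l L)"
    then have "\<iota> a \<in> carrier H" "x \<in> carrier L" using sub by auto
    then show "f (\<iota> a \<odot>\<^bsub>L\<^esub> x) = \<iota> a \<odot>\<^bsub>L'\<^esub> f x" by (rule f(3))
  qed
qed

end

section \<open>The correspondence\<close>

lemma Irr_eq:
  fixes R :: "('r, 'x) ring_scheme"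
  shows "Irr R = simple_class R ` {M :: ('r, 'r set) module. simple_module R M}"
proof -
  have "{(M, N). simple_module R M \<and> simple_module R N \<and> module_iso R M N} `` {M} = simple_class R M"
    if "simple_module R M" for M :: "('r, 'r set) module"
    using that by (auto simp: simple_class_def)
  then show ?thesis unfolding Irr_def quotient_def by auto
qed

lemma simple_class_cong:
  assumes M: "left_module R M" and MN: "module_iso R M N"
  shows "simple_class R M = simple_class R N"
  using module_iso_trans [OF MN] module_iso_trans [OF module_iso_sym [OF M MN]]
  by (auto simp: simple_class_def)

context hecke begin

lemma acts_iso:
  assumes V: "left_module K V" and W: "left_module K W" and iso: "module_iso K V W" and c: "c \<in> carrier K" "acts c V"
  shows "acts c W"
proof -
  interpret V: left_module K V by (rule V)
  interpret W: left_module K W by (rule W)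
  obtain f where f: "bij_betw f (carrier V) (carrier W)"
    "\<And>x y. x \<in> carrier V \<Longrightarrow> y \<in> carrier V \<Longrightarrow> f (x \<oplus>\<^bsub>V\<^esub> y) = f x \<oplus>\<^bsub>W\<^esub> f y"
    "\<And>a x. a \<in> carrier K \<Longrightarrow> x \<in> carrier V \<Longrightarrow> f (a \<odot>\<^bsub>V\<^esub> x) = a \<odot>\<^bsub>W\<^esub> f x"
    using iso by (rule module_isoE) blast
  have inj: "inj_on f (carrier V)" and im: "f ` carrier V = carrier W" using f(1) by (auto simp: bij_betw_def)
  have "f \<zero>\<^bsub>V\<^esub> \<in> carrier W" using im V.M.zero_closed by blast
  then have f0: "f \<zero>\<^bsub>V\<^esub> = \<zero>\<^bsub>W\<^esub>" using f(3) [of \<zero> "\<zero>\<^bsub>V\<^esub>"] by simp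
  obtain v where v: "v \<in> carrier V" "c \<odot>\<^bsub>V\<^esub> v \<noteq> \<zero>\<^bsub>V\<^esub>" using c by (auto simp: acts_def)
  have "f (c \<odot>\<^bsub>V\<^esub> v) \<noteq> f \<zero>\<^bsub>V\<^esub>" using inj v c V.smult_closed by (auto simp: inj_on_def)
  moreover have "f v \<in> carrier W" using im v by blast
  ultimately show ?thesis using v c f(3) f0 by (auto simp: acts_def)
qed

lemma specht_image_simple_f_prod:
  assumes "is_partition n l" "simple_module K V" "acts (f_prod l) V"
  shows "simple_module H (specht_image l V)"
  using assms by (intro specht_image_simple [OF _ _ _ N_closed rev_col_acts]) (auto simp: is_partition_def)

text \<open>Describes the class of the image by data of \<open>L\<close> alone: read from left to
  right it gives injectivity of the correspondence, from right to left surjectivity.\<close>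

lemma specht_image_iso_iff:
  assumes l: "is_partition n l" and V: "simple_module K V" "acts (f_prod l) V" and L: "simple_module H L"
  shows "module_iso H (specht_image l V) L \<longleftrightarrow> highest l L \<and> module_iso K V (weight_module l L)"
proof
  have p: "composition n l" "antimono l" using l by (auto simp: is_partition_def)
  note g = N_closed rev_col_acts [OF p V]
  note V' = simple_moduleD(1) [OF V(1)] and L' = simple_moduleD(1) [OF L]
  have D: "left_module H (specht_image l V)" by (rule specht_image_module [OF p V(1)])
  {
    assume iso: "module_iso H (specht_image l V) L"
    note h = highest_iso [OF D L' iso p(1) specht_image_highest [OF p V(1) g]]
    show "highest l L \<and> module_iso K V (weight_module l L)"
      using h(1) module_iso_trans [OF specht_image_weight [OF p V(1) g] h(2)] by blast
  next
    assume h: "highest l L \<and> module_iso K V (weight_module l L)"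
    have "module_iso K (weight_module l L) V" using h by (intro module_iso_sym [OF V']) simp
    from iso_specht_image [OF p L _ V(1) this] show "module_iso H (specht_image l V) L"
      using h by (intro module_iso_sym [OF L']) simp
  }
qed

lemma Irr_ideal_obtain:
  assumes c: "c \<in> Irr_ideal K (PIdl (f_prod l))"
  obtains V :: "('a, 'a set) module" where "simple_module K V" "acts (f_prod l) V" "c = simple_class K V"
proof -
  obtain V :: "('a, 'a set) module" where V: "simple_module K V" "c = simple_class K V"
    using c by (auto simp: Irr_ideal_def Irr_eq)
  then have "V \<in> c" by (auto simp: simple_class_def module_iso_refl)
  moreover have "acts (f_prod l) V"
    using c \<open>V \<in> c\<close> ideal_smult_iff [OF V(1) f_prod_closed] by (auto simp: Irr_ideal_def)
  ultimately show ?thesis using that V by blast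
qed

text \<open>The union in the theorem runs over isomorphic modules V', which all produce the same
  class, and over at least one of them by \<open>simple_module_realization\<close>.\<close>

lemma correspondence_eq:
  assumes l: "is_partition n l" and V: "simple_module K V" "acts (f_prod l) V"
  shows "(\<Union>V'\<in>simple_class K V. simple_class H (specht_image l V')) = simple_class H (specht_image l V)"
proof -
  have eq: "simple_class H (specht_image l V') = {L. simple_module H L \<and> highest l L \<and> module_iso K V (weight_module l L)}"
    if V': "simple_module K V'" "module_iso K V V'" for V' :: "('a, 'a set) module"
  proof -
    note lm = simple_moduleD(1) [OF V(1)] simple_moduleD(1) [OF V'(1)]
    have "acts (f_prod l) V'" by (rule acts_iso [OF lm V'(2) f_prod_closed V(2)])
    note iff = specht_image_iso_iff [OF l V'(1) this]
    have "module_iso K V' W \<longleftrightarrow> module_iso K V W" for W :: "('a, (nat list \<Rightarrow> 'a) set set) module"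
      using module_iso_trans [OF V'(2)] module_iso_trans [OF module_iso_sym [OF lm(1) V'(2)]] by blast
    then show ?thesis using iff by (auto simp: simple_class_def)
  qed
  have "simple_class H (specht_image l V) = {L. simple_module H L \<and> highest l L \<and> module_iso K V (weight_module l L)}"
    using specht_image_iso_iff [OF l V] by (auto simp: simple_class_def)
  moreover obtain V0 :: "('a, 'a set) module" where "simple_module K V0" "module_iso K V V0"
    using simple_module_realization [OF V(1)] by blast
  then have "V0 \<in> simple_class K V" by (simp add: simple_class_def)
  ultimately show ?thesis using eq by (auto simp: simple_class_def)
qed

end

theorem theorem5p21:
  fixes K :: "('a, 'k) ring_scheme" and q :: 'a and n :: nat
  assumes "cring K" and "q \<in> Units K"
  shows "(\<forall>l (V :: ('a, 'v) module).
            is_partition n l \<and> simple_module K V \<and>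
            ideal_smult (PIdl\<^bsub>K\<^esub> (hecke_setup.f_prod K q l)) V = carrier V \<longrightarrow>
            simple_module (hecke_setup.H K q n) (hecke_setup.specht_image K q n l V)) \<and>
         bij_betw
           (\<lambda>(l, c). \<Union>V\<in>c. simple_class (hecke_setup.H K q n) (hecke_setup.specht_image K q n l V))
           (SIGMA l:{l. is_partition n l}. Irr_ideal K (PIdl\<^bsub>K\<^esub> (hecke_setup.f_prod K q l)))
           (Irr (hecke_setup.H K q n))"
proof
  interpret cring K by (rule assms(1))
  interpret hecke K q n by unfold_locales (rule assms(2))
  show "\<forall>l (V :: ('a, 'v) module). is_partition n l \<and> simple_module K V \<and>
            ideal_smult (PIdl\<^bsub>K\<^esub> (f_prod l)) V = carrier V \<longrightarrow> simple_module H (specht_image l V)"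
  proof (intro allI impI)
    fix l and V :: "('a, 'v) module"
    assume a: "is_partition n l \<and> simple_module K V \<and> ideal_smult (PIdl\<^bsub>K\<^esub> (f_prod l)) V = carrier V"
    then have "acts (f_prod l) V" using ideal_smult_iff [OF _ f_prod_closed] by blast
    then show "simple_module H (specht_image l V)" using a specht_image_simple_f_prod by blast
  qed
  let ?\<Phi> = "\<lambda>(l, c). \<Union>V\<in>c. simple_class H (specht_image l V)"
  let ?A = "SIGMA l:{l. is_partition n l}. Irr_ideal K (PIdl\<^bsub>K\<^esub> (f_prod l))"
  show "bij_betw ?\<Phi> ?A (Irr H)"
    unfolding bij_betw_def
  proof
    show "inj_on ?\<Phi> ?A"
    proof (rule inj_onI)
      fix x y assume x: "x \<in> ?A" and y: "y \<in> ?A" and eq: "?\<Phi> x = ?\<Phi> y"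
      obtain l c where lc: "x = (l, c)" "is_partition n l" "c \<in> Irr_ideal K (PIdl\<^bsub>K\<^esub> (f_prod l))" using x by blast
      obtain l' c' where lc': "y = (l', c')" "is_partition n l'" "c' \<in> Irr_ideal K (PIdl\<^bsub>K\<^esub> (f_prod l'))" using y by blast
      obtain V :: "('a, 'a set) module" where V: "simple_module K V" "acts (f_prod l) V" "c = simple_class K V"
        using lc(3) by (rule Irr_ideal_obtain)
      obtain V' :: "('a, 'a set) module" where V': "simple_module K V'" "acts (f_prod l') V'" "c' = simple_class K V'"
        using lc'(3) by (rule Irr_ideal_obtain)
      have eq': "simple_class H (specht_image l V) = simple_class H (specht_image l' V')"
        using eq unfolding lc(1) lc'(1) V(3) V'(3)
        by (simp only: prod.case correspondence_eq [OF lc(2) V(1,2)] correspondence_eq [OF lc'(2) V'(1,2)])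
      \<comment> \<open>The image consists of functions; a realization on subsets of the algebra
        represents its class in \<open>Irr\<close>, and both partitions are read off from
        it.\<close>
      obtain L :: "((nat list \<Rightarrow> 'a) set, (nat list \<Rightarrow> 'a) set set) module"
        where L: "simple_module H L" "module_iso H (specht_image l V) L"
        using simple_module_realization [OF specht_image_simple_f_prod [OF lc(2) V(1,2)]] by blast
      then have "L \<in> simple_class H (specht_image l' V')" unfolding eq' [symmetric] by (simp add: simple_class_def)
      then have L': "module_iso H (specht_image l' V') L" by (simp add: simple_class_def)
      have h: "highest l L" "module_iso K V (weight_module l L)"
        using specht_image_iso_iff [OF lc(2) V(1,2) L(1)] L(2) by auto
      have h': "highest l' L" "module_iso K V' (weight_module l' L)"
        using specht_image_iso_iff [OF lc'(2) V'(1,2) L(1)] L' by auto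
      have ll: "l = l'" by (rule highest_unique [OF L(1) lc(2) h(1) lc'(2) h'(1)])
      have "c = simple_class K (weight_module l L)"
        unfolding V(3) by (rule simple_class_cong [OF simple_moduleD(1) [OF V(1)] h(2)])
      moreover have "c' = simple_class K (weight_module l L)"
        unfolding V'(3) ll by (rule simple_class_cong [OF simple_moduleD(1) [OF V'(1)] h'(2)])
      ultimately show "x = y" using ll by (simp add: lc lc')
    qed
    show "?\<Phi> ` ?A = Irr H"
    proof (rule equalityI; rule subsetI)
      fix C assume "C \<in> ?\<Phi> ` ?A"
      then obtain l c where lc: "is_partition n l" "c \<in> Irr_ideal K (PIdl\<^bsub>K\<^esub> (f_prod l))"
        and C: "C = (\<Union>V\<in>c. simple_class H (specht_image l V))" by auto
      obtain V :: "('a, 'a set) module" where V: "simple_module K V" "acts (f_prod l) V" "c = simple_class K V"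
        using lc(2) by (rule Irr_ideal_obtain)
      note D = specht_image_simple_f_prod [OF lc(1) V(1,2)]
      obtain L :: "((nat list \<Rightarrow> 'a) set, (nat list \<Rightarrow> 'a) set set) module"
        where L: "simple_module H L" "module_iso H (specht_image l V) L"
        using simple_module_realization [OF D] by blast
      have "C = simple_class H (specht_image l V)" unfolding C V(3) by (rule correspondence_eq [OF lc(1) V(1,2)])
      also have "\<dots> = simple_class H L" by (rule simple_class_cong [OF simple_moduleD(1) [OF D] L(2)])
      finally show "C \<in> Irr H" unfolding Irr_eq using L(1) by blast
    next
      fix C assume "C \<in> Irr H"
      then obtain L :: "((nat list \<Rightarrow> 'a) set, (nat list \<Rightarrow> 'a) set set) module"
        where L: "simple_module H L" "C = simple_class H L" unfolding Irr_eq by blast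
      obtain l where l: "is_partition n l" "highest l L" using exists_highest [OF L(1)] by blast
      then have p: "composition n l" "antimono l" by (auto simp: is_partition_def)
      note W = weight_simple [OF p L(1) l(2)]
      \<comment> \<open>The weight module has the elements of \<open>L\<close>; it is moved to
        subsets of the ground ring to obtain a class in \<open>Irr K\<close>.\<close>
      obtain V :: "('a, 'a set) module" where V: "simple_module K V" "module_iso K (weight_module l L) V"
        using simple_module_realization [OF W] by blast
      have act: "acts (f_prod l) V'" if "simple_module K V'" "module_iso K V V'" for V' :: "('a, 'a set) module"
        using acts_iso [OF simple_moduleD(1) [OF W] simple_moduleD(1) [OF that(1)]
            module_iso_trans [OF V(2) that(2)] f_prod_closed weight_f_prod [OF p L(1) l(2)]] .
      have aV: "acts (f_prod l) V" by (rule act [OF V(1) module_iso_refl])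
      have c: "simple_class K V \<in> Irr_ideal K (PIdl\<^bsub>K\<^esub> (f_prod l))"
        unfolding Irr_ideal_def
      proof (intro CollectI conjI ballI)
        show "simple_class K V \<in> Irr K" unfolding Irr_eq using V(1) by blast
        fix V' assume "V' \<in> simple_class K V"
        then show "ideal_smult (PIdl\<^bsub>K\<^esub> (f_prod l)) V' = carrier V'"
          using act ideal_smult_iff [OF _ f_prod_closed] by (auto simp: simple_class_def)
      qed
      have iso: "module_iso H (specht_image l V) L"
        using specht_image_iso_iff [OF l(1) V(1) aV L(1)] l(2) module_iso_sym [OF simple_moduleD(1) [OF W] V(2)] by blast
      have "C = simple_class H (specht_image l V)"
        unfolding L(2) by (rule simple_class_cong [OF specht_image_module [OF p V(1)] iso, symmetric])
      also have "\<dots> = ?\<Phi> (l, simple_class K V)" unfolding prod.case by (rule correspondence_eq [OF l(1) V(1) aV, symmetric])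
      finally show "C \<in> ?\<Phi> ` ?A" using l(1) c by blast
    qed
  qed
qed

end
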